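(* Let $c,d\in\mathbb{Z}$. There is an inclusion of complexes $$\mathbf{Sym}:\ \mathbf{GC}_c\otimes\mathbf{GC}_d\longrightarrow\mathbf{GC}_{c,d}^{\ge2},\qquad \Gamma_1\otimes\Gamma_2\longmapsto\sum_{\substack{f_1:E(\Gamma_2)\to V(\Gamma_1)\\ f_2:E(\Gamma_1)\to V(\Gamma_2)}}(\Gamma_1^{f_1},\Gamma_2^{f_2}),$$ where the sum runs over all possible hair attachments: $\Gamma_1^{f_1}$ is $\Gamma_1$ with, for each $e\in E(\Gamma_2)$, a hair labelled $e$ attached to the vertex $f_1(e)$, and $\Gamma_2^{f_2}$ is defined in the same way. In addition, this map induces an inclusion on the level of cohomology $$H(\mathbf{GC}_c)\otimes H(\mathbf{GC}_d)\longrightarrow H(\mathbf{GC}_{c,d}^{\ge2}).$$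
   Context: Work over a field $\mathbb{K}$ of characteristic $0$, with Koszul signs. $V[k]$ is the shift $V[k]^j=V^{j+k}$; $\mathrm{sgn}_n^{\otimes|d|}$ is the sign representation of $\mathbb{S}_n$ if $d$ is odd and trivial if $d$ is even. $\mathbf{Lieb}_{c,d}$ is the properad of degree shifted Lie bialgebras, generated by a bracket (2 inputs, 1 output, degree $1-c$, symmetry $(-1)^c$) and a cobracket (1 input, 2 outputs, degree $1-d$, symmetry $(-1)^d$) subject to Jacobi, co-Jacobi and the Lie bialgebra compatibility relation. **Kontsevich graph complex $\mathbf{GC}_d$.** The full graph complex is $$\mathbf{fGC}_d=\prod_{v\ge1}\prod_{e\ge0}\big(\mathbb{K}\langle G_{v,e}\rangle\otimes\mathbb{K}[-d]^{\otimes v}\otimes\mathbb{K}[d-1]^{\otimes e}\otimes_{\mathbb{S}_v\times(\mathbb{S}_2^e\ltimes\mathbb{S}_e)}\mathrm{sgn}_d^{\otimes e}\big)[d],$$ with $G_{v,e}$ the set of directed graphs with $v$ vertices and $e$ edges and the group acting by renumbering vertices and edges and flipping edges (with sign $(-1)^d$); its differential is given (up to signs) by vertex splitting. $\mathbf{GC}_d$ is the complex spanned by connected graphs all of whose vertices are at least bivalent, with differential the vertex splitting that creates no univalent vertices. **The properad of entangled graphs $\mathbf{Gra}_{c,d}$.** The component $\mathbf{Gra}_{c,d}(m,n)$ ($m$ outputs, $n$ inputs) is spanned by pairs $(\Gamma_1,\Gamma_2)$, where $\Gamma_1$ is a graph with vertices labelled $1,\dots,n$, $\Gamma_2$ is a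 graph with vertices labelled $1,\dots,m$, each edge of $\Gamma_2$ appears as the label of exactly one hair attached to a vertex of $\Gamma_1$, and each edge of $\Gamma_1$ as the label of exactly one hair attached to a vertex of $\Gamma_2$. Edges of $\Gamma_1$ have degree $1-c$, edges of $\Gamma_2$ degree $1-d$. Orientation: for $c$ even, the edges of $\Gamma_1$ are ordered, up to permutation and multiplication by its sign; for $c$ odd, the edges of $\Gamma_1$ are directed, up to flip and multiplication by $-1$; likewise for $\Gamma_2$ with $d$. The pair must be connected: the graph on $V(\Gamma_1)\sqcup V(\Gamma_2)$ in which every edge of one graph is joined to its two endpoints and to the vertex of the other graph carrying its hair is connected (the pair of two single vertices without edges is the unit). The composition $(\Gamma_1,\Gamma_2)\,{}_{i_1,\dots,i_k}\circ_{j_1,\dots,j_k}(\gamma_1,\gamma_2)$, with $i_s\in V(\Gamma_1)$ and $j_s\in V(\gamma_2)$, is $(G_1,G_2)$, where $G_1$ is obtained by erasing $i_1,\dots,i_k$ from $\Gamma_1$ and summing over all attachments of their half-edges (including hairs) to the vertices of $\gamma_1$, and $G_2$ is obtained by erasing $j_1,\dots,j_k$ from $\gamma_2$ and summing over all attachments of their half-edges (including hairs) to the vertices of $\Gamma_2$. **The complex $\mathbf{fcGC}_{c,d}$.** Let $\circ\overset{e}{-}\circ$ be the graph with two vertices and one edge $e$, and $\bullet^{e}$ the single vertex with one hair labelled $e$. There is a morphism $\mathbf{Lieb}_{c,d}\to\mathbf{Gra}_{c,d}$ sending the bracket to $(\circ\overset{e}{-}\circ,\bullet^e)$ and the cobracket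 to $(\bullet^e,\circ\overset{e}{-}\circ)$, and $\mathbf{fcGC}_{c,d}=\mathbf{Def}(\mathbf{Lieb}_{c,d}\to\mathbf{Gra}_{c,d})$ is its deformation complex $$\prod_{m,n\ge1,\;m+n\ge3}\big(\mathbf{Gra}_{c,d}(m,n)\otimes\mathrm{sgn}_m^{\otimes|d|}\otimes\mathrm{sgn}_n^{\otimes|c|}\big)^{\mathbb{S}_m\times\mathbb{S}_n}[d(1-m)+c(1-n)],$$ with differential the bracket with the morphism $\mathbf{Lieb}_{c,d}\to\mathbf{Gra}_{c,d}$ that sends the Lie bracket generator to $(\circ\overset{e}{-}\circ,\bullet^e)$ and the cobracket generator to $(\bullet^e,\circ\overset{e}{-}\circ)$, viewed as a degree $1$ element (commutator of compositions along one output-input pair). Explicitly $\delta=\delta'\pm\delta''$, where $$\delta'(\Gamma_1,\Gamma_2)=\sum_{v\in V(\Gamma_1),\,w\in V(\Gamma_2)}(\Gamma_1^{+v},\Gamma_2^w)\ \pm\sum_{v\in V(\Gamma_1),\,w\in V(\Gamma_2)}(\Gamma_1\circ_v(\circ-\circ),\Gamma_2^w).$$ Here $\Gamma_1^{+v}$ attaches a new univalent vertex without hairs to $v$ by a new edge; $\Gamma_1\circ_v(\circ-\circ)$ replaces $v$ by two vertices joined by a new edge, summed over all reattachments of the half-edges and hairs of $v$; $\Gamma_2^w$ is $\Gamma_2$ with a hair labelled by the new edge attached to $w$. $\delta''$ is the same with the roles of $\Gamma_1,\Gamma_2$ exchanged. The signs are such that, for a vertex carrying at least one edge or hair, the terms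 creating a univalent vertex without hairs cancel. **$\mathbf{GC}^1_{c,d}$ and $\mathbf{GC}^{\ge2}_{c,d}$.** The valency of a vertex counts edges, not hairs. $\mathbf{GC}_{c,d}^1\subset\mathbf{fcGC}_{c,d}$ is the subcomplex spanned by pairs $(\Gamma_1,\Gamma_2)$ with at least one univalent vertex (in $\Gamma_1$ or $\Gamma_2$), and $\mathbf{GC}_{c,d}^{\ge2}:=\mathbf{fcGC}_{c,d}/\mathbf{GC}_{c,d}^1$ with the induced differential (terms with univalent vertices are dropped).
   Formalization: For c and d both even, Sym kills tadpole⊗tadpole (m=n=1 is excluded by m+n≥3), so injectivity is stated modulo that line, on complexes and on cohomology. The target is a product over edge numbers too, as Sym of a series requires when c=1 or d=1. *)

theory Defs
  imports
    Complex_Main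
    "HOL-Library.Function_Algebras"
    "HOL-Combinatorics.Permutations"
begin

text \<open>
  A possibly infinite formal linear combination of basis elements of type 'a over the field 'k is
  its coefficient function.
\<close>

type_synonym ('a, 'k) series = "'a \<Rightarrow> 'k"

definition scl :: "'k::field \<Rightarrow> ('a, 'k) series \<Rightarrow> ('a, 'k) series" where
  "scl r x = (\<lambda>X. r * x X)"

abbreviation spn :: "('a, 'k::field) series set \<Rightarrow> ('a, 'k) series set" where
  "spn \<equiv> module.span scl"

definition bas :: "'a \<Rightarrow> ('a, 'k::field) series" where
  "bas X = (\<lambda>Y. if Y = X then 1 else 0)"

text \<open>
  The linear extension of a map given on basis elements. In all uses below every \<open>Y\<close> occurs in
  \<open>F X\<close> for finitely many \<open>X\<close> only, so that the extension makes sense on infinite series.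
\<close>

definition lin_ext :: "('a \<Rightarrow> ('b, 'k::field) series) \<Rightarrow> ('a, 'k) series \<Rightarrow> ('b, 'k) series" where
  "lin_ext F x = (\<lambda>Y. \<Sum>X | F X Y \<noteq> 0. x X * F X Y)"

text \<open>
  A cochain complex is given by a presentation: its degree \<open>p\<close> part is the quotient vector space
  \<open>crr p / nul p\<close>, and \<open>dif\<close> acts on representatives. The field \<open>bdeg\<close> is the degree of a basis
  element; it is only used for the Koszul sign in tensor products.
\<close>

record ('a, 'k) cpx =
  bdeg :: "'a \<Rightarrow> int"
  crr :: "int \<Rightarrow> ('a, 'k) series set"
  nul :: "int \<Rightarrow> ('a, 'k) series set"
  dif :: "('a, 'k) series \<Rightarrow> ('a, 'k) series"

definition is_complex :: "('a, 'k::field) cpx \<Rightarrow> bool" where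
  "is_complex A \<longleftrightarrow>
     Vector_Spaces.linear scl scl (dif A) \<and>
     (\<forall>p. module.subspace scl (crr A p) \<and> module.subspace scl (nul A p) \<and> nul A p \<subseteq> crr A p \<and>
          dif A ` crr A p \<subseteq> crr A (p + 1) \<and> dif A ` nul A p \<subseteq> nul A (p + 1) \<and>
          (\<forall>x \<in> crr A p. dif A (dif A x) \<in> nul A (p + 2)))"

definition chain_map ::
  "('a, 'k::field) cpx \<Rightarrow> ('b, 'k) cpx \<Rightarrow> (('a, 'k) series \<Rightarrow> ('b, 'k) series) \<Rightarrow> bool" where
  "chain_map A B F \<longleftrightarrow>
     Vector_Spaces.linear scl scl F \<and>
     (\<forall>p. F ` crr A p \<subseteq> crr B p \<and> F ` nul A p \<subseteq> nul B p \<and>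
          (\<forall>x \<in> crr A p. dif B (F x) - F (dif A x) \<in> nul B (p + 1)))"

definition inclusion_of_complexes ::
  "('a, 'k::field) cpx \<Rightarrow> ('b, 'k) cpx \<Rightarrow> (('a, 'k) series \<Rightarrow> ('b, 'k) series) \<Rightarrow> bool" where
  "inclusion_of_complexes A B F \<longleftrightarrow>
     chain_map A B F \<and> (\<forall>p. \<forall>x \<in> crr A p. F x \<in> nul B p \<longrightarrow> x \<in> nul A p)"

text \<open>The cohomology is again presented, as cocycles modulo coboundaries with zero differential.\<close>

definition cohomology :: "('a, 'k::field) cpx \<Rightarrow> ('a, 'k) cpx" where
  "cohomology A =
     \<lparr>bdeg = bdeg A,
      crr = (\<lambda>p. {x \<in> crr A p. dif A x \<in> nul A (p + 1)}),
      nul = (\<lambda>p. {x \<in> crr A p. \<exists>y \<in> crr A (p - 1). x - dif A y \<in> nul A p}),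
      dif = (\<lambda>_. 0)\<rparr>"

text \<open>
  The algebraic tensor product. For spaces \<open>V\<close>, \<open>W\<close> of functions, \<open>V \<otimes> W\<close> is the span of the
  functions \<open>x(X) y(Y)\<close> of two variables, and \<open>V/N \<otimes> W/M = (V \<otimes> W) / (N \<otimes> W + V \<otimes> M)\<close>.
  The differential sends \<open>x \<otimes> y\<close> to \<open>dx \<otimes> y + (-1)^|x| x \<otimes> dy\<close>.
\<close>

definition otimes :: "('a, 'k::field) series \<Rightarrow> ('b, 'k) series \<Rightarrow> ('a \<times> 'b, 'k) series" where
  "otimes x y = (\<lambda>(X, Y). x X * y Y)"

definition koszul :: "int \<Rightarrow> 'k::field" where
  "koszul p = (if even p then 1 else - 1)"

definition tensor :: "('a, 'k::field) cpx \<Rightarrow> ('b, 'k) cpx \<Rightarrow> ('a \<times> 'b, 'k) cpx" where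
  "tensor A B =
     \<lparr>bdeg = (\<lambda>(X, Y). bdeg A X + bdeg B Y),
      crr = (\<lambda>p. spn {otimes x y | x y i. x \<in> crr A i \<and> y \<in> crr B (p - i)}),
      nul = (\<lambda>p. spn {otimes x y | x y i. x \<in> crr A i \<and> y \<in> crr B (p - i) \<and>
                                           (x \<in> nul A i \<or> y \<in> nul B (p - i))}),
      dif = (\<lambda>t (X, Y). dif A (\<lambda>X'. t (X', Y)) X +
                         koszul (bdeg A X) * dif B (\<lambda>Y'. t (X, Y')) Y)\<rparr>"

definition mod_out :: "('a, 'k::field) series set \<Rightarrow> ('a, 'k) cpx \<Rightarrow> ('a, 'k) cpx" where
  "mod_out R A = A\<lparr>nul := (\<lambda>p. spn (nul A p \<union> (R \<inter> crr A p)))\<rparr>"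

text \<open>
  A graph has vertices \<open>0, \<dots>, v - 1\<close> and a list of directed edges (multiple edges and tadpoles
  are allowed); the half-edge \<open>(i, b)\<close> is the source (\<open>b\<close>) or the target (\<open>\<not> b\<close>) of edge \<open>i\<close>.
\<close>

type_synonym graph = "nat \<times> (nat \<times> nat) list"

definition endpoint :: "(nat \<times> nat) list \<Rightarrow> nat \<times> bool \<Rightarrow> nat" where
  "endpoint es h = (if snd h then fst (es ! fst h) else snd (es ! fst h))"

definition half_edges :: "(nat \<times> nat) list \<Rightarrow> nat \<Rightarrow> (nat \<times> bool) set" where
  "half_edges es u = {h. fst h < length es \<and> endpoint es h = u}"

definition valency :: "graph \<Rightarrow> nat \<Rightarrow> nat" where
  "valency G u = card (half_edges (snd G) u)"

definition wf_graph :: "graph \<Rightarrow> bool" where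
  "wf_graph G \<longleftrightarrow> fst G \<ge> 1 \<and> set (snd G) \<subseteq> {..<fst G} \<times> {..<fst G}"

definition has_univalent :: "graph \<Rightarrow> bool" where
  "has_univalent G \<longleftrightarrow> (\<exists>u < fst G. valency G u = 1)"

definition connected_graph :: "graph \<Rightarrow> bool" where
  "connected_graph G \<longleftrightarrow>
     (\<forall>u < fst G. \<forall>v < fst G. (u, v) \<in> (set (snd G) \<union> (set (snd G))\<inverse>)\<^sup>*)"

text \<open>
  Degree of a graph in \<open>GC\<^sub>d\<close>: vertices have degree \<open>d\<close>, edges degree \<open>1 - d\<close>, and there is a global
  shift by \<open>d\<close>.
\<close>

definition gdeg :: "int \<Rightarrow> graph \<Rightarrow> int" where
  "gdeg d G = d * (int (fst G) - 1) + (1 - d) * int (length (snd G))"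

definition vertex_sign :: "int \<Rightarrow> (nat \<Rightarrow> nat) \<Rightarrow> 'k::field" where
  "vertex_sign d s = (if odd d then of_int (sign s) else 1)"

definition edge_sign :: "int \<Rightarrow> (nat \<Rightarrow> nat) \<Rightarrow> 'k::field" where
  "edge_sign d t = (if even d then of_int (sign t) else 1)"

definition flip_sign :: "int \<Rightarrow> 'k::field" where
  "flip_sign d = (if odd d then - 1 else 1)"

definition relabel :: "(nat \<Rightarrow> nat) \<Rightarrow> (nat \<times> nat) list \<Rightarrow> (nat \<times> nat) list" where
  "relabel s es = map (map_prod s s) es"

definition flip_edge :: "nat \<Rightarrow> (nat \<times> nat) list \<Rightarrow> (nat \<times> nat) list" where
  "flip_edge i es = es[i := prod.swap (es ! i)]"

text \<open>
  Splitting the vertex \<open>u\<close> joins it by a new edge to a new vertex, to which the half-edges in the set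
  \<open>S\<close> of half-edges at \<open>u\<close> are moved. To have no further signs, the new vertex is the first vertex
  (the old vertex \<open>v\<close> becomes \<open>Suc v\<close>), the new edge is the first edge, and it is directed from the
  new vertex to the old one.
\<close>

definition split_edges :: "nat \<Rightarrow> (nat \<times> bool) set \<Rightarrow> graph \<Rightarrow> graph" where
  "split_edges u S G =
     (let mv = (\<lambda>h. if h \<in> S then 0 else Suc (endpoint (snd G) h))
      in (Suc (fst G), (0, Suc u) # map (\<lambda>i. (mv (i, True), mv (i, False))) [0..<length (snd G)]))"

definition GC_graph :: "graph \<Rightarrow> bool" where
  "GC_graph G \<longleftrightarrow> wf_graph G \<and> connected_graph G \<and> (\<forall>u < fst G. valency G u \<ge> 2)"

definition GC_rel :: "int \<Rightarrow> (graph, 'k::field) series set" where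
  "GC_rel d =
     {bas (v, es) - scl (vertex_sign d s) (bas (v, relabel s es)) | v es s.
        GC_graph (v, es) \<and> s permutes {..<v}} \<union>
     {bas (v, es) - scl (edge_sign d t) (bas (v, permute_list t es)) | v es t.
        GC_graph (v, es) \<and> t permutes {..<length es}} \<union>
     {bas (v, es) - scl (flip_sign d) (bas (v, flip_edge i es)) | v es i.
        GC_graph (v, es) \<and> i < length es}"

text \<open>
  The sum over all sets \<open>S\<close> counts every splitting twice (the two new vertices can be exchanged),
  hence the factor \<open>1/2\<close>.
\<close>

definition GC_split :: "graph \<Rightarrow> (graph, 'k::field) series" where
  "GC_split G =
     (\<Sum>u < fst G. \<Sum>S | S \<subseteq> half_edges (snd G) u \<and> \<not> has_univalent (split_edges u S G).
        scl (1 / 2) (bas (split_edges u S G)))"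

text \<open>
  The complex is the product over the numbers of vertices and edges of spaces of coinvariants, so
  the relations are imposed separately for each pair of these numbers.
\<close>

definition GC :: "int \<Rightarrow> (graph, 'k::field) cpx" where
  "GC d =
     (let C = (\<lambda>p. {x. \<forall>G. x G \<noteq> 0 \<longrightarrow> GC_graph G \<and> gdeg d G = p})
      in \<lparr>bdeg = gdeg d,
          crr = C,
          nul = (\<lambda>p. {x \<in> C p. \<forall>v e.
                   (\<lambda>G. if fst G = v \<and> length (snd G) = e then x G else 0) \<in> spn (GC_rel d)}),
          dif = lin_ext GC_split\<rparr>)"

text \<open>
  A hairy graph \<open>\<Gamma>\<^sup>f\<close> is a graph with the list \<open>f\<close> of the vertices carrying its hairs. In a pair
  \<open>(\<Gamma>\<^sub>1\<^bsup>f1\<^esup>, \<Gamma>\<^sub>2\<^bsup>f2\<^esup>)\<close> the hair of \<open>\<Gamma>\<^sub>1\<close> labelled by the \<open>j\<close>-th edge of \<open>\<Gamma>\<^sub>2\<close> sits at the vertex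
  \<open>f1 ! j\<close> of \<open>\<Gamma>\<^sub>1\<close>, and vice versa. The graph \<open>\<Gamma>\<^sub>1\<close> has \<open>n\<close> vertices (inputs) and \<open>\<Gamma>\<^sub>2\<close> has \<open>m\<close>
  vertices (outputs).
\<close>

type_synonym hgraph = "graph \<times> nat list"
type_synonym egraph = "hgraph \<times> hgraph"

definition attachments :: "graph \<Rightarrow> graph \<Rightarrow> nat list set" where
  "attachments G H = {f. length f = length (snd H) \<and> set f \<subseteq> {..<fst G}}"

fun incidences :: "egraph \<Rightarrow> ((nat + nat) \<times> (nat + nat)) set" where
  "incidences (((n, es1), f1), ((m, es2), f2)) =
     {(Inl a, Inl b) | a b. (a, b) \<in> set es1} \<union>
     {(Inl (endpoint es1 (i, k)), Inr (f2 ! i)) | i k. i < length es1} \<union>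
     {(Inr a, Inr b) | a b. (a, b) \<in> set es2} \<union>
     {(Inr (endpoint es2 (j, k)), Inl (f1 ! j)) | j k. j < length es2}"

definition connected_pair :: "egraph \<Rightarrow> bool" where
  "connected_pair X \<longleftrightarrow>
     (let V = Inl ` {..<fst (fst (fst X))} \<union> Inr ` {..<fst (fst (snd X))}
      in \<forall>a \<in> V. \<forall>b \<in> V. (a, b) \<in> (incidences X \<union> (incidences X)\<inverse>)\<^sup>*)"

definition Gra_pair :: "egraph \<Rightarrow> bool" where
  "Gra_pair X \<longleftrightarrow>
     wf_graph (fst (fst X)) \<and> wf_graph (fst (snd X)) \<and>
     snd (fst X) \<in> attachments (fst (fst X)) (fst (snd X)) \<and>
     snd (snd X) \<in> attachments (fst (snd X)) (fst (fst X)) \<and>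
     connected_pair X"

definition admissible :: "graph \<Rightarrow> graph \<Rightarrow> bool" where
  "admissible G H \<longleftrightarrow> fst G + fst H \<ge> 3"

definition fcGC_pair :: "egraph \<Rightarrow> bool" where
  "fcGC_pair X \<longleftrightarrow> Gra_pair X \<and> admissible (fst (fst X)) (fst (snd X))"

text \<open>
  The degree in \<open>Gra\<^sub>c\<^sub>,\<^sub>d(m,n)[d(1-m) + c(1-n)]\<close> of a pair: edges of \<open>\<Gamma>\<^sub>1\<close> and \<open>\<Gamma>\<^sub>2\<close> have degree
  \<open>1 - c\<close> and \<open>1 - d\<close>, so this is \<open>gdeg c \<Gamma>\<^sub>1 + gdeg d \<Gamma>\<^sub>2\<close>.
\<close>

fun edeg :: "int \<Rightarrow> int \<Rightarrow> egraph \<Rightarrow> int" where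
  "edeg c d (((n, es1), f1), ((m, es2), f2)) =
     (1 - c) * int (length es1) + (1 - d) * int (length es2)
     - (d * (1 - int m) + c * (1 - int n))"

text \<open>
  The relations changing the numbering of the vertices and the orientation of the first graph: the
  orientations of \<open>Gra\<close> and the representation \<open>sgn\<^sub>n\<^bsup>\<otimes>|c|\<^esup>\<close>. In characteristic 0 the invariants of
  \<open>\<S>\<^sub>m \<times> \<S>\<^sub>n\<close> are identified with the coinvariants via symmetrization; this is what a pair with
  unlabelled vertices stands for. Reordering the edges of one graph also reorders the hairs of the
  other one.
\<close>

definition rel1 :: "int \<Rightarrow> (egraph, 'k::field) series set" where
  "rel1 c =
     {bas (((n, es), f), (H, g)) -
        scl (vertex_sign c s) (bas (((n, relabel s es), map s f), (H, g))) | n es f H g s.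
        fcGC_pair (((n, es), f), (H, g)) \<and> s permutes {..<n}} \<union>
     {bas (((n, es), f), (H, g)) -
        scl (edge_sign c t) (bas (((n, permute_list t es), f), (H, permute_list t g))) | n es f H g t.
        fcGC_pair (((n, es), f), (H, g)) \<and> t permutes {..<length es}} \<union>
     {bas (((n, es), f), (H, g)) -
        scl (flip_sign c) (bas (((n, flip_edge i es), f), (H, g))) | n es f H g i.
        fcGC_pair (((n, es), f), (H, g)) \<and> i < length es}"

definition fcGC_rel :: "int \<Rightarrow> int \<Rightarrow> (egraph, 'k::field) series set" where
  "fcGC_rel c d = rel1 c \<union> (\<lambda>x. x \<circ> prod.swap) ` rel1 d"

text \<open>
  \<open>\<delta>'\<close> on a pair: the splittings \<open>\<Gamma>\<^sub>1 \<circ>\<^sub>v (\<circ>-\<circ>)\<close>, with the set \<open>S\<close> of half-edges and the set \<open>T\<close> of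
  hairs of \<open>v\<close> moved to the new vertex, minus the graphs \<open>\<Gamma>\<^sub>1\<^bsup>+v\<^esup>\<close>. Each splitting of a vertex with at
  least one edge or hair is counted twice, hence \<open>1/2\<close>; with this factor the terms with a new
  univalent vertex without hairs cancel. The hair labelled by the new edge is attached to \<open>w\<close> (and
  comes first because the new edge does).
\<close>

definition hairs :: "nat list \<Rightarrow> nat \<Rightarrow> nat set" where
  "hairs f v = {j. j < length f \<and> f ! j = v}"

definition split_hairs :: "nat set \<Rightarrow> nat list \<Rightarrow> nat list" where
  "split_hairs T f = map (\<lambda>j. if j \<in> T then 0 else Suc (f ! j)) [0..<length f]"

definition plus_vertex :: "nat \<Rightarrow> hgraph \<Rightarrow> hgraph" where
  "plus_vertex v A =
     ((Suc (fst (fst A)), (0, Suc v) # relabel Suc (snd (fst A))), map Suc (snd A))"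

definition split_vertex :: "nat \<Rightarrow> (nat \<times> bool) set \<Rightarrow> nat set \<Rightarrow> hgraph \<Rightarrow> hgraph" where
  "split_vertex v S T A = (split_edges v S (fst A), split_hairs T (snd A))"

definition add_hair :: "nat \<Rightarrow> hgraph \<Rightarrow> hgraph" where
  "add_hair w B = (fst B, w # snd B)"

definition delta1 :: "egraph \<Rightarrow> (egraph, 'k::field) series" where
  "delta1 X =
     (case X of (A, B) \<Rightarrow>
        (\<Sum>v < fst (fst A). \<Sum>w < fst (fst B).
           (\<Sum>S \<in> Pow (half_edges (snd (fst A)) v). \<Sum>T \<in> Pow (hairs (snd A) v).
              scl (1 / 2) (bas (split_vertex v S T A, add_hair w B)))
           - bas (plus_vertex v A, add_hair w B)))"

definition delta2 :: "egraph \<Rightarrow> (egraph, 'k::field) series" where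
  "delta2 X = delta1 (prod.swap X) \<circ> prod.swap"

definition delta :: "int \<Rightarrow> egraph \<Rightarrow> (egraph, 'k::field) series" where
  "delta c X = delta1 X + scl (koszul (gdeg c (fst (fst X)))) (delta2 X)"

fun esize :: "egraph \<Rightarrow> (nat \<times> nat) \<times> (nat \<times> nat)" where
  "esize (((n, es1), f1), ((m, es2), f2)) = ((n, length es1), (m, length es2))"

text \<open>
  The product is taken over the numbers of vertices and of edges, as for \<open>GC\<^sub>d\<close>. If \<open>c = 1\<close>, graphs
  with a fixed number of vertices and any number of edges have the same degree in \<open>GC\<^sub>c\<close>, so the
  image of \<open>Sym\<close> contains infinite series of pairs for a fixed \<open>(m,n)\<close>.
\<close>

definition fcGC :: "int \<Rightarrow> int \<Rightarrow> (egraph, 'k::field) cpx" where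
  "fcGC c d =
     (let C = (\<lambda>p. {x. \<forall>X. x X \<noteq> 0 \<longrightarrow> fcGC_pair X \<and> edeg c d X = p})
      in \<lparr>bdeg = edeg c d,
          crr = C,
          nul = (\<lambda>p. {x \<in> C p. \<forall>k.
                   (\<lambda>X. if esize X = k then x X else 0) \<in> spn (fcGC_rel c d)}),
          dif = lin_ext (delta c)\<rparr>)"

definition GC1 :: "int \<Rightarrow> int \<Rightarrow> int \<Rightarrow> (egraph, 'k::field) series set" where
  "GC1 c d p =
     {x \<in> crr (fcGC c d) p. \<forall>X. x X \<noteq> 0 \<longrightarrow>
        has_univalent (fst (fst X)) \<or> has_univalent (fst (snd X))}"

definition GC2 :: "int \<Rightarrow> int \<Rightarrow> (egraph, 'k::field) cpx" where
  "GC2 c d =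
     (fcGC c d)\<lparr>nul := (\<lambda>p. {x + y | x y. x \<in> nul (fcGC c d) p \<and> y \<in> GC1 c d p})\<rparr>"

text \<open>
  Pairs with \<open>m + n < 3\<close> are not part of \<open>fcGC\<close>, so \<open>Sym\<close> drops them. On \<open>GC\<^sub>c \<otimes> GC\<^sub>d\<close> this matters
  only if \<open>c\<close> and \<open>d\<close> are even: the tensors of two one-vertex graphs are then, modulo relations, the
  multiples of the cocycle \<open>tadpole \<otimes> tadpole\<close> below, and otherwise they vanish.
\<close>

definition Sym_basis :: "graph \<times> graph \<Rightarrow> (egraph, 'k::field) series" where
  "Sym_basis X =
     (case X of (G, H) \<Rightarrow>
        if admissible G H
        then \<Sum>f1 \<in> attachments G H. \<Sum>f2 \<in> attachments H G. bas ((G, f1), (H, f2))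
        else 0)"

definition Sym :: "(graph \<times> graph, 'k::field) series \<Rightarrow> (egraph, 'k) series" where
  "Sym = lin_ext Sym_basis"

definition tadpole :: graph where
  "tadpole = (1, [(0, 0)])"

end

theory Submission
  imports Defs
begin

text \<open>
  An element of one of the quotients vanishes if and only if it is killed by all functionals of finite support that are
  equivariant under renumbering and reorienting. On functionals the differential becomes the contraction of edges and
  \<open>Sym\<close> the summation over all hair positions. This makes \<open>Sym\<close> a chain map and, as the products \<open>\<phi> \<otimes> \<psi>\<close> of
  equivariant functionals separate the elements of a tensor product, injective.

  For the cohomology let \<open>\<phi>\<close> and \<open>\<psi>\<close> be functionals vanishing on coboundaries, and let \<open>Sym x\<close> be the boundary of \<open>y\<close>. It
  suffices that \<open>\<phi> \<otimes> \<psi>\<close> kills \<open>x\<close>, and this is clear if \<open>y\<close> does not depend on the positions of the hairs. Insertion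
  of bivalent vertices is a homotopy that counts the hairs on whose position an equivariant function depends. By
  descending induction on the number of vertices it is used to remove this dependence from \<open>y\<close>, first for the hairs of
  one graph and then for those of the other one, without changing the boundary of \<open>y\<close>.
\<close>

text \<open>The obstacle is that the complexes are infinite products of coinvariants: a primitive
  \<open>y\<close> of \<open>Sym x\<close> is an infinite series, determined only modulo relations.
  The differential preserves edges minus vertices in each of the two graphs and raises the total
  number of vertices by one, so a test functional of one size sees only finitely many sizes of
  \<open>y\<close>. This finite part of \<open>y\<close> is replaced by an equivariant function with
  the same pairings. On equivariant functions the differential becomes a genuine operator
  \<open>Dd\<close>, a signed sum over the contractions of all edges. The homotopy controls only the
  contractions in one graph. Contractions in the other graph keep the number of vertices of the
  first one, and the equation for the boundary expresses one kind of contraction by the other. So,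
  at the level above the current one, the contractions in the first graph give a function from which
  the dependence has been removed already; this dictates a descending induction. Characteristic 0
  enters through averages over hair positions and through division by the number of hairs, the
  eigenvalue of the homotopy.\<close>

type_synonym 'k efun = "(egraph, 'k) series"
type_synonym 'k gfun = "(graph, 'k) series"
type_synonym 'k gpfun = "(graph \<times> graph, 'k) series"

abbreviation tsp :: "nat \<Rightarrow> nat \<Rightarrow> nat \<Rightarrow> nat" where "tsp \<equiv> Transposition.transpose"

abbreviation noflip :: "nat \<Rightarrow> bool" where "noflip \<equiv> \<lambda>_. False"

abbreviation dGC :: "(graph, 'k::field) series \<Rightarrow> (graph, 'k) series" where "dGC \<equiv> lin_ext GC_split"

section \<open>The group acting on the first graph of a pair\<close>

text \<open>Position \<open>i\<close> of the result holds the edge \<open>t i\<close>, so edge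
  permutations act from the right while vertex permutations act from the left. This explains the
  order \<open>s \<circ> s'\<close>, \<open>t' \<circ> t\<close> in the composition laws. Flips are
  indexed by positions in the result.\<close>

definition act_edges ::
  "(nat \<Rightarrow> nat) \<Rightarrow> (nat \<Rightarrow> nat) \<Rightarrow> (nat \<Rightarrow> bool) \<Rightarrow> (nat \<times> nat) list \<Rightarrow> (nat \<times> nat) list" where
  "act_edges s t F es =
     map (\<lambda>i. (if F i then prod.swap else id) (map_prod s s (es ! t i))) [0..<length es]"

fun act1 :: "(nat \<Rightarrow> nat) \<Rightarrow> (nat \<Rightarrow> nat) \<Rightarrow> (nat \<Rightarrow> bool) \<Rightarrow> egraph \<Rightarrow> egraph" where
  "act1 s t F (((n, es), f), (H, g)) =
     (((n, act_edges s t F es), map s f), (H, permute_list t g))"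

text \<open>The character by which renumberings and flips act on orientations. It takes only the
  values 1 and -1, hence is its own inverse (\<open>or_sign_sq\<close>), and relations can be read
  in both directions.\<close>

definition or_sign ::
  "int \<Rightarrow> nat \<Rightarrow> (nat \<Rightarrow> nat) \<Rightarrow> (nat \<Rightarrow> nat) \<Rightarrow> (nat \<Rightarrow> bool) \<Rightarrow> 'k::field_char_0" where
  "or_sign c e s t F =
     vertex_sign c s * edge_sign c t * (\<Prod>i<e. if F i then flip_sign c else 1)"

text \<open>\<open>Gra_pair\<close> without connectedness, written by pattern matching so that
  simplification decides it on explicit pairs. Contraction and the group action respect it, which
  makes it the basic hypothesis on a single pair.\<close>

fun wfp :: "egraph \<Rightarrow> bool" where
  "wfp (((n, es), f), ((m, es'), g)) \<longleftrightarrow>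
     1 \<le> n \<and> 1 \<le> m \<and> set es \<subseteq> {..<n} \<times> {..<n} \<and> set es' \<subseteq> {..<m} \<times> {..<m} \<and>
     length f = length es' \<and> set f \<subseteq> {..<n} \<and> length g = length es \<and> set g \<subseteq> {..<m}"

abbreviation nv1 :: "egraph \<Rightarrow> nat" where "nv1 X \<equiv> fst (fst (fst X))"
abbreviation ne1 :: "egraph \<Rightarrow> nat" where "ne1 X \<equiv> length (snd (fst (fst X)))"
abbreviation nv2 :: "egraph \<Rightarrow> nat" where "nv2 X \<equiv> fst (fst (snd X))"
abbreviation ne2 :: "egraph \<Rightarrow> nat" where "ne2 X \<equiv> length (snd (fst (snd X)))"

lemma length_act_edges [simp]: "length (act_edges s t F es) = length es"
  by (simp add: act_edges_def)

lemma nth_act_edges [simp]: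
  "i < length es \<Longrightarrow>
     act_edges s t F es ! i = (if F i then prod.swap else id) (map_prod s s (es ! t i))"
  by (simp add: act_edges_def)

lemma permutes_less: "p permutes {..<n} \<Longrightarrow> i < n \<Longrightarrow> p i < (n::nat)"
  using permutes_in_image[of p "{..<n}" i] by simp

lemma permutes_permutation: "p permutes {..<n::nat} \<Longrightarrow> permutation p"
  by (rule permutes_imp_permutation) auto

lemma set_act_edges:
  assumes "s permutes {..<n}" "t permutes {..<length es}" "set es \<subseteq> {..<n} \<times> {..<n}"
  shows "set (act_edges s t F es) \<subseteq> {..<n} \<times> {..<n}"
proof
  fix p assume "p \<in> set (act_edges s t F es)"
  then obtain i where i: "i < length es" "p = act_edges s t F es ! i"
    by (auto simp: in_set_conv_nth)
  have "es ! t i \<in> {..<n} \<times> {..<n}"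
    using assms(3) permutes_less[OF assms(2) i(1)] by (meson nth_mem subsetD)
  then show "p \<in> {..<n} \<times> {..<n}"
    using i permutes_less[OF assms(1)] by (cases "es ! t i") auto
qed

lemma wfp_act1:
  assumes "wfp X" "s permutes {..<nv1 X}" "t permutes {..<ne1 X}"
  shows "wfp (act1 s t F X)"
proof -
  obtain n es f m es' g where X: "X = (((n, es), f), ((m, es'), g))"
    by (metis prod.exhaust)
  show ?thesis
    using assms set_act_edges[of s n t es F] permutes_less[of s n]
    unfolding X by (auto simp: subset_iff)
qed

lemma sizes_act1 [simp]:
  "nv1 (act1 s t F X) = nv1 X" "ne1 (act1 s t F X) = ne1 X"
  "fst (snd (act1 s t F X)) = fst (snd X)"
proof -
  obtain n es f H g where X: "X = (((n, es), f), (H, g))"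
    by (metis prod.exhaust)
  show "nv1 (act1 s t F X) = nv1 X" "ne1 (act1 s t F X) = ne1 X"
    "fst (snd (act1 s t F X)) = fst (snd X)" by (simp_all add: X)
qed

lemma act_edges_comp:
  assumes "t permutes {..<length es}"
  shows "act_edges s t F (act_edges s' t' F' es) =
         act_edges (s \<circ> s') (t' \<circ> t) (\<lambda>i. F i \<noteq> F' (t i)) es"
proof (rule nth_equalityI)
  fix i assume "i < length (act_edges s t F (act_edges s' t' F' es))"
  then have i: "i < length es" by simp
  show "act_edges s t F (act_edges s' t' F' es) ! i =
        act_edges (s \<circ> s') (t' \<circ> t) (\<lambda>i. F i \<noteq> F' (t i)) es ! i"
    using i permutes_less[OF assms i] by (cases "es ! t' (t i)") auto
qed simp

lemma act1_act1:
  assumes "wfp X" "t permutes {..<ne1 X}"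
  shows "act1 s t F (act1 s' t' F' X) = act1 (s \<circ> s') (t' \<circ> t) (\<lambda>i. F i \<noteq> F' (t i)) X"
proof -
  obtain n es f m es' g where X: "X = (((n, es), f), ((m, es'), g))"
    by (metis prod.exhaust)
  show ?thesis using assms unfolding X
    by (simp add: act_edges_comp permute_list_compose)
qed

lemma act_edges_id [simp]: "act_edges id id noflip es = es"
  by (rule nth_equalityI) (auto simp: map_prod_def)

lemma act1_id [simp]: "act1 id id noflip X = X"
proof -
  obtain n es f H g where X: "X = (((n, es), f), (H, g))"
    by (metis prod.exhaust)
  show ?thesis by (simp add: X)
qed

lemma act1_inverse:
  assumes "wfp X" "s permutes {..<nv1 X}" "t permutes {..<ne1 X}"
  shows "act1 (inv s) (inv t) (\<lambda>i. F (inv t i)) (act1 s t F X) = X"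
  using act1_act1[OF assms(1) permutes_inv[OF assms(3)], of "inv s" "\<lambda>i. F (inv t i)" s t F]
    permutes_inv_o[OF assms(2)] permutes_inv_o[OF assms(3)] by simp

lemma act1_inverse':
  assumes "wfp X" "s permutes {..<nv1 X}" "t permutes {..<ne1 X}"
  shows "act1 s t F (act1 (inv s) (inv t) (\<lambda>i. F (inv t i)) X) = X"
proof -
  have "inv t (t i) = i" for i
    using permutes_inverses(2)[OF assms(3)] by simp
  then show ?thesis
  using act1_act1[OF assms(1) assms(3), of s F "inv s" "inv t" "\<lambda>i. F (inv t i)"]
    permutes_inv_o[OF assms(2)] permutes_inv_o[OF assms(3)] by simp
qed

lemma flip_sign_sq [simp]: "flip_sign c * flip_sign c = (1 :: 'k::field_char_0)"
  by (simp add: flip_sign_def)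

lemma vertex_sign_comp:
  "permutation s \<Longrightarrow> permutation s' \<Longrightarrow>
     vertex_sign c (s \<circ> s') = (vertex_sign c s * vertex_sign c s' :: 'k::field_char_0)"
  by (simp add: vertex_sign_def sign_compose)

lemma edge_sign_comp:
  "permutation s \<Longrightarrow> permutation s' \<Longrightarrow>
     edge_sign c (s \<circ> s') = (edge_sign c s * edge_sign c s' :: 'k::field_char_0)"
  by (simp add: edge_sign_def sign_compose)

lemma or_sign_comp:
  assumes "s permutes {..<n}" "s' permutes {..<n'}" "t permutes {..<e}" "t' permutes {..<e}"
  shows "or_sign c e (s \<circ> s') (t' \<circ> t) (\<lambda>i. F i \<noteq> F' (t i)) =
         (or_sign c e s t F * or_sign c e s' t' F' :: 'k::field_char_0)"
proof -
  let ?fl = "\<lambda>b. if b then flip_sign c else (1::'k)"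
  have "(\<Prod>i<e. ?fl (F i \<noteq> F' (t i))) = (\<Prod>i<e. ?fl (F i) * ?fl (F' (t i)))"
    by (rule prod.cong) auto
  also have "\<dots> = (\<Prod>i<e. ?fl (F i)) * (\<Prod>i<e. ?fl (F' (t i)))"
    by (rule prod.distrib)
  also have "(\<Prod>i<e. ?fl (F' (t i))) = (\<Prod>i<e. ?fl (F' i))"
    using prod.permute[OF assms(3), of "\<lambda>i. ?fl (F' i)"] by (simp add: comp_def)
  finally show ?thesis
    unfolding or_sign_def
    using vertex_sign_comp[of s s' c, where 'k='k] edge_sign_comp[of t' t c, where 'k='k] assms
    by (simp add: permutes_permutation mult_ac)
qed

lemma or_sign_id [simp]: "or_sign c e id id noflip = 1"
  by (simp add: or_sign_def vertex_sign_def edge_sign_def)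

lemma or_sign_sq:
  "or_sign c e s t F * or_sign c e s t F = (1 :: 'k::field_char_0)"
proof -
  have sg: "of_int (sign p) * of_int (sign p) = (1::'k)" for p :: "nat \<Rightarrow> nat"
    by (simp add: sign_def)
  have "(\<Prod>i<e. if F i then flip_sign c else 1) * (\<Prod>i<e. if F i then flip_sign c else 1)
      = (\<Prod>i<e. (1::'k))"
    unfolding prod.distrib[symmetric] by (rule prod.cong) auto
  moreover have "vertex_sign c s * vertex_sign c s = (1::'k)"
    "edge_sign c t * edge_sign c t = (1::'k)"
    by (simp_all add: vertex_sign_def edge_sign_def sg)
  moreover have sq: "(a * b * p) * (a * b * p) = (a * a) * (b * b) * (p * p)" for a b p :: 'k
    by (simp only: mult_ac)
  ultimately show ?thesis
    unfolding or_sign_def sq by simp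
qed

text \<open>For functions supported on \<open>fcGC_pair\<close>, this is the condition that the
  pairing kills \<open>rel1 c\<close> (\<open>EQ1_iff_rel1\<close>). One formula for arbitrary group
  elements is easier to transport along contractions than three families of generators.\<close>

definition EQ1 :: "int \<Rightarrow> 'k::field_char_0 efun \<Rightarrow> bool" where
  "EQ1 c \<Phi> \<longleftrightarrow>
     (\<forall>X s t F. wfp X \<longrightarrow> s permutes {..<nv1 X} \<longrightarrow> t permutes {..<ne1 X} \<longrightarrow>
        \<Phi> (act1 s t F X) = or_sign c (ne1 X) s t F * \<Phi> X)"

lemma EQ1D:
  "EQ1 c \<Phi> \<Longrightarrow> wfp X \<Longrightarrow> s permutes {..<nv1 X} \<Longrightarrow> t permutes {..<ne1 X} \<Longrightarrow>
     \<Phi> (act1 s t F X) = or_sign c (ne1 X) s t F * \<Phi> X"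
  unfolding EQ1_def by blast

lemma EQ1D':
  assumes "EQ1 c \<Phi>" "wfp X" "s permutes {..<nv1 X}" "t permutes {..<ne1 X}"
  shows "\<Phi> X = or_sign c (ne1 X) s t F * \<Phi> (act1 s t F X)"
  unfolding EQ1D[OF assms] by (simp only: mult.assoc[symmetric] or_sign_sq mult_1)

definition EQ :: "int \<Rightarrow> int \<Rightarrow> 'k::field_char_0 efun \<Rightarrow> bool" where
  "EQ c d \<Phi> \<longleftrightarrow> EQ1 c \<Phi> \<and> EQ1 d (\<Phi> \<circ> prod.swap)"

lemma EQ_swap: "EQ c d \<Phi> \<Longrightarrow> EQ d c (\<Phi> \<circ> prod.swap)"
  by (simp add: EQ_def comp_assoc)

lemma wfp_swap [simp]: "wfp (prod.swap X) \<longleftrightarrow> wfp X"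
proof -
  obtain n es f m es' g where X: "X = (((n, es), f), ((m, es'), g))"
    by (metis prod.exhaust)
  show ?thesis by (auto simp: X)
qed

section \<open>Contraction of the first edge\<close>

definition merge :: "nat \<Rightarrow> nat \<Rightarrow> nat" where
  "merge u x = (case x of 0 \<Rightarrow> u | Suc v \<Rightarrow> v)"

lemma merge_simps [simp]: "merge u 0 = u" "merge u (Suc v) = v"
  by (simp_all add: merge_def)

text \<open>The position in which \<open>split_vertex\<close> leaves its new edge: first in the list
  and directed from the vertex 0 to another one. In this position contraction reverses splitting
  without any sign.\<close>

fun std1 :: "egraph \<Rightarrow> bool" where
  "std1 (((n, es), f), (H, g)) \<longleftrightarrow> es \<noteq> [] \<and> (\<exists>u. hd es = (0, Suc u))"

fun contract1 :: "egraph \<Rightarrow> egraph" where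
  "contract1 (((n, es), f), (H, g)) =
     (((n - 1, map (map_prod (merge (snd (hd es) - 1)) (merge (snd (hd es) - 1))) (tl es)),
       map (merge (snd (hd es) - 1)) f), (H, tl g))"

lemma std1_cases:
  assumes "std1 X" "wfp X"
  obtains n u es f m es' g w where
    "X = (((Suc n, (0, Suc u) # es), f), ((m, es'), w # g))" "u < n" "w < m"
    "contract1 X = (((n, map (map_prod (merge u) (merge u)) es), map (merge u) f), ((m, es'), g))"
proof -
  obtain n es f m es' g where X: "X = (((n, es), f), ((m, es'), g))"
    by (metis prod.exhaust)
  obtain u es1 where es: "es = (0, Suc u) # es1"
    using assms(1) X by (cases es) auto
  obtain w g1 where g: "g = w # g1"
    using assms(2) X es by (cases g) auto
  show ?thesis
    using assms(2) by (intro that[of "n - 1" u es1 f m es' w g1]) (auto simp: X es g)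
qed

lemma merge_less: "x < Suc n \<Longrightarrow> u < n \<Longrightarrow> merge u x < n"
  by (cases x) auto

lemma wfp_contract1:
  assumes "std1 X" "wfp X"
  shows "wfp (contract1 X)"
proof -
  obtain n u es f m es' g w where X: "X = (((Suc n, (0, Suc u) # es), f), ((m, es'), w # g))"
    "u < n" "w < m"
    "contract1 X = (((n, map (map_prod (merge u) (merge u)) es), map (merge u) f), ((m, es'), g))"
    by (rule std1_cases[OF assms])
  show ?thesis
    unfolding X(4) using assms(2) X(2) merge_less[of _ n u] unfolding X(1)
    by (auto simp: subset_iff)
qed

text \<open>Renumberings of the contracted graph correspond to those renumberings of the graph that
  fix the new vertex 0 and the new edge 0. This embedding preserves the signs
  (\<open>or_sign_lift\<close>).\<close>

definition lift_perm :: "(nat \<Rightarrow> nat) \<Rightarrow> nat \<Rightarrow> nat" where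
  "lift_perm s x = (case x of 0 \<Rightarrow> 0 | Suc v \<Rightarrow> Suc (s v))"

lemma lift_perm_simps [simp]: "lift_perm s 0 = 0" "lift_perm s (Suc v) = Suc (s v)"
  by (simp_all add: lift_perm_def)

definition lift_flip :: "(nat \<Rightarrow> bool) \<Rightarrow> nat \<Rightarrow> bool" where
  "lift_flip F i = (case i of 0 \<Rightarrow> False | Suc j \<Rightarrow> F j)"

lemma lift_flip_simps [simp]: "lift_flip F 0 = False" "lift_flip F (Suc v) = F v"
  by (simp_all add: lift_flip_def)

lemma lift_perm_permutes:
  assumes "s permutes {..<n}"
  shows "lift_perm s permutes {..<Suc n}"
proof (rule bij_imp_permutes)
  have "lift_perm s ` {..<Suc n} \<subseteq> {..<Suc n}"
    using permutes_less[OF assms] by (auto simp: lift_perm_def split: nat.splits)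
  moreover have "inj_on (lift_perm s) {..<Suc n}"
  proof (rule inj_onI)
    fix x y assume "lift_perm s x = lift_perm s y"
    then show "x = y"
      using injD[OF permutes_inj[OF assms]] by (cases x; cases y) auto
  qed
  ultimately show "bij_betw (lift_perm s) {..<Suc n} {..<Suc n}"
    by (simp add: bij_betw_def endo_inj_surj)
next
  fix x assume "x \<notin> {..<Suc n}"
  then show "lift_perm s x = x"
    using permutes_not_in[OF assms] by (cases x) auto
qed

lemma lift_perm_comp: "lift_perm (s \<circ> s') = lift_perm s \<circ> lift_perm s'"
  by (auto simp: lift_perm_def fun_eq_iff split: nat.splits)

lemma lift_perm_transpose:
  "lift_perm (tsp a b) = tsp (Suc a) (Suc b)"
  by (auto simp: lift_perm_def fun_eq_iff Transposition.transpose_def split: nat.splits)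

text \<open>Lifting is a homomorphism that sends transpositions to transpositions.\<close>

lemma sign_lift_perm:
  assumes "s permutes {..<n::nat}"
  shows "sign (lift_perm s) = sign s"
proof -
  have "finite {..<n}" by simp
  from assms this show ?thesis
  proof (induction rule: permutes_induct)
    case id
    have "lift_perm id = id" by (auto simp: lift_perm_def fun_eq_iff split: nat.splits)
    then show ?case by metis
  next
    case (swap a b p)
    have "sign (lift_perm (tsp a b \<circ> p)) =
        sign (tsp (Suc a) (Suc b)) * sign (lift_perm p)"
      unfolding lift_perm_comp lift_perm_transpose
      using swap by (intro sign_compose permutation_swap_id)
        (auto intro: permutes_permutation lift_perm_permutes)
    also have "\<dots> = sign (tsp a b) * sign p"
      using swap by (simp add: sign_swap_id)
    also have "\<dots> = sign (tsp a b \<circ> p)"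
      using swap by (intro sign_compose[symmetric] permutation_swap_id permutes_permutation)
    finally show ?case .
  qed
qed

lemma or_sign_lift:
  assumes "s permutes {..<n}" "t permutes {..<e}"
  shows "or_sign c (Suc e) (lift_perm s) (lift_perm t) (lift_flip F) =
         (or_sign c e s t F :: 'k::field_char_0)"
  using sign_lift_perm[OF assms(1)] sign_lift_perm[OF assms(2)]
  unfolding or_sign_def vertex_sign_def edge_sign_def prod.lessThan_Suc_shift by simp

lemma merge_lift: "merge (s u) (lift_perm s x) = s (merge u x)"
  by (cases x) auto

lemma act_edges_Cons_lift:
  "act_edges (lift_perm s) (lift_perm t) (lift_flip F) (p # es) =
     map_prod (lift_perm s) (lift_perm s) p # act_edges (lift_perm s) t F es"
proof (rule nth_equalityI)
  fix i assume "i < length (act_edges (lift_perm s) (lift_perm t) (lift_flip F) (p # es))"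
  then show "act_edges (lift_perm s) (lift_perm t) (lift_flip F) (p # es) ! i =
    (map_prod (lift_perm s) (lift_perm s) p # act_edges (lift_perm s) t F es) ! i"
    by (cases i) auto
qed simp

lemma permute_list_Cons_lift:
  "permute_list (lift_perm t) (w # g) = w # permute_list t g"
  by (rule nth_equalityI) (auto simp: permute_list_def less_Suc_eq_0_disj simp del: upt_Suc)

lemma contract1_act1_lift:
  assumes "std1 Z" "wfp Z" "t permutes {..<ne1 (contract1 Z)}"
  shows "std1 (act1 (lift_perm s) (lift_perm t) (lift_flip F) Z)"
    "contract1 (act1 (lift_perm s) (lift_perm t) (lift_flip F) Z) = act1 s t F (contract1 Z)"
proof -
  obtain n u es f m es' g w where Z: "Z = (((Suc n, (0, Suc u) # es), f), ((m, es'), w # g))"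
    "u < n" "w < m"
    "contract1 Z = (((n, map (map_prod (merge u) (merge u)) es), map (merge u) f), ((m, es'), g))"
    by (rule std1_cases[OF assms(1,2)])
  have t: "t permutes {..<length es}" using assms(3) Z(4) by simp
  have *: "map (map_prod (merge (s u)) (merge (s u))) (act_edges (lift_perm s) t F es) =
        act_edges s t F (map (map_prod (merge u) (merge u)) es)"
  proof (rule nth_equalityI)
    fix i assume "i < length (map (map_prod (merge (s u)) (merge (s u))) (act_edges (lift_perm s) t F es))"
    then have i: "i < length es" by simp
    show "map (map_prod (merge (s u)) (merge (s u))) (act_edges (lift_perm s) t F es) ! i =
        act_edges s t F (map (map_prod (merge u) (merge u)) es) ! i"
      using i permutes_less[OF t i] by (cases "es ! t i") (auto simp: merge_lift)
  qed simp
  show "std1 (act1 (lift_perm s) (lift_perm t) (lift_flip F) Z)"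
    by (simp add: Z(1) act_edges_Cons_lift)
  show "contract1 (act1 (lift_perm s) (lift_perm t) (lift_flip F) Z) = act1 s t F (contract1 Z)"
    unfolding Z(4) unfolding Z(1)
    by (simp add: act_edges_Cons_lift permute_list_Cons_lift * merge_lift)
qed

lemma sizes_contract1:
  assumes "std1 Z" "wfp Z"
  shows "nv1 Z = Suc (nv1 (contract1 Z))" "ne1 Z = Suc (ne1 (contract1 Z))"
    "fst (snd (contract1 Z)) = fst (snd Z)"
  by (rule std1_cases[OF assms], simp)+

lemma unlift_perm:
  assumes "s permutes {..<Suc n}" "s 0 = 0"
  obtains s' where "s' permutes {..<n}" "s = lift_perm s'"
proof
  define s' where "s' v = s (Suc v) - 1" for v
  have nz: "s (Suc v) \<noteq> 0" for v
    using permutes_inj[OF assms(1)] assms(2) by (metis injD nat.distinct(1))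
  show eq: "s = lift_perm s'"
    using assms(2) nz by (auto simp: fun_eq_iff lift_perm_def s'_def split: nat.splits)
  show "s' permutes {..<n}"
  proof (rule bij_imp_permutes)
    have "s' ` {..<n} \<subseteq> {..<n}"
    proof
      fix y assume "y \<in> s' ` {..<n}"
      then obtain v where "v < n" "y = s' v" by auto
      then show "y \<in> {..<n}"
        using permutes_less[OF assms(1), of "Suc v"] nz[of v] by (auto simp: s'_def)
    qed
    moreover have "inj_on s' {..<n}"
    proof (rule inj_onI)
      fix x y assume "s' x = s' y"
      then have "s (Suc x) = s (Suc y)" by (simp add: eq)
      then show "x = y" using permutes_inj[OF assms(1)] by (auto dest: injD)
    qed
    ultimately show "bij_betw s' {..<n} {..<n}"
      by (simp add: bij_betw_def endo_inj_surj)
  next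
    fix x assume "x \<notin> {..<n}"
    then show "s' x = x"
      using permutes_not_in[OF assms(1), of "Suc x"] by (simp add: s'_def)
  qed
qed

text \<open>
  The value of an equivariant function on the contraction of an edge depends only on the edge and
  not on the group element that moves it to the front.
\<close>

lemma EQ1_contract_fix:
  assumes "EQ1 c y" "wfp Z" "std1 Z" "s permutes {..<nv1 Z}" "t permutes {..<ne1 Z}"
    "t 0 = 0" "std1 (act1 s t F Z)"
  shows "y (contract1 (act1 s t F Z)) = or_sign c (ne1 Z) s t F * y (contract1 Z)"
proof -
  have noflip: "y (contract1 (act1 s t F Z)) = or_sign c (ne1 Z) s t F * y (contract1 Z)"
    if Z: "wfp Z" "std1 Z" and s: "s permutes {..<nv1 Z}" and t: "t permutes {..<ne1 Z}" "t 0 = 0"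
      and st: "std1 (act1 s t F Z)" and F0: "\<not> F 0" for Z s F
  proof -
    obtain n u es f m es' g w where ZZ: "Z = (((Suc n, (0, Suc u) # es), f), ((m, es'), w # g))"
      by (rule std1_cases[OF Z(2,1)])
    have "s 0 = 0"
    proof -
      have "act_edges s t F ((0, Suc u) # es) ! 0 = (s 0, s (Suc u))"
        using F0 t(2) by (subst nth_act_edges) auto
      moreover have "hd (act_edges s t F ((0, Suc u) # es)) = act_edges s t F ((0, Suc u) # es) ! 0"
        by (rule hd_conv_nth) (metis length_act_edges length_0_conv list.distinct(1))
      ultimately show ?thesis using st by (auto simp: ZZ)
    qed
    then obtain s' where s': "s' permutes {..<n}" "s = lift_perm s'"
      using unlift_perm[of s n] s by (auto simp: ZZ)
    obtain t' where t': "t' permutes {..<length es}" "t = lift_perm t'"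
      using unlift_perm[of t "length es"] t by (auto simp: ZZ)
    have F: "F = lift_flip (\<lambda>i. F (Suc i))"
      using F0 by (auto simp: lift_flip_def fun_eq_iff split: nat.splits)
    have e: "ne1 (contract1 Z) = length es" "nv1 (contract1 Z) = n" "ne1 Z = Suc (length es)"
      using sizes_contract1[OF Z(2,1)] by (simp_all add: ZZ)
    have "contract1 (act1 s t F Z) = act1 s' t' (\<lambda>i. F (Suc i)) (contract1 Z)"
      using contract1_act1_lift(2)[OF Z(2,1), of t' s' "\<lambda>i. F (Suc i)"] t' s' F e by simp
    moreover have "or_sign c (ne1 Z) s t F = (or_sign c (length es) s' t' (\<lambda>i. F (Suc i)) :: 'a)"
      using or_sign_lift[OF s'(1) t'(1), of c "\<lambda>i. F (Suc i)", where 'k='a] F s' t' e by simp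
    ultimately show ?thesis
      using EQ1D[OF assms(1) wfp_contract1[OF Z(2,1)], of s' t'] s' t' e by simp
  qed
  show ?thesis
  proof (cases "F 0")
    case False
    then show ?thesis using noflip assms by blast
  next
    case True
    obtain n u es f m es' g w where Z: "Z = (((Suc n, (0, Suc u) # es), f), ((m, es'), w # g))"
      "u < n" "w < m"
      "contract1 Z = (((n, map (map_prod (merge u) (merge u)) es), map (merge u) f), ((m, es'), g))"
      by (rule std1_cases[OF assms(3,2)])
    \<comment> \<open>A reversed first edge is turned round by exchanging its two ends and flipping
      it. This changes neither the contraction nor the sign: the exchange and the flip each count -1
      for odd \<open>c\<close> and 1 for even \<open>c\<close>.\<close>
    let ?r = "tsp 0 (Suc u)" and ?G = "\<lambda>i::nat. i = 0"
    let ?Z = "act1 ?r id ?G Z"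
    have r: "?r permutes {..<Suc n}" using Z(2) by (intro permutes_swap_id) auto
    have mr: "merge u (?r x) = merge u x" for x
      by (cases x) (auto simp: Transposition.transpose_def)
    have tl: "act_edges ?r id ?G ((0, Suc u) # es) = (0, Suc u) # map (map_prod ?r ?r) es"
      by (rule nth_equalityI) (auto simp: less_Suc_eq_0_disj)
    have Z1: "wfp ?Z" "std1 ?Z" "contract1 ?Z = contract1 Z"
      using wfp_act1[OF assms(2), of ?r id ?G] r unfolding Z(4)
      by (simp_all add: Z(1) tl mr map_prod_def prod.case_distrib split_def permutes_id)
    have s2: "s \<circ> ?r permutes {..<nv1 ?Z}"
      using permutes_compose[OF r] assms(4) by (simp add: Z(1))
    have comp: "act1 (s \<circ> ?r) t (\<lambda>i. i \<noteq> 0 \<and> F i) ?Z = act1 s t F Z"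
    proof -
      have tz: "t i = 0 \<longleftrightarrow> i = 0" for i
        using assms(6) permutes_inj[OF assms(5)] by (metis injD)
      have "(\<lambda>i. (i \<noteq> 0 \<and> F i) \<noteq> (t i = 0)) = F" using True tz by (auto simp: fun_eq_iff)
      moreover have "s \<circ> ?r \<circ> ?r = s" by (simp add: comp_assoc)
      ultimately show ?thesis
        using act1_act1[OF assms(2,5), of "s \<circ> ?r" "\<lambda>i. i \<noteq> 0 \<and> F i" ?r id ?G] by simp
    qed
    have sgn: "or_sign c (ne1 Z) (s \<circ> ?r) t (\<lambda>i. i \<noteq> 0 \<and> F i) = (or_sign c (ne1 Z) s t F :: 'a)"
    proof -
      have vs: "vertex_sign c (s \<circ> ?r) = (vertex_sign c s * flip_sign c :: 'a)"
        using assms(4) r by (simp add: vertex_sign_comp permutes_permutation Z(1))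
          (simp add: vertex_sign_def flip_sign_def sign_swap_id)
      have "(\<Prod>i<ne1 Z. if F i then flip_sign c else (1::'a)) =
        flip_sign c * (\<Prod>i<ne1 Z. if i \<noteq> 0 \<and> F i then flip_sign c else 1)"
        using True by (simp add: Z(1) prod.lessThan_Suc_shift del: prod.lessThan_Suc)
      then show ?thesis unfolding or_sign_def vs by (simp add: mult_ac)
    qed
    show ?thesis
      using noflip[of ?Z "s \<circ> ?r" "\<lambda>i. i \<noteq> 0 \<and> F i"] Z1 s2 assms(5,6,7) comp sgn
      by (simp del: act1.simps)
  qed
qed

text \<open>The quotient of the two group elements fixes the first edge, so
  \<open>EQ1_contract_fix\<close> applies to it. Together with its sign, the contraction of an edge
  thus becomes a function of the edge alone; this is what makes \<open>cval\<close> independent of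
  choices.\<close>

lemma EQ1_contract_choice:
  assumes "EQ1 c y" "wfp Y"
    and p: "s permutes {..<nv1 Y}" "t permutes {..<ne1 Y}" "s' permutes {..<nv1 Y}" "t' permutes {..<ne1 Y}"
    and "t 0 = t' 0" "std1 (act1 s t F Y)" "std1 (act1 s' t' F' Y)"
  shows "or_sign c (ne1 Y) s t F * y (contract1 (act1 s t F Y)) =
         or_sign c (ne1 Y) s' t' F' * y (contract1 (act1 s' t' F' Y))"
proof -
  let ?Z = "act1 s t F Y"
  let ?s = "s' \<circ> inv s" and ?t = "inv t \<circ> t'" and ?F = "\<lambda>i. F' i \<noteq> F (inv t (t' i))"
  have Z: "wfp ?Z" using wfp_act1 assms by blast
  have perm: "?s permutes {..<nv1 Y}" "?t permutes {..<ne1 Y}"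
    using p by (auto intro: permutes_compose permutes_inv)
  have cancel: "?s \<circ> s = s'" "t \<circ> ?t = t'"
    using permutes_inv_o[OF p(1)] permutes_inv_o[OF p(2)]
    by (simp_all add: comp_assoc flip: comp_assoc[of t])
  have FF: "(\<lambda>i. ?F i \<noteq> F (?t i)) = F'" by (auto simp: fun_eq_iff)
  have eq: "act1 ?s ?t ?F ?Z = act1 s' t' F' Y"
    using act1_act1[OF assms(2) perm(2), of ?s ?F s t F] cancel FF by simp
  have "?t 0 = 0"
    using assms(7) permutes_inverses(2)[OF p(2)] by (metis comp_apply)
  then have A: "y (contract1 (act1 s' t' F' Y)) = or_sign c (ne1 Y) ?s ?t ?F * y (contract1 ?Z)"
    using EQ1_contract_fix[OF assms(1) Z assms(8), of ?s ?t ?F] perm assms(9) eq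
    by (simp del: act1.simps)
  have B: "or_sign c (ne1 Y) s' t' F' =
      (or_sign c (ne1 Y) ?s ?t ?F * or_sign c (ne1 Y) s t F :: 'a)"
    using or_sign_comp[OF perm(1) p(1) perm(2) p(2), of c ?F F, where 'k='a] cancel FF by simp
  have key: "a * p = (b * a) * (b * p)" if "b * b = 1" for a b p :: 'a
  proof -
    have "(b * a) * (b * p) = (b * b) * (a * p)" by (simp only: mult_ac)
    then show ?thesis using that by simp
  qed
  show ?thesis unfolding A B by (rule key[OF or_sign_sq])
qed

section \<open>Functionals of finite support\<close>

definition FS :: "('a, 'k::field) series \<Rightarrow> bool" where
  "FS x \<longleftrightarrow> finite {X. x X \<noteq> 0}"

text \<open>The index set is finite as soon as one of the two factors has finite support; the other
  one may be an infinite series. Over an infinite index set the sum would be 0, so additivity is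
  stated under finiteness of supports.\<close>

definition pr :: "('a, 'k::field) series \<Rightarrow> ('a, 'k) series \<Rightarrow> 'k" where
  "pr \<Phi> x = (\<Sum>X | \<Phi> X * x X \<noteq> 0. \<Phi> X * x X)"

interpretation ser: vector_space "scl :: 'k::field \<Rightarrow> ('a, 'k) series \<Rightarrow> ('a, 'k) series"
  by unfold_locales (auto simp: scl_def fun_eq_iff algebra_simps)

lemma vector_space_pair_scl_mult:
  "vector_space_pair (scl :: 'k::field \<Rightarrow> ('a, 'k) series \<Rightarrow> ('a, 'k) series) ((*) :: 'k \<Rightarrow> 'k \<Rightarrow> 'k)"
  by unfold_locales (auto simp: algebra_simps)

lemma pr_sum:
  assumes "finite A" "\<And>X. \<Phi> X \<noteq> 0 \<Longrightarrow> x X \<noteq> 0 \<Longrightarrow> X \<in> A"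
  shows "pr \<Phi> x = (\<Sum>X\<in>A. \<Phi> X * x X)"
  unfolding pr_def by (rule sum.mono_neutral_left) (use assms in auto)

lemma pr_left: "FS \<Phi> \<Longrightarrow> pr \<Phi> x = (\<Sum>X | \<Phi> X \<noteq> 0. \<Phi> X * x X)"
  by (rule pr_sum) (auto simp: FS_def)

lemma pr_right: "FS x \<Longrightarrow> pr \<Phi> x = (\<Sum>X | x X \<noteq> 0. \<Phi> X * x X)"
  by (rule pr_sum) (auto simp: FS_def)

lemma FS_zero [simp]: "FS 0" "FS (\<lambda>_. 0)"
  by (auto simp: FS_def)

lemma FS_bas [simp]: "FS (bas X)"
  by (simp add: FS_def bas_def)

lemma FS_add: "FS x \<Longrightarrow> FS y \<Longrightarrow> FS (x + y)"
  unfolding FS_def by (rule finite_subset[of _ "{X. x X \<noteq> 0} \<union> {X. y X \<noteq> 0}"]) auto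

lemma FS_diff: "FS x \<Longrightarrow> FS y \<Longrightarrow> FS (x - y)"
  unfolding FS_def by (rule finite_subset[of _ "{X. x X \<noteq> 0} \<union> {X. y X \<noteq> 0}"]) auto

lemma FS_scl: "FS x \<Longrightarrow> FS (scl r x)"
  unfolding FS_def by (rule finite_subset[of _ "{X. x X \<noteq> 0}"]) (auto simp: scl_def)

lemma FS_sum: "(\<And>i. i \<in> I \<Longrightarrow> FS (f i)) \<Longrightarrow> FS (sum f I)"
  by (induction I rule: infinite_finite_induct) (auto intro: FS_add)

lemma FS_mono: "FS x \<Longrightarrow> (\<And>X. y X \<noteq> 0 \<Longrightarrow> x X \<noteq> 0) \<Longrightarrow> FS y"
  unfolding FS_def by (erule finite_subset[rotated]) auto

lemma pr_bas [simp]: "pr \<Phi> (bas X) = \<Phi> X"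
proof -
  have "pr \<Phi> (bas X) = (\<Sum>Y\<in>{X}. \<Phi> Y * bas X Y)"
    by (rule pr_sum) (auto simp: bas_def split: if_splits)
  then show ?thesis by (simp add: bas_def)
qed

lemma pr_bas_left [simp]: "pr (bas X) x = x X"
proof -
  have "pr (bas X) x = (\<Sum>Y\<in>{X}. bas X Y * x Y)"
    by (rule pr_sum) (auto simp: bas_def split: if_splits)
  then show ?thesis by (simp add: bas_def)
qed

lemma pr_commute: "pr x y = pr y x"
  by (simp add: pr_def mult.commute)

lemma pr_scl: "pr \<Phi> (scl r x) = r * pr \<Phi> x"
proof (cases "r = 0")
  case False
  have "(\<Sum>X | \<Phi> X * (r * x X) \<noteq> 0. \<Phi> X * (r * x X)) = (\<Sum>X | \<Phi> X * x X \<noteq> 0. r * (\<Phi> X * x X))"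
    by (rule sum.cong) (use False in \<open>auto simp: mult_ac\<close>)
  then show ?thesis unfolding pr_def scl_def by (simp only: sum_distrib_left)
qed (simp add: pr_def scl_def)

lemma pr_add_FS: "FS x \<Longrightarrow> FS y \<Longrightarrow> pr \<Phi> (x + y) = pr \<Phi> x + pr \<Phi> y"
  using pr_sum[of "{X. x X \<noteq> 0} \<union> {X. y X \<noteq> 0}" \<Phi> "x + y"]
    pr_sum[of "{X. x X \<noteq> 0} \<union> {X. y X \<noteq> 0}" \<Phi> x]
    pr_sum[of "{X. x X \<noteq> 0} \<union> {X. y X \<noteq> 0}" \<Phi> y]
  by (fastforce simp: FS_def sum.distrib distrib_left)

lemma pr_add: "FS \<Phi> \<Longrightarrow> pr \<Phi> (x + y) = pr \<Phi> x + pr \<Phi> y"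
  by (simp add: pr_left sum.distrib distrib_left)

lemma pr_diff: "FS \<Phi> \<Longrightarrow> pr \<Phi> (x - y) = pr \<Phi> x - pr \<Phi> y"
  by (simp add: pr_left sum_subtractf right_diff_distrib)

lemma pr_diff_FS: "FS x \<Longrightarrow> FS y \<Longrightarrow> pr \<Phi> (x - y) = pr \<Phi> x - pr \<Phi> y"
  using pr_sum[of "{X. x X \<noteq> 0} \<union> {X. y X \<noteq> 0}" \<Phi> "x - y"]
    pr_sum[of "{X. x X \<noteq> 0} \<union> {X. y X \<noteq> 0}" \<Phi> x]
    pr_sum[of "{X. x X \<noteq> 0} \<union> {X. y X \<noteq> 0}" \<Phi> y]
  by (fastforce simp: FS_def sum_subtractf right_diff_distrib)

lemma pr_zero [simp]: "pr \<Phi> 0 = 0" "pr \<Phi> (\<lambda>_. 0) = 0" "pr 0 \<Phi> = 0"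
  by (simp_all add: pr_def)

lemma pr_span_zero:
  assumes "\<And>r. r \<in> R \<Longrightarrow> FS r" "\<And>r. r \<in> R \<Longrightarrow> pr \<Phi> r = 0" "x \<in> spn R"
  shows "pr \<Phi> x = 0" "FS x"
proof -
  have "FS x \<and> pr \<Phi> x = 0"
    using assms(3)
  proof (induction rule: ser.span_induct_alt)
    case (step c r y)
    have "FS (scl c r)" using step(1) assms(1) by (blast intro: FS_scl)
    moreover have "pr \<Phi> (scl c r) = 0" using step(1) assms(2) by (simp add: pr_scl)
    ultimately show ?case using step(2) FS_add pr_add_FS by (metis add.right_neutral)
  next
    case base
    show ?case using FS_zero(1) pr_zero(1) by blast
  qed
  then show "pr \<Phi> x = 0" "FS x" by auto
qed

lemma sum_fun_at: "(\<Sum>i\<in>I. f i) x = (\<Sum>i\<in>I. f i x)"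
  by (induction I rule: infinite_finite_induct) auto

lemma FS_expand: "FS x \<Longrightarrow> x = (\<Sum>X | x X \<noteq> 0. scl (x X) (bas X))"
  by (rule ext) (auto simp: scl_def bas_def FS_def sum_fun_at sum.delta if_distrib cong: if_cong)

lemma linear_module_hom: "Vector_Spaces.linear s t f \<Longrightarrow> module_hom s t f"
  by (simp add: Vector_Spaces.linear_def)

text \<open>A vector outside the span can be separated from it by a linear functional
  \<open>g\<close>, obtained by extension from an independent set. On elements of finite support
  \<open>g\<close> is the pairing with its values on the basis elements. The resulting \<Phi> may
  have infinite support; \<open>levels_in_span_iff\<close> cuts it down.\<close>

lemma span_functional:
  assumes "\<And>r. r \<in> R \<Longrightarrow> FS r" "FS x"
    and "\<And>\<Phi>. (\<And>r. r \<in> R \<Longrightarrow> pr \<Phi> r = 0) \<Longrightarrow> pr \<Phi> x = 0"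
  shows "x \<in> spn (R :: ('a, 'k::field) series set)"
proof (rule ccontr)
  assume x: "x \<notin> spn R"
  obtain B where B: "B \<subseteq> R" "ser.independent B" "R \<subseteq> spn B"
    using ser.maximal_independent_subset[of R] by blast
  have "x \<notin> spn B" using x ser.span_mono[OF B(1)] by blast
  then have "ser.independent (insert x B)" using ser.independent_insertI B(2) by blast
  from vector_space_pair.linear_independent_extend[OF vector_space_pair_scl_mult this, of "\<lambda>y. if y = x then 1 else 0"]
  obtain g where g: "Vector_Spaces.linear scl (*) g"
    "\<And>y. y \<in> insert x B \<Longrightarrow> g y = (if y = x then 1 else (0::'k))" by blast
  note g_sum = module_hom.sum[OF linear_module_hom[OF g(1)]]
    and g_scale = module_hom.scale[OF linear_module_hom[OF g(1)]]
    and g_add = module_hom.add[OF linear_module_hom[OF g(1)]]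
    and g_zero = module_hom.zero[OF linear_module_hom[OF g(1)]]
  define \<Phi> where "\<Phi> X = g (bas X)" for X
  have gpr: "g y = pr \<Phi> y" if "FS y" for y
  proof -
    have "g y = g (\<Sum>X | y X \<noteq> 0. scl (y X) (bas X))" using FS_expand[OF that] by simp
    also have "\<dots> = (\<Sum>X | y X \<noteq> 0. y X * g (bas X))" by (simp add: g_sum g_scale)
    finally show ?thesis using that by (simp add: pr_right \<Phi>_def mult.commute)
  qed
  have g0: "g y = 0" if "y \<in> B" for y
    using that g(2)[of y] \<open>x \<notin> spn B\<close> ser.span_base by fastforce
  have "g r = 0" if "r \<in> R" for r
  proof -
    have "r \<in> spn B" using that B(3) by blast
    then show ?thesis
    proof (induction rule: ser.span_induct_alt)
      case base
      show ?case by (rule g_zero)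
    next
      case (step c x y)
      have "g (scl c x) = 0" using step(1) g0 g_scale[of c x] by simp
      then show ?case using step(2) g_add[of "scl c x" y] by (simp add: plus_fun_def)
    qed
  qed
  then have "pr \<Phi> x = 0" using assms(3)[of \<Phi>] gpr assms(1) by fastforce
  then show False using gpr[OF assms(2)] g(2)[of x] by simp
qed

lemma FS_level: "finite {X. V X \<and> sz X = k} \<Longrightarrow> (\<And>X. x X \<noteq> 0 \<Longrightarrow> V X) \<Longrightarrow>
    FS (\<lambda>X. if sz X = k then x X else 0)"
  unfolding FS_def by (erule finite_subset[rotated]) auto

text \<open>Every relation lives on one level \<open>sz X = k\<close>, and a level contains finitely
  many basis elements. Hence a functional that kills the relations still does so after restriction
  to a level, and functionals of finite support detect the level-wise span although \<open>x\<close>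
  may be an infinite series.\<close>

lemma levels_in_span_iff:
  fixes R :: "('a, 'k::field) series set" and sz :: "'a \<Rightarrow> 'b"
  assumes R: "\<And>r. r \<in> R \<Longrightarrow> \<exists>k. \<forall>X. r X \<noteq> 0 \<longrightarrow> V X \<and> sz X = k"
    and fin: "\<And>k. finite {X. V X \<and> sz X = k}"
    and x: "\<And>X. x X \<noteq> 0 \<Longrightarrow> V X"
  shows "(\<forall>k. (\<lambda>X. if sz X = k then x X else 0) \<in> spn R) \<longleftrightarrow>
     (\<forall>\<Phi>. FS \<Phi> \<longrightarrow> (\<forall>X. \<Phi> X \<noteq> 0 \<longrightarrow> V X) \<longrightarrow> (\<forall>r\<in>R. pr \<Phi> r = 0) \<longrightarrow> pr \<Phi> x = 0)"
proof -
  have FSR: "FS r" if r: "r \<in> R" for r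
  proof -
    obtain k where k: "\<forall>X. r X \<noteq> 0 \<longrightarrow> V X \<and> sz X = k" using R r by blast
    show ?thesis unfolding FS_def using k by (intro finite_subset[OF _ fin[of k]]) auto
  qed
  show ?thesis
  proof (intro iffI allI impI)
    fix \<Phi> assume L: "\<forall>k. (\<lambda>X. if sz X = k then x X else 0) \<in> spn R"
      and P: "FS \<Phi>" "\<forall>X. \<Phi> X \<noteq> 0 \<longrightarrow> V X" "\<forall>r\<in>R. pr \<Phi> r = 0"
    let ?A = "{X. \<Phi> X \<noteq> 0}"
    have A: "finite ?A" using P(1) by (simp add: FS_def)
    have "pr \<Phi> x = (\<Sum>X\<in>?A. \<Phi> X * x X)" using P(1) by (simp add: pr_left)
    also have "\<dots> = (\<Sum>X\<in>?A. \<Sum>k\<in>sz ` ?A. if sz X = k then \<Phi> X * x X else 0)"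
      using A by (intro sum.cong refl) (simp add: sum.delta)
    also have "\<dots> = (\<Sum>k\<in>sz ` ?A. \<Sum>X\<in>?A. if sz X = k then \<Phi> X * x X else 0)"
      by (rule sum.swap)
    also have "\<dots> = (\<Sum>k\<in>sz ` ?A. pr \<Phi> (\<lambda>X. if sz X = k then x X else 0))"
      using P(1) by (simp add: pr_left if_distrib cong: if_cong)
    also have "\<dots> = 0"
      by (rule sum.neutral) (use pr_span_zero(1)[OF FSR] L P(3) in blast)
    finally show "pr \<Phi> x = 0" .
  next
    fix k
    assume L: "\<forall>\<Phi>. FS \<Phi> \<longrightarrow> (\<forall>X. \<Phi> X \<noteq> 0 \<longrightarrow> V X) \<longrightarrow> (\<forall>r\<in>R. pr \<Phi> r = 0) \<longrightarrow> pr \<Phi> x = 0"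
    show "(\<lambda>X. if sz X = k then x X else 0) \<in> spn R"
    proof (rule span_functional)
      show "FS (\<lambda>X. if sz X = k then x X else 0)" using FS_level[OF fin] x by blast
      fix \<Phi> :: "('a, 'k) series" assume P: "\<And>r. r \<in> R \<Longrightarrow> pr \<Phi> r = 0"
      define \<Psi> where "\<Psi> X = (if V X \<and> sz X = k then \<Phi> X else 0)" for X
      have "FS \<Psi>" unfolding FS_def by (rule finite_subset[OF _ fin[of k]]) (auto simp: \<Psi>_def)
      moreover have "pr \<Psi> r = 0" if r: "r \<in> R" for r
      proof -
        obtain j where j: "\<forall>X. r X \<noteq> 0 \<longrightarrow> V X \<and> sz X = j" using R r by blast
        show ?thesis
        proof (cases "j = k")
          case True
          then have "\<Psi> X * r X = \<Phi> X * r X" for X using j by (auto simp: \<Psi>_def)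
          then have "pr \<Psi> r = pr \<Phi> r" unfolding pr_def by presburger
          then show ?thesis using P[OF r] by simp
        next
          case False
          then have "\<Psi> X * r X = 0" for X using j by (auto simp: \<Psi>_def)
          then show ?thesis by (simp add: pr_def)
        qed
      qed
      moreover have "\<Psi> X * x X = \<Phi> X * (if sz X = k then x X else 0)" for X
        using x by (auto simp: \<Psi>_def)
      then have "pr \<Psi> x = pr \<Phi> (\<lambda>X. if sz X = k then x X else 0)" by (simp add: pr_def)
      moreover have "\<forall>X. \<Psi> X \<noteq> 0 \<longrightarrow> V X" by (auto simp: \<Psi>_def)
      ultimately show "pr \<Phi> (\<lambda>X. if sz X = k then x X else 0) = 0" using L by metis
    qed (use FSR in blast)
  qed
qed

text \<open>
  A basis element \<open>X\<close> that is not a relation spans, modulo the relations, a line with basis elements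
  \<open>\<plusminus> X\<close> (its signed orbit); the sum of the orbit with these signs is an equivariant representative of
  a multiple of \<open>X\<close>. No averaging over a group is needed.
\<close>

lemma equivariant_representative_bas:
  fixes R :: "('a, 'k::field_char_0) series set" and sz :: "'a \<Rightarrow> 'b"
  assumes R: "\<And>r. r \<in> R \<Longrightarrow> \<exists>X Y e. r = bas X - scl e (bas Y) \<and> (e = 1 \<or> e = -1) \<and>
      V X \<and> V Y \<and> sz X = sz Y"
    and fin: "\<And>k. finite {X. V X \<and> sz X = k}" and X: "V X"
  shows "\<exists>\<Phi>. FS \<Phi> \<and> (\<forall>Y. \<Phi> Y \<noteq> 0 \<longrightarrow> V Y \<and> sz Y = sz X) \<and> (\<forall>r\<in>R. pr \<Phi> r = 0) \<and> bas X - \<Phi> \<in> spn R"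
proof (cases "bas X \<in> spn R")
  case True
  then show ?thesis by (intro exI[of _ 0]) auto
next
  case False
  let ?S = "spn R"
  \<comment> \<open>The signed orbit of \<open>X\<close>: the sign with which a basis element is
    congruent to \<open>X\<close>, and 0 if it is not. The sign is unique, since both congruences
    together would put \<open>bas X\<close> into the span.\<close>
  define e where "e Y = (if bas Y - bas X \<in> ?S then 1 else if bas Y + bas X \<in> ?S then - 1 else (0::'k))" for Y
  have both: False if "bas Y - bas X \<in> ?S" "bas Y + bas X \<in> ?S" for Y
  proof -
    have "scl (1/2) ((bas Y + bas X) - (bas Y - bas X)) \<in> ?S"
      by (intro ser.span_scale ser.span_diff that)
    moreover have "scl (1/2) ((bas Y + bas X) - (bas Y - bas X)) = (bas X :: ('a,'k) series)"
      by (rule ext) (simp add: scl_def)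
    ultimately show False using False by simp
  qed
  \<comment> \<open>Relations live on single levels, so truncation to a level preserves the span.
    This confines the orbit of \<open>X\<close> to its own level, a finite set.\<close>
  have level: "(\<lambda>Y. if V Y \<and> sz Y = k then z Y else 0) \<in> ?S" if "z \<in> ?S" for z k
    using that
  proof (induction rule: ser.span_induct_alt)
    case base
    have "(\<lambda>Y. if V Y \<and> sz Y = k then (0 :: ('a, 'k) series) Y else 0) = 0" by auto
    then show ?case by (simp add: ser.span_zero)
  next
    case (step c r y)
    obtain X1 Y1 e1 where r: "r = bas X1 - scl e1 (bas Y1)" "V X1" "V Y1" "sz X1 = sz Y1"
      using R[OF step(1)] by blast
    have "(\<lambda>Y. if V Y \<and> sz Y = k then r Y else 0) = (if sz X1 = k then r else 0)"
      using r by (auto simp: fun_eq_iff bas_def scl_def)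
    then have "(\<lambda>Y. if V Y \<and> sz Y = k then r Y else 0) \<in> ?S"
      using step(1) by (simp add: ser.span_base ser.span_zero)
    then have "scl c (\<lambda>Y. if V Y \<and> sz Y = k then r Y else 0) + (\<lambda>Y. if V Y \<and> sz Y = k then y Y else 0) \<in> ?S"
      by (intro ser.span_add ser.span_scale step)
    moreover have "scl c (\<lambda>Y. if V Y \<and> sz Y = k then r Y else 0) + (\<lambda>Y. if V Y \<and> sz Y = k then y Y else 0) =
      (\<lambda>Y. if V Y \<and> sz Y = k then (scl c r + y) Y else 0)" by (auto simp: fun_eq_iff scl_def)
    ultimately show ?case by simp
  qed
  have supp: "V Y \<and> sz Y = sz X" if "e Y \<noteq> 0" for Y
  proof (rule ccontr)
    assume n: "\<not> (V Y \<and> sz Y = sz X)"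
    have "bas Y - bas X \<in> ?S \<or> bas Y + bas X \<in> ?S" using that by (auto simp: e_def split: if_splits)
    then have "(\<lambda>Z. if V Z \<and> sz Z = sz X then (bas Y - bas X) Z else 0) \<in> ?S \<or>
      (\<lambda>Z. if V Z \<and> sz Z = sz X then (bas Y + bas X) Z else 0) \<in> ?S" using level by blast
    moreover have "(\<lambda>Z. if V Z \<and> sz Z = sz X then (bas Y - bas X) Z else 0) = scl (-1) (bas X)"
      "(\<lambda>Z. if V Z \<and> sz Z = sz X then (bas Y + bas X) Z else 0) = (bas X :: ('a,'k) series)"
      using n X by (auto simp: fun_eq_iff bas_def scl_def)
    ultimately have "scl (-1) (bas X) \<in> ?S \<or> bas X \<in> ?S" by metis
    with ser.span_scale[of "scl (-1) (bas X)" R "-1"] False show False by auto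
  qed
  have fin': "finite {Y. e Y \<noteq> 0}" by (rule finite_subset[OF _ fin[of "sz X"]]) (use supp in auto)
  then have FSe: "FS e" by (simp add: FS_def)
  have inv: "pr e r = 0" if rR: "r \<in> R" for r
  proof -
    obtain X1 Y1 e1 where r: "r = bas X1 - scl e1 (bas Y1)" "e1 = 1 \<or> e1 = -1"
      using R[OF rR] by blast
    have rS: "r \<in> ?S" using rR by (rule ser.span_base)
    have "e X1 = e1 * e Y1"
    proof (cases "e1 = 1")
      case True
      have "bas X1 - bas X \<in> ?S \<longleftrightarrow> bas Y1 - bas X \<in> ?S"
        using ser.span_add_eq[OF rS, of "bas Y1 - bas X"] by (simp add: r True algebra_simps)
      moreover have "bas X1 + bas X \<in> ?S \<longleftrightarrow> bas Y1 + bas X \<in> ?S"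
        using ser.span_add_eq[OF rS, of "bas Y1 + bas X"] by (simp add: r True algebra_simps)
      ultimately show ?thesis by (simp add: e_def True)
    next
      case False
      then have m: "e1 = -1" using r by simp
      have rr: "r = bas X1 + bas Y1" by (simp add: r m)
      have 1: "bas X1 - bas X \<in> ?S \<longleftrightarrow> bas Y1 + bas X \<in> ?S"
        using ser.span_diff[OF rS, of "bas X1 - bas X"] ser.span_diff[OF rS, of "bas Y1 + bas X"]
        by (auto simp: rr algebra_simps)
      have 2: "bas X1 + bas X \<in> ?S \<longleftrightarrow> bas Y1 - bas X \<in> ?S"
        using ser.span_diff[OF rS, of "bas X1 + bas X"] ser.span_diff[OF rS, of "bas Y1 - bas X"]
        by (auto simp: rr algebra_simps)
      show ?thesis using 1 2 both[of X1] both[of Y1] by (auto simp: e_def m)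
    qed
    then show ?thesis by (simp add: r pr_diff_FS FS_scl pr_scl)
  qed
  let ?A = "{Y. e Y \<noteq> 0}"
  have XA: "X \<in> ?A" using ser.span_zero[of R] by (simp add: e_def)
  have n0: "of_nat (card ?A) \<noteq> (0::'k)" using fin' XA by (auto simp: card_eq_0_iff)
  have trm: "scl (e Y) (bas Y) - bas X \<in> ?S" if YA: "Y \<in> ?A" for Y
  proof -
    consider "e Y = 1" "bas Y - bas X \<in> ?S" | "e Y = -1" "bas Y + bas X \<in> ?S"
      using YA by (auto simp: e_def split: if_splits)
    then show ?thesis
    proof cases
      case 2
      then have "scl (-1) (bas Y + bas X) \<in> ?S" by (intro ser.span_scale)
      moreover have "scl (-1) (bas Y + bas X) = scl (e Y) (bas Y) - bas X"
        using 2 by (auto simp: fun_eq_iff scl_def)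
      ultimately show ?thesis by simp
    qed simp
  qed
  \<comment> \<open>Each summand \<open>scl (e Y) (bas Y)\<close> is congruent to
    \<open>bas X\<close>, so \<open>e\<close> is congruent to \<open>card ?A\<close> times
    \<open>bas X\<close>; characteristic 0 permits the division.\<close>
  have "(\<Sum>Y\<in>?A. scl (e Y) (bas Y) - bas X) \<in> ?S" by (rule ser.span_sum) (use trm in blast)
  also have "(\<Sum>Y\<in>?A. scl (e Y) (bas Y) - bas X) = e - scl (of_nat (card ?A)) (bas X)"
    using FS_expand[OF FSe] by (simp add: sum_subtractf) (rule ext, simp add: scl_def)
  finally have "scl (- 1 / of_nat (card ?A)) (e - scl (of_nat (card ?A)) (bas X)) \<in> ?S"
    by (rule ser.span_scale)
  moreover have "scl (- 1 / of_nat (card ?A)) (e - scl (of_nat (card ?A)) (bas X)) =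
      bas X - scl (1 / of_nat (card ?A)) e"
    using n0 by (auto simp: fun_eq_iff scl_def field_simps)
  ultimately have "bas X - scl (1 / of_nat (card ?A)) e \<in> ?S" by simp
  moreover have "pr (scl (1 / of_nat (card ?A)) e) r = 0" if "r \<in> R" for r
    using inv[OF that] by (simp add: pr_commute[of _ r] pr_scl)
  moreover have "\<forall>Y. scl (1 / of_nat (card ?A)) e Y \<noteq> 0 \<longrightarrow> V Y \<and> sz Y = sz X"
    using supp by (auto simp: scl_def)
  ultimately show ?thesis
    using FS_scl[OF FSe, of "1 / of_nat (card ?A)"] by (intro exI[of _ "scl (1 / of_nat (card ?A)) e"]) auto
qed

text \<open>A linear combination of the representatives of basis elements. The predicate
  \<open>P\<close> records that no new sizes appear, which later keeps a representative inside a
  finite window of sizes.\<close>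

lemma equivariant_representative:
  fixes R :: "('a, 'k::field_char_0) series set" and sz :: "'a \<Rightarrow> 'b"
  assumes R: "\<And>r. r \<in> R \<Longrightarrow> \<exists>X Y e. r = bas X - scl e (bas Y) \<and> (e = 1 \<or> e = -1) \<and>
      V X \<and> V Y \<and> sz X = sz Y"
    and fin: "\<And>k. finite {X. V X \<and> sz X = k}" and y: "FS y" "\<And>X. y X \<noteq> 0 \<Longrightarrow> V X \<and> P (sz X)"
  obtains \<Phi> where "FS \<Phi>" "\<And>Y. \<Phi> Y \<noteq> 0 \<Longrightarrow> V Y \<and> P (sz Y)" "\<And>r. r \<in> R \<Longrightarrow> pr \<Phi> r = 0" "y - \<Phi> \<in> spn R"
proof -
  have "\<forall>X. V X \<longrightarrow> (\<exists>\<Phi>. FS \<Phi> \<and> (\<forall>Y. \<Phi> Y \<noteq> 0 \<longrightarrow> V Y \<and> sz Y = sz X) \<and> (\<forall>r\<in>R. pr \<Phi> r = 0) \<and> bas X - \<Phi> \<in> spn R)"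
    using equivariant_representative_bas[of R V sz, OF R fin] by blast
  then obtain G where G: "\<And>X. V X \<Longrightarrow> FS (G X)" "\<And>X Y. V X \<Longrightarrow> G X Y \<noteq> 0 \<Longrightarrow> V Y \<and> sz Y = sz X"
    "\<And>X r. V X \<Longrightarrow> r \<in> R \<Longrightarrow> pr (G X) r = 0" "\<And>X. V X \<Longrightarrow> bas X - G X \<in> spn R" by metis
  let ?A = "{X. y X \<noteq> 0}"
  define \<Phi> where "\<Phi> = (\<Sum>X\<in>?A. scl (y X) (G X))"
  have FSG: "FS (scl (y X) (G X))" if "X \<in> ?A" for X using that y G FS_scl by blast
  have "FS \<Phi>" unfolding \<Phi>_def using FSG by (intro FS_sum) auto
  moreover have "V Y \<and> P (sz Y)" if "\<Phi> Y \<noteq> 0" for Y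
  proof -
    have "\<exists>X\<in>?A. G X Y \<noteq> 0"
    proof (rule ccontr)
      assume "\<not> ?thesis"
      then have "\<Phi> Y = 0" by (auto simp: \<Phi>_def sum_fun_at scl_def intro!: sum.neutral)
      with that show False by simp
    qed
    then obtain X where "y X \<noteq> 0" "G X Y \<noteq> 0" by blast
    then show ?thesis using G(2)[of X Y] y(2)[of X] by auto
  qed
  moreover have "pr \<Phi> r = 0" if "r \<in> R" for r
  proof -
    have "FS (\<Sum>X\<in>B. scl (y X) (G X)) \<and> pr r (\<Sum>X\<in>B. scl (y X) (G X)) = 0"
      if "finite B" "B \<subseteq> ?A" for B
      using that
    proof (induction B rule: finite_induct)
      case (insert a B)
      have "pr r (G a) = 0"
        using insert.prems y(2)[of a] G(3)[of a, OF _ \<open>r \<in> R\<close>] by (auto simp: pr_commute[of r])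
      then have "pr r (scl (y a) (G a)) = 0" by (simp add: pr_scl)
      moreover have "FS (scl (y a) (G a))" using FSG insert.prems by blast
      moreover have "FS (\<Sum>X\<in>B. scl (y X) (G X))" "pr r (\<Sum>X\<in>B. scl (y X) (G X)) = 0"
        using insert by auto
      ultimately have "FS (scl (y a) (G a) + (\<Sum>X\<in>B. scl (y X) (G X)))"
        "pr r (scl (y a) (G a) + (\<Sum>X\<in>B. scl (y X) (G X))) = 0"
        using FS_add pr_add_FS[of "scl (y a) (G a)" "\<Sum>X\<in>B. scl (y X) (G X)" r] by auto
      then show ?case using sum.insert[OF insert.hyps, of "\<lambda>X. scl (y X) (G X)"] by metis
    qed simp
    then show ?thesis using y(1) unfolding \<Phi>_def FS_def by (simp add: pr_commute[of _ r])
  qed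
  moreover have "y - \<Phi> \<in> spn R"
  proof -
    have "(\<Sum>X\<in>?A. scl (y X) (bas X - G X)) \<in> spn R"
      using G(4) y(2) by (intro ser.span_sum ser.span_scale) auto
    moreover have "y - \<Phi> = (\<Sum>X\<in>?A. scl (y X) (bas X - G X))"
      unfolding \<Phi>_def ser.scale_right_diff_distrib sum_subtractf FS_expand[OF y(1), symmetric] ..
    ultimately show ?thesis by simp
  qed
  ultimately show ?thesis using that by blast
qed

section \<open>Separation of elements of a tensor product\<close>

lemma pr_sum_list:
  "FS \<Phi> \<Longrightarrow> pr \<Phi> (sum_list (map f l)) = sum_list (map (\<lambda>z. pr \<Phi> (f z)) l)"
  by (induction l) (auto simp: pr_add)

text \<open>Gaussian elimination on a sum of pure tensors. If some \<psi> is nonzero on the first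
  right factor \<open>b\<close>, multiples of \<open>b\<close> are subtracted from the other right
  factors so that \<psi> kills them. The left factor \<open>a'\<close> that collects at
  \<open>b\<close> is then killed by every functional in \<open>K\<close>, hence is null, and a
  shorter sum remains.\<close>

lemma tensor_separation:
  fixes A :: "('a, 'k::field) cpx" and B :: "('b, 'k) cpx"
    and K :: "('a, 'k) series set" and L :: "('b, 'k) series set"
  assumes subA: "\<And>i. ser.subspace (crr A i)" and subB: "\<And>i. ser.subspace (crr B i)"
    and sepA: "\<And>i a. a \<in> crr A i \<Longrightarrow> (\<And>\<phi>. \<phi> \<in> K \<Longrightarrow> pr \<phi> a = 0) \<Longrightarrow> a \<in> nul A i"
    and sepB: "\<And>i b. b \<in> crr B i \<Longrightarrow> (\<And>\<psi>. \<psi> \<in> L \<Longrightarrow> pr \<psi> b = 0) \<Longrightarrow> b \<in> nul B i"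
    and FSK: "\<And>\<phi>. \<phi> \<in> K \<Longrightarrow> FS \<phi>" and FSL: "\<And>\<psi>. \<psi> \<in> L \<Longrightarrow> FS \<psi>"
    and hom: "\<And>\<psi> i j b b'. \<psi> \<in> L \<Longrightarrow> b \<in> crr B i \<Longrightarrow> b' \<in> crr B j \<Longrightarrow> pr \<psi> b \<noteq> 0 \<Longrightarrow> pr \<psi> b' \<noteq> 0 \<Longrightarrow> i = j"
    and l: "\<forall>(i, a, b)\<in>set l. a \<in> crr A i \<and> b \<in> crr B (p - i)"
    and zero: "\<And>\<phi> \<psi>. \<phi> \<in> K \<Longrightarrow> \<psi> \<in> L \<Longrightarrow> (\<Sum>(i, a, b)\<leftarrow>l. pr \<phi> a * pr \<psi> b) = 0"
  shows "(\<Sum>(i, a, b)\<leftarrow>l. otimes a b) \<in> nul (tensor A B) p"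
  using l zero
proof (induction l rule: length_induct)
  case (1 l)
  let ?G = "{otimes x y | x y i. x \<in> crr A i \<and> y \<in> crr B (p - i) \<and> (x \<in> nul A i \<or> y \<in> nul B (p - i))}"
  have nul: "nul (tensor A B) p = spn ?G" by (simp add: tensor_def)
  show ?case
  proof (cases l)
    case Nil
    then have z: "(\<Sum>(i, a, b)\<leftarrow>l. otimes a b) = 0" by simp
    show ?thesis unfolding nul z by (rule ser.span_zero)
  next
    case (Cons z l')
    obtain i a b where z: "z = (i, a, b)" by (metis prod.exhaust)
    have ab: "a \<in> crr A i" "b \<in> crr B (p - i)" using 1(2) Cons z by auto
    have l': "\<forall>(i, a, b)\<in>set l'. a \<in> crr A i \<and> b \<in> crr B (p - i)" using 1(2) Cons by auto
    show ?thesis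
    proof (cases "\<forall>\<psi>\<in>L. pr \<psi> b = 0")
      case True
      then have "b \<in> nul B (p - i)" using sepB ab by blast
      then have "otimes a b \<in> spn ?G" using ab by (intro ser.span_base) blast
      moreover have "(\<Sum>(i, a, b)\<leftarrow>l'. otimes a b) \<in> spn ?G"
      proof -
        have "(\<Sum>(i, a, b)\<leftarrow>l'. pr \<phi> a * pr \<psi> b) = 0" if "\<phi> \<in> K" "\<psi> \<in> L" for \<phi> \<psi>
          using 1(3)[OF that] True that by (simp add: Cons z)
        then show ?thesis using 1(1)[rule_format, of l'] l' unfolding nul by (simp add: Cons)
      qed
      ultimately have S: "otimes a b + (\<Sum>(i, a, b)\<leftarrow>l'. otimes a b) \<in> spn ?G" by (rule ser.span_add)
      show ?thesis unfolding nul Cons z using S by (simp only: list.map sum_list.Cons prod.case)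
    next
      case False
      then obtain \<psi> where \<psi>: "\<psi> \<in> L" "pr \<psi> b \<noteq> 0" by blast
      define c where "c b' = pr \<psi> b' / pr \<psi> b" for b'
      \<comment> \<open>By \<open>hom\<close>, \<psi> sees one degree only. Hence only tensors of
        the same bidegree are combined, and \<open>a'\<close> is homogeneous.\<close>
      have c0: "c b' = 0 \<or> j = i" if "b' \<in> crr B (p - j)" for b' j
        using hom[OF \<psi>(1) that ab(2)] \<psi>(2) by (auto simp: c_def)
      define a' where "a' = a + (\<Sum>(j, a2, b2)\<leftarrow>l'. scl (c b2) a2)"
      define l2 where "l2 = map (\<lambda>(j, a2, b2). (j, a2, b2 - scl (c b2) b)) l'"
      have "(\<Sum>(j, a2, b2)\<leftarrow>l'. scl (c b2) a2) \<in> crr A i"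
        using l'
      proof (induction l')
        case Nil
        show ?case using ser.subspace_0[OF subA] by (simp add: zero_fun_def)
      next
        case (Cons y l')
        obtain j a2 b2 where y: "y = (j, a2, b2)" by (metis prod.exhaust)
        have "scl (c b2) a2 \<in> crr A i"
          using c0[of b2 j] Cons.prems ser.subspace_0[OF subA] ser.subspace_scale[OF subA]
          by (auto simp: y)
        moreover have "(\<Sum>(j, a2, b2)\<leftarrow>l'. scl (c b2) a2) \<in> crr A i" using Cons by auto
        ultimately have "scl (c b2) a2 + (\<Sum>(j, a2, b2)\<leftarrow>l'. scl (c b2) a2) \<in> crr A i"
          by (rule ser.subspace_add[OF subA])
        then show ?case unfolding y by (simp only: list.map sum_list.Cons prod.case)
      qed
      then have a'1: "a' \<in> crr A i" unfolding a'_def using ab ser.subspace_add[OF subA] by blast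
      have pa': "pr \<phi> a' = 0" if \<phi>: "\<phi> \<in> K" for \<phi>
      proof -
        have "pr \<psi> b * pr \<phi> a' = pr \<phi> a * pr \<psi> b + (\<Sum>(j, a2, b2)\<leftarrow>l'. pr \<phi> a2 * pr \<psi> b2)"
          unfolding a'_def using \<psi>(2)
          by (simp add: pr_add FSK[OF \<phi>] pr_sum_list split_def pr_scl distrib_left
              sum_list_const_mult[symmetric] c_def mult.commute cong: map_cong)
        also have "\<dots> = 0" using 1(3)[OF \<phi> \<psi>(1)] by (simp add: Cons z)
        finally show ?thesis using \<psi>(2) by simp
      qed
      have "a' \<in> nul A i" using sepA a'1 pa' by blast
      then have T1: "otimes a' b \<in> spn ?G" using ab a'1 by (intro ser.span_base) blast
      have L2: "\<forall>(j, a2, b2)\<in>set l2. a2 \<in> crr A j \<and> b2 \<in> crr B (p - j)"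
      proof -
        have "b2 - scl (c b2) b \<in> crr B (p - j)" if "b2 \<in> crr B (p - j)" for b2 j
          using c0[OF that] that ab ser.subspace_diff[OF subB] ser.subspace_scale[OF subB] ser.subspace_0[OF subB]
          by auto
        then show ?thesis using l' by (auto simp: l2_def)
      qed
      have Z2: "(\<Sum>(j, a2, b2)\<leftarrow>l2. pr \<phi> a2 * pr \<psi>' b2) = 0" if \<phi>: "\<phi> \<in> K" and \<psi>': "\<psi>' \<in> L" for \<phi> \<psi>'
      proof -
        have "(\<Sum>(j, a2, b2)\<leftarrow>l2. pr \<phi> a2 * pr \<psi>' b2) =
          (\<Sum>(j, a2, b2)\<leftarrow>l'. pr \<phi> a2 * pr \<psi>' b2) - (\<Sum>(j, a2, b2)\<leftarrow>l'. c b2 * pr \<phi> a2) * pr \<psi>' b"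
          unfolding l2_def
          by (induction l') (auto simp: pr_diff FSL[OF \<psi>'] pr_scl algebra_simps
              simp del: minus_apply plus_fun_apply zero_fun_apply)
        also have "(\<Sum>(j, a2, b2)\<leftarrow>l'. c b2 * pr \<phi> a2) = pr \<phi> a' - pr \<phi> a"
          unfolding a'_def by (simp add: pr_add FSK[OF \<phi>] pr_sum_list split_def pr_scl
              del: minus_apply plus_fun_apply zero_fun_apply)
        also have "pr \<phi> a' = 0" by (rule pa'[OF \<phi>])
        finally show ?thesis using 1(3)[OF \<phi> \<psi>'] by (simp add: Cons z algebra_simps)
      qed
      have T2: "(\<Sum>(j, a2, b2)\<leftarrow>l2. otimes a2 b2) \<in> spn ?G"
        unfolding nul[symmetric]
      proof (rule 1(1)[rule_format, of l2])
        show "length l2 < length l" by (simp add: Cons l2_def)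
      qed (use L2 Z2 in blast)+
      have "(\<Sum>(j, a2, b2)\<leftarrow>l2. otimes a2 b2) + otimes (\<Sum>(j, a2, b2)\<leftarrow>l'. scl (c b2) a2) b =
          (\<Sum>(j, a2, b2)\<leftarrow>l'. otimes a2 b2)"
        unfolding l2_def
        by (induction l') (auto simp: otimes_def fun_eq_iff scl_def algebra_simps)
      moreover have "otimes a' b = otimes a b + otimes (\<Sum>(j, a2, b2)\<leftarrow>l'. scl (c b2) a2) b"
        unfolding a'_def by (auto simp: otimes_def fun_eq_iff algebra_simps)
      moreover have "(\<Sum>(i, a, b)\<leftarrow>l. otimes a b) = otimes a b + (\<Sum>(i, a, b)\<leftarrow>l'. otimes a b)"
        unfolding Cons z by (simp only: list.map sum_list.Cons prod.case)
      ultimately have "(\<Sum>(i, a, b)\<leftarrow>l. otimes a b) = otimes a' b + (\<Sum>(j, a2, b2)\<leftarrow>l2. otimes a2 b2)"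
        by (simp only: add_ac)
      then show ?thesis unfolding nul using ser.span_add[OF T1 T2] by (simp only:)
    qed
  qed
qed

section \<open>The differential at pairs without univalent vertices\<close>

text \<open>The basis elements that survive in \<open>GC2\<close>. The functionals in
  \<open>Fun2\<close> are supported on them, so the differential has to be computed explicitly at
  such pairs only.\<close>

definition nonuniv :: "egraph \<Rightarrow> bool" where
  "nonuniv X \<longleftrightarrow> \<not> has_univalent (fst (fst X)) \<and> \<not> has_univalent (fst (snd X))"

lemma nonuniv_swap [simp]: "nonuniv (prod.swap X) \<longleftrightarrow> nonuniv X"
  by (auto simp: nonuniv_def prod.swap_def)

lemma half_edges_alt:
  "half_edges es u = (\<lambda>i. (i, True)) ` {i. i < length es \<and> fst (es ! i) = u} \<union>
     (\<lambda>i. (i, False)) ` {i. i < length es \<and> snd (es ! i) = u}"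
proof (rule set_eqI)
  fix h :: "nat \<times> bool"
  obtain i b where h: "h = (i, b)" by (cases h)
  show "h \<in> half_edges es u \<longleftrightarrow> h \<in> (\<lambda>i. (i, True)) ` {i. i < length es \<and> fst (es ! i) = u} \<union>
     (\<lambda>i. (i, False)) ` {i. i < length es \<and> snd (es ! i) = u}"
    unfolding h by (cases b) (auto simp: half_edges_def endpoint_def)
qed

lemma finite_half_edges [simp]: "finite (half_edges es u)"
  unfolding half_edges_alt by simp

lemma finite_hairs [simp]: "finite (hairs f v)"
  unfolding hairs_def by simp

lemma valency_sum:
  "valency G u = (\<Sum>i<length (snd G). of_bool (fst (snd G ! i) = u) + of_bool (snd (snd G ! i) = u))"
proof -
  let ?es = "snd G"
  have c: "card {i. i < length ?es \<and> P i} = (\<Sum>i<length ?es. of_bool (P i))" for P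
    by (simp add: of_bool_def sum.If_cases Collect_conj_eq Int_commute lessThan_def)
  have "card (half_edges ?es u) =
      card {i. i < length ?es \<and> fst (?es ! i) = u} + card {i. i < length ?es \<and> snd (?es ! i) = u}"
    unfolding half_edges_alt
    by (subst card_Un_disjoint) (auto simp: card_image inj_on_def)
  then show ?thesis by (simp add: valency_def c sum.distrib)
qed

lemma endpoint_map:
  "fst h < length es \<Longrightarrow> endpoint (map (map_prod p p) es) h = p (endpoint es h)"
  by (simp add: endpoint_def)

lemma snd_split_edges:
  "snd (split_edges u S G) = (0, Suc u) #
     map (\<lambda>i. (if (i, True) \<in> S then 0 else Suc (endpoint (snd G) (i, True)),
               if (i, False) \<in> S then 0 else Suc (endpoint (snd G) (i, False)))) [0..<length (snd G)]"
  by (simp add: split_edges_def)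

lemma fst_split_edges [simp]: "fst (split_edges u S G) = Suc (fst G)"
  by (simp add: split_edges_def)

lemma endpoint_split_edges:
  "fst h < length (snd G) \<Longrightarrow>
     endpoint (tl (snd (split_edges u S G))) h = (if h \<in> S then 0 else Suc (endpoint (snd G) h))"
  by (cases h) (auto simp: snd_split_edges endpoint_def)

lemma endpoint_split_edges_Suc:
  "i < length (snd G) \<Longrightarrow>
     endpoint (snd (split_edges u S G)) (Suc i, b) = (if (i, b) \<in> S then 0 else Suc (endpoint (snd G) (i, b)))"
  by (cases b) (auto simp: snd_split_edges endpoint_def)

lemma length_split_edges [simp]: "length (snd (split_edges u S G)) = Suc (length (snd G))"
  by (simp add: snd_split_edges)

lemma length_split_hairs [simp]: "length (split_hairs T f) = length f"
  by (simp add: split_hairs_def)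

lemma half_edges_split:
  assumes "S \<subseteq> half_edges (snd G) u"
  shows "half_edges (tl (snd (split_edges u S G))) 0 = S"
proof (rule set_eqI)
  fix h
  show "h \<in> half_edges (tl (snd (split_edges u S G))) 0 \<longleftrightarrow> h \<in> S"
  proof (cases "fst h < length (snd G)")
    case True
    then show ?thesis using endpoint_split_edges[OF True, of u S]
      by (auto simp: half_edges_def split: if_splits)
  next
    case False
    then show ?thesis using assms by (auto simp: half_edges_def)
  qed
qed

lemma hairs_split: "T \<subseteq> hairs f v \<Longrightarrow> hairs (split_hairs T f) 0 = T"
  by (auto simp: hairs_def split_hairs_def split: if_splits)

lemma merge_split_edges:
  assumes "S \<subseteq> half_edges (snd G) u"
  shows "map (map_prod (merge u) (merge u)) (tl (snd (split_edges u S G))) = snd G"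
proof (rule nth_equalityI)
  fix i assume "i < length (map (map_prod (merge u) (merge u)) (tl (snd (split_edges u S G))))"
  then have i: "i < length (snd G)" by simp
  have "(i, True) \<in> S \<Longrightarrow> fst (snd G ! i) = u" "(i, False) \<in> S \<Longrightarrow> snd (snd G ! i) = u"
    using assms by (auto simp: half_edges_def endpoint_def)
  then show "map (map_prod (merge u) (merge u)) (tl (snd (split_edges u S G))) ! i = snd G ! i"
    using i by (simp add: snd_split_edges endpoint_def prod_eq_iff)
qed simp

lemma merge_split_hairs: "T \<subseteq> hairs f v \<Longrightarrow> map (merge v) (split_hairs T f) = f"
  by (rule nth_equalityI) (auto simp: hairs_def split_hairs_def)

lemma split_merge_edges:
  "split_edges u (half_edges es 0) (n, map (map_prod (merge u) (merge u)) es) = (Suc n, (0, Suc u) # es)"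
proof -
  have "snd (split_edges u (half_edges es 0) (n, map (map_prod (merge u) (merge u)) es)) = (0, Suc u) # es"
  proof (rule nth_equalityI)
    fix i assume "i < length (snd (split_edges u (half_edges es 0) (n, map (map_prod (merge u) (merge u)) es)))"
    then have i: "i < Suc (length es)" by simp
    have A: "(if h \<in> half_edges es 0 then 0 else Suc (merge u (endpoint es h))) = endpoint es h"
      if "fst h < length es" for h
      using that by (cases "endpoint es h") (auto simp: half_edges_def)
    show "snd (split_edges u (half_edges es 0) (n, map (map_prod (merge u) (merge u)) es)) ! i =
        ((0, Suc u) # es) ! i"
    proof (cases i)
      case (Suc k)
      then have k: "k < length es" using i by simp
      have "snd (split_edges u (half_edges es 0) (n, map (map_prod (merge u) (merge u)) es)) ! Suc k =
        (endpoint es (k, True), endpoint es (k, False))"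
        using k A[of "(k, True)"] A[of "(k, False)"]
        by (auto simp: snd_split_edges endpoint_map split: if_splits)
      then show ?thesis by (simp add: Suc endpoint_def)
    qed (simp add: snd_split_edges)
  qed simp
  then show ?thesis by (simp add: prod_eq_iff)
qed

lemma split_merge_hairs: "split_hairs (hairs f 0) (map (merge v) f) = f"
proof (rule nth_equalityI)
  fix i assume "i < length (split_hairs (hairs f 0) (map (merge v) f))"
  then show "split_hairs (hairs f 0) (map (merge v) f) ! i = f ! i"
    by (cases "f ! i") (auto simp: split_hairs_def hairs_def)
qed simp

lemma half_edges_merge: "half_edges es 0 \<subseteq> half_edges (map (map_prod (merge u) (merge u)) es) u"
  by (auto simp: half_edges_def endpoint_map)

lemma hairs_merge: "hairs f 0 \<subseteq> hairs (map (merge v) f) v"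
  by (auto simp: hairs_def)

lemma contract1_split:
  assumes "S \<subseteq> half_edges (snd (fst A)) v" "T \<subseteq> hairs (snd A) v"
  shows "std1 (split_vertex v S T A, add_hair w B)"
    "contract1 (split_vertex v S T A, add_hair w B) = (A, B)"
proof -
  obtain n es f where A: "A = ((n, es), f)" by (metis prod.exhaust)
  obtain H g where B: "B = (H, g)" by (metis prod.exhaust)
  have S: "S \<subseteq> half_edges (snd (n, es)) v" "T \<subseteq> hairs f v" using assms by (auto simp: A)
  have spl: "split_edges v S (n, es) = (Suc n, snd (split_edges v S (n, es)))"
    by (simp add: prod_eq_iff)
  have hd: "hd (snd (split_edges v S (n, es))) = (0, Suc v)"
    "snd (split_edges v S (n, es)) \<noteq> []" by (simp_all add: snd_split_edges)
  show "std1 (split_vertex v S T A, add_hair w B)"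
    unfolding A B split_vertex_def add_hair_def fst_conv snd_conv
    by (subst spl) (use hd in simp)
  show "contract1 (split_vertex v S T A, add_hair w B) = (A, B)"
    unfolding A B split_vertex_def add_hair_def fst_conv snd_conv
    by (subst spl) (use hd merge_split_edges[OF S(1)] merge_split_hairs[OF S(2)] in simp)
qed

lemma sum_single:
  assumes "finite A" "a \<in> A" "\<And>x. x \<in> A \<Longrightarrow> x \<noteq> a \<Longrightarrow> f x = 0"
  shows "sum f A = (f a :: 'b::comm_monoid_add)"
  using sum.mono_neutral_right[of A "{a}" f] assms by auto

lemma univalent_plus_vertex: "has_univalent (fst (plus_vertex v A))"
proof -
  obtain n es f where A: "A = ((n, es), f)" by (metis prod.exhaust)
  have "half_edges ((0, Suc v) # relabel Suc es) 0 = {(0, True)}"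
  proof (rule set_eqI)
    fix h :: "nat \<times> bool"
    obtain i b where h: "h = (i, b)" by (cases h)
    show "h \<in> half_edges ((0, Suc v) # relabel Suc es) 0 \<longleftrightarrow> h \<in> {(0, True)}"
      unfolding h by (cases i; cases b) (auto simp: half_edges_def endpoint_def relabel_def)
  qed
  then have "valency (fst (plus_vertex v A)) 0 = 1" by (simp add: A plus_vertex_def valency_def)
  moreover have "0 < fst (fst (plus_vertex v A))" by (simp add: A plus_vertex_def)
  ultimately show ?thesis unfolding has_univalent_def by blast
qed

text \<open>A pair without univalent vertices comes from at most one splitting: its first edge
  reveals the split vertex, its first hair the vertex \<open>w\<close>, and the half-edges and hairs
  at the vertex 0 the sets \<open>S\<close> and \<open>T\<close>. The terms with
  \<open>plus_vertex\<close> have a univalent vertex, so the coefficient is the bare factor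
  1/2.\<close>

lemma delta1_nonuniv:
  assumes Y: "wfp Y" "nonuniv Y"
  shows "delta1 X Y = (if std1 Y \<and> contract1 Y = X then 1 / 2 else (0 :: 'k::field_char_0))"
proof -
  obtain A B where X: "X = (A, B)" by (cases X)
  let ?b = "\<lambda>v w S T. scl (1 / 2) (bas (split_vertex v S T A, add_hair w B)) Y :: 'k"
  have plus: "bas (plus_vertex v A, add_hair w B) Y = (0 :: 'k)" for v w
    using univalent_plus_vertex[of v A] Y(2) by (auto simp: bas_def nonuniv_def)
  have "delta1 X Y = (\<Sum>v<fst (fst A). \<Sum>w<fst (fst B).
      \<Sum>S\<in>Pow (half_edges (snd (fst A)) v). \<Sum>T\<in>Pow (hairs (snd A) v). ?b v w S T)"
    by (simp add: delta1_def X sum_fun_at plus)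
  also have "\<dots> = (if std1 Y \<and> contract1 Y = X then 1 / 2 else 0)"
  proof (cases "std1 Y \<and> contract1 Y = X")
    case False
    have "?b v w S T = 0" if "S \<in> Pow (half_edges (snd (fst A)) v)" "T \<in> Pow (hairs (snd A) v)" for v w S T
      using contract1_split[of S A v T w B] that False by (auto simp: scl_def bas_def X)
    then show ?thesis using False by (simp add: sum.neutral)
  next
    case True
    obtain n u es f m es' g w where YY: "Y = (((Suc n, (0, Suc u) # es), f), ((m, es'), w # g))"
      "u < n" "w < m"
      "contract1 Y = (((n, map (map_prod (merge u) (merge u)) es), map (merge u) f), ((m, es'), g))"
      using std1_cases[OF conjunct1[OF True] Y(1)] by metis
    have AB: "A = ((n, map (map_prod (merge u) (merge u)) es), map (merge u) f)" "B = ((m, es'), g)"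
      using True YY(4) X by simp_all
    let ?S = "half_edges es 0" and ?T = "hairs f 0"
    have val: "?b v w' S T = (if v = u \<and> w' = w \<and> S = ?S \<and> T = ?T then 1 / 2 else 0)"
      if ST: "S \<in> Pow (half_edges (snd (fst A)) v)" "T \<in> Pow (hairs (snd A) v)" for v w' S T
    proof -
      have "(split_vertex v S T A, add_hair w' B) = Y \<longleftrightarrow> v = u \<and> w' = w \<and> S = ?S \<and> T = ?T"
      proof
        assume eq: "(split_vertex v S T A, add_hair w' B) = Y"
        have e: "snd (split_edges v S (fst A)) = (0, Suc u) # es" "split_hairs T (snd A) = f" "w' = w"
          using eq unfolding YY(1) by (auto simp: split_vertex_def add_hair_def)
        have "v = u" using e(1) by (simp add: snd_split_edges)
        moreover have "S = ?S" using half_edges_split[of S "fst A" v] ST e(1) by simp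
        moreover have "T = ?T" using hairs_split[of T "snd A" v] ST e(2) by simp
        ultimately show "v = u \<and> w' = w \<and> S = ?S \<and> T = ?T" using e by simp
      next
        assume "v = u \<and> w' = w \<and> S = ?S \<and> T = ?T"
        then show "(split_vertex v S T A, add_hair w' B) = Y"
          unfolding YY(1) AB by (simp add: split_vertex_def add_hair_def split_merge_edges split_merge_hairs)
      qed
      then show ?thesis by (auto simp: scl_def bas_def)
    qed
    have S: "?S \<in> Pow (half_edges (snd (fst A)) u)" "?T \<in> Pow (hairs (snd A) u)"
      using half_edges_merge[of es u] hairs_merge[of f u] by (auto simp: AB)
    have u: "u \<in> {..<fst (fst A)}" "w \<in> {..<fst (fst B)}" using YY(2,3) by (simp_all add: AB)
    have z: "v \<noteq> u \<or> w' \<noteq> w \<or> S \<noteq> ?S \<or> T \<noteq> ?T \<Longrightarrow> S \<in> Pow (half_edges (snd (fst A)) v) \<Longrightarrow>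
        T \<in> Pow (hairs (snd A) v) \<Longrightarrow> ?b v w' S T = 0" for v w' S T
      using val[of S v T w'] by simp
    have "(\<Sum>v<fst (fst A). \<Sum>w<fst (fst B).
      \<Sum>S\<in>Pow (half_edges (snd (fst A)) v). \<Sum>T\<in>Pow (hairs (snd A) v). ?b v w S T) =
      (\<Sum>w<fst (fst B). \<Sum>S\<in>Pow (half_edges (snd (fst A)) u). \<Sum>T\<in>Pow (hairs (snd A) u). ?b u w S T)"
      by (rule sum_single) (use u in \<open>auto intro!: sum.neutral z\<close>)
    also have "\<dots> = (\<Sum>S\<in>Pow (half_edges (snd (fst A)) u). \<Sum>T\<in>Pow (hairs (snd A) u). ?b u w S T)"
      by (rule sum_single) (use u in \<open>auto intro!: sum.neutral z\<close>)
    also have "\<dots> = (\<Sum>T\<in>Pow (hairs (snd A) u). ?b u w ?S T)"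
      by (rule sum_single) (use S in \<open>auto intro!: sum.neutral z\<close>)
    also have "\<dots> = ?b u w ?S ?T"
      by (rule sum_single) (use S in \<open>auto intro!: z\<close>)
    also have "\<dots> = 1 / 2" using val[OF S, of w] by simp
    finally show ?thesis using True by simp
  qed
  finally show ?thesis .
qed

abbreviation contract2 :: "egraph \<Rightarrow> egraph" where
  "contract2 X \<equiv> prod.swap (contract1 (prod.swap X))"

abbreviation std2 :: "egraph \<Rightarrow> bool" where
  "std2 X \<equiv> std1 (prod.swap X)"

lemma snd_contract1 [simp]: "fst (snd (contract1 X)) = fst (snd X)"
proof -
  obtain n es f H g where X: "X = (((n, es), f), (H, g))"
    by (metis prod.exhaust)
  show ?thesis by (simp add: X)
qed

text \<open>Only the two contractions of \<open>Y\<close> can contribute to the sum in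
  \<open>lin_ext\<close>, one for each of the two graphs.\<close>

lemma dif_fcGC_nonuniv:
  assumes Y: "wfp Y" "nonuniv Y"
  shows "dif (fcGC c d) x Y =
     (1 / 2) * (if std1 Y then x (contract1 Y) else 0) +
     (1 / 2) * koszul (gdeg c (fst (fst Y))) * (if std2 Y then x (contract2 Y) else (0 :: 'k::field_char_0))"
proof -
  let ?a = "\<lambda>X. if std1 Y \<and> contract1 Y = X then 1 / 2 else (0 :: 'k)"
  let ?b = "\<lambda>X. if std2 Y \<and> contract2 Y = X then koszul (gdeg c (fst (fst Y))) / 2 else (0 :: 'k)"
  have D: "delta c X Y = ?a X + ?b X" for X
  proof -
    have "delta2 X Y = (if std2 Y \<and> contract2 Y = X then 1 / 2 else (0 :: 'k))"
    proof -
      have "contract1 (prod.swap Y) = prod.swap X \<longleftrightarrow> contract2 Y = X"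
        by (metis swap_swap)
      moreover have "wfp (prod.swap Y)" "nonuniv (prod.swap Y)" using Y by simp_all
      ultimately show ?thesis
        using delta1_nonuniv[of "prod.swap Y" "prod.swap X", where 'k='k]
        unfolding delta2_def comp_apply by presburger
    qed
    then show ?thesis
      using delta1_nonuniv[OF Y, of X, where 'k='k] unfolding delta_def by (auto simp: scl_def)
  qed
  let ?S = "{contract1 Y, contract2 Y}"
  have "dif (fcGC c d) x Y = (\<Sum>X | delta c X Y \<noteq> (0::'k). x X * delta c X Y)"
    by (simp add: fcGC_def lin_ext_def Let_def)
  also have "\<dots> = (\<Sum>X\<in>?S. x X * delta c X Y)"
    by (rule sum.mono_neutral_left) (auto simp: D split: if_splits)
  also have "\<dots> = (\<Sum>X\<in>?S. x X * ?a X) + (\<Sum>X\<in>?S. x X * ?b X)"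
    by (simp only: D distrib_left sum.distrib)
  also have "(\<Sum>X\<in>?S. x X * ?a X) = x (contract1 Y) * ?a (contract1 Y)"
    by (rule sum_single) auto
  also have "(\<Sum>X\<in>?S. x X * ?b X) = x (contract2 Y) * ?b (contract2 Y)"
    by (rule sum_single) auto
  finally show ?thesis by simp
qed

section \<open>Connectedness\<close>

text \<open>Connectedness is pulled back along a map whose fibres are connected and along which
  edges lift. It is applied to the merging of two vertices, where the nontrivial fibre is joined by
  the new edge, and to renumberings, where the map is a bijection.\<close>

lemma connected_lift:
  assumes lift: "\<And>a b. (a, b) \<in> R \<Longrightarrow> \<exists>a'\<in>V'. \<exists>b'\<in>V'. p a' = a \<and> p b' = b \<and> (a', b') \<in> (R' \<union> R'\<inverse>)\<^sup>*"
    and fib: "\<And>a b. a \<in> V' \<Longrightarrow> b \<in> V' \<Longrightarrow> p a = p b \<Longrightarrow> (a, b) \<in> (R' \<union> R'\<inverse>)\<^sup>*"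
    and conn: "(p a, p b) \<in> (R \<union> R\<inverse>)\<^sup>*" and a: "a \<in> V'" "b \<in> V'"
  shows "(a, b) \<in> (R' \<union> R'\<inverse>)\<^sup>*"
proof -
  have sym: "(y, x) \<in> (R' \<union> R'\<inverse>)\<^sup>*" if "(x, y) \<in> (R' \<union> R'\<inverse>)\<^sup>*" for x y
    using that by (metis sym_rtrancl sym_Un_converse symD)
  have "\<forall>b'\<in>V'. p b' = z \<longrightarrow> (a, b') \<in> (R' \<union> R'\<inverse>)\<^sup>*" if "(p a, z) \<in> (R \<union> R\<inverse>)\<^sup>*" for z
    using that
  proof (induction rule: rtrancl_induct)
    case base
    then show ?case using fib a by metis
  next
    case (step y z)
    obtain y' z' where yz: "y' \<in> V'" "z' \<in> V'" "p y' = y" "p z' = z" "(y', z') \<in> (R' \<union> R'\<inverse>)\<^sup>*"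
      using step(2) lift[of y z] lift[of z y] sym by blast
    have az: "(a, z') \<in> (R' \<union> R'\<inverse>)\<^sup>*" using step(3) yz rtrancl_trans[OF _ yz(5)] by blast
    show ?case using fib[OF yz(2)] yz(4) rtrancl_trans[OF az] by metis
  qed
  then show ?thesis using conn a by blast
qed

lemma r_into_sym: "(a, b) \<in> R \<Longrightarrow> (a, b) \<in> (R \<union> R\<inverse>)\<^sup>*" "(b, a) \<in> R \<Longrightarrow> (a, b) \<in> (R \<union> R\<inverse>)\<^sup>*"
  by (auto intro: r_into_rtrancl)

lemma merge_fiber: "merge u x = merge u y \<Longrightarrow> x = y \<or> x = 0 \<and> y = Suc u \<or> x = Suc u \<and> y = 0"
  by (cases x; cases y) auto

lemma Gra_pair_wfp: "Gra_pair X \<Longrightarrow> wfp X"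
proof -
  obtain n es f m es' g where X: "X = (((n, es), f), ((m, es'), g))"
    by (metis prod.exhaust)
  show "Gra_pair X \<Longrightarrow> wfp X"
    unfolding X by (auto simp: Gra_pair_def wf_graph_def attachments_def)
qed

lemma Gra_pair_iff: "Gra_pair X \<longleftrightarrow> wfp X \<and> connected_pair X"
proof -
  obtain n es f m es' g where X: "X = (((n, es), f), ((m, es'), g))"
    by (metis prod.exhaust)
  show ?thesis
    unfolding X by (auto simp: Gra_pair_def wf_graph_def attachments_def)
qed

lemma fcGC_pair_wfp: "fcGC_pair X \<Longrightarrow> wfp X"
  by (simp add: fcGC_pair_def Gra_pair_wfp)

lemma endpoint_less:
  assumes "set es \<subseteq> {..<n} \<times> {..<n}" "i < length es"
  shows "endpoint es (i, b) < n"
proof -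
  have "es ! i \<in> {..<n} \<times> {..<n}" using assms nth_mem by blast
  then show ?thesis by (cases "es ! i") (auto simp: endpoint_def)
qed

lemma split_connected_pair:
  assumes X: "Gra_pair (A, B)" and v: "v < fst (fst A)" "w < fst (fst B)"
    and S: "S \<subseteq> half_edges (snd (fst A)) v" "T \<subseteq> hairs (snd A) v"
  shows "Gra_pair (split_vertex v S T A, add_hair w B)"
proof -
  obtain n es f where A: "A = ((n, es), f)" by (metis prod.exhaust)
  obtain m es' g where B: "B = ((m, es'), g)" by (metis prod.exhaust)
  have wf: "1 \<le> n" "1 \<le> m" "set es \<subseteq> {..<n} \<times> {..<n}" "set es' \<subseteq> {..<m} \<times> {..<m}"
    "length f = length es'" "set f \<subseteq> {..<n}" "length g = length es" "set g \<subseteq> {..<m}"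
    using Gra_pair_wfp[OF X] by (simp_all add: A B)
  let ?es = "snd (split_edges v S (n, es))" and ?f = "split_hairs T f"
  have spl: "split_edges v S (n, es) = (Suc n, ?es)" by (simp add: prod_eq_iff)
  have Y: "(split_vertex v S T A, add_hair w B) = (((Suc n, ?es), ?f), ((m, es'), w # g))"
    using spl by (simp add: A B split_vertex_def add_hair_def)
  have "wfp (((Suc n, ?es), ?f), ((m, es'), w # g))"
    using wf v endpoint_less[OF wf(3)] subsetD[OF wf(6) nth_mem]
    by (auto simp: A B snd_split_edges split_hairs_def)
  moreover have "connected_pair (((Suc n, ?es), ?f), ((m, es'), w # g))"
  proof -
    let ?R = "incidences (((n, es), f), ((m, es'), g))"
    let ?R' = "incidences (((Suc n, ?es), ?f), ((m, es'), w # g))"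
    let ?p = "map_sum (merge v) id :: nat + nat \<Rightarrow> nat + nat"
    let ?V = "Inl ` {..<n} \<union> Inr ` {..<m} :: (nat + nat) set"
    let ?V' = "Inl ` {..<Suc n} \<union> Inr ` {..<m} :: (nat + nat) set"
    let ?mv = "\<lambda>h. if h \<in> S then 0 else Suc (endpoint es h)"
    have mv: "merge v (?mv h) = endpoint es h" for h
      using S by (auto simp: half_edges_def A)
    have mv_less: "?mv (i, b) < Suc n" if "i < length es" for i b
      using endpoint_less[OF wf(3) that, of b] by simp
    have ep: "endpoint ?es (Suc i, b) = ?mv (i, b)" if "i < length es" for i b
      using that endpoint_split_edges_Suc[of i "(n, es)" v S b] by simp
    \<comment> \<open>The new edge joins 0 and \<open>Suc v\<close>, the only two vertices that
      \<open>?p\<close> identifies.\<close>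
    have e0: "(Inl 0, Inl (Suc v)) \<in> ?R'" by (auto simp: snd_split_edges)
    show ?thesis
      unfolding connected_pair_def Let_def fst_conv snd_conv
    proof (intro ballI)
      fix a b assume ab: "a \<in> ?V'" "b \<in> ?V'"
      show "(a, b) \<in> (?R' \<union> ?R'\<inverse>)\<^sup>*"
      proof (rule connected_lift[where p = ?p and V' = ?V' and R = ?R])
        fix a b assume "(a, b) \<in> ?R"
        then consider
          (1) i where "i < length es" "a = Inl (endpoint es (i, True))" "b = Inl (endpoint es (i, False))"
          | (2) i k where "i < length es" "a = Inl (endpoint es (i, k))" "b = Inr (g ! i)"
          | (3) x y where "(x, y) \<in> set es'" "a = Inr x" "b = Inr y"
          | (4) j k where "j < length es'" "a = Inr (endpoint es' (j, k))" "b = Inl (f ! j)"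
          by (auto simp: in_set_conv_nth endpoint_def) fastforce
        then show "\<exists>a'\<in>?V'. \<exists>b'\<in>?V'. ?p a' = a \<and> ?p b' = b \<and> (a', b') \<in> (?R' \<union> ?R'\<inverse>)\<^sup>*"
        proof cases
          case 1
          have "(?mv (i, True), ?mv (i, False)) = ?es ! Suc i"
            using 1(1) by (simp add: snd_split_edges)
          then have "(?mv (i, True), ?mv (i, False)) \<in> set ?es"
            using 1(1) by (metis Suc_less_eq length_split_edges nth_mem snd_conv)
          then have "(Inl (?mv (i, True)), Inl (?mv (i, False))) \<in> ?R'" by auto
          then show ?thesis
            using 1 mv mv_less[OF 1(1)]
            by (intro bexI[of _ "Inl (?mv (i, True))"] bexI[of _ "Inl (?mv (i, False))"] conjI r_into_sym(1)) auto
        next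
          case 2
          have "(Inl (endpoint ?es (Suc i, k)), Inr ((w # g) ! Suc i)) \<in> ?R'"
            unfolding incidences.simps using 2(1) by (intro UnI1 UnI2) (auto simp del: nth_Cons_Suc)
          then have "(Inl (?mv (i, k)), Inr (g ! i)) \<in> ?R'" using ep[OF 2(1)] by (simp del: incidences.simps)
          moreover have "g ! i < m" using wf(7,8) 2(1) by (metis lessThan_iff nth_mem subsetD)
          ultimately show ?thesis
            using 2 mv mv_less[OF 2(1)]
            by (intro bexI[of _ "Inl (?mv (i, k))"] bexI[of _ "Inr (g ! i)"] conjI r_into_sym(1)) auto
        next
          case 3
          then have "(Inr x, Inr y) \<in> ?R'" by auto
          moreover have "x < m" "y < m" using 3 wf(4) by auto
          ultimately show ?thesis
            using 3 by (intro bexI[of _ "Inr x"] bexI[of _ "Inr y"] conjI r_into_sym(1)) auto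
        next
          case 4
          then have "(Inr (endpoint es' (j, k)), Inl (?f ! j)) \<in> ?R'" by auto
          moreover have "endpoint es' (j, k) < m" using endpoint_less[OF wf(4) 4(1)] .
          moreover have "f ! j < n" using wf(5,6) 4(1) by (metis lessThan_iff nth_mem subsetD)
          moreover have "merge v (?f ! j) = f ! j" "?f ! j < Suc n" using S(2) 4(1) wf(5) \<open>f ! j < n\<close>
            by (auto simp: split_hairs_def hairs_def A)
          ultimately show ?thesis
            using 4 by (intro bexI[of _ "Inr (endpoint es' (j, k))"] bexI[of _ "Inl (?f ! j)"] conjI r_into_sym(1)) auto
        qed
      next
        fix a b assume ab: "a \<in> ?V'" "b \<in> ?V'" "?p a = ?p b"
        have "a = b \<or> a = Inl 0 \<and> b = Inl (Suc v) \<or> a = Inl (Suc v) \<and> b = Inl 0"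
          using ab(3) by (cases a; cases b) (auto dest: merge_fiber)
        then show "(a, b) \<in> (?R' \<union> ?R'\<inverse>)\<^sup>*"
          using r_into_sym(1)[OF e0] r_into_sym(2)[OF e0] by blast
      next
        have C: "\<forall>a\<in>?V. \<forall>b\<in>?V. (a, b) \<in> (?R \<union> ?R\<inverse>)\<^sup>*"
          using X unfolding Gra_pair_def connected_pair_def Let_def A B fst_conv snd_conv by (elim conjE)
        have V: "?p x \<in> ?V" if "x \<in> ?V'" for x
          using that v(1) merge_less[of _ n v] by (cases x) (auto simp: A)
        then show "(?p a, ?p b) \<in> (?R \<union> ?R\<inverse>)\<^sup>*"
          using C V[OF ab(1)] V[OF ab(2)] by (simp del: incidences.simps)
      qed (use ab in auto)
    qed
  qed
  ultimately show ?thesis unfolding Y Gra_pair_iff by blast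
qed

text \<open>The subtracted graph is the splitting that moves nothing to the new vertex. Thus every
  term of \<open>delta1\<close> is a splitting, and statements about supports have to treat only
  these.\<close>

lemma plus_vertex_eq_split: "plus_vertex v A = split_vertex v {} {} A"
proof -
  obtain n es f where A: "A = ((n, es), f)" by (metis prod.exhaust)
  have "relabel Suc es = map (\<lambda>i. (Suc (endpoint es (i, True)), Suc (endpoint es (i, False)))) [0..<length es]"
    by (rule nth_equalityI) (auto simp: relabel_def endpoint_def prod_eq_iff)
  moreover have "map Suc f = split_hairs {} f"
    by (rule nth_equalityI) (auto simp: split_hairs_def)
  ultimately show ?thesis by (simp add: A plus_vertex_def split_vertex_def split_edges_def)
qed

lemma delta1_nonzero:
  assumes "delta1 (A, B) Y \<noteq> (0 :: 'k::field_char_0)"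
  obtains v w S T where "v < fst (fst A)" "w < fst (fst B)" "S \<subseteq> half_edges (snd (fst A)) v"
    "T \<subseteq> hairs (snd A) v" "Y = (split_vertex v S T A, add_hair w B)"
proof (rule ccontr)
  assume n: "\<not> thesis"
  note th = that
  have z: "bas (split_vertex v S T A, add_hair w B) Y = (0 :: 'k)"
    if "v < fst (fst A)" "w < fst (fst B)" "S \<subseteq> half_edges (snd (fst A)) v" "T \<subseteq> hairs (snd A) v" for v w S T
  proof -
    have "Y \<noteq> (split_vertex v S T A, add_hair w B)" using n th[of v w S T] that by blast
    then show ?thesis by (simp add: bas_def)
  qed
  have "delta1 (A, B) Y = (0 :: 'k)"
    unfolding delta1_def plus_vertex_eq_split by (simp add: sum_fun_at scl_def z)
  then show False using assms by simp
qed

section \<open>Equivariant functionals and the null spaces\<close>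

declare split_paired_All [simp del] split_paired_Ex [simp del]

lemma wfp_nthD:
  "wfp (((n, es), f), ((m, es'), g)) \<Longrightarrow> i < length es \<Longrightarrow> g ! i < m"
  "wfp (((n, es), f), ((m, es'), g)) \<Longrightarrow> i < length es' \<Longrightarrow> f ! i < n"
  using nth_mem[of i g] nth_mem[of i f] by (auto simp: subset_iff)

lemma incidences_cases:
  assumes "(a, b) \<in> incidences (((n, es), f), ((m, es'), g))"
  obtains
    (edge1) i where "i < length es" "a = Inl (endpoint es (i, True))" "b = Inl (endpoint es (i, False))"
  | (hair1) i k where "i < length es" "a = Inl (endpoint es (i, k))" "b = Inr (g ! i)"
  | (edge2) x y where "(x, y) \<in> set es'" "a = Inr x" "b = Inr y"
  | (hair2) j k where "j < length es'" "a = Inr (endpoint es' (j, k))" "b = Inl (f ! j)"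
  using assms by (auto simp: in_set_conv_nth endpoint_def) fastforce

lemma endpoint_act_edges:
  assumes "i < length es"
  shows "endpoint (act_edges s t F es) (i, k) = s (endpoint es (t i, k \<noteq> F i))"
  using assms by (cases "es ! t i") (auto simp: endpoint_def)

lemma connected_pair_act1:
  assumes X: "wfp X" "connected_pair X" and s: "s permutes {..<nv1 X}" and t: "t permutes {..<ne1 X}"
  shows "connected_pair (act1 s t F X)"
proof -
  obtain n es f m es' g where XX: "X = (((n, es), f), ((m, es'), g))"
    by (metis prod.exhaust)
  have wf: "set es \<subseteq> {..<n} \<times> {..<n}" "set es' \<subseteq> {..<m} \<times> {..<m}" "length g = length es" "length f = length es'"
    using X(1) by (simp_all add: XX)
  have s': "s permutes {..<n}" and t': "t permutes {..<length es}" using s t by (simp_all add: XX)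
  let ?es = "act_edges s t F es" and ?g = "permute_list t g"
  let ?R = "incidences (((n, es), f), ((m, es'), g))"
  let ?R' = "incidences (((n, ?es), map s f), ((m, es'), ?g))"
  let ?p = "map_sum (inv s) id :: nat + nat \<Rightarrow> nat + nat"
  let ?V = "Inl ` {..<n} \<union> Inr ` {..<m} :: (nat + nat) set"
  have isv: "inv s (s x) = x" "s (inv s x) = x" for x using permutes_inverses[OF s'] by simp_all
  have itv: "inv t i < length es" "t (inv t i) = i" if "i < length es" for i
    using permutes_less[OF permutes_inv[OF t'] that] permutes_inverses[OF t'] by simp_all
  have sl: "s x < n" if "x < n" for x using permutes_less[OF s' that] .
  have C: "\<forall>a\<in>?V. \<forall>b\<in>?V. (a, b) \<in> (?R \<union> ?R\<inverse>)\<^sup>*"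
    using X(2) unfolding connected_pair_def Let_def XX fst_conv snd_conv .
  have V: "?p x \<in> ?V" if "x \<in> ?V" for x
    using that permutes_less[OF permutes_inv[OF s']] by (cases x) auto
  have "(a, b) \<in> (?R' \<union> ?R'\<inverse>)\<^sup>*" if ab: "a \<in> ?V" "b \<in> ?V" for a b
  proof (rule connected_lift[where p = ?p and V' = ?V and R = ?R])
    fix a b assume "(a, b) \<in> ?R"
    then show "\<exists>a'\<in>?V. \<exists>b'\<in>?V. ?p a' = a \<and> ?p b' = b \<and> (a', b') \<in> (?R' \<union> ?R'\<inverse>)\<^sup>*"
    proof (cases rule: incidences_cases)
      case (edge1 i)
      let ?x = "s (endpoint es (i, True))" and ?y = "s (endpoint es (i, False))"
      have "?es ! inv t i = (?x, ?y) \<or> ?es ! inv t i = (?y, ?x)"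
        using itv[OF edge1(1)] by (cases "es ! i") (simp add: endpoint_def)
      then have "(?x, ?y) \<in> set ?es \<or> (?y, ?x) \<in> set ?es"
        using itv(1)[OF edge1(1)] nth_mem[of "inv t i" ?es] by auto
      then have "(Inl ?x, Inl ?y) \<in> ?R' \<or> (Inl ?y, Inl ?x) \<in> ?R'" by auto
      then have "(Inl ?x, Inl ?y) \<in> (?R' \<union> ?R'\<inverse>)\<^sup>*" using r_into_sym by metis
      then show ?thesis
        using edge1 isv sl endpoint_less[OF wf(1) edge1(1)]
        by (intro bexI[of _ "Inl ?x"] bexI[of _ "Inl ?y"]) (auto simp del: incidences.simps)
    next
      case (hair1 i k)
      have "(Inl (endpoint ?es (inv t i, k \<noteq> F (inv t i))), Inr (?g ! inv t i)) \<in> ?R'"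
        using itv(1)[OF hair1(1)] by auto
      moreover have "endpoint ?es (inv t i, k \<noteq> F (inv t i)) = s (endpoint es (i, k))"
        using endpoint_act_edges[OF itv(1)[OF hair1(1)], of s t F] itv(2)[OF hair1(1)]
        by (cases "F (inv t i)") auto
      moreover have "?g ! inv t i = g ! i"
        using permute_list_nth[of t g "inv t i"] t' itv[OF hair1(1)] wf(3) by simp
      ultimately have "(Inl (s (endpoint es (i, k))), Inr (g ! i)) \<in> ?R'" by metis
      then show ?thesis
        using hair1 isv sl endpoint_less[OF wf(1) hair1(1)] wfp_nthD(1)[of n es f m es' g i] X(1)
        by (intro bexI[of _ "Inl (s (endpoint es (i, k)))"] bexI[of _ "Inr (g ! i)"] conjI r_into_sym(1))
          (auto simp: XX simp del: incidences.simps)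
    next
      case (edge2 x y)
      then have "(Inr x, Inr y) \<in> ?R'" "x < m" "y < m" using wf(2) by auto
      then show ?thesis
        using edge2 by (intro bexI[of _ "Inr x"] bexI[of _ "Inr y"] conjI r_into_sym(1))
          (auto simp del: incidences.simps)
    next
      case (hair2 j k)
      have "(Inr (endpoint es' (j, k)), Inl (map s f ! j)) \<in> ?R'" using hair2 by auto
      moreover have "map s f ! j = s (f ! j)" using hair2 wf(4) by simp
      ultimately have "(Inr (endpoint es' (j, k)), Inl (s (f ! j))) \<in> ?R'" by metis
      then show ?thesis
        using hair2 isv sl endpoint_less[OF wf(2) hair2(1)] wfp_nthD(2)[of n es f m es' g j] X(1)
        by (intro bexI[of _ "Inr (endpoint es' (j, k))"] bexI[of _ "Inl (s (f ! j))"] conjI r_into_sym(1))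
          (auto simp: XX simp del: incidences.simps)
    qed
  next
    fix a b assume "?p a = ?p b"
    moreover have "x = y" if "inv s x = inv s y" for x y using that isv(2) by metis
    ultimately have "a = b" by (cases a; cases b) auto
    then show "(a, b) \<in> (?R' \<union> ?R'\<inverse>)\<^sup>*" by (simp del: incidences.simps)
  next
    show "(?p a, ?p b) \<in> (?R \<union> ?R\<inverse>)\<^sup>*" using C V[OF ab(1)] V[OF ab(2)] by (simp del: incidences.simps)
  qed (rule ab)+
  then show ?thesis
    unfolding connected_pair_def Let_def XX act1.simps fst_conv snd_conv by (intro ballI)
qed

lemma fcGC_pair_iff: "fcGC_pair X \<longleftrightarrow> wfp X \<and> connected_pair X \<and> fst (fst (fst X)) + nv2 X \<ge> 3"
  by (auto simp: fcGC_pair_def Gra_pair_iff admissible_def)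

lemma fcGC_pair_act1:
  assumes "fcGC_pair X" "s permutes {..<nv1 X}" "t permutes {..<ne1 X}"
  shows "fcGC_pair (act1 s t F X)"
  using assms connected_pair_act1[of X s t F] wfp_act1[of X s t F] unfolding fcGC_pair_iff by simp

lemma fcGC_pair_act1_iff:
  assumes "wfp X" "s permutes {..<nv1 X}" "t permutes {..<ne1 X}"
  shows "fcGC_pair (act1 s t F X) \<longleftrightarrow> fcGC_pair X"
  using fcGC_pair_act1[OF _ assms(2,3)] act1_inverse[OF assms, of F]
    fcGC_pair_act1[of "act1 s t F X" "inv s" "inv t" "\<lambda>i. F (inv t i)"] permutes_inv assms(2,3)
  by (metis sizes_act1(1,2))

lemma valency_act_edges:
  assumes "s permutes {..<n}" "t permutes {..<length es}"
  shows "valency (n, act_edges s t F es) (s u) = valency (n, es) u"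
proof -
  let ?G = "\<lambda>i. of_bool (fst (es ! i) = u) + of_bool (snd (es ! i) = u) :: nat"
  have inj: "s x = s u \<longleftrightarrow> x = u" for x using permutes_inj[OF assms(1)] by (auto dest: injD)
  have "valency (n, act_edges s t F es) (s u) = (\<Sum>i<length es. ?G (t i))"
    unfolding valency_sum
    by (simp, rule sum.cong) (auto simp: inj)
  also have "\<dots> = (\<Sum>i<length es. ?G i)"
    using sum.permute[OF assms(2), of ?G] by (simp add: comp_def)
  finally show ?thesis by (simp add: valency_sum)
qed

lemma nonuniv_act1:
  assumes "wfp X" "s permutes {..<nv1 X}" "t permutes {..<ne1 X}"
  shows "nonuniv (act1 s t F X) \<longleftrightarrow> nonuniv X"
proof -
  obtain n es f H g where X: "X = (((n, es), f), (H, g))" by (metis prod.exhaust)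
  have s: "s permutes {..<n}" and t: "t permutes {..<length es}" using assms by (simp_all add: X)
  have "(\<exists>u<n. valency (n, act_edges s t F es) u = 1) \<longleftrightarrow> (\<exists>u<n. valency (n, es) u = 1)"
  proof
    assume "\<exists>u<n. valency (n, act_edges s t F es) u = 1"
    then obtain u where u: "u < n" "valency (n, act_edges s t F es) u = 1" by blast
    then have "valency (n, es) (inv s u) = 1"
      using valency_act_edges[OF s t, of F "inv s u"] permutes_inverses[OF s] by simp
    then show "\<exists>u<n. valency (n, es) u = 1" using permutes_less[OF permutes_inv[OF s] u(1)] by blast
  next
    assume "\<exists>u<n. valency (n, es) u = 1"
    then show "\<exists>u<n. valency (n, act_edges s t F es) u = 1"
      using valency_act_edges[OF s t, of F] permutes_less[OF s] by metis
  qed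
  then show ?thesis by (auto simp: X nonuniv_def has_univalent_def)
qed

lemma act_edges_relabel: "act_edges s id noflip es = relabel s es"
  by (rule nth_equalityI) (auto simp: relabel_def)

lemma act_edges_permute: "t permutes {..<length es} \<Longrightarrow> act_edges id t noflip es = permute_list t es"
  by (rule nth_equalityI) (auto simp: permute_list_nth map_prod_def)

lemma act_edges_flip: "i < length es \<Longrightarrow> act_edges id id (\<lambda>j. j = i) es = flip_edge i es"
  by (rule nth_equalityI) (auto simp: flip_edge_def map_prod_def nth_list_update)

lemma or_sign_simps:
  "or_sign c e s id noflip = (vertex_sign c s :: 'k::field_char_0)"
  "or_sign c e id t noflip = (edge_sign c t :: 'k)"
  "i < e \<Longrightarrow> or_sign c e id id (\<lambda>j. j = i) = (flip_sign c :: 'k)"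
  by (simp_all add: or_sign_def vertex_sign_def edge_sign_def prod.delta)

text \<open>All three kinds of relations are instances of a single one, with identities in the
  remaining slots.\<close>

lemma rel1_cases:
  assumes "r \<in> rel1 c"
  obtains X s t F where "fcGC_pair X" "s permutes {..<nv1 X}" "t permutes {..<ne1 X}"
    "r = bas X - scl (or_sign c (ne1 X) s t F :: 'k::field_char_0) (bas (act1 s t F X))"
proof -
  note th = that
  consider
    (v) n es f H g s where "fcGC_pair (((n, es), f), (H, g))" "s permutes {..<n}"
      "r = bas (((n, es), f), (H, g)) - scl (vertex_sign c s) (bas (((n, relabel s es), map s f), (H, g)))"
  | (e) n es f H g t where "fcGC_pair (((n, es), f), (H, g))" "t permutes {..<length es}"
      "r = bas (((n, es), f), (H, g)) -
        scl (edge_sign c t) (bas (((n, permute_list t es), f), (H, permute_list t g)))"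
  | (f) n es f H g i where "fcGC_pair (((n, es), f), (H, g))" "i < length es"
      "r = bas (((n, es), f), (H, g)) - scl (flip_sign c) (bas (((n, flip_edge i es), f), (H, g)))"
    using assms unfolding rel1_def by blast
  then show ?thesis
  proof cases
    case v
    show ?thesis
      by (rule th[of "(((n, es), f), (H, g))" s id "\<lambda>_. False"])
        (use v in \<open>simp_all add: act_edges_relabel or_sign_simps permutes_id\<close>)
  next
    case e
    show ?thesis
      by (rule th[of "(((n, es), f), (H, g))" id t "\<lambda>_. False"])
        (use e in \<open>simp_all add: act_edges_permute or_sign_simps permutes_id\<close>)
  next
    case f
    show ?thesis
      by (rule th[of "(((n, es), f), (H, g))" id id "\<lambda>j. j = i"])
        (use f in \<open>simp_all add: act_edges_flip or_sign_simps permutes_id\<close>)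
  qed
qed

lemma pr_relation: "pr \<Phi> (bas X - scl e (bas Y)) = \<Phi> X - e * \<Phi> Y"
  by (simp add: pr_diff_FS FS_scl pr_scl)

text \<open>Vertex permutations, edge permutations and single flips generate the group, and the
  elements satisfying \<open>M\<close> are closed under composition. The stable set \<open>V\<close>
  is a parameter because the argument serves both pairs and plain graphs.\<close>

lemma EQ1_from_moves:
  fixes \<Phi> :: "'k::field_char_0 efun"
  assumes V: "\<And>X. V X \<Longrightarrow> wfp X"
    and cl: "\<And>X s t F. V X \<Longrightarrow> s permutes {..<nv1 X} \<Longrightarrow> t permutes {..<ne1 X} \<Longrightarrow> V (act1 s t F X)"
    and supp: "\<And>X. \<Phi> X \<noteq> 0 \<Longrightarrow> V X"
    and mv: "\<And>X s. V X \<Longrightarrow> s permutes {..<nv1 X} \<Longrightarrow>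
      \<Phi> X = vertex_sign c s * \<Phi> (act1 s id noflip X)"
    and me: "\<And>X t. V X \<Longrightarrow> t permutes {..<ne1 X} \<Longrightarrow>
      \<Phi> X = edge_sign c t * \<Phi> (act1 id t noflip X)"
    and mf: "\<And>X i. V X \<Longrightarrow> i < ne1 X \<Longrightarrow> \<Phi> X = flip_sign c * \<Phi> (act1 id id (\<lambda>j. j = i) X)"
  shows "EQ1 c \<Phi>"
proof -
  define M where "M n e s t F \<longleftrightarrow> (\<forall>X. V X \<longrightarrow> nv1 X = n \<longrightarrow> ne1 X = e \<longrightarrow>
    \<Phi> (act1 s t F X) = or_sign c e s t F * \<Phi> X)" for n e s t F
  have sq: "b = a * x" if "x = a * b" "a * a = 1" for a b x :: 'k
    using that by (simp add: mult.assoc[symmetric])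
  have Ms: "M n e s id noflip" if "s permutes {..<n}" for n e s
    unfolding M_def
    using sq[OF mv] or_sign_sq[of c e s id "\<lambda>_. False", where 'k='k] that unfolding or_sign_simps by blast
  have Mt: "M n e id t noflip" if "t permutes {..<e}" for n e t
    unfolding M_def
    using sq[OF me] or_sign_sq[of c e id t "\<lambda>_. False", where 'k='k] that unfolding or_sign_simps by blast
  have Mi: "M n e id id (\<lambda>j. j = i)" if "i < e" for n e i
    unfolding M_def or_sign_simps(3)[OF that]
    using sq[OF mf flip_sign_sq] that by blast
  have cliff: "V (act1 s t F X) \<longleftrightarrow> V X"
    if "wfp X" "s permutes {..<nv1 X}" "t permutes {..<ne1 X}" for s t F X
    using cl[OF _ that(2,3), of F] act1_inverse[OF that, of F]
      cl[of "act1 s t F X" "inv s" "inv t" "\<lambda>i. F (inv t i)"] permutes_inv that(2,3)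
    by (metis sizes_act1(1,2))
  have Mcomp: "M n e (s \<circ> s') (t' \<circ> t) (\<lambda>i. F i \<noteq> F' (t i))"
    if "M n e s t F" "M n e s' t' F'" "s permutes {..<n}" "s' permutes {..<n}"
      "t permutes {..<e}" "t' permutes {..<e}" for n e s s' t t' F F'
    unfolding M_def
  proof (intro allI impI)
    fix X assume X: "V X" "nv1 X = n" "ne1 X = e"
    have "act1 (s \<circ> s') (t' \<circ> t) (\<lambda>i. F i \<noteq> F' (t i)) X = act1 s t F (act1 s' t' F' X)"
      using act1_act1[OF V[OF X(1)], of t s F s' t' F'] that X by simp
    moreover have "V (act1 s' t' F' X)" using cl[OF X(1)] that X by simp
    ultimately show "\<Phi> (act1 (s \<circ> s') (t' \<circ> t) (\<lambda>i. F i \<noteq> F' (t i)) X) =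
        or_sign c e (s \<circ> s') (t' \<circ> t) (\<lambda>i. F i \<noteq> F' (t i)) * \<Phi> X"
      using that(1,2) X or_sign_comp[OF that(3,4,5,6), of c F F', where 'k='k]
      unfolding M_def by (metis (no_types, lifting) mult.assoc sizes_act1(1,2))
  qed
  have MF: "M n e id id (\<lambda>i. i \<in> A)" if "finite A" "A \<subseteq> {..<e}" for n e A
    using that
  proof (induction A rule: finite_induct)
    case empty
    then show ?case unfolding M_def by simp
  next
    case (insert a A)
    have a: "a < e" using insert(4) by simp
    have "A \<subseteq> {..<e}" using insert(4) by simp
    then have IH: "M n e id id (\<lambda>i. i \<in> A)" by (rule insert(3))
    have "(\<lambda>i. (i = a) \<noteq> (id i \<in> A)) = (\<lambda>i. i \<in> insert a A)" using insert(2) by auto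
    moreover have "M n e (id \<circ> id) (id \<circ> id) (\<lambda>i. (i = a) \<noteq> (id i \<in> A))"
      by (rule Mcomp[OF Mi[OF a] IH]) (rule permutes_id)+
    ultimately show ?case by (simp only: comp_id)
  qed
  show "EQ1 c \<Phi>"
    unfolding EQ1_def
  proof (intro allI impI)
    fix X s t F assume X: "wfp X" "s permutes {..<nv1 X}" "t permutes {..<ne1 X}"
    show "\<Phi> (act1 s t F X) = or_sign c (ne1 X) s t F * \<Phi> X"
    proof (cases "V X")
      case False
      then have "\<not> V (act1 s t F X)" using cliff[OF X] by simp
      then show ?thesis using supp False by (metis mult_zero_right)
    next
      case True
      let ?n = "nv1 X" and ?e = "ne1 X"
      let ?A = "{i. i < ?e \<and> F i}"
      have M2: "M ?n ?e (id \<circ> s) (id \<circ> t) (\<lambda>i. False \<noteq> False)"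
        by (rule Mcomp[OF Mt[OF X(3)] Ms[OF X(2)]]) (use X(2,3) permutes_id in blast)+
      have "M ?n ?e (id \<circ> s) (t \<circ> id) (\<lambda>i. (i \<in> ?A) \<noteq> False)"
        by (rule Mcomp[OF MF[of ?A ?e ?n]], use M2 in \<open>simp_all only: id_comp comp_id simp_thms\<close>)
          (use X(2,3) permutes_id in auto)
      then have A1: "M ?n ?e s t (\<lambda>i. i \<in> ?A)" by (simp only: id_comp comp_id simp_thms)
      \<comment> \<open>Only flips at existing edges matter, so \<open>F\<close> may be replaced by
        a finite set of flips.\<close>
      have A2: "act1 s t (\<lambda>i. i \<in> ?A) X = act1 s t F X"
      proof -
        obtain n es f H g where XX: "X = (((n, es), f), (H, g))" by (metis prod.exhaust)
        have "act_edges s t (\<lambda>i. i \<in> ?A) es = act_edges s t F es"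
          by (rule nth_equalityI) (auto simp: XX)
        then show ?thesis by (simp add: XX)
      qed
      have A3: "or_sign c ?e s t (\<lambda>i. i \<in> ?A) = (or_sign c ?e s t F :: 'k)"
        unfolding or_sign_def by (intro arg_cong2[where f = "(*)"] refl prod.cong) auto
      show ?thesis using A1[unfolded M_def, rule_format, OF True refl refl] unfolding A2 A3 .
    qed
  qed
qed

lemma EQ1_iff_rel1:
  fixes \<Phi> :: "'k::field_char_0 efun"
  assumes supp: "\<And>X. \<Phi> X \<noteq> 0 \<Longrightarrow> fcGC_pair X"
  shows "(\<forall>r\<in>rel1 c. pr \<Phi> r = 0) \<longleftrightarrow> EQ1 c \<Phi>"
proof
  assume E: "EQ1 c \<Phi>"
  show "\<forall>r\<in>rel1 c. pr \<Phi> r = 0"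
  proof
    fix r :: "'k efun" assume "r \<in> rel1 c"
    then obtain X s t F where r: "fcGC_pair X" "s permutes {..<nv1 X}" "t permutes {..<ne1 X}"
      "r = bas X - scl (or_sign c (ne1 X) s t F) (bas (act1 s t F X))" by (rule rel1_cases)
    show "pr \<Phi> r = 0"
      unfolding r(4) pr_relation using EQ1D'[OF E fcGC_pair_wfp[OF r(1)] r(2,3), of F] by simp
  qed
next
  assume R: "\<forall>r\<in>rel1 c. pr \<Phi> r = 0"
  have K: "\<Phi> X = e * \<Phi> Y" if "bas X - scl e (bas Y) \<in> rel1 c" for X Y e
    using R[rule_format, OF that] unfolding pr_relation by simp
  show "EQ1 c \<Phi>"
  proof (rule EQ1_from_moves[of fcGC_pair])
    fix X assume X: "fcGC_pair X"
    obtain n es f H g where XX: "X = (((n, es), f), (H, g))" by (metis prod.exhaust)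
    note X' = X[unfolded XX]
    fix s assume "s permutes {..<nv1 X}"
    then show "\<Phi> X = vertex_sign c s * \<Phi> (act1 s id noflip X)"
      using X' unfolding XX act1.simps act_edges_relabel permute_list_id
      by (intro K) (auto simp: rel1_def)
  next
    fix X t assume X: "fcGC_pair X" and t: "t permutes {..<ne1 X}"
    obtain n es f H g where XX: "X = (((n, es), f), (H, g))" by (metis prod.exhaust)
    have t': "t permutes {..<length es}" using t by (simp add: XX)
    show "\<Phi> X = edge_sign c t * \<Phi> (act1 id t noflip X)"
      using X[unfolded XX] t' unfolding XX act1.simps act_edges_permute[OF t'] list.map_id
      by (intro K) (unfold rel1_def, blast)
  next
    fix X i assume X: "fcGC_pair X" and i: "i < ne1 X"
    obtain n es f H g where XX: "X = (((n, es), f), (H, g))" by (metis prod.exhaust)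
    have i': "i < length es" using i by (simp add: XX)
    show "\<Phi> X = flip_sign c * \<Phi> (act1 id id (\<lambda>j. j = i) X)"
      using X[unfolded XX] i' unfolding XX act1.simps act_edges_flip[OF i'] list.map_id permute_list_id
      by (intro K) (unfold rel1_def, blast)
  qed (use supp fcGC_pair_wfp fcGC_pair_act1 in blast)+
qed

lemma pr_swap: "pr \<Phi> (x \<circ> prod.swap) = pr (\<Phi> \<circ> prod.swap) x"
  unfolding pr_def
  by (rule sum.reindex_bij_witness[of _ prod.swap prod.swap]) auto

lemma FS_swap: "FS \<Phi> \<Longrightarrow> FS (\<Phi> \<circ> prod.swap)"
proof -
  assume "FS \<Phi>"
  then have "finite (prod.swap ` {X. \<Phi> X \<noteq> 0})" by (simp add: FS_def)
  moreover have "{X. (\<Phi> \<circ> prod.swap) X \<noteq> 0} \<subseteq> prod.swap ` {X. \<Phi> X \<noteq> 0}" by force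
  ultimately show ?thesis unfolding FS_def by (rule finite_subset[rotated])
qed

lemma connected_pair_swap: "connected_pair X \<Longrightarrow> connected_pair (prod.swap X)"
proof -
  assume C: "connected_pair X"
  obtain n es f m es' g where XX: "X = (((n, es), f), ((m, es'), g))"
    by (metis prod.exhaust)
  let ?R = "incidences X" and ?R' = "incidences (prod.swap X)"
  let ?p = "case_sum Inr Inl :: nat + nat \<Rightarrow> nat + nat"
  let ?V = "Inl ` {..<n} \<union> Inr ` {..<m} :: (nat + nat) set"
  have R: "(?p a, ?p b) \<in> ?R'" if "(a, b) \<in> ?R" for a b
    using that unfolding XX by (cases rule: incidences_cases) (auto simp: endpoint_def in_set_conv_nth, fastforce?)
  have pp: "?p (?p x) = x" for x by (cases x) auto
  have C': "\<forall>a\<in>?V. \<forall>b\<in>?V. (a, b) \<in> (?R \<union> ?R\<inverse>)\<^sup>*"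
    using C unfolding connected_pair_def Let_def XX fst_conv snd_conv .
  have "(?p a, ?p b) \<in> (?R' \<union> ?R'\<inverse>)\<^sup>*" if "(a, b) \<in> (?R \<union> ?R\<inverse>)\<^sup>*" for a b
    using that
  proof (induction rule: rtrancl_induct)
    case (step y z)
    then have "(?p y, ?p z) \<in> ?R' \<union> ?R'\<inverse>" using R by auto
    then show ?case using step(3) by (meson rtrancl.rtrancl_into_rtrancl)
  qed simp
  then have D: "(a, b) \<in> (?R' \<union> ?R'\<inverse>)\<^sup>*" if "?p a \<in> ?V" "?p b \<in> ?V" for a b
    using C' that pp by metis
  have V: "?p a \<in> ?V" if "a \<in> Inl ` {..<m} \<union> Inr ` {..<n}" for a using that by auto
  show ?thesis
    unfolding connected_pair_def Let_def using D V by (simp add: XX del: incidences.simps)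
qed

lemma fcGC_pair_swap [simp]: "fcGC_pair (prod.swap X) \<longleftrightarrow> fcGC_pair X"
  unfolding fcGC_pair_iff using connected_pair_swap[of X] connected_pair_swap[of "prod.swap X"]
  by auto

lemma EQ_iff_rel:
  fixes \<Phi> :: "'k::field_char_0 efun"
  assumes supp: "\<And>X. \<Phi> X \<noteq> 0 \<Longrightarrow> fcGC_pair X"
  shows "(\<forall>r\<in>fcGC_rel c d. pr \<Phi> r = 0) \<longleftrightarrow> EQ c d \<Phi>"
proof -
  have "(\<Phi> \<circ> prod.swap) X \<noteq> 0 \<Longrightarrow> fcGC_pair X" for X using supp[of "prod.swap X"] by simp
  then show ?thesis
    unfolding fcGC_rel_def EQ_def using EQ1_iff_rel1[of \<Phi> c, OF supp] EQ1_iff_rel1[of "\<Phi> \<circ> prod.swap" d]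
    by (auto simp: pr_swap ball_Un)
qed

lemma finite_wfp_esize: "finite {X. wfp X \<and> esize X = k}"
proof -
  obtain n e m e' where k: "k = ((n, e), (m, e'))" by (metis prod.exhaust)
  let ?L = "\<lambda>A e. {xs. set xs \<subseteq> A \<and> length xs = e}"
  have "{X. wfp X \<and> esize X = k} \<subseteq>
    (({n} \<times> ?L ({..<n} \<times> {..<n}) e) \<times> ?L {..<n} e') \<times> (({m} \<times> ?L ({..<m} \<times> {..<m}) e') \<times> ?L {..<m} e)"
    (is "_ \<subseteq> ?B")
  proof
    fix X assume X: "X \<in> {X. wfp X \<and> esize X = k}"
    obtain n' es f m' es' g where XX: "X = (((n', es), f), ((m', es'), g))"
      by (metis prod.exhaust)
    show "X \<in> ?B" using X unfolding XX k by auto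
  qed
  moreover have "finite ?B" by (intro finite_SigmaI finite_lists_length_eq) auto
  ultimately show ?thesis by (rule finite_subset)
qed

lemma esize_act1 [simp]: "esize (act1 s t F X) = esize X"
proof -
  obtain n es f m es' g where X: "X = (((n, es), f), ((m, es'), g))" by (metis prod.exhaust)
  show ?thesis by (simp add: X)
qed

lemma esize_swap: "esize (prod.swap X) = prod.swap (esize X)"
proof -
  obtain n es f m es' g where X: "X = (((n, es), f), ((m, es'), g))" by (metis prod.exhaust)
  show ?thesis by (simp add: X)
qed

lemma or_sign_pm: "or_sign c e s t F = (1 :: 'k) \<or> or_sign c e s t F = (- 1 :: 'k::field_char_0)"
  by (rule square_eq_1_iff[THEN iffD1, OF or_sign_sq])

lemma bas_swap: "bas X \<circ> prod.swap = bas (prod.swap X)"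
proof
  fix Y
  show "(bas X \<circ> prod.swap) Y = bas (prod.swap X) Y"
    by (cases X; cases Y) (auto simp: bas_def)
qed

lemma fcGC_rel_cases:
  assumes "r \<in> (fcGC_rel c d :: 'k::field_char_0 efun set)"
  shows "\<exists>X Y e. r = bas X - scl e (bas Y) \<and> (e = 1 \<or> e = -1) \<and>
      fcGC_pair X \<and> fcGC_pair Y \<and> esize X = esize Y"
proof -
  have R: "\<exists>X Y e. r = bas X - scl e (bas Y) \<and> (e = 1 \<or> e = -1) \<and>
      fcGC_pair X \<and> fcGC_pair Y \<and> esize X = esize Y" if "r \<in> rel1 c" for r :: "'k efun" and c
    using that
  proof (rule rel1_cases)
    fix X s t F assume X: "fcGC_pair X" "s permutes {..<nv1 X}" "t permutes {..<ne1 X}"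
      "r = bas X - scl (or_sign c (ne1 X) s t F) (bas (act1 s t F X))"
    show ?thesis
      by (rule exI[of _ X], rule exI[of _ "act1 s t F X"], rule exI[of _ "or_sign c (ne1 X) s t F"])
        (intro conjI X(1,4) or_sign_pm fcGC_pair_act1[OF X(1-3)] esize_act1[symmetric])
  qed
  from assms consider "r \<in> rel1 c" | r' where "r' \<in> rel1 d" "r = r' \<circ> prod.swap"
    unfolding fcGC_rel_def by blast
  then show ?thesis
  proof cases
    case 1 then show ?thesis by (rule R)
  next
    case 2
    obtain X Y e where X: "r' = bas X - scl e (bas Y)" "e = 1 \<or> e = -1" "fcGC_pair X" "fcGC_pair Y" "esize X = esize Y"
      using R[OF 2(1)] by blast
    have "r = bas (prod.swap X) - scl e (bas (prod.swap Y))"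
      unfolding 2(2) X(1) bas_swap[symmetric] by (auto simp: scl_def fun_eq_iff)
    then show ?thesis
      using X by (intro exI[of _ "prod.swap X"] exI[of _ "prod.swap Y"] exI[of _ e]) (simp add: esize_swap)
  qed
qed

lemma finite_fcGC_esize: "finite {X. fcGC_pair X \<and> esize X = k}"
  by (rule finite_subset[OF _ finite_wfp_esize[of k]]) (use fcGC_pair_wfp in auto)

text \<open>The dual of \<open>GC2\<close>: vanishing at pairs with a univalent vertex takes care of
  \<open>GC1\<close>, equivariance takes care of the relations.\<close>

definition Fun2 :: "int \<Rightarrow> int \<Rightarrow> 'k::field_char_0 efun set" where
  "Fun2 c d = {\<Phi>. FS \<Phi> \<and> (\<forall>X. \<Phi> X \<noteq> 0 \<longrightarrow> fcGC_pair X \<and> nonuniv X) \<and> EQ c d \<Phi>}"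

lemma crr_fcGC: "x \<in> crr (fcGC c d) p \<longleftrightarrow> (\<forall>X. x X \<noteq> 0 \<longrightarrow> fcGC_pair X \<and> edeg c d X = p)"
  by (simp add: fcGC_def Let_def)

lemma nul_fcGC_iff:
  fixes x :: "'k::field_char_0 efun"
  assumes "x \<in> crr (fcGC c d) p"
  shows "x \<in> nul (fcGC c d) p \<longleftrightarrow>
    (\<forall>\<Phi>. FS \<Phi> \<longrightarrow> (\<forall>X. \<Phi> X \<noteq> 0 \<longrightarrow> fcGC_pair X) \<longrightarrow> EQ c d \<Phi> \<longrightarrow> pr \<Phi> x = 0)"
proof -
  have x: "x X \<noteq> 0 \<Longrightarrow> fcGC_pair X" for X using assms by (simp add: crr_fcGC)
  have R: "\<exists>k. \<forall>X. r X \<noteq> 0 \<longrightarrow> fcGC_pair X \<and> esize X = k" if rr: "r \<in> fcGC_rel c d" for r :: "'k efun"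
  proof -
    obtain X Y e where "r = bas X - scl e (bas Y)" "fcGC_pair X" "fcGC_pair Y" "esize X = esize Y"
      using fcGC_rel_cases[OF rr] by blast
    then show ?thesis by (intro exI[of _ "esize X"]) (auto simp: bas_def scl_def split: if_splits)
  qed
  have "x \<in> nul (fcGC c d) p \<longleftrightarrow> (\<forall>k. (\<lambda>X. if esize X = k then x X else 0) \<in> spn (fcGC_rel c d))"
    using assms unfolding fcGC_def Let_def by simp
  also have "\<dots> \<longleftrightarrow> (\<forall>\<Phi>. FS \<Phi> \<longrightarrow> (\<forall>X. \<Phi> X \<noteq> 0 \<longrightarrow> fcGC_pair X) \<longrightarrow> (\<forall>r\<in>fcGC_rel c d. pr \<Phi> r = 0) \<longrightarrow> pr \<Phi> x = 0)"
    by (rule levels_in_span_iff[of "fcGC_rel c d" fcGC_pair esize x, OF R finite_fcGC_esize x])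
  also have "\<dots> \<longleftrightarrow> (\<forall>\<Phi>. FS \<Phi> \<longrightarrow> (\<forall>X. \<Phi> X \<noteq> 0 \<longrightarrow> fcGC_pair X) \<longrightarrow> EQ c d \<Phi> \<longrightarrow> pr \<Phi> x = 0)"
    using EQ_iff_rel[of _ c d, where 'k='k] by blast
  finally show ?thesis .
qed

lemma EQ1_restrict:
  assumes "EQ1 c \<Phi>" "\<And>X s t F. wfp X \<Longrightarrow> s permutes {..<nv1 X} \<Longrightarrow> t permutes {..<ne1 X} \<Longrightarrow>
      P (act1 s t F X) \<longleftrightarrow> P X"
  shows "EQ1 c (\<lambda>X. if P X then \<Phi> X else 0)"
  unfolding EQ1_def
proof (intro allI impI)
  fix X s t F assume X: "wfp X" "s permutes {..<nv1 X}" "t permutes {..<ne1 X}"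
  show "(if P (act1 s t F X) then \<Phi> (act1 s t F X) else 0) =
      or_sign c (ne1 X) s t F * (if P X then \<Phi> X else 0)"
    using EQ1D[OF assms(1) X, of F] assms(2)[OF X, of F] by simp
qed

lemma EQ_restrict:
  assumes "EQ c d \<Phi>" "\<And>X s t F. wfp X \<Longrightarrow> s permutes {..<nv1 X} \<Longrightarrow> t permutes {..<ne1 X} \<Longrightarrow>
      P (act1 s t F X) \<longleftrightarrow> P X" "\<And>X. P (prod.swap X) \<longleftrightarrow> P X"
  shows "EQ c d (\<lambda>X. if P X then \<Phi> X else 0)"
proof -
  have "(\<lambda>X. if P X then \<Phi> X else 0) \<circ> prod.swap = (\<lambda>X. if P X then (\<Phi> \<circ> prod.swap) X else 0)"
    using assms(3) by (auto simp: fun_eq_iff)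
  then show ?thesis
    using EQ1_restrict[of c \<Phi> P, OF _ assms(2)] EQ1_restrict[of d "\<Phi> \<circ> prod.swap" P, OF _ assms(2)]
      assms(1) unfolding EQ_def by simp
qed

text \<open>The group action only permutes valencies, so a functional may be set to 0 at the pairs
  with univalent vertices and stays equivariant. Accordingly the part of \<open>x\<close> on these
  pairs goes into \<open>GC1\<close>, and the rest is tested in \<open>fcGC\<close>.\<close>

lemma nul_GC2_iff:
  fixes x :: "'k::field_char_0 efun"
  assumes "x \<in> crr (GC2 c d) p"
  shows "x \<in> nul (GC2 c d) p \<longleftrightarrow> (\<forall>\<Phi>\<in>Fun2 c d. pr \<Phi> x = 0)"
proof
  assume "x \<in> nul (GC2 c d) p"
  then obtain a b where x: "x = a + b" "a \<in> nul (fcGC c d) p" "b \<in> GC1 c d p"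
    by (auto simp: GC2_def)
  show "\<forall>\<Phi>\<in>Fun2 c d. pr \<Phi> x = 0"
  proof
    fix \<Phi> :: "'k efun" assume P: "\<Phi> \<in> Fun2 c d"
    have "a \<in> crr (fcGC c d) p" using x(2) by (auto simp: fcGC_def Let_def)
    then have "pr \<Phi> a = 0" using x(2) nul_fcGC_iff P unfolding Fun2_def by blast
    moreover have "\<Phi> X * b X = 0" for X
      using x(3) P unfolding GC1_def Fun2_def nonuniv_def mem_Collect_eq by (cases "b X = 0") auto
    then have "pr \<Phi> b = 0" by (simp add: pr_def)
    ultimately show "pr \<Phi> x = 0" using P by (simp add: x(1) pr_add Fun2_def)
  qed
next
  assume N: "\<forall>\<Phi>\<in>Fun2 c d. pr \<Phi> x = 0"
  define a b where "a = (\<lambda>X. if nonuniv X then x X else 0)" and "b = (\<lambda>X. if nonuniv X then 0 else x X)"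
  have xc: "x \<in> crr (fcGC c d) p" using assms by (simp add: GC2_def)
  have "a + b = x" by (auto simp: a_def b_def fun_eq_iff)
  moreover have "b \<in> GC1 c d p" using xc unfolding GC1_def crr_fcGC by (auto simp: b_def nonuniv_def)
  moreover have ac: "a \<in> crr (fcGC c d) p" using xc unfolding crr_fcGC by (auto simp: a_def)
  moreover have "a \<in> nul (fcGC c d) p"
    unfolding nul_fcGC_iff[OF ac]
  proof (intro allI impI)
    fix \<Phi> :: "'k efun"
    assume P: "FS \<Phi>" "\<forall>X. \<Phi> X \<noteq> 0 \<longrightarrow> fcGC_pair X" "EQ c d \<Phi>"
    let ?\<Psi> = "\<lambda>X. if nonuniv X then \<Phi> X else 0"
    have "?\<Psi> \<in> Fun2 c d"
    proof -
      have "FS ?\<Psi>" by (rule FS_mono[OF P(1)]) (simp split: if_splits)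
      moreover have "EQ c d ?\<Psi>" by (rule EQ_restrict[OF P(3)]) (auto simp only: nonuniv_act1 nonuniv_swap)
      ultimately show ?thesis unfolding Fun2_def using P(2) by simp
    qed
    then have "pr ?\<Psi> x = 0" using N by blast
    moreover have "?\<Psi> X * x X = \<Phi> X * a X" for X by (simp add: a_def)
    ultimately show "pr \<Phi> a = 0" by (simp add: pr_def)
  qed
  ultimately show "x \<in> nul (GC2 c d) p" unfolding GC2_def by simp metis
qed

section \<open>The transpose of the differential\<close>

text \<open>The transpose of \<open>up1\<close> (\<open>pr_D1\<close>): a sum over the pairs that
  contract to \<open>X\<close>. The condition \<open>\<Psi> Y \<noteq> 0\<close> keeps the index set
  finite for \<Psi> of finite support.\<close>

definition D1 :: "'k::field_char_0 efun \<Rightarrow> 'k efun" where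
  "D1 \<Psi> X = (\<Sum>Y | \<Psi> Y \<noteq> 0 \<and> std1 Y \<and> contract1 Y = X. \<Psi> Y)"

definition D2 :: "'k::field_char_0 efun \<Rightarrow> 'k efun" where
  "D2 \<Psi> = D1 (\<Psi> \<circ> prod.swap) \<circ> prod.swap"

definition up1 :: "'k::field_char_0 efun \<Rightarrow> 'k efun" where
  "up1 x Y = (if std1 Y then x (contract1 Y) else 0)"

definition up2 :: "'k::field_char_0 efun \<Rightarrow> 'k efun" where
  "up2 x Y = (if std2 Y then x (contract2 Y) else 0)"

lemma up2_up1: "up2 x = up1 (x \<circ> prod.swap) \<circ> prod.swap"
  by (auto simp: up2_def up1_def fun_eq_iff)

lemma D1_supp:
  assumes "D1 \<Psi> X \<noteq> 0"
  obtains Y where "\<Psi> Y \<noteq> 0" "std1 Y" "contract1 Y = X"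
proof (rule ccontr)
  assume n: "\<not> thesis"
  note th = that
  have "{Y. \<Psi> Y \<noteq> 0 \<and> std1 Y \<and> contract1 Y = X} = {}" using n th by blast
  then have "D1 \<Psi> X = 0" unfolding D1_def by (simp only: sum.empty)
  with assms show False by simp
qed

lemma FS_D1: "FS \<Psi> \<Longrightarrow> FS (D1 \<Psi>)"
  unfolding FS_def
proof (rule finite_subset[of _ "contract1 ` {Y. \<Psi> Y \<noteq> 0}"])
  show "{X. D1 \<Psi> X \<noteq> 0} \<subseteq> contract1 ` {Y. \<Psi> Y \<noteq> 0}"
  proof
    fix X assume "X \<in> {X. D1 \<Psi> X \<noteq> 0}"
    then have "D1 \<Psi> X \<noteq> 0" by simp
    then show "X \<in> contract1 ` {Y. \<Psi> Y \<noteq> 0}" by (rule D1_supp) blast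
  qed
qed simp

lemma FS_D2: "FS \<Psi> \<Longrightarrow> FS (D2 \<Psi>)"
  unfolding D2_def by (intro FS_swap FS_D1)

lemma pr_D1:
  assumes "FS \<Psi>"
  shows "pr (D1 \<Psi>) x = pr \<Psi> (up1 x)"
proof -
  let ?A = "{Y. \<Psi> Y \<noteq> 0 \<and> std1 Y}"
  have A: "finite ?A" using assms unfolding FS_def by (rule finite_subset[rotated]) auto
  have "pr \<Psi> (up1 x) = (\<Sum>Y\<in>?A. \<Psi> Y * up1 x Y)"
    by (rule pr_sum[OF A]) (auto simp: up1_def split: if_splits)
  also have "\<dots> = (\<Sum>Y\<in>?A. \<Psi> Y * x (contract1 Y))" by (rule sum.cong) (auto simp: up1_def)
  also have "\<dots> = (\<Sum>X\<in>contract1 ` ?A. \<Sum>Y\<in>{Y. Y \<in> ?A \<and> contract1 Y = X}. \<Psi> Y * x (contract1 Y))"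
    by (rule sum.image_gen[OF A])
  also have "\<dots> = (\<Sum>X\<in>contract1 ` ?A. D1 \<Psi> X * x X)"
  proof (rule sum.cong[OF refl])
    fix X
    have "(\<Sum>Y\<in>{Y. Y \<in> ?A \<and> contract1 Y = X}. \<Psi> Y * x (contract1 Y)) =
        (\<Sum>Y\<in>{Y. \<Psi> Y \<noteq> 0 \<and> std1 Y \<and> contract1 Y = X}. \<Psi> Y * x X)"
      by (rule sum.cong) auto
    then show "(\<Sum>Y\<in>{Y. Y \<in> ?A \<and> contract1 Y = X}. \<Psi> Y * x (contract1 Y)) = D1 \<Psi> X * x X"
      unfolding D1_def by (simp only: sum_distrib_right)
  qed
  also have "\<dots> = pr (D1 \<Psi>) x"
  proof (rule pr_sum[symmetric])
    fix X assume "D1 \<Psi> X \<noteq> 0"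
    then show "X \<in> contract1 ` ?A" by (rule D1_supp) auto
  qed (use A in simp)
  finally show ?thesis ..
qed

lemma pr_D2:
  assumes "FS \<Psi>"
  shows "pr (D2 \<Psi>) x = pr \<Psi> (up2 x)"
proof -
  have "pr (D2 \<Psi>) x = pr (D1 (\<Psi> \<circ> prod.swap)) (x \<circ> prod.swap)"
    unfolding D2_def by (simp only: pr_swap)
  also have "\<dots> = pr (\<Psi> \<circ> prod.swap) (up1 (x \<circ> prod.swap))" by (rule pr_D1[OF FS_swap[OF assms]])
  also have "\<dots> = pr \<Psi> (up2 x)" unfolding up2_up1 by (simp only: pr_swap)
  finally show ?thesis .
qed

lemma lift_perm_id: "lift_perm id = id"
  by (auto simp: lift_perm_def fun_eq_iff split: nat.splits)

lemma inv_lift_perm: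
  assumes "s permutes {..<n}"
  shows "inv (lift_perm s) = lift_perm (inv s)"
  using permutes_inv_o[OF assms] by (intro inv_unique_comp) (simp_all only: lift_perm_comp[symmetric] lift_perm_id)

text \<open>A group element for \<open>X\<close> lifts to the pairs that contract to
  \<open>X\<close> by fixing the new vertex and the new edge. The lift permutes the fibres of
  \<open>contract1\<close> and has the same sign, so the sum can be reindexed.\<close>

lemma D1_EQ1:
  assumes E: "EQ1 c \<Psi>" and supp: "\<And>X. \<Psi> X \<noteq> 0 \<Longrightarrow> wfp X"
  shows "EQ1 c (D1 \<Psi>)"
  unfolding EQ1_def
proof (intro allI impI)
  fix X s t F assume X: "wfp X" and s: "s permutes {..<nv1 X}" and t: "t permutes {..<ne1 X}"
  let ?L = "act1 (lift_perm s) (lift_perm t) (lift_flip F)"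
  let ?L' = "act1 (lift_perm (inv s)) (lift_perm (inv t)) (lift_flip (\<lambda>i. F (inv t i)))"
  let ?A = "\<lambda>X. {Y. \<Psi> Y \<noteq> 0 \<and> std1 Y \<and> contract1 Y = X}"
  have F': "(\<lambda>i. lift_flip F (lift_perm (inv t) i)) = lift_flip (\<lambda>i. F (inv t i))"
    by (auto simp: fun_eq_iff lift_flip_def lift_perm_def split: nat.splits)
  have sz: "nv1 Y = Suc (nv1 X)" "ne1 Y = Suc (ne1 X)" "wfp Y" if "Y \<in> ?A X" for Y X
    using that sizes_contract1[of Y] supp[of Y] by auto
  have inv1: "?L' (?L Y) = Y" if "wfp Y" "nv1 Y = Suc (nv1 X)" "ne1 Y = Suc (ne1 X)" for Y
    using act1_inverse[OF that(1), of "lift_perm s" "lift_perm t" "lift_flip F"] that(2,3)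
      lift_perm_permutes[OF s] lift_perm_permutes[OF t] unfolding inv_lift_perm[OF s] inv_lift_perm[OF t] F'
    by simp
  have inv2: "?L (?L' Y) = Y" if "wfp Y" "nv1 Y = Suc (nv1 X)" "ne1 Y = Suc (ne1 X)" for Y
    using act1_inverse'[OF that(1), of "lift_perm s" "lift_perm t" "lift_flip F"] that(2,3)
      lift_perm_permutes[OF s] lift_perm_permutes[OF t] unfolding inv_lift_perm[OF s] inv_lift_perm[OF t] F'
    by simp
  have Lv: "\<Psi> (?L Y) = or_sign c (ne1 X) s t F * \<Psi> Y"
    if "wfp Y" "nv1 Y = Suc (nv1 X)" "ne1 Y = Suc (ne1 X)" for Y
    using EQ1D[OF E that(1), of "lift_perm s" "lift_perm t" "lift_flip F"] that(2,3)
      lift_perm_permutes[OF s] lift_perm_permutes[OF t] or_sign_lift[OF s t, of c F, where 'k='a]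
    by simp
  have nz: "or_sign c (ne1 X) s t F \<noteq> (0::'a)"
    using or_sign_sq[of c "ne1 X" s t F, where 'k='a] by auto
  have AX: "nv1 (act1 s t F X) = nv1 X" "ne1 (act1 s t F X) = ne1 X" by simp_all
  have "D1 \<Psi> (act1 s t F X) = (\<Sum>Y\<in>?A X. \<Psi> (?L Y))"
    unfolding D1_def
  proof (rule sum.reindex_bij_witness[of _ ?L ?L'])
    fix Z assume Z: "Z \<in> ?A (act1 s t F X)"
    note z = sz[OF Z, unfolded AX]
    show "?L (?L' Z) = Z" by (rule inv2[OF z(3,1,2)])
    then show "\<Psi> (?L (?L' Z)) = \<Psi> Z" by (simp only:)
    have "contract1 (?L' Z) = X" "std1 (?L' Z)"
      using contract1_act1_lift[of Z "inv t" "inv s" "\<lambda>i. F (inv t i)"] Z z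
        act1_inverse[OF X s t, of F] permutes_inv[OF t] by simp_all
    moreover have "\<Psi> (?L' Z) \<noteq> 0"
    proof -
      have "wfp (?L' Z)" using wfp_act1[OF z(3)] z lift_perm_permutes[OF permutes_inv[OF s]]
          lift_perm_permutes[OF permutes_inv[OF t]] by simp
      then have "\<Psi> (?L (?L' Z)) = or_sign c (ne1 X) s t F * \<Psi> (?L' Z)"
        using Lv[of "?L' Z"] z by simp
      then show ?thesis using Z unfolding inv2[OF z(3,1,2)] by auto
    qed
    ultimately show "?L' Z \<in> ?A X" by simp
  next
    fix Y assume Y: "Y \<in> ?A X"
    note z = sz[OF Y]
    show "?L' (?L Y) = Y" by (rule inv1[OF z(3,1,2)])
    show "?L Y \<in> ?A (act1 s t F X)"
      using contract1_act1_lift[of Y t s F] Y z t Lv[OF z(3,1,2)] nz by simp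
  qed
  also have "\<dots> = (\<Sum>Y\<in>?A X. or_sign c (ne1 X) s t F * \<Psi> Y)"
    by (rule sum.cong[OF refl], rule Lv) (use sz in blast)+
  also have "\<dots> = or_sign c (ne1 X) s t F * D1 \<Psi> X"
    unfolding D1_def by (simp only: sum_distrib_left)
  finally show "D1 \<Psi> (act1 s t F X) = or_sign c (ne1 X) s t F * D1 \<Psi> X" .
qed

abbreviation act2 :: "(nat \<Rightarrow> nat) \<Rightarrow> (nat \<Rightarrow> nat) \<Rightarrow> (nat \<Rightarrow> bool) \<Rightarrow> egraph \<Rightarrow> egraph" where
  "act2 s t F X \<equiv> prod.swap (act1 s t F (prod.swap X))"

lemma contract1_act2:
  assumes "wfp X" "t permutes {..<ne2 X}"
  shows "contract1 (act2 s t F X) = act2 s t F (contract1 X)" "std1 (act2 s t F X) \<longleftrightarrow> std1 X"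
proof -
  obtain n es f m es' g where X: "X = (((n, es), f), ((m, es'), g))" by (metis prod.exhaust)
  show "contract1 (act2 s t F X) = act2 s t F (contract1 X)" "std1 (act2 s t F X) \<longleftrightarrow> std1 X"
    using assms by (simp_all add: X permute_list_map map_tl)
qed

text \<open>The group of the second graph commutes with contraction in the first one, so here a
  group element acts on the fibres as it is.\<close>

lemma D1_EQ2:
  assumes E: "EQ1 d (\<Psi> \<circ> prod.swap)" and supp: "\<And>X. \<Psi> X \<noteq> 0 \<Longrightarrow> wfp X"
  shows "EQ1 d (D1 \<Psi> \<circ> prod.swap)"
  unfolding EQ1_def
proof (intro allI impI)
  fix X' s t F assume X: "wfp X'" and s: "s permutes {..<nv1 X'}" and t: "t permutes {..<ne1 X'}"
  define X where "X = prod.swap X'"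
  have X': "X' = prod.swap X" by (simp add: X_def)
  let ?L = "act2 s t F" and ?L' = "act2 (inv s) (inv t) (\<lambda>i. F (inv t i))"
  let ?A = "\<lambda>X. {Y. \<Psi> Y \<noteq> 0 \<and> std1 Y \<and> contract1 Y = X}"
  have sz: "fst (snd Y) = fst (snd X)" "wfp Y" if "Y \<in> ?A X" for X Y
    using that supp snd_contract1[of Y] by auto
  have nz: "or_sign d (ne1 X') s t F \<noteq> (0::'a)"
    using or_sign_sq[of d "ne1 X'" s t F, where 'k='a] by auto
  have nv: "nv2 X = nv1 X'" "ne2 X = ne1 X'" by (simp_all add: X_def)
  let ?h = "\<lambda>Y. nv2 Y = nv1 X' \<and> ne2 Y = ne1 X'"
  have perm: "s permutes {..<nv1 (prod.swap Y)}" "t permutes {..<ne1 (prod.swap Y)}" if "?h Y" for Y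
    using s t that by simp_all
  have inv1: "?L' (?L Y) = Y" if "wfp Y" "?h Y" for Y
    using act1_inverse[of "prod.swap Y" s t F] that(1) perm[OF that(2)] by simp
  have inv2: "?L (?L' Y) = Y" if "wfp Y" "?h Y" for Y
    using act1_inverse'[of "prod.swap Y" s t F] that(1) perm[OF that(2)] by simp
  have Lv: "\<Psi> (?L Y) = or_sign d (ne1 X') s t F * \<Psi> Y" if "wfp Y" "?h Y" for Y
    using EQ1D[OF E, of "prod.swap Y" s t F] that perm[OF that(2)] by simp
  have hA: "?h Y \<and> wfp Y" if "Y \<in> ?A X" for Y
    using sz[OF that] nv by simp
  have hA2: "?h Y \<and> wfp Y" if "Y \<in> ?A (?L X)" for Y
    using sz[OF that] nv by simp
  have "D1 \<Psi> (?L X) = (\<Sum>Y\<in>?A X. \<Psi> (?L Y))"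
    unfolding D1_def
  proof (rule sum.reindex_bij_witness[of _ ?L ?L'])
    fix Z assume Z: "Z \<in> ?A (?L X)"
    have z: "wfp Z" "?h Z" using hA2[OF Z] by auto
    show "?L (?L' Z) = Z" by (rule inv2[OF z])
    then show "\<Psi> (?L (?L' Z)) = \<Psi> Z" by (simp only:)
    have t': "inv t permutes {..<ne2 Z}" using permutes_inv[OF t] z by simp
    have "contract1 (?L' Z) = X" "std1 (?L' Z)"
      using contract1_act2[OF z(1) t', of "inv s" "\<lambda>i. F (inv t i)"] Z inv1[of X] X nv
      by (simp_all add: X_def)
    moreover have "\<Psi> (?L' Z) \<noteq> 0"
    proof -
      have "wfp (?L' Z)" using wfp_act1[of "prod.swap Z" "inv s" "inv t"] z permutes_inv[OF s] permutes_inv[OF t] by simp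
      then have "\<Psi> (?L (?L' Z)) = or_sign d (ne1 X') s t F * \<Psi> (?L' Z)"
        using Lv[of "?L' Z"] z by simp
      then show ?thesis using Z unfolding inv2[OF z] by auto
    qed
    ultimately show "?L' Z \<in> ?A X" by simp
  next
    fix Y assume Y: "Y \<in> ?A X"
    have z: "wfp Y" "?h Y" using hA[OF Y] by auto
    show "?L' (?L Y) = Y" by (rule inv1[OF z])
    have t': "t permutes {..<ne2 Y}" using t z by simp
    show "?L Y \<in> ?A (?L X)"
      using contract1_act2[OF z(1) t', of s F] Y Lv[OF z] nz by simp
  qed
  also have "\<dots> = (\<Sum>Y\<in>?A X. or_sign d (ne1 X') s t F * \<Psi> Y)"
    by (rule sum.cong[OF refl], rule Lv) (use hA in blast)+
  also have "\<dots> = or_sign d (ne1 X') s t F * D1 \<Psi> X"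
    unfolding D1_def by (simp only: sum_distrib_left)
  finally show "(D1 \<Psi> \<circ> prod.swap) (act1 s t F X') = or_sign d (ne1 X') s t F * (D1 \<Psi> \<circ> prod.swap) X'"
    by (simp add: X_def)
qed

lemma D1_EQ: "EQ c d \<Psi> \<Longrightarrow> (\<And>X. \<Psi> X \<noteq> 0 \<Longrightarrow> wfp X) \<Longrightarrow> EQ c d (D1 \<Psi>)"
  using D1_EQ1[of c \<Psi>] D1_EQ2[of d \<Psi>] unfolding EQ_def by blast

lemma D2_EQ: "EQ c d \<Psi> \<Longrightarrow> (\<And>X. \<Psi> X \<noteq> 0 \<Longrightarrow> wfp X) \<Longrightarrow> EQ c d (D2 \<Psi>)"
proof -
  assume E: "EQ c d \<Psi>" and s: "\<And>X. \<Psi> X \<noteq> 0 \<Longrightarrow> wfp X"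
  have "EQ d c (D1 (\<Psi> \<circ> prod.swap))"
    using s wfp_swap by (intro D1_EQ EQ_swap[OF E]) (metis comp_apply)
  then show ?thesis unfolding D2_def by (rule EQ_swap)
qed

lemma valency_contract:
  assumes "set es \<subseteq> {..<Suc n} \<times> {..<Suc n}" "u < n"
  shows "valency (n, map (map_prod (merge u) (merge u)) es) v =
     (if v = u then valency (Suc n, es) 0 + valency (Suc n, es) (Suc u) else valency (Suc n, es) (Suc v))"
proof -
  have "of_bool (merge u x = v) = (if v = u then of_bool (x = 0) + of_bool (x = Suc u) else of_bool (x = Suc v) :: nat)" for x
    by (cases x) auto
  then show ?thesis unfolding valency_sum by (simp add: sum.distrib)
qed

lemma valency_Cons:
  "valency (n, (a, b) # es) u = of_bool (a = u) + of_bool (b = u) + valency (n', es) u"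
  unfolding valency_sum snd_conv by (simp add: sum.lessThan_Suc_shift del: sum.lessThan_Suc)

text \<open>Each end of the first edge carries a further half-edge, as it is not univalent. The
  merged vertex inherits both of these and has valency at least 2; the other valencies do not
  change.\<close>

lemma nonuniv_contract1:
  assumes "wfp Y" "std1 Y" "nonuniv Y"
  shows "nonuniv (contract1 Y)"
proof -
  obtain n u es f m es' g w where Y: "Y = (((Suc n, (0, Suc u) # es), f), ((m, es'), w # g))"
    "u < n" "w < m"
    "contract1 Y = (((n, map (map_prod (merge u) (merge u)) es), map (merge u) f), ((m, es'), g))"
    by (rule std1_cases[OF assms(2,1)])
  have es: "set es \<subseteq> {..<Suc n} \<times> {..<Suc n}" using assms(1) by (simp add: Y(1))
  have nu: "valency (Suc n, (0, Suc u) # es) v \<noteq> 1" if "v < Suc n" for v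
    using assms(3) that unfolding nonuniv_def has_univalent_def Y(1) by auto
  have "valency (n, map (map_prod (merge u) (merge u)) es) v \<noteq> 1" if "v < n" for v
    using nu[of 0] nu[of "Suc u"] nu[of "Suc v"] that Y(2)
    unfolding valency_contract[OF es Y(2)] valency_Cons[of _ _ _ _ _ "Suc n"] by auto
  then show ?thesis using assms(3) unfolding Y(4) unfolding Y(1) nonuniv_def has_univalent_def by simp
qed

lemma up_commute: "up1 (up2 x) Z = up2 (up1 x) Z"
proof -
  obtain n es f m es' g where Z: "Z = (((n, es), f), ((m, es'), g))" by (metis prod.exhaust)
  show ?thesis by (simp add: up1_def up2_def Z map_tl)
qed

text \<open>
  Two successive contractions can be done in either order. Exchanging the two contracted edges and
  moving the vertices back to standard position is an odd group element.
\<close>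

definition exch :: "egraph \<Rightarrow> egraph" where
  "exch Z = (let es = snd (fst (fst Z)) in
     act1 (if snd (es ! 0) = 1 \<and> fst (es ! 1) = 0 then tsp 1 (snd (es ! 1))
           else tsp 0 1) (tsp 0 1) noflip Z)"

lemma act_edges_exch:
  "act_edges r (tsp 0 1) noflip (a # b # es) =
     map_prod r r b # map_prod r r a # map (map_prod r r) es"
proof (rule nth_equalityI)
  fix i assume "i < length (act_edges r (tsp 0 1) noflip (a # b # es))"
  then have "i < Suc (Suc (length es))" by simp
  then show "act_edges r (tsp 0 1) noflip (a # b # es) ! i =
      (map_prod r r b # map_prod r r a # map (map_prod r r) es) ! i"
    by (cases i; cases "i - 1") (auto simp: Transposition.transpose_def)
qed simp

lemma permute_list_exch:
  "permute_list (tsp 0 1) (a # b # g) = b # a # g"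
proof (rule nth_equalityI)
  fix i assume "i < length (permute_list (tsp 0 1) (a # b # g))"
  then have "i < Suc (Suc (length g))" by simp
  then show "permute_list (tsp 0 1) (a # b # g) ! i = (b # a # g) ! i"
    by (cases i; cases "i - 1") (auto simp: Transposition.transpose_def permute_list_def simp del: upt_Suc)
qed simp

lemma merge_merge_0:
  "merge q (merge 0 (tsp 1 (Suc (Suc q)) x)) = merge q (merge 0 x)"
  by (cases x; cases "x - 1") (auto simp: Transposition.transpose_def merge_def split: nat.splits)

lemma merge_merge_1:
  assumes "merge u q = Suc v"
  defines "r \<equiv> tsp 0 1" and "w \<equiv> (if q = 0 then 0 else q - 1)"
  shows "r q = Suc w" "merge w (r (Suc u)) = Suc (merge w (r (Suc u)) - 1)" "merge w 1 = 0"
    "merge (merge w (r (Suc u)) - 1) (merge w (r x)) = merge v (merge u x)"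
    "(if r (Suc u) = 0 then 0 else r (Suc u) - 1) = u"
  using assms(1) unfolding r_def w_def
  by (cases x; cases "x - 1"; cases u; cases q; cases "q - 1";
      auto simp: Transposition.transpose_def merge_def split: nat.splits if_splits)+

lemma exch_properties:
  assumes Z: "wfp Z" "std1 Z" "std1 (contract1 Z)"
  shows "wfp (exch Z)" "std1 (exch Z)" "std1 (contract1 (exch Z))"
    "contract1 (contract1 (exch Z)) = contract1 (contract1 Z)" "exch (exch Z) = Z"
    "EQ1 c \<Psi> \<Longrightarrow> \<Psi> (exch Z) = - (\<Psi> Z :: 'k::field_char_0)"
proof -
  obtain n u es0 f m es' g0 w1 where Z0: "Z = (((Suc n, (0, Suc u) # es0), f), ((m, es'), w1 # g0))"
    "u < n" "w1 < m"
    "contract1 Z = (((n, map (map_prod (merge u) (merge u)) es0), map (merge u) f), ((m, es'), g0))"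
    by (rule std1_cases[OF Z(2,1)])
  obtain p q es where es0: "es0 = (p, q) # es" using Z(3) unfolding Z0(4) by (cases es0) auto
  obtain w2 g where g0: "g0 = w2 # g" using Z(1) unfolding Z0(1) es0 by (cases g0) auto
  note Z1 = Z0(1)[unfolded es0 g0]
  obtain v where pq: "merge u p = 0" "merge u q = Suc v"
    using Z(3) unfolding Z0(4) es0 by auto
  have qn: "q < Suc n" "p < Suc n" using Z(1) unfolding Z1 by auto
  define r where "r = (if Suc u = 1 \<and> p = 0 then tsp 1 q else tsp 0 (1::nat))"
  let ?t = "tsp 0 (1::nat)"
  have ex: "exch Z = act1 r ?t noflip Z" by (simp add: exch_def Z1 r_def)
  have ex': "exch Z = (((Suc n, (r p, r q) # (r 0, r (Suc u)) # map (map_prod r r) es), map r f), ((m, es'), w2 # w1 # g))"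
    unfolding ex unfolding Z1 act1.simps act_edges_exch permute_list_exch by simp
  have r: "r permutes {..<nv1 Z}" unfolding r_def Z1 using qn Z0(2) by (auto intro!: permutes_swap_id)
  have t: "?t permutes {..<ne1 Z}" unfolding Z1 by (auto intro!: permutes_swap_id)
  show w: "wfp (exch Z)" unfolding ex by (rule wfp_act1[OF Z(1) r t])
  have rr: "r \<circ> r = id" "?t \<circ> ?t = id" by (simp_all add: r_def)
  have q1: "q \<noteq> 1" if "u = 0" using pq(2) that by auto
  \<comment> \<open>After the contraction the second edge must start at 0. Either it starts at 1,
    and exchanging 0 and 1 makes it start at 0, or both edges start at 0 and the first one ends at
    1; then their other ends are exchanged instead.\<close>
  have C: "std1 (exch Z) \<and> std1 (contract1 (exch Z)) \<and>
    contract1 (contract1 (exch Z)) = contract1 (contract1 Z) \<and> exch (exch Z) = act1 r ?t noflip (exch Z)"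
  proof (cases "u = 0 \<and> p = 0")
    case True
    then have q: "q = Suc (Suc v)" using pq by (cases q) auto
    have rv: "r = tsp 1 q" using True by (simp add: r_def)
    have rs: "r p = 0" "r q = 1" "r 0 = 0" "r (Suc u) = q" using True q by (simp_all add: rv Transposition.transpose_def)
    have mm: "merge v (merge 0 (r x)) = merge v (merge 0 x)" for x
      using merge_merge_0[of v x] by (simp add: rv q)
    show ?thesis
      unfolding ex' rs using True pq q mm
      by (simp add: Z1 exch_def map_prod_def split_def comp_def rv)
  next
    case False
    have p: "p = 1" using pq(1) False by (cases p; cases "p - 1") auto
    have rv: "r = ?t" using False by (auto simp: r_def)
    define w where "w = (if q = 0 then 0 else q - 1)"
    have M: "r q = Suc w" "merge w (r (Suc u)) = Suc (merge w (r (Suc u)) - 1)" "merge w 1 = 0"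
      "\<And>x. merge (merge w (r (Suc u)) - 1) (merge w (r x)) = merge v (merge u x)"
      using merge_merge_1[OF pq(2)] unfolding rv w_def by blast+
    have rs: "r p = 0" "r 0 = 1" using p by (simp_all add: rv)
    define a where "a = merge w (r (Suc u)) - 1"
    have Ma: "merge w (r (Suc u)) = Suc a" "\<And>x. merge a (merge w (r x)) = merge v (merge u x)"
      using M(2,4) unfolding a_def by blast+
    have s1: "std1 (exch Z)" unfolding ex' rs M(1) by simp
    have c1: "contract1 (exch Z) = (((n, (0, Suc a) # map (map_prod (merge w) (merge w)) (map (map_prod r r) es)),
        map (merge w) (map r f)), ((m, es'), w1 # g))"
      unfolding ex' rs M(1) using Ma(1) M(3) by simp
    have "contract1 (contract1 (exch Z)) = contract1 (contract1 Z)"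
      unfolding c1 Z0(4) es0 g0 using pq Ma(2) by (simp add: map_prod_def split_def comp_def)
    moreover have "exch (exch Z) = act1 r ?t noflip (exch Z)"
      unfolding exch_def[of "exch Z"] unfolding ex' rs by (simp add: rv)
    ultimately show ?thesis using s1 c1 by simp
  qed
  then show "std1 (exch Z)" "std1 (contract1 (exch Z))"
    "contract1 (contract1 (exch Z)) = contract1 (contract1 Z)" by auto
  have "act1 r ?t noflip (exch Z) = act1 (r \<circ> r) (?t \<circ> ?t) (\<lambda>i. False \<noteq> False) Z"
    unfolding ex by (rule act1_act1[OF Z(1) t])
  also have "\<dots> = Z" unfolding rr by (simp only: simp_thms act1_id)
  finally show "exch (exch Z) = Z" using C by simp
  assume E: "EQ1 c \<Psi>"
  \<comment> \<open>One transposition of vertices and one of edges: the parity of \<open>c\<close>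
    decides which of the two counts, and the sign is -1 in either case.\<close>
  have "or_sign c (ne1 Z) r ?t noflip = (- 1 :: 'k)"
    using q1 unfolding r_def by (auto simp: or_sign_def vertex_sign_def edge_sign_def sign_swap_id)
  then show "\<Psi> (exch Z) = - \<Psi> Z" using EQ1D[OF E Z(1) r t, of "\<lambda>_. False"] unfolding ex by simp
qed

text \<open>The involution \<open>exch\<close> preserves the double contraction and changes the sign
  of \<Psi>, so the pairing equals its own negative.\<close>

lemma pr_up1_up1:
  fixes \<Psi> :: "'k::field_char_0 efun"
  assumes E: "EQ1 c \<Psi>" and FS: "FS \<Psi>" and supp: "\<And>X. \<Psi> X \<noteq> 0 \<Longrightarrow> wfp X"
  shows "pr \<Psi> (up1 (up1 x)) = 0"
proof -
  let ?A = "{Z. \<Psi> Z \<noteq> 0 \<and> std1 Z \<and> std1 (contract1 Z)}"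
  let ?h = "\<lambda>Z. \<Psi> Z * x (contract1 (contract1 Z))"
  have A: "finite ?A" using FS unfolding FS_def by (rule finite_subset[rotated]) auto
  have "pr \<Psi> (up1 (up1 x)) = (\<Sum>Z\<in>?A. \<Psi> Z * up1 (up1 x) Z)"
    by (rule pr_sum[OF A]) (auto simp: up1_def split: if_splits)
  also have "\<dots> = (\<Sum>Z\<in>?A. ?h Z)" by (rule sum.cong) (auto simp: up1_def)
  finally have S: "pr \<Psi> (up1 (up1 x)) = (\<Sum>Z\<in>?A. ?h Z)" .
  have w: "wfp Z" "std1 Z" "std1 (contract1 Z)" if "Z \<in> ?A" for Z using that supp by auto
  have "(\<Sum>Z\<in>?A. ?h Z) = (\<Sum>Z\<in>?A. - ?h Z)"
  proof (rule sum.reindex_bij_witness[of _ exch exch])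
    fix Z assume Z: "Z \<in> ?A"
    note P = exch_properties[OF w[OF Z]]
    show "exch (exch Z) = Z" by (rule P(5))
    show "exch Z \<in> ?A" using P(2,3) P(6)[OF E] Z by simp
    show "- ?h (exch Z) = ?h Z" using P(4) P(6)[OF E] by simp
    show "exch (exch Z) = Z" by (rule P(5))
    show "exch Z \<in> ?A" using P(2,3) P(6)[OF E] Z by simp
  qed
  then have "2 * (\<Sum>Z\<in>?A. ?h Z) = 0" by (simp add: sum_negf)
  then show ?thesis unfolding S by (simp only: mult_eq_0_iff) simp
qed

lemma pr_up2_up2:
  fixes \<Psi> :: "'k::field_char_0 efun"
  assumes E: "EQ1 d (\<Psi> \<circ> prod.swap)" and FS: "FS \<Psi>" and supp: "\<And>X. \<Psi> X \<noteq> 0 \<Longrightarrow> wfp X"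
  shows "pr \<Psi> (up2 (up2 x)) = 0"
proof -
  have "(up1 (x \<circ> prod.swap) \<circ> prod.swap) \<circ> prod.swap = up1 (x \<circ> prod.swap)" by (simp add: comp_assoc)
  then have "up2 (up2 x) = up1 (up1 (x \<circ> prod.swap)) \<circ> prod.swap" unfolding up2_up1 by (simp only:)
  then have "pr \<Psi> (up2 (up2 x)) = pr (\<Psi> \<circ> prod.swap) (up1 (up1 (x \<circ> prod.swap)))" by (simp only: pr_swap)
  also have "\<dots> = 0"
  proof (rule pr_up1_up1[OF E FS_swap[OF FS]])
    fix X assume "(\<Psi> \<circ> prod.swap) X \<noteq> 0"
    then show "wfp X" using supp[of "prod.swap X"] by simp
  qed
  finally show ?thesis .
qed

section \<open>The complex of pairs\<close>

text \<open>The differential at well-formed pairs without univalent vertices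
  (\<open>dif_eq_bd\<close>). At other pairs it may differ from \<open>lin_ext (delta c)\<close>,
  but functionals in \<open>Fun2\<close> do not see these.\<close>

definition bd :: "int \<Rightarrow> 'k::field_char_0 efun \<Rightarrow> 'k efun" where
  "bd c x Y = (1 / 2) * up1 x Y + (1 / 2) * koszul (gdeg c (fst (fst Y))) * up2 x Y"

lemma pr_cong: "(\<And>X. \<Phi> X \<noteq> 0 \<Longrightarrow> x X = y X) \<Longrightarrow> pr \<Phi> x = pr \<Phi> y"
  unfolding pr_def by (rule sum.cong) auto

lemma pr_cong_left: "(\<And>X. x X \<noteq> 0 \<Longrightarrow> \<Phi> X = \<Psi> X) \<Longrightarrow> pr \<Phi> x = pr \<Psi> x"
  unfolding pr_def by (rule sum.cong) auto

lemma dif_GC2 [simp]: "dif (GC2 c d) = lin_ext (delta c)" "dif (fcGC c d) = lin_ext (delta c)"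
  by (simp_all add: GC2_def fcGC_def Let_def)

lemma crr_GC2 [simp]: "crr (GC2 c d) = crr (fcGC c d)"
  by (simp add: GC2_def)

lemma dif_eq_bd: "wfp Y \<Longrightarrow> nonuniv Y \<Longrightarrow> lin_ext (delta c) x Y = bd c x Y"
  using dif_fcGC_nonuniv[of Y c 0 x] by (simp add: bd_def up1_def up2_def)

lemma pr_dif:
  assumes "\<And>X. \<Phi> X \<noteq> 0 \<Longrightarrow> wfp X \<and> nonuniv X"
  shows "pr \<Phi> (lin_ext (delta c) x) = pr \<Phi> (bd c x)"
  by (rule pr_cong) (use assms dif_eq_bd in blast)

lemma pr_bd:
  assumes "FS \<Phi>"
  shows "pr \<Phi> (bd c x) = (1 / 2) * pr \<Phi> (up1 x) +
    (1 / 2) * pr (\<lambda>X. koszul (gdeg c (fst (fst X))) * \<Phi> X) (up2 x)"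
proof -
  have F: "FS (\<lambda>X. koszul (gdeg c (fst (fst X))) * \<Phi> X)"
    by (rule FS_mono[OF assms]) auto
  have k: "koszul a \<noteq> (0::'a)" for a by (simp add: koszul_def)
  have "pr \<Phi> (bd c x) = (\<Sum>X | \<Phi> X \<noteq> 0. (1 / 2) * (\<Phi> X * up1 x X)) +
      (\<Sum>X | \<Phi> X \<noteq> 0. (1 / 2) * (koszul (gdeg c (fst (fst X))) * \<Phi> X * up2 x X))"
    unfolding pr_left[OF assms] bd_def sum.distrib[symmetric]
    by (rule sum.cong) (auto simp: algebra_simps)
  then show ?thesis unfolding pr_left[OF F] pr_left[OF assms] sum_distrib_left using k by simp
qed

lemma gdeg_act1: "gdeg c (fst (fst (act1 s t F X))) = gdeg c (fst (fst X))"
  by (simp add: gdeg_def)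

lemma koszul_cases: "koszul a = (1 :: 'k::field_char_0) \<or> koszul a = (- 1 :: 'k)"
  by (simp add: koszul_def)

lemma koszul_Suc: "koszul (a + 1) = (- koszul a :: 'k::field_char_0)"
  by (simp add: koszul_def)

lemma koszul_sq [simp]: "koszul a * koszul a = (1 :: 'k::field_char_0)"
  by (simp add: koszul_def)

lemma EQ_koszul:
  assumes "EQ c d \<Phi>"
  shows "EQ c d (\<lambda>X. koszul (gdeg a (fst (fst X))) * \<Phi> X)"
proof -
  have "EQ1 c (\<lambda>X. koszul (gdeg a (fst (fst X))) * \<Phi> X)"
    unfolding EQ1_def
  proof (intro allI impI)
    fix X s t F assume X: "wfp X" "s permutes {..<nv1 X}" "t permutes {..<ne1 X}"
    show "koszul (gdeg a (fst (fst (act1 s t F X)))) * \<Phi> (act1 s t F X) =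
        or_sign c (ne1 X) s t F * (koszul (gdeg a (fst (fst X))) * \<Phi> X)"
      using EQ1D[of c \<Phi>, OF _ X, of F] assms unfolding EQ_def gdeg_act1 by (simp only: mult.left_commute)
  qed
  moreover have "EQ1 d ((\<lambda>X. koszul (gdeg a (fst (fst X))) * \<Phi> X) \<circ> prod.swap)"
    unfolding EQ1_def
  proof (intro allI impI)
    fix X s t F assume X: "wfp X" "s permutes {..<nv1 X}" "t permutes {..<ne1 X}"
    have "(\<Phi> \<circ> prod.swap) (act1 s t F X) = or_sign d (ne1 X) s t F * (\<Phi> \<circ> prod.swap) X"
      using EQ1D[of d "\<Phi> \<circ> prod.swap", OF _ X, of F] assms unfolding EQ_def by blast
    then show "((\<lambda>X. koszul (gdeg a (fst (fst X))) * \<Phi> X) \<circ> prod.swap) (act1 s t F X) =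
        or_sign d (ne1 X) s t F * ((\<lambda>X. koszul (gdeg a (fst (fst X))) * \<Phi> X) \<circ> prod.swap) X"
      by (simp add: mult.left_commute)
  qed
  ultimately show ?thesis unfolding EQ_def by blast
qed

lemma nonuniv_contract2:
  "wfp Y \<Longrightarrow> std2 Y \<Longrightarrow> nonuniv Y \<Longrightarrow> nonuniv (contract2 Y)"
  using nonuniv_contract1[of "prod.swap Y"] by simp

lemma wfp_contract2: "wfp Y \<Longrightarrow> std2 Y \<Longrightarrow> wfp (contract2 Y)"
  using wfp_contract1[of "prod.swap Y"] by simp

lemma Fun2D:
  assumes "\<Phi> \<in> Fun2 c d"
  shows "FS \<Phi>" "\<And>X. \<Phi> X \<noteq> 0 \<Longrightarrow> fcGC_pair X" "\<And>X. \<Phi> X \<noteq> 0 \<Longrightarrow> nonuniv X"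
    "\<And>X. \<Phi> X \<noteq> 0 \<Longrightarrow> wfp X" "EQ c d \<Phi>"
  using assms fcGC_pair_wfp unfolding Fun2_def by blast+

lemma restrict_fcGC_Fun2:
  assumes "FS \<Psi>" "EQ c d \<Psi>" "\<And>X. \<Psi> X \<noteq> 0 \<Longrightarrow> nonuniv X"
  shows "(\<lambda>X. if fcGC_pair X then \<Psi> X else 0) \<in> Fun2 c d"
proof -
  have "FS (\<lambda>X. if fcGC_pair X then \<Psi> X else 0)"
    by (rule FS_mono[OF assms(1)]) (simp split: if_splits)
  moreover have "EQ c d (\<lambda>X. if fcGC_pair X then \<Psi> X else 0)"
    by (rule EQ_restrict[OF assms(2)]) (simp_all only: fcGC_pair_act1_iff fcGC_pair_swap)
  ultimately show ?thesis unfolding Fun2_def using assms(3) by simp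
qed

lemma D1_Fun2_nonuniv:
  assumes "\<And>X. \<Phi> X \<noteq> 0 \<Longrightarrow> wfp X \<and> nonuniv X" "D1 \<Phi> X \<noteq> 0"
  shows "nonuniv X"
  using assms(2) by (rule D1_supp) (use assms(1) nonuniv_contract1 in blast)

text \<open>The differential is moved to the functional. The transposed functionals may be nonzero
  at pairs with \<open>m + n < 3\<close>, because contraction lowers the number of vertices; as
  \<open>x\<close> vanishes there, they may be cut down to \<open>fcGC_pair\<close>.\<close>

lemma Fun2_kills_bd:
  fixes x :: "'k::field_char_0 efun"
  assumes P: "\<Phi> \<in> Fun2 c d" and supp: "\<And>X. x X \<noteq> 0 \<Longrightarrow> fcGC_pair X"
    and N: "\<And>\<Psi>. \<Psi> \<in> Fun2 c d \<Longrightarrow> pr \<Psi> x = 0"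
  shows "pr \<Phi> (bd c x) = 0"
proof -
  have kill: "pr \<Psi> x = 0" if "FS \<Psi>" "EQ c d \<Psi>" "\<And>X. \<Psi> X \<noteq> 0 \<Longrightarrow> nonuniv X" for \<Psi>
  proof -
    have "pr \<Psi> x = pr (\<lambda>X. if fcGC_pair X then \<Psi> X else 0) x"
      by (rule pr_cong_left) (use supp in simp)
    then show ?thesis using N[OF restrict_fcGC_Fun2[OF that]] by simp
  qed
  have "pr (D1 \<Phi>) x = 0"
    using Fun2D[OF P] by (intro kill FS_D1 D1_EQ) (auto elim: D1_Fun2_nonuniv[rotated])
  let ?\<Phi> = "\<lambda>X. koszul (gdeg c (fst (fst X))) * \<Phi> X"
  have F: "FS ?\<Phi>" by (rule FS_mono[OF Fun2D(1)[OF P]]) auto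
  have sup2: "wfp X \<and> nonuniv X" if "?\<Phi> X \<noteq> 0" for X
    using Fun2D[OF P] that by simp
  have "pr (D2 ?\<Phi>) x = 0"
  proof (rule kill[OF FS_D2[OF F] D2_EQ[OF EQ_koszul[OF Fun2D(5)[OF P]]]])
    show "wfp X" if "?\<Phi> X \<noteq> 0" for X using sup2[OF that] by blast
    fix X assume "D2 ?\<Phi> X \<noteq> 0"
    then have "D1 (?\<Phi> \<circ> prod.swap) (prod.swap X) \<noteq> 0" by (simp add: D2_def)
    then have "nonuniv (prod.swap X)"
      using sup2 by (intro D1_Fun2_nonuniv[of "?\<Phi> \<circ> prod.swap"]) (metis comp_apply wfp_swap nonuniv_swap)+
    then show "nonuniv X" by simp
  qed
  with \<open>pr (D1 \<Phi>) x = 0\<close> show ?thesis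
    unfolding pr_bd[OF Fun2D(1)[OF P]] pr_D1[OF Fun2D(1)[OF P], symmetric] pr_D2[OF F, symmetric] by simp
qed

text \<open>Contracting an edge of the first graph lowers its degree by one and thereby changes the
  Koszul sign, so that the two mixed terms cancel.\<close>

lemma bd_bd:
  assumes "wfp Y"
  shows "bd c (bd c x) Y = (1 / 4) * up1 (up1 x) Y + (1 / 4) * up2 (up2 x) (Y :: egraph)"
proof -
  let ?k = "\<lambda>Y. koszul (gdeg c (fst (fst Y))) :: 'a"
  have 1: "up1 (bd c x) Y = (1 / 2) * up1 (up1 x) Y - (1 / 2) * ?k Y * up1 (up2 x) Y"
  proof (cases "std1 Y")
    case True
    have "gdeg c (fst (fst Y)) = gdeg c (fst (fst (contract1 Y))) + 1"
      using sizes_contract1[OF True assms] by (simp add: gdeg_def algebra_simps)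
    then have "?k (contract1 Y) = - ?k Y" by (simp add: koszul_Suc)
    then show ?thesis using True by (simp add: up1_def[of "bd c x"] bd_def up1_def[of "up1 x"] up1_def[of "up2 x"])
  qed (simp add: up1_def)
  have 2: "up2 (bd c x) Y = (1 / 2) * up2 (up1 x) Y + (1 / 2) * ?k Y * up2 (up2 x) Y"
    by (simp add: up2_def[of "bd c x"] bd_def up2_def[of "up1 x"] up2_def[of "up2 x"])
  have "bd c (bd c x) Y = (1 / 2) * up1 (bd c x) Y + (1 / 2) * ?k Y * up2 (bd c x) Y"
    unfolding bd_def[of c "bd c x"] ..
  also have "\<dots> = (1 / 4) * up1 (up1 x) Y + (1 / 4) * (?k Y * ?k Y) * up2 (up2 x) Y"
    unfolding 1 2 up_commute[symmetric] by (simp add: algebra_simps)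
  finally show ?thesis by simp
qed

lemma Fun2_bd_bd:
  assumes P: "\<Phi> \<in> Fun2 c d"
  shows "pr \<Phi> (bd c (bd c x)) = (0 :: 'k::field_char_0)"
proof -
  have F: "FS \<Phi>" "EQ1 c \<Phi>" "EQ1 d (\<Phi> \<circ> prod.swap)" using Fun2D[OF P] unfolding EQ_def by blast+
  have w: "wfp X" if "\<Phi> X \<noteq> 0" for X using Fun2D(4)[OF P that] .
  have "pr \<Phi> (bd c (bd c x)) = pr \<Phi> (scl (1 / 4) (up1 (up1 x)) + scl (1 / 4) (up2 (up2 x)))"
    by (rule pr_cong) (simp add: bd_bd w scl_def)
  also have "\<dots> = 0"
    using pr_up1_up1[OF F(2,1) w, of x] pr_up2_up2[OF F(3,1) w, of x]
    unfolding pr_add[OF F(1)] pr_scl by simp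
  finally show ?thesis .
qed

lemma linear_lin_ext: "Vector_Spaces.linear scl scl (lin_ext F :: ('a, 'k::field) series \<Rightarrow> ('b, 'k) series)"
proof -
  have A: "module_hom_axioms scl scl (lin_ext F :: ('a, 'k) series \<Rightarrow> ('b, 'k) series)"
    by unfold_locales (auto simp: lin_ext_def scl_def fun_eq_iff sum.distrib sum_distrib_left algebra_simps)
  then show ?thesis
    unfolding Vector_Spaces.linear_def module_hom_def
    by (intro conjI ser.vector_space_axioms ser.module_axioms A)
qed

lemma lin_ext_nonzero:
  assumes "lin_ext F x Y \<noteq> 0"
  obtains X where "x X \<noteq> 0" "F X Y \<noteq> 0"
proof (rule ccontr)
  assume n: "\<not> thesis"
  note th = that
  have A: "x X * F X Y = 0" for X using n th[of X] by auto
  have "lin_ext F x Y = 0" unfolding lin_ext_def by (rule sum.neutral) (use A in blast)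
  with assms show False by simp
qed

lemma delta1_support:
  assumes "delta1 X Y \<noteq> (0 :: 'k::field_char_0)" "fcGC_pair X"
  shows "fcGC_pair Y" "edeg c d Y = edeg c d X + 1"
proof -
  obtain A B where X: "X = (A, B)" by (cases X)
  obtain n es f where A: "A = ((n, es), f)" by (metis prod.exhaust)
  obtain m es' g where B: "B = ((m, es'), g)" by (metis prod.exhaust)
  obtain v w S T where Y: "v < fst (fst A)" "w < fst (fst B)" "S \<subseteq> half_edges (snd (fst A)) v"
    "T \<subseteq> hairs (snd A) v" "Y = (split_vertex v S T A, add_hair w B)"
    using delta1_nonzero[of A B Y] assms(1) unfolding X by metis
  have "Gra_pair Y" using split_connected_pair[OF _ Y(1-4)] assms(2) Y(5) unfolding fcGC_pair_def X by blast
  moreover have YY: "Y = (((Suc n, snd (split_edges v S (n, es))), split_hairs T f), ((m, es'), w # g))"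
    unfolding Y(5) A B split_vertex_def add_hair_def by (simp add: prod_eq_iff)
  ultimately show "fcGC_pair Y" using assms(2) unfolding fcGC_pair_def admissible_def X A B by simp
  show "edeg c d Y = edeg c d X + 1" unfolding YY X A B by (simp add: algebra_simps)
qed

lemma edeg_swap: "edeg c d (prod.swap X) = edeg d c X"
proof -
  obtain n es f m es' g where X: "X = (((n, es), f), ((m, es'), g))" by (metis prod.exhaust)
  show ?thesis by (simp add: X)
qed

lemma delta_support:
  assumes "delta c X Y \<noteq> (0 :: 'k::field_char_0)" "fcGC_pair X"
  shows "fcGC_pair Y \<and> edeg c d Y = edeg c d X + 1"
proof -
  have "delta1 X Y \<noteq> (0 :: 'k) \<or> delta1 (prod.swap X) (prod.swap Y) \<noteq> (0 :: 'k)"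
    using assms(1) unfolding delta_def delta2_def by (auto simp: scl_def)
  then show ?thesis
  proof
    assume "delta1 X Y \<noteq> (0 :: 'k)"
    then show ?thesis using delta1_support(1)[of X Y] delta1_support(2)[of X Y c d] assms(2) by blast
  next
    assume "delta1 (prod.swap X) (prod.swap Y) \<noteq> (0 :: 'k)"
    then have "fcGC_pair (prod.swap Y)" "edeg d c (prod.swap Y) = edeg d c (prod.swap X) + 1"
      using delta1_support(1)[of "prod.swap X" "prod.swap Y"]
        delta1_support(2)[of "prod.swap X" "prod.swap Y" d c] assms(2) fcGC_pair_swap[of X] by blast+
    then show ?thesis unfolding edeg_swap fcGC_pair_swap by blast
  qed
qed

lemma nul_GC2_subset: "nul (GC2 c d) p \<subseteq> crr (fcGC c d) p"
proof
  fix x :: "(egraph, 'a) series" assume "x \<in> nul (GC2 c d) p"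
  then obtain a b where x: "x = a + b" "a \<in> nul (fcGC c d) p" "b \<in> GC1 c d p"
    by (auto simp: GC2_def)
  have "a \<in> crr (fcGC c d) p" using x(2) by (auto simp: fcGC_def Let_def)
  moreover have "b \<in> crr (fcGC c d) p" using x(3) by (simp add: GC1_def)
  ultimately show "x \<in> crr (fcGC c d) p"
    unfolding crr_fcGC x(1) by (metis add.right_neutral plus_fun_apply)
qed

lemma nul_GC2_eq: "nul (GC2 c d) p = {x \<in> crr (fcGC c d) p. \<forall>\<Phi>\<in>Fun2 c d. pr \<Phi> x = (0 :: 'k::field_char_0)}"
  using nul_GC2_iff[of _ c d p, where 'k='k] nul_GC2_subset[of c d p, where 'a='k] by auto

lemma subspace_supp: "ser.subspace {x. \<forall>X. x X \<noteq> 0 \<longrightarrow> P X}"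
  unfolding ser.subspace_def by (auto simp: scl_def) (metis add.right_neutral)

lemma subspace_crr_fcGC: "ser.subspace (crr (fcGC c d) p)"
  using subspace_supp[of "\<lambda>X. fcGC_pair X \<and> edeg c d X = p"] by (simp add: fcGC_def Let_def)

lemma subspace_kill:
  assumes "ser.subspace C" "\<And>\<Phi>. \<Phi> \<in> K \<Longrightarrow> FS \<Phi>"
  shows "ser.subspace {x \<in> C. \<forall>\<Phi>\<in>K. pr \<Phi> x = 0}"
  using assms unfolding ser.subspace_def by (simp add: pr_add pr_scl)

lemma is_complex_GC2: "is_complex (GC2 c d :: (egraph, 'k::field_char_0) cpx)"
  unfolding is_complex_def
proof (intro conjI allI)
  show "Vector_Spaces.linear scl scl (dif (GC2 c d :: (egraph, 'k) cpx))"
    unfolding dif_GC2 by (rule linear_lin_ext)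
  fix p
  show "ser.subspace (crr (GC2 c d :: (egraph, 'k) cpx) p)" unfolding crr_GC2 by (rule subspace_crr_fcGC)
  show "ser.subspace (nul (GC2 c d :: (egraph, 'k) cpx) p)"
    unfolding nul_GC2_eq by (rule subspace_kill[OF subspace_crr_fcGC Fun2D(1)])
  show "nul (GC2 c d) p \<subseteq> crr (GC2 c d :: (egraph, 'k) cpx) p" unfolding crr_GC2 by (rule nul_GC2_subset)
  have C: "lin_ext (delta c) x \<in> crr (fcGC c d) (q + 1)" if "x \<in> crr (fcGC c d) q" for x :: "'k efun" and q
    unfolding crr_fcGC
  proof (intro allI impI)
    fix Y assume "lin_ext (delta c) x Y \<noteq> 0"
    then obtain X where "x X \<noteq> 0" "delta c X Y \<noteq> (0 :: 'k)" by (rule lin_ext_nonzero)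
    then show "fcGC_pair Y \<and> edeg c d Y = q + 1"
      using \<open>x \<in> crr (fcGC c d) q\<close> delta_support[of c X Y d] unfolding crr_fcGC by metis
  qed
  then show "dif (GC2 c d) ` crr (GC2 c d) p \<subseteq> crr (GC2 c d :: (egraph, 'k) cpx) (p + 1)"
    unfolding crr_GC2 dif_GC2 by blast
  have w: "wfp X \<and> nonuniv X" if "\<Phi> \<in> Fun2 c d" "\<Phi> X \<noteq> 0" for \<Phi> :: "'k efun" and X
    using Fun2D(3,4)[OF that] by blast
  show "dif (GC2 c d) ` nul (GC2 c d) p \<subseteq> nul (GC2 c d :: (egraph, 'k) cpx) (p + 1)"
    unfolding dif_GC2 nul_GC2_eq
  proof (intro image_subsetI CollectI conjI ballI)
    fix x \<Phi> :: "'k efun"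
    assume x: "x \<in> {x \<in> crr (fcGC c d) p. \<forall>\<Phi>\<in>Fun2 c d. pr \<Phi> x = 0}"
    then show "lin_ext (delta c) x \<in> crr (fcGC c d) (p + 1)" using C by blast
    assume P: "\<Phi> \<in> Fun2 c d"
    have "pr \<Phi> (bd c x) = 0"
      by (rule Fun2_kills_bd[OF P]) (use x in \<open>auto simp only: crr_fcGC mem_Collect_eq\<close>)
    then show "pr \<Phi> (lin_ext (delta c) x) = 0" using pr_dif[of \<Phi> c x] w[OF P] by simp
  qed
  show "\<forall>x\<in>crr (GC2 c d) p. dif (GC2 c d) (dif (GC2 c d) x) \<in> nul (GC2 c d :: (egraph, 'k) cpx) (p + 2)"
    unfolding dif_GC2 crr_GC2 nul_GC2_eq
  proof (intro ballI CollectI conjI)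
    fix x \<Phi> :: "'k efun"
    assume x: "x \<in> crr (fcGC c d) p"
    show "lin_ext (delta c) (lin_ext (delta c) x) \<in> crr (fcGC c d) (p + 2)"
      using C[OF C[OF x]] by (simp add: add.assoc)
    assume P: "\<Phi> \<in> Fun2 c d"
    have "pr \<Phi> (lin_ext (delta c) (lin_ext (delta c) x)) = pr \<Phi> (bd c (lin_ext (delta c) x))"
      by (rule pr_dif) (use w[OF P] in blast)
    \<comment> \<open>The outer \<open>bd\<close> evaluates the inner differential at contractions
      of \<open>Y\<close>, which again are well formed and without univalent vertices.\<close>
    also have "\<dots> = pr \<Phi> (bd c (bd c x))"
    proof (rule pr_cong)
      fix Y assume "\<Phi> Y \<noteq> 0"
      then have Y: "wfp Y" "nonuniv Y" using w[OF P] by auto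
      have "up1 (lin_ext (delta c) x) Y = up1 (bd c x) Y"
        using dif_eq_bd[of "contract1 Y" c x] wfp_contract1[of Y] nonuniv_contract1[of Y] Y by (simp add: up1_def)
      moreover have "up2 (lin_ext (delta c) x) Y = up2 (bd c x) Y"
        using dif_eq_bd[of "contract2 Y" c x] wfp_contract2[of Y] nonuniv_contract2[of Y] Y unfolding up2_def by presburger
      ultimately show "bd c (lin_ext (delta c) x) Y = bd c (bd c x) Y"
        unfolding bd_def[of c "lin_ext (delta c) x"] bd_def[of c "bd c x"] by (simp only:)
    qed
    also have "\<dots> = 0" by (rule Fun2_bd_bd[OF P])
    finally show "pr \<Phi> (lin_ext (delta c) (lin_ext (delta c) x)) = 0" .
  qed
qed

section \<open>Graphs as pairs with a trivial second graph\<close>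

text \<open>A single vertex carries the hairs of all edges of \<open>G\<close>, and \<open>G\<close>
  has no hairs. The group action, the contraction and the signs are those of \<open>G\<close>, so
  results on \<open>wfp\<close> pairs cover plain graphs. The pair may lie outside
  \<open>fcGC_pair\<close>.\<close>

definition jp :: "graph \<Rightarrow> egraph" where
  "jp G = ((G, []), ((1, []), replicate (length (snd G)) 0))"

definition lft :: "'k::field_char_0 gfun \<Rightarrow> 'k efun" where
  "lft \<phi> X = (if X = jp (fst (fst X)) then \<phi> (fst (fst X)) else 0)"

abbreviation gstd :: "graph \<Rightarrow> bool" where "gstd G \<equiv> std1 (jp G)"

definition gcontract :: "graph \<Rightarrow> graph" where "gcontract G = fst (fst (contract1 (jp G)))"

lemma fst_jp [simp]: "fst (fst (jp G)) = G"
  by (simp add: jp_def)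

lemma inj_jp: "inj jp"
  by (rule injI) (metis fst_jp)

lemma lft_jp [simp]: "lft \<phi> (jp G) = \<phi> G"
  by (simp add: lft_def)

lemma lft_nonzero: "lft \<phi> X \<noteq> 0 \<Longrightarrow> \<exists>G. X = jp G \<and> \<phi> G \<noteq> 0"
  by (auto simp: lft_def split: if_splits)

lemma wfp_jp: "wfp (jp G) \<longleftrightarrow> wf_graph G"
  by (cases G) (auto simp: jp_def wf_graph_def)

lemma contract1_jp: "contract1 (jp G) = jp (gcontract G)"
  by (cases G) (auto simp: jp_def gcontract_def)

lemma act1_jp:
  assumes "t permutes {..<length (snd G)}"
  shows "act1 s t F (jp G) = jp (fst G, act_edges s t F (snd G))"
proof -
  obtain n es where G: "G = (n, es)" by (cases G)
  have "permute_list t (replicate (length es) (0::nat)) = replicate (length es) 0"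
    using assms permutes_less[of t "length es"] by (intro nth_equalityI) (auto simp: permute_list_def G)
  then show ?thesis by (simp add: jp_def G)
qed

definition gEQ :: "int \<Rightarrow> 'k::field_char_0 gfun \<Rightarrow> bool" where
  "gEQ c \<phi> \<longleftrightarrow> (\<forall>G s t F. wf_graph G \<longrightarrow> s permutes {..<fst G} \<longrightarrow> t permutes {..<length (snd G)} \<longrightarrow>
     \<phi> (fst G, act_edges s t F (snd G)) = or_sign c (length (snd G)) s t F * \<phi> G)"

lemma act1_jp_iff:
  assumes X: "wfp X" "s permutes {..<nv1 X}" "t permutes {..<ne1 X}"
  shows "(\<exists>G. act1 s t F X = jp G) \<longleftrightarrow> (\<exists>G. X = jp G)"
proof
  assume "\<exists>G. X = jp G"
  then show "\<exists>G. act1 s t F X = jp G" using act1_jp X(3) by fastforce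
next
  assume "\<exists>G. act1 s t F X = jp G"
  then obtain G where G: "act1 s t F X = jp G" by blast
  have "inv t permutes {..<length (snd G)}"
    using permutes_inv[OF X(3)] sizes_act1(2)[of s t F X] unfolding G fst_jp by simp
  from act1_jp[OF this] show "\<exists>G. X = jp G" using act1_inverse[OF X, of F] unfolding G by metis
qed

lemma gEQ_iff_EQ1: "gEQ c \<phi> \<longleftrightarrow> EQ1 c (lft \<phi>)"
proof
  assume E: "gEQ c \<phi>"
  show "EQ1 c (lft \<phi>)"
    unfolding EQ1_def
  proof (intro allI impI)
    fix X s t F assume X: "wfp X" "s permutes {..<nv1 X}" "t permutes {..<ne1 X}"
    show "lft \<phi> (act1 s t F X) = or_sign c (ne1 X) s t F * lft \<phi> X"
    proof (cases "\<exists>G. X = jp G")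
      case True
      then obtain G where G: "X = jp G" by blast
      have "\<phi> (fst G, act_edges s t F (snd G)) = or_sign c (length (snd G)) s t F * \<phi> G"
        using E X unfolding gEQ_def G wfp_jp fst_jp by blast
      then show ?thesis using act1_jp[of t G s F] X(3) unfolding G fst_jp lft_jp by simp
    next
      case False
      then have "lft \<phi> X = 0" "lft \<phi> (act1 s t F X) = 0"
        using lft_nonzero[of \<phi>] act1_jp_iff[OF X, of F] by metis+
      then show ?thesis by simp
    qed
  qed
next
  assume E: "EQ1 c (lft \<phi>)"
  show "gEQ c \<phi>"
    unfolding gEQ_def
  proof (intro allI impI)
    fix G s t F assume G: "wf_graph G" "s permutes {..<fst G}" "t permutes {..<length (snd G)}"
    show "\<phi> (fst G, act_edges s t F (snd G)) = or_sign c (length (snd G)) s t F * \<phi> G"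
      using EQ1D[OF E, of "jp G" s t F] G act1_jp[OF G(3), of s F] wfp_jp by simp
  qed
qed

lemma pr_lft: "pr (lft \<phi>) z = pr \<phi> (z \<circ> jp)"
  unfolding pr_def
proof (rule sum.reindex_bij_witness[of _ jp "\<lambda>X. fst (fst X)"])
  fix X assume X: "X \<in> {X. lft \<phi> X * z X \<noteq> 0}"
  then obtain G where G: "X = jp G" using lft_nonzero[of \<phi> X] by auto
  show "jp (fst (fst X)) = X" "fst (fst X) \<in> {G. \<phi> G * (z \<circ> jp) G \<noteq> 0}"
    "\<phi> (fst (fst X)) * (z \<circ> jp) (fst (fst X)) = lft \<phi> X * z X"
    using X unfolding G by simp_all
qed auto

lemma FS_lft: "FS \<phi> \<Longrightarrow> FS (lft \<phi>)"
  unfolding FS_def by (rule finite_subset[of _ "jp ` {G. \<phi> G \<noteq> 0}"]) (use lft_nonzero in blast, simp)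

definition gup :: "'k::field_char_0 gfun \<Rightarrow> 'k gfun" where
  "gup x G = (if gstd G then x (gcontract G) else 0)"

definition gD :: "'k::field_char_0 gfun \<Rightarrow> 'k gfun" where
  "gD \<phi> = D1 (lft \<phi>) \<circ> jp"

lemma up1_fst_jp: "up1 (x \<circ> (\<lambda>X. fst (fst X))) \<circ> jp = gup x"
  by (simp add: up1_def gup_def fun_eq_iff contract1_jp)

text \<open>Pairs of the form \<open>jp G\<close> contract to pairs of this form, so the transpose
  does not leave them either.\<close>

lemma lft_gD: "lft (gD \<phi>) = D1 (lft \<phi>)"
proof
  fix X
  show "lft (gD \<phi>) X = D1 (lft \<phi>) X"
  proof (cases "\<exists>G. X = jp G")
    case True
    then show ?thesis by (auto simp: gD_def)
  next
    case False
    have "D1 (lft \<phi>) X = 0"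
    proof (rule ccontr)
      assume "D1 (lft \<phi>) X \<noteq> 0"
      then obtain Y where Y: "lft \<phi> Y \<noteq> 0" "contract1 Y = X" by (rule D1_supp)
      then show False using False lft_nonzero[of \<phi> Y] contract1_jp by metis
    qed
    then show ?thesis using False lft_nonzero[of "gD \<phi>" X] by metis
  qed
qed

lemma pr_gD:
  assumes "FS \<phi>"
  shows "pr (gD \<phi>) x = pr \<phi> (gup x)"
proof -
  have "(x \<circ> (\<lambda>X. fst (fst X))) \<circ> jp = x" by (simp add: fun_eq_iff)
  then have "pr (gD \<phi>) x = pr (lft (gD \<phi>)) (x \<circ> (\<lambda>X. fst (fst X)))" unfolding pr_lft by (simp only:)
  also have "\<dots> = pr (lft \<phi>) (up1 (x \<circ> (\<lambda>X. fst (fst X))))" unfolding lft_gD by (rule pr_D1[OF FS_lft[OF assms]])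
  also have "\<dots> = pr \<phi> (gup x)" unfolding pr_lft up1_fst_jp ..
  finally show ?thesis .
qed

lemma pr_gup_gup:
  assumes "gEQ c \<phi>" "FS \<phi>" "\<And>G. \<phi> G \<noteq> 0 \<Longrightarrow> wf_graph G"
  shows "pr \<phi> (gup (gup x)) = 0"
proof -
  have w: "wfp X" if "lft \<phi> X \<noteq> 0" for X using lft_nonzero[OF that] assms(3) wfp_jp by blast
  have "up1 (up1 (x \<circ> (\<lambda>X. fst (fst X)))) \<circ> jp = gup (gup x)"
    by (simp add: up1_def gup_def fun_eq_iff contract1_jp)
  then have "pr \<phi> (gup (gup x)) = pr (lft \<phi>) (up1 (up1 (x \<circ> (\<lambda>X. fst (fst X)))))"
    unfolding pr_lft by (simp only:)
  also have "\<dots> = 0" using assms gEQ_iff_EQ1 by (intro pr_up1_up1[OF _ FS_lft w]) auto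
  finally show ?thesis .
qed

lemma gEQ_gD:
  assumes "gEQ c \<phi>" "\<And>G. \<phi> G \<noteq> 0 \<Longrightarrow> wf_graph G"
  shows "gEQ c (gD \<phi>)"
  unfolding gEQ_iff_EQ1 lft_gD
  by (rule D1_EQ1) (use assms gEQ_iff_EQ1 lft_nonzero[of \<phi>] wfp_jp in blast)+

section \<open>The graph complex\<close>

lemma gstd_cases:
  assumes "gstd G" "wf_graph G"
  obtains n u es where "G = (Suc n, (0, Suc u) # es)" "u < n" "set es \<subseteq> {..<Suc n} \<times> {..<Suc n}"
    "gcontract G = (n, map (map_prod (merge u) (merge u)) es)"
proof -
  obtain n es0 where G: "G = (n, es0)" by (cases G)
  obtain u es where es0: "es0 = (0, Suc u) # es" using assms(1) by (cases es0) (auto simp: G jp_def)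
  show ?thesis
    using assms(2) by (intro that[of "n - 1" u es]) (auto simp: G es0 wf_graph_def gcontract_def jp_def)
qed

lemma connected_graph_contract:
  assumes u: "u < n" and es: "set es \<subseteq> {..<Suc n} \<times> {..<Suc n}"
  shows "connected_graph (n, map (map_prod (merge u) (merge u)) es) \<longleftrightarrow>
    connected_graph (Suc n, (0, Suc u) # es)"
proof -
  let ?p = "merge u"
  let ?R = "set (map (map_prod ?p ?p) es)" and ?R' = "set ((0, Suc u) # es)"
  show ?thesis
  proof
    assume C: "connected_graph (n, map (map_prod ?p ?p) es)"
    show "connected_graph (Suc n, (0, Suc u) # es)"
      unfolding connected_graph_def fst_conv snd_conv
    proof (intro allI impI)
      fix a b assume ab: "a < Suc n" "b < Suc n"
      show "(a, b) \<in> (?R' \<union> ?R'\<inverse>)\<^sup>*"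
      proof (rule connected_lift[where p = ?p and V' = "{..<Suc n}" and R = ?R])
        fix x y assume "(x, y) \<in> ?R"
        then obtain x' y' where "(x', y') \<in> set es" "x = ?p x'" "y = ?p y'" by auto
        moreover have "(x', y') \<in> (?R' \<union> ?R'\<inverse>)\<^sup>*" if "(x', y') \<in> set es" for x' y'
          using that by (intro r_into_sym) simp
        ultimately show "\<exists>a'\<in>{..<Suc n}. \<exists>b'\<in>{..<Suc n}. ?p a' = x \<and> ?p b' = y \<and> (a', b') \<in> (?R' \<union> ?R'\<inverse>)\<^sup>*"
          using es by blast
      next
        fix a b assume "?p a = ?p b"
        then show "(a, b) \<in> (?R' \<union> ?R'\<inverse>)\<^sup>*"
          using merge_fiber[of u a b] r_into_sym[of a b ?R'] by auto
      next
        show "(?p a, ?p b) \<in> (?R \<union> ?R\<inverse>)\<^sup>*"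
          using C merge_less[OF ab(1) u] merge_less[OF ab(2) u] unfolding connected_graph_def fst_conv snd_conv by blast
      qed (use ab in auto)
    qed
  next
    assume C: "connected_graph (Suc n, (0, Suc u) # es)"
    have step: "(?p x, ?p y) \<in> (?R \<union> ?R\<inverse>)\<^sup>*" if "(x, y) \<in> ?R' \<union> ?R'\<inverse>" for x y
    proof -
      from that consider "(x, y) \<in> set es \<or> (y, x) \<in> set es" | "?p x = ?p y" by auto
      then show ?thesis
      proof cases
        case 1
        then have "(?p x, ?p y) \<in> ?R \<union> ?R\<inverse>" by force
        then show ?thesis by (rule r_into_rtrancl)
      qed simp
    qed
    have img: "(?p x, ?p y) \<in> (?R \<union> ?R\<inverse>)\<^sup>*" if "(x, y) \<in> (?R' \<union> ?R'\<inverse>)\<^sup>*" for x y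
      using that
    proof (induction rule: rtrancl_induct)
      case (step y z)
      from step(3) \<open>\<And>x y. (x, y) \<in> ?R' \<union> ?R'\<inverse> \<Longrightarrow> (?p x, ?p y) \<in> (?R \<union> ?R\<inverse>)\<^sup>*\<close>[OF step(2)]
      show ?case by (rule rtrancl_trans)
    qed simp
    show "connected_graph (n, map (map_prod ?p ?p) es)"
      unfolding connected_graph_def fst_conv snd_conv
    proof (intro allI impI)
      fix a b assume ab: "a < n" "b < n"
      then have "(Suc a, Suc b) \<in> (?R' \<union> ?R'\<inverse>)\<^sup>*"
        using C unfolding connected_graph_def fst_conv snd_conv by simp
      from img[OF this] show "(a, b) \<in> (?R \<union> ?R\<inverse>)\<^sup>*" unfolding merge_simps .
    qed
  qed
qed

text \<open>An end of the contracted edge that is not univalent has a further half-edge, so all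
  valencies are at least 2 before the contraction if and only if they are so afterwards. One
  direction serves the differential, the other one its transpose.\<close>

lemma GC_graph_contract:
  assumes G: "wf_graph G" "gstd G" "\<not> has_univalent G"
  shows "GC_graph (gcontract G) \<longleftrightarrow> GC_graph G"
proof -
  obtain n u es where GG: "G = (Suc n, (0, Suc u) # es)" "u < n" "set es \<subseteq> {..<Suc n} \<times> {..<Suc n}"
    "gcontract G = (n, map (map_prod (merge u) (merge u)) es)"
    by (rule gstd_cases[OF G(2,1)])
  have nu: "of_bool (0 = v) + of_bool (Suc u = v) + valency (Suc n, es) v \<noteq> 1" if "v < Suc n" for v
    using G(3) that unfolding has_univalent_def GG(1) valency_Cons[of _ _ _ _ _ "Suc n"] by auto
  have "(\<forall>v<n. valency (n, map (map_prod (merge u) (merge u)) es) v \<ge> 2) \<longleftrightarrow>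
      (\<forall>v<Suc n. valency (Suc n, (0, Suc u) # es) v \<ge> 2)"
    unfolding valency_contract[OF GG(3,2)] valency_Cons[of _ _ _ _ _ "Suc n"]
  proof
    assume L: "\<forall>v<n. 2 \<le> (if v = u then valency (Suc n, es) 0 + valency (Suc n, es) (Suc u) else valency (Suc n, es) (Suc v))"
    show "\<forall>v<Suc n. 2 \<le> of_bool (0 = v) + of_bool (Suc u = v) + valency (Suc n, es) v"
    proof (intro allI impI)
      fix v assume v: "v < Suc n"
      show "2 \<le> of_bool (0 = v) + of_bool (Suc u = v) + valency (Suc n, es) v"
        using L[rule_format, of "v - 1"] nu[OF v] v by (cases v) (auto split: if_splits)
    qed
  next
    assume R: "\<forall>v<Suc n. 2 \<le> of_bool (0 = v) + of_bool (Suc u = v) + valency (Suc n, es) v"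
    show "\<forall>v<n. 2 \<le> (if v = u then valency (Suc n, es) 0 + valency (Suc n, es) (Suc u) else valency (Suc n, es) (Suc v))"
    proof (intro allI impI)
      fix v assume "v < n"
      then show "2 \<le> (if v = u then valency (Suc n, es) 0 + valency (Suc n, es) (Suc u) else valency (Suc n, es) (Suc v))"
        using R[rule_format, of 0] R[rule_format, of "Suc u"] R[rule_format, of "Suc v"] GG(2) by auto
    qed
  qed
  moreover have "wf_graph (n, map (map_prod (merge u) (merge u)) es)" "wf_graph G"
    using GG(2,3) merge_less[of _ n u] G(1) by (auto simp: wf_graph_def)
  ultimately show ?thesis
    unfolding GC_graph_def GG(4) using connected_graph_contract[OF GG(2,3)] unfolding GG(1) by simp
qed

lemma GC_graph_wf: "GC_graph G \<Longrightarrow> wf_graph G"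
  by (simp add: GC_graph_def)

lemma GC_graph_not_univalent: "GC_graph G \<Longrightarrow> \<not> has_univalent G"
  by (auto simp: GC_graph_def has_univalent_def)

lemma GC_graph_act:
  assumes G: "GC_graph G" and s: "s permutes {..<fst G}" and t: "t permutes {..<length (snd G)}"
  shows "GC_graph (fst G, act_edges s t F (snd G))"
proof -
  obtain n es where GG: "G = (n, es)" by (cases G)
  have s': "s permutes {..<n}" and t': "t permutes {..<length es}" using s t by (simp_all add: GG)
  have es: "set es \<subseteq> {..<n} \<times> {..<n}" "1 \<le> n" using G by (simp_all add: GC_graph_def wf_graph_def GG)
  let ?es = "act_edges s t F es"
  have "\<forall>u<n. valency (n, ?es) u \<ge> 2"
  proof (intro allI impI)
    fix u assume u: "u < n"
    have "valency (n, ?es) (s (inv s u)) = valency (n, es) (inv s u)" by (rule valency_act_edges[OF s' t'])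
    then show "valency (n, ?es) u \<ge> 2"
      using G permutes_less[OF permutes_inv[OF s'] u] permutes_inverses(1)[OF s'] by (simp add: GC_graph_def GG)
  qed
  moreover have "connected_graph (n, ?es)"
    unfolding connected_graph_def fst_conv snd_conv
  proof (intro allI impI)
    fix a b assume ab: "a < n" "b < n"
    let ?R = "set es" and ?R' = "set ?es"
    show "(a, b) \<in> (?R' \<union> ?R'\<inverse>)\<^sup>*"
    proof (rule connected_lift[where p = "inv s" and V' = "{..<n}" and R = ?R])
      fix x y assume xy: "(x, y) \<in> ?R"
      then obtain i where i: "i < length es" "es ! i = (x, y)" by (metis in_set_conv_nth)
      have it: "inv t i < length es" "t (inv t i) = i"
        using permutes_less[OF permutes_inv[OF t'] i(1)] permutes_inverses(1)[OF t'] by simp_all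
      have "?es ! inv t i = (s x, s y) \<or> ?es ! inv t i = (s y, s x)" using it i by simp
      then have "(s x, s y) \<in> ?R' \<or> (s y, s x) \<in> ?R'"
        using it(1) nth_mem[of "inv t i" ?es] by auto
      then have "(s x, s y) \<in> (?R' \<union> ?R'\<inverse>)\<^sup>*" using r_into_sym by metis
      then show "\<exists>a'\<in>{..<n}. \<exists>b'\<in>{..<n}. inv s a' = x \<and> inv s b' = y \<and> (a', b') \<in> (?R' \<union> ?R'\<inverse>)\<^sup>*"
        using xy es(1) permutes_less[OF s'] permutes_inverses(2)[OF s']
        by (intro bexI[of _ "s x"] bexI[of _ "s y"]) auto
    next
      fix a b assume "inv s a = inv s b"
      then have "a = b" using permutes_inverses(1)[OF s'] by metis
      then show "(a, b) \<in> (?R' \<union> ?R'\<inverse>)\<^sup>*" by simp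
    next
      show "(inv s a, inv s b) \<in> (?R \<union> ?R\<inverse>)\<^sup>*"
        using G ab permutes_less[OF permutes_inv[OF s']] by (simp add: GC_graph_def connected_graph_def GG)
    qed (use ab in auto)
  qed
  ultimately show ?thesis using set_act_edges[OF s' t' es(1), of F] es(2) by (simp add: GC_graph_def wf_graph_def GG)
qed

lemma GC_rel_cases:
  assumes "r \<in> GC_rel c"
  obtains G s t F where "GC_graph G" "s permutes {..<fst G}" "t permutes {..<length (snd G)}"
    "r = bas G - scl (or_sign c (length (snd G)) s t F :: 'k::field_char_0) (bas (fst G, act_edges s t F (snd G)))"
proof -
  note th = that
  consider
    (v) v es s where "GC_graph (v, es)" "s permutes {..<v}"
      "r = bas (v, es) - scl (vertex_sign c s) (bas (v, relabel s es))"
  | (e) v es t where "GC_graph (v, es)" "t permutes {..<length es}"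
      "r = bas (v, es) - scl (edge_sign c t) (bas (v, permute_list t es))"
  | (f) v es i where "GC_graph (v, es)" "i < length es"
      "r = bas (v, es) - scl (flip_sign c) (bas (v, flip_edge i es))"
    using assms unfolding GC_rel_def by blast
  then show ?thesis
  proof cases
    case v
    show ?thesis
      by (rule th[of "(v, es)" s id "\<lambda>_. False"])
        (use v in \<open>simp_all add: act_edges_relabel or_sign_simps permutes_id\<close>)
  next
    case e
    show ?thesis
      by (rule th[of "(v, es)" id t "\<lambda>_. False"])
        (use e in \<open>simp_all add: act_edges_permute or_sign_simps permutes_id\<close>)
  next
    case f
    show ?thesis
      by (rule th[of "(v, es)" id id "\<lambda>j. j = i"])
        (use f in \<open>simp_all add: act_edges_flip or_sign_simps permutes_id\<close>)
  qed
qed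

lemma gEQ_iff_rel:
  fixes \<phi> :: "'k::field_char_0 gfun"
  assumes supp: "\<And>G. \<phi> G \<noteq> 0 \<Longrightarrow> GC_graph G"
  shows "(\<forall>r\<in>GC_rel c. pr \<phi> r = 0) \<longleftrightarrow> gEQ c \<phi>"
proof
  assume E: "gEQ c \<phi>"
  show "\<forall>r\<in>GC_rel c. pr \<phi> r = 0"
  proof
    fix r :: "'k gfun" assume "r \<in> GC_rel c"
    then obtain G s t F where r: "GC_graph G" "s permutes {..<fst G}" "t permutes {..<length (snd G)}"
      "r = bas G - scl (or_sign c (length (snd G)) s t F) (bas (fst G, act_edges s t F (snd G)))"
      by (rule GC_rel_cases)
    show "pr \<phi> r = 0"
      unfolding r(4) pr_relation
      using EQ1D'[OF E[unfolded gEQ_iff_EQ1], of "jp G" s t F] r(1-3) GC_graph_wf wfp_jp act1_jp[OF r(3), of s F]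
      by simp
  qed
next
  assume R: "\<forall>r\<in>GC_rel c. pr \<phi> r = 0"
  have K: "\<phi> X = e * \<phi> Y" if "bas X - scl e (bas Y) \<in> GC_rel c" for X Y e
    using R[rule_format, OF that] unfolding pr_relation by simp
  let ?V = "\<lambda>X. \<exists>G. GC_graph G \<and> X = jp G"
  show "gEQ c \<phi>"
    unfolding gEQ_iff_EQ1
  proof (rule EQ1_from_moves[of ?V])
    fix X assume "?V X" then show "wfp X" using GC_graph_wf wfp_jp by blast
  next
    fix X s t F assume X: "?V X" "s permutes {..<nv1 X}" "t permutes {..<ne1 X}"
    then obtain G where G: "GC_graph G" "X = jp G" by blast
    have "GC_graph (fst G, act_edges s t F (snd G))" using GC_graph_act[OF G(1)] X(2,3) unfolding G(2) fst_jp by blast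
    then show "?V (act1 s t F X)" using act1_jp X(3) unfolding G(2) fst_jp by blast
  next
    fix X assume "lft \<phi> X \<noteq> 0"
    then show "?V X" using lft_nonzero[of \<phi> X] supp by blast
  next
    fix X s assume "?V X" and s: "s permutes {..<nv1 X}"
    then obtain n es where G: "GC_graph (n, es)" "X = jp (n, es)" by (metis prod.exhaust)
    have A: "act1 s id noflip X = jp (n, relabel s es)"
      using act1_jp[of id "(n, es)" s "\<lambda>_. False"] unfolding G(2) by (simp add: act_edges_relabel permutes_id)
    show "lft \<phi> X = vertex_sign c s * lft \<phi> (act1 s id noflip X)"
      unfolding A unfolding G(2) lft_jp using G s by (intro K) (auto simp: GC_rel_def)
  next
    fix X t assume "?V X" and t: "t permutes {..<ne1 X}"
    then obtain n es where G: "GC_graph (n, es)" "X = jp (n, es)" by (metis prod.exhaust)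
    have t': "t permutes {..<length es}" using t by (simp add: G(2))
    have A: "act1 id t noflip X = jp (n, permute_list t es)"
      using act1_jp[of t "(n, es)" id "\<lambda>_. False"] t' unfolding G(2) by (simp add: act_edges_permute)
    show "lft \<phi> X = edge_sign c t * lft \<phi> (act1 id t noflip X)"
      unfolding A unfolding G(2) lft_jp using G t' by (intro K) (unfold GC_rel_def, blast)
  next
    fix X i assume "?V X" and i: "i < ne1 X"
    then obtain n es where G: "GC_graph (n, es)" "X = jp (n, es)" by (metis prod.exhaust)
    have i': "i < length es" using i by (simp add: G(2))
    have A: "act1 id id (\<lambda>j. j = i) X = jp (n, flip_edge i es)"
      using act1_jp[of id "(n, es)" id "\<lambda>j. j = i"] unfolding G(2) by (simp add: act_edges_flip[OF i'] permutes_id)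
    show "lft \<phi> X = flip_sign c * lft \<phi> (act1 id id (\<lambda>j. j = i) X)"
      unfolding A unfolding G(2) lft_jp using G i' by (intro K) (unfold GC_rel_def, blast)
  qed
qed

abbreviation gsize :: "graph \<Rightarrow> nat \<times> nat" where "gsize G \<equiv> (fst G, length (snd G))"

lemma finite_wf_graph_size: "finite {G. wf_graph G \<and> gsize G = k}"
proof -
  obtain n e where k: "k = (n, e)" by (cases k)
  have "{G. wf_graph G \<and> gsize G = k} \<subseteq> {n} \<times> {xs. set xs \<subseteq> {..<n} \<times> {..<n} \<and> length xs = e}"
    by (auto simp: wf_graph_def k)
  moreover have "finite ({n} \<times> {xs. set xs \<subseteq> {..<n} \<times> {..<n} \<and> length xs = e})"
    by (intro finite_SigmaI finite_lists_length_eq) auto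
  ultimately show ?thesis by (rule finite_subset)
qed

lemma finite_GC_size: "finite {G. GC_graph G \<and> gsize G = k}"
  by (rule finite_subset[OF _ finite_wf_graph_size[of k]]) (use GC_graph_wf in auto)

definition Fun1 :: "int \<Rightarrow> 'k::field_char_0 gfun set" where
  "Fun1 c = {\<phi>. FS \<phi> \<and> (\<forall>G. \<phi> G \<noteq> 0 \<longrightarrow> GC_graph G) \<and> gEQ c \<phi>}"

lemma Fun1D:
  assumes "\<phi> \<in> Fun1 c"
  shows "FS \<phi>" "\<And>G. \<phi> G \<noteq> 0 \<Longrightarrow> GC_graph G" "gEQ c \<phi>" "\<And>G. \<phi> G \<noteq> 0 \<Longrightarrow> wf_graph G"
  using assms GC_graph_wf unfolding Fun1_def by blast+

lemma crr_GC: "x \<in> crr (GC c) p \<longleftrightarrow> (\<forall>G. x G \<noteq> 0 \<longrightarrow> GC_graph G \<and> gdeg c G = p)"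
  by (simp add: GC_def Let_def)

lemma dif_GC [simp]: "dif (GC c) = dGC"
  by (simp add: GC_def Let_def)

lemma bdeg_GC [simp]: "bdeg (GC c) = gdeg c"
  by (simp add: GC_def Let_def)

lemma nul_GC: "x \<in> nul (GC c) p \<longleftrightarrow>
    x \<in> crr (GC c) p \<and> (\<forall>k. (\<lambda>G. if gsize G = k then x G else 0) \<in> spn (GC_rel c))"
  by (auto simp: GC_def Let_def split_paired_All)

lemma GC_rel_level:
  assumes rr: "r \<in> (GC_rel c :: 'k::field_char_0 gfun set)"
  shows "\<exists>k. \<forall>X. r X \<noteq> 0 \<longrightarrow> GC_graph X \<and> gsize X = k"
proof -
  obtain G s t F where r: "GC_graph G" "s permutes {..<fst G}" "t permutes {..<length (snd G)}"
    "r = bas G - scl (or_sign c (length (snd G)) s t F) (bas (fst G, act_edges s t F (snd G)))"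
    using GC_rel_cases[OF rr] by metis
  then show ?thesis
    using GC_graph_act[OF r(1-3), of F]
    by (intro exI[of _ "gsize G"]) (auto simp: bas_def scl_def split: if_splits)
qed

lemma FS_GC_rel:
  assumes rr: "r \<in> (GC_rel c :: 'k::field_char_0 gfun set)"
  shows "FS r"
proof -
  obtain k where "\<forall>X. r X \<noteq> 0 \<longrightarrow> GC_graph X \<and> gsize X = k" using GC_rel_level[OF rr] by blast
  then show ?thesis unfolding FS_def by (intro finite_subset[OF _ finite_GC_size[of k]]) auto
qed

lemma nul_GC_iff:
  fixes x :: "'k::field_char_0 gfun"
  assumes "x \<in> crr (GC c) p"
  shows "x \<in> nul (GC c) p \<longleftrightarrow> (\<forall>\<phi>\<in>Fun1 c. pr \<phi> x = 0)"
proof -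
  have x: "x X \<noteq> 0 \<Longrightarrow> GC_graph X" for X using assms by (simp add: crr_GC)
  have "x \<in> nul (GC c) p \<longleftrightarrow> (\<forall>k. (\<lambda>X. if gsize X = k then x X else 0) \<in> spn (GC_rel c))"
    using assms nul_GC by blast
  also have "\<dots> \<longleftrightarrow> (\<forall>\<Phi>. FS \<Phi> \<longrightarrow> (\<forall>X. \<Phi> X \<noteq> 0 \<longrightarrow> GC_graph X) \<longrightarrow> (\<forall>r\<in>GC_rel c. pr \<Phi> r = 0) \<longrightarrow> pr \<Phi> x = 0)"
    by (rule levels_in_span_iff[of "GC_rel c" GC_graph gsize x, OF GC_rel_level finite_GC_size x])
  also have "\<dots> \<longleftrightarrow> (\<forall>\<phi>\<in>Fun1 c. pr \<phi> x = 0)"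
    unfolding Fun1_def using gEQ_iff_rel[of _ c, where 'k='k] by blast
  finally show ?thesis .
qed

lemma gcontract_split:
  assumes "S \<subseteq> half_edges (snd G) u"
  shows "gstd (split_edges u S G)" "gcontract (split_edges u S G) = G"
proof -
  have spl: "split_edges u S G = (Suc (fst G), snd (split_edges u S G))" by (simp add: prod_eq_iff)
  have hd: "hd (snd (split_edges u S G)) = (0, Suc u)" "snd (split_edges u S G) \<noteq> []"
    by (simp_all add: snd_split_edges)
  show "gstd (split_edges u S G)" by (subst spl) (use hd in \<open>simp add: jp_def\<close>)
  show "gcontract (split_edges u S G) = G"
    by (subst spl) (use hd merge_split_edges[OF assms] in \<open>simp add: jp_def gcontract_def\<close>)
qed

lemma GC_split_apply:
  assumes "wf_graph G'"
  shows "GC_split G G' = (if \<not> has_univalent G' \<and> gstd G' \<and> gcontract G' = G then 1 / 2 else (0 :: 'k::field_char_0))"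
proof -
  let ?D = "\<lambda>u. {S. S \<subseteq> half_edges (snd G) u \<and> \<not> has_univalent (split_edges u S G)}"
  let ?b = "\<lambda>u S. scl (1 / 2) (bas (split_edges u S G)) G' :: 'k"
  have fin: "finite (?D u)" for u
    by (rule finite_subset[of _ "Pow (half_edges (snd G) u)"]) auto
  have E: "GC_split G G' = (\<Sum>u<fst G. \<Sum>S\<in>?D u. ?b u S)"
    by (simp add: GC_split_def sum_fun_at)
  show ?thesis
  proof (cases "\<not> has_univalent G' \<and> gstd G' \<and> gcontract G' = G")
    case False
    have "?b u S = 0" if "S \<in> ?D u" for u S
      using that False gcontract_split[of S G u] by (auto simp: scl_def bas_def)
    then show ?thesis unfolding E using False by (simp add: sum.neutral)
  next
    case True
    obtain n u es where GG: "G' = (Suc n, (0, Suc u) # es)" "u < n" "set es \<subseteq> {..<Suc n} \<times> {..<Suc n}"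
      "gcontract G' = (n, map (map_prod (merge u) (merge u)) es)"
      using gstd_cases[OF _ assms] True by metis
    have G: "G = (n, map (map_prod (merge u) (merge u)) es)" using True GG(4) by simp
    let ?S = "half_edges es 0"
    have spl: "split_edges u ?S G = G'" unfolding G GG(1) by (rule split_merge_edges)
    have SD: "?S \<in> ?D u" using True spl half_edges_merge[of es u] by (simp add: G)
    have z: "?b v S = 0" if "S \<in> ?D v" "v \<noteq> u \<or> S \<noteq> ?S" for v S
    proof -
      have "split_edges v S G \<noteq> G'"
      proof
        assume eq: "split_edges v S G = G'"
        then have "snd (split_edges v S G) = (0, Suc u) # es" by (simp add: GG(1))
        then have "v = u" "tl (snd (split_edges v S G)) = es" by (simp_all add: snd_split_edges)
        moreover have "S = ?S" using half_edges_split[of S G v] that(1) \<open>tl (snd (split_edges v S G)) = es\<close> by simp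
        ultimately show False using that(2) by simp
      qed
      then show ?thesis by (simp add: scl_def bas_def)
    qed
    have "(\<Sum>u<fst G. \<Sum>S\<in>?D u. ?b u S) = (\<Sum>S\<in>?D u. ?b u S)"
      by (rule sum_single) (use GG(2) G z in \<open>auto intro!: sum.neutral\<close>)
    also have "\<dots> = ?b u ?S" by (rule sum_single[OF fin SD]) (use z in blast)
    also have "\<dots> = 1 / 2" unfolding spl by (simp add: scl_def bas_def)
    finally show ?thesis unfolding E using True by simp
  qed
qed

lemma GC_split_support:
  assumes "GC_split G G' \<noteq> (0 :: 'k::field_char_0)" "GC_graph G"
  shows "GC_graph G'" "gdeg c G' = gdeg c G + 1"
proof -
  have "\<exists>u<fst G. \<exists>S. S \<subseteq> half_edges (snd G) u \<and> \<not> has_univalent (split_edges u S G) \<and> G' = split_edges u S G"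
  proof (rule ccontr)
    assume "\<not> ?thesis"
    then have "scl (1 / 2) (bas (split_edges u S G)) G' = (0 :: 'k)"
      if "u < fst G" "S \<subseteq> half_edges (snd G) u" "\<not> has_univalent (split_edges u S G)" for u S
      using that by (auto simp: scl_def bas_def)
    then have "GC_split G G' = (0 :: 'k)"
      unfolding GC_split_def sum_fun_at by (auto intro!: sum.neutral)
    with assms(1) show False by simp
  qed
  then obtain u S where u: "u < fst G" "S \<subseteq> half_edges (snd G) u" "\<not> has_univalent G'" "G' = split_edges u S G"
    by blast
  have wf: "set (snd G) \<subseteq> {..<fst G} \<times> {..<fst G}" using GC_graph_wf[OF assms(2)] by (simp add: wf_graph_def)
  have "wf_graph G'"
    unfolding u(4) wf_graph_def using u(1) endpoint_less[OF wf] by (auto simp: snd_split_edges)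
  then show "GC_graph G'"
    using GC_graph_contract[of G'] gcontract_split[OF u(2)] u(3,4) assms(2) by simp
  show "gdeg c G' = gdeg c G + 1" by (simp add: u(4) gdeg_def algebra_simps)
qed

lemma dif_GC_apply:
  assumes "wf_graph G'"
  shows "dGC x G' = (if \<not> has_univalent G' then (1 / 2) * gup x G' else (0 :: 'k::field_char_0))"
proof -
  have "dGC x G' = (\<Sum>G\<in>{gcontract G'}. x G * GC_split G G')"
    unfolding lin_ext_def
    by (rule sum.mono_neutral_left) (auto simp: GC_split_apply[OF assms] split: if_splits)
  then show ?thesis by (simp add: GC_split_apply[OF assms] gup_def)
qed

lemma dif_GC_crr:
  fixes x :: "'k::field_char_0 gfun"
  assumes "x \<in> crr (GC c) p"
  shows "dGC x \<in> crr (GC c) (p + 1)"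
  unfolding crr_GC
proof (intro allI impI)
  fix G' assume "dGC x G' \<noteq> 0"
  then obtain G where "x G \<noteq> 0" "GC_split G G' \<noteq> (0 :: 'k)" by (rule lin_ext_nonzero)
  then show "GC_graph G' \<and> gdeg c G' = p + 1"
    using assms GC_split_support(1)[of G G'] GC_split_support(2)[of G G' c] unfolding crr_GC by metis
qed

lemma pr_dif_GC:
  assumes "\<phi> \<in> Fun1 c"
  shows "pr \<phi> (dGC x) = (1 / 2) * pr (gD \<phi>) x"
proof -
  have "pr \<phi> (dGC x) = pr \<phi> (scl (1 / 2) (gup x))"
    by (rule pr_cong) (use Fun1D(2,4)[OF assms] GC_graph_not_univalent in \<open>simp add: dif_GC_apply scl_def\<close>)
  then show ?thesis by (simp add: pr_scl pr_gD[OF Fun1D(1)[OF assms]])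
qed

lemma gD_nonzero:
  assumes "gD \<phi> G \<noteq> 0"
  obtains G' where "\<phi> G' \<noteq> 0" "gstd G'" "gcontract G' = G"
proof -
  note th = that
  have "D1 (lft \<phi>) (jp G) \<noteq> 0" using assms by (simp add: gD_def)
  then obtain Y where Y: "lft \<phi> Y \<noteq> 0" "std1 Y" "contract1 Y = jp G" by (rule D1_supp)
  then obtain G' where G': "Y = jp G'" "\<phi> G' \<noteq> 0" using lft_nonzero by blast
  show ?thesis using th[OF G'(2)] Y(2,3) unfolding G'(1) contract1_jp by (metis injD inj_jp)
qed

lemma gD_Fun1:
  assumes "\<phi> \<in> Fun1 c"
  shows "gD \<phi> \<in> Fun1 c"
proof -
  have "FS (gD \<phi>)"
    using finite_vimageI[OF FS_D1[OF FS_lft[OF Fun1D(1)[OF assms]], unfolded FS_def] inj_jp]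
    by (simp add: FS_def gD_def vimage_def)
  moreover have "GC_graph G" if nz: "gD \<phi> G \<noteq> 0" for G
  proof -
    obtain G' where G': "\<phi> G' \<noteq> 0" "gstd G'" "gcontract G' = G" using gD_nonzero[OF nz] by metis
    then show ?thesis
      using GC_graph_contract[of G'] Fun1D(2,4)[OF assms G'(1)] GC_graph_not_univalent by blast
  qed
  moreover have "gEQ c (gD \<phi>)" using gEQ_gD Fun1D(3,4)[OF assms] by blast
  ultimately show ?thesis unfolding Fun1_def by blast
qed

lemma subspace_crr_GC: "ser.subspace (crr (GC c) p)"
  using subspace_supp[of "\<lambda>G. GC_graph G \<and> gdeg c G = p"] by (simp add: GC_def Let_def)

lemma nul_GC_eq: "nul (GC c) p = {x \<in> crr (GC c) p. \<forall>\<phi>\<in>Fun1 c. pr \<phi> x = (0 :: 'k::field_char_0)}"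
  using nul_GC_iff[of _ c p, where 'k='k] nul_GC[of _ c p, where 'a='k] by blast

lemma is_complex_GC: "is_complex (GC c :: (graph, 'k::field_char_0) cpx)"
  unfolding is_complex_def
proof (intro conjI allI)
  show "Vector_Spaces.linear scl scl (dif (GC c :: (graph, 'k) cpx))"
    unfolding dif_GC by (rule linear_lin_ext)
  fix p
  show "ser.subspace (crr (GC c :: (graph, 'k) cpx) p)" by (rule subspace_crr_GC)
  show "ser.subspace (nul (GC c :: (graph, 'k) cpx) p)"
    unfolding nul_GC_eq by (rule subspace_kill[OF subspace_crr_GC Fun1D(1)])
  show "nul (GC c) p \<subseteq> crr (GC c :: (graph, 'k) cpx) p" unfolding nul_GC_eq by blast
  show "dif (GC c) ` crr (GC c) p \<subseteq> crr (GC c :: (graph, 'k) cpx) (p + 1)"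
    unfolding dif_GC using dif_GC_crr by blast
  show "dif (GC c) ` nul (GC c) p \<subseteq> nul (GC c :: (graph, 'k) cpx) (p + 1)"
    unfolding dif_GC nul_GC_eq using dif_GC_crr by (auto simp: pr_dif_GC gD_Fun1)
  show "\<forall>x\<in>crr (GC c) p. dif (GC c) (dif (GC c) x) \<in> nul (GC c :: (graph, 'k) cpx) (p + 2)"
    unfolding dif_GC nul_GC_eq
  proof (intro ballI CollectI conjI)
    fix x \<phi> :: "'k gfun"
    assume x: "x \<in> crr (GC c) p"
    show "dGC (dGC x) \<in> crr (GC c) (p + 2)"
      using dif_GC_crr[OF dif_GC_crr[OF x]] by (simp add: add.assoc)
    assume P: "\<phi> \<in> Fun1 c"
    have "pr (gD (gD \<phi>)) x = pr \<phi> (gup (gup x))"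
      using pr_gD[OF Fun1D(1)[OF gD_Fun1[OF P]], of x] pr_gD[OF Fun1D(1)[OF P], of "gup x"] by simp
    also have "\<dots> = 0" by (rule pr_gup_gup[OF Fun1D(3,1,4)[OF P]])
    finally show "pr \<phi> (dGC (dGC x)) = 0"
      by (simp add: pr_dif_GC[OF P] pr_dif_GC[OF gD_Fun1[OF P]])
  qed
qed

section \<open>Functionals that detect the cohomology of the graph complex\<close>

lemma gsize_gcontract: "gstd G \<Longrightarrow> wf_graph G \<Longrightarrow> gsize G = (Suc (fst (gcontract G)), Suc (length (snd (gcontract G))))"
  by (erule gstd_cases) auto

lemma dif_bas_level:
  assumes "GC_graph G" "dGC (bas G) G' \<noteq> (0 :: 'k::field_char_0)"
  shows "GC_graph G' \<and> gsize G' = (Suc (fst G), Suc (length (snd G)))"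
proof -
  obtain G2 where G2: "bas G G2 \<noteq> (0 :: 'k)" "GC_split G2 G' \<noteq> (0 :: 'k)" using lin_ext_nonzero[OF assms(2)] by metis
  then have "G2 = G" by (auto simp: bas_def split: if_splits)
  then have "GC_graph G'" using GC_split_support(1)[OF G2(2)] assms(1) by simp
  then show ?thesis
    using G2 GC_split_apply[OF GC_graph_wf, of G' G2, where 'k='k] gsize_gcontract[of G'] GC_graph_wf[of G'] \<open>G2 = G\<close>
    by (auto split: if_splits)
qed

text \<open>Cocycles of the dual complex: \<open>gD \<phi> = 0\<close> says that \<phi> kills
  coboundaries. Since the complex is a product over sizes, functionals of a single size suffice;
  they are homogeneous and, in \<open>cocycle_kills_primitive\<close>, single out finitely many
  sizes.\<close>

definition cocycles :: "int \<Rightarrow> 'k::field_char_0 gfun set" where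
  "cocycles c = {\<phi> \<in> Fun1 c. gD \<phi> = 0 \<and> (\<exists>k. \<forall>G. \<phi> G \<noteq> 0 \<longrightarrow> gsize G = k)}"

lemma restrict_Fun1:
  assumes "\<phi> \<in> Fun1 c"
  shows "(\<lambda>G. if gsize G = k then \<phi> G else 0) \<in> Fun1 c"
proof -
  have "FS (\<lambda>G. if gsize G = k then \<phi> G else 0)"
    by (rule FS_mono[OF Fun1D(1)[OF assms]]) (simp split: if_splits)
  moreover have "gEQ c (\<lambda>G. if gsize G = k then \<phi> G else 0)"
    using Fun1D(3)[OF assms] unfolding gEQ_def by simp
  ultimately show ?thesis using Fun1D(2)[OF assms] unfolding Fun1_def by simp
qed

lemma Fun1_restrictI:
  fixes \<Phi> :: "'k::field_char_0 gfun"
  assumes "\<And>r. r \<in> GC_rel c \<Longrightarrow> pr \<Phi> r = 0"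
  shows "(\<lambda>G. if GC_graph G \<and> gsize G = k then \<Phi> G else 0) \<in> Fun1 c"
    (is "?\<Psi> \<in> _")
proof -
  have "FS ?\<Psi>" unfolding FS_def by (rule finite_subset[OF _ finite_GC_size[of k]]) auto
  moreover have "pr ?\<Psi> r = 0" if r: "r \<in> GC_rel c" for r
  proof -
    obtain j where j: "\<forall>X. r X \<noteq> 0 \<longrightarrow> GC_graph X \<and> gsize X = j" using GC_rel_level[OF r] by blast
    show ?thesis
    proof (cases "j = k")
      case True
      have "pr ?\<Psi> r = pr \<Phi> r" by (rule pr_cong_left) (use j True in auto)
      then show ?thesis using assms[OF r] by simp
    next
      case False
      have "pr ?\<Psi> r = pr 0 r" by (rule pr_cong_left) (use j False in auto)
      then show ?thesis by simp
    qed
  qed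
  moreover have supp: "GC_graph G" if "?\<Psi> G \<noteq> 0" for G using that by (simp split: if_splits)
  ultimately have "gEQ c ?\<Psi>" using gEQ_iff_rel[of ?\<Psi> c] by blast
  then show ?thesis using \<open>FS ?\<Psi>\<close> supp unfolding Fun1_def by blast
qed

text \<open>On one level this is linear algebra in finite dimension: the part of \<open>x\<close> on
  it lies in the span of the relations and of the coboundaries of basis elements. Indeed a
  functional that kills both of these becomes a cocycle when cut down to the level, and so kills
  \<open>x\<close>.\<close>

lemma cohomology_separation_level:
  fixes x :: "'k::field_char_0 gfun"
  assumes x: "x \<in> crr (GC c) p" and N: "\<And>\<phi>. \<phi> \<in> cocycles c \<Longrightarrow> pr \<phi> x = 0"
  shows "\<exists>y. (\<forall>G. y G \<noteq> 0 \<longrightarrow> GC_graph G \<and> (Suc (fst G), Suc (length (snd G))) = k \<and> gdeg c G = p - 1) \<and>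
    (\<lambda>G. if gsize G = k then x G else 0) - dGC y \<in> spn (GC_rel c)"
proof (cases "\<exists>G. x G \<noteq> 0 \<and> gsize G = k")
  case False
  then have "(\<lambda>G. if gsize G = k then x G else 0) - dGC 0 = 0"
    by (auto simp: fun_eq_iff lin_ext_def)
  then show ?thesis using ser.span_zero[of "GC_rel c"] by (intro exI[of _ 0]) simp
next
  case True
  then obtain G1 where G1: "x G1 \<noteq> 0" "gsize G1 = k" by blast
  let ?xk = "\<lambda>G. if gsize G = k then x G else 0"
  let ?B = "bas ` {G. GC_graph G \<and> (Suc (fst G), Suc (length (snd G))) = k} :: 'k gfun set"
  let ?R = "GC_rel c \<union> dGC ` ?B"
  have FSd: "FS (dGC (bas G) :: 'k gfun)" if "GC_graph G" for G
    unfolding FS_def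
    by (rule finite_subset[OF _ finite_GC_size[of "(Suc (fst G), Suc (length (snd G)))"]]) (use dif_bas_level[OF that] in blast)
  have "?xk \<in> spn ?R"
  proof (rule span_functional)
    show "FS r" if "r \<in> ?R" for r using that FS_GC_rel FSd by auto
    show "FS ?xk" using FS_level[OF finite_GC_size] x unfolding crr_GC by blast
    fix \<Phi> :: "'k gfun" assume P: "\<And>r. r \<in> ?R \<Longrightarrow> pr \<Phi> r = 0"
    let ?\<Psi> = "\<lambda>G. if GC_graph G \<and> gsize G = k then \<Phi> G else 0"
    have F: "?\<Psi> \<in> Fun1 c" by (rule Fun1_restrictI) (use P in blast)
    have "gD ?\<Psi> G = 0" for G
    proof (cases "GC_graph G \<and> (Suc (fst G), Suc (length (snd G))) = k")
      case True
      \<comment> \<open>The factor 2 undoes the factor 1/2 in the differential.\<close>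
      have "gD ?\<Psi> G = 2 * pr ?\<Psi> (dGC (bas G))" using pr_dif_GC[OF F, of "bas G"] by (simp add: mult.commute)
      also have "pr ?\<Psi> (dGC (bas G)) = pr \<Phi> (dGC (bas G))"
        by (rule pr_cong_left) (use dif_bas_level[of G, where 'k='k] True in auto)
      also have "\<dots> = 0" using P True by blast
      finally show ?thesis by simp
    next
      case False
      show ?thesis
      proof (rule ccontr)
        assume nz: "gD ?\<Psi> G \<noteq> 0"
        then have "GC_graph G" using Fun1D(2)[OF gD_Fun1[OF F]] by blast
        moreover obtain G' where "?\<Psi> G' \<noteq> 0" "gstd G'" "gcontract G' = G" using gD_nonzero[OF nz] by metis
        then have "(Suc (fst G), Suc (length (snd G))) = k"
          using gsize_gcontract[of G'] GC_graph_wf[of G'] by (auto split: if_splits)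
        ultimately show False using False by blast
      qed
    qed
    then have "gD ?\<Psi> = 0" by (simp add: fun_eq_iff)
    then have "?\<Psi> \<in> cocycles c"
      unfolding cocycles_def using F by auto
    then have "pr ?\<Psi> x = 0" by (rule N)
    moreover have eq: "?\<Psi> G * x G = \<Phi> G * ?xk G" for G using x unfolding crr_GC by auto
    have "pr ?\<Psi> x = pr \<Phi> ?xk" unfolding pr_def by (simp only: eq)
    ultimately show "pr \<Phi> ?xk = 0" by simp
  qed
  then obtain r s where rs: "?xk = r + s" "r \<in> spn (GC_rel c)" "s \<in> spn (dGC ` ?B)"
    unfolding ser.span_Un by blast
  have lin: "module_hom scl scl (dGC :: 'k gfun \<Rightarrow> 'k gfun)"
    using linear_lin_ext by (rule linear_module_hom)
  have "s \<in> dGC ` spn ?B"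
    using rs(3) module_hom.span_image[OF lin, of ?B] by simp
  then obtain y where y: "s = dGC y" "y \<in> spn ?B" by blast
  have "y G \<noteq> 0 \<longrightarrow> GC_graph G \<and> (Suc (fst G), Suc (length (snd G))) = k" for G
    using y(2)
  proof (induction rule: ser.span_induct_alt)
    case (step a b z)
    then show ?case by (auto simp: scl_def bas_def split: if_splits)
  qed simp
  moreover have "gdeg c G = p - 1" if "(Suc (fst G), Suc (length (snd G))) = k" for G
  proof -
    have "gdeg c G1 = p" using x G1(1) unfolding crr_GC by blast
    moreover have "fst G1 = Suc (fst G)" "length (snd G1) = Suc (length (snd G))" using that G1(2) by auto
    ultimately show ?thesis by (simp add: gdeg_def algebra_simps)
  qed
  ultimately have "\<forall>G. y G \<noteq> 0 \<longrightarrow> GC_graph G \<and> (Suc (fst G), Suc (length (snd G))) = k \<and> gdeg c G = p - 1"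
    by blast
  moreover have "?xk - dGC y \<in> spn (GC_rel c)"
    using rs(2) unfolding rs(1) y(1) by simp
  ultimately show ?thesis by blast
qed

text \<open>The differential raises the numbers of vertices and edges by one each, so the primitives
  of the levels live on disjoint sets of graphs and can be glued to one series. \<open>Y k\<close>
  is indexed by the size of its boundary, hence the two \<open>Suc\<close> in
  \<open>y\<close>.\<close>

lemma cohomology_separation:
  fixes x :: "'k::field_char_0 gfun"
  assumes x: "x \<in> crr (GC c) p" and N: "\<And>\<phi>. \<phi> \<in> cocycles c \<Longrightarrow> pr \<phi> x = 0"
  shows "\<exists>y\<in>crr (GC c) (p - 1). x - dGC y \<in> nul (GC c) p"
proof -
  have "\<forall>k. \<exists>y. (\<forall>G. y G \<noteq> 0 \<longrightarrow> GC_graph G \<and> (Suc (fst G), Suc (length (snd G))) = k \<and> gdeg c G = p - 1) \<and>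
    (\<lambda>G. if gsize G = k then x G else 0) - dGC y \<in> spn (GC_rel c)"
    by (intro allI cohomology_separation_level[OF x N])
  from choice[OF this] obtain Y where
    YY: "\<forall>k. (\<forall>G. Y k G \<noteq> 0 \<longrightarrow> GC_graph G \<and> (Suc (fst G), Suc (length (snd G))) = k \<and> gdeg c G = p - 1) \<and>
    (\<lambda>G. if gsize G = k then x G else 0) - dGC (Y k) \<in> spn (GC_rel c)" ..
  have Y: "\<And>k G. Y k G \<noteq> 0 \<Longrightarrow> GC_graph G \<and> (Suc (fst G), Suc (length (snd G))) = k \<and> gdeg c G = p - 1"
    "\<And>k. (\<lambda>G. if gsize G = k then x G else 0) - dGC (Y k) \<in> spn (GC_rel c)"
    using YY by blast+
  define y where "y G = Y (Suc (fst G), Suc (length (snd G))) G" for G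
  have yc: "y \<in> crr (GC c) (p - 1)" unfolding crr_GC y_def using Y(1) by blast
  have dc: "dGC y \<in> crr (GC c) p" using dif_GC_crr[OF yc] by simp
  have "x - dGC y \<in> nul (GC c) p"
    unfolding nul_GC
  proof (intro conjI allI)
    show "x - dGC y \<in> crr (GC c) p" using x dc by (rule ser.subspace_diff[OF subspace_crr_GC])
    fix k
    have "(if gsize G = k then (x - dGC y) G else 0) =
        ((\<lambda>G. if gsize G = k then x G else 0) - dGC (Y k)) G" for G
    proof (cases "GC_graph G")
      case True
      have w: "wf_graph G" using True by (rule GC_graph_wf)
      have "gup (Y k) G = (if gsize G = k then gup y G else 0)"
        using gsize_gcontract[of G, OF _ w] Y(1)[of k "gcontract G"] unfolding gup_def y_def by auto
      then show ?thesis using GC_graph_not_univalent[OF True] by (simp add: dif_GC_apply[OF w])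
    next
      case False
      have "Y k \<in> crr (GC c) (p - 1)" unfolding crr_GC using Y(1) by blast
      then have "dGC (Y k) \<in> crr (GC c) p" using dif_GC_crr by fastforce
      then have "x G = 0" "dGC y G = 0" "dGC (Y k) G = 0"
        using False x dc unfolding crr_GC by blast+
      then show ?thesis by simp
    qed
    then show "(\<lambda>G. if gsize G = k then (x - dGC y) G else 0) \<in> spn (GC_rel c)"
      using Y(2)[of k] by presburger
  qed
  then show ?thesis using yc by blast
qed

section \<open>Forgetting the hairs\<close>

abbreviation fg :: "egraph \<Rightarrow> graph \<times> graph" where
  "fg X \<equiv> (fst (fst X), fst (snd X))"

text \<open>This is \<open>Sym\<close> up to the condition \<open>admissible\<close>
  (\<open>Sym_hat\<close>): the coefficient of a pair with hairs is that of the underlying pair of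
  graphs. Its transpose is \<open>flat\<close>.\<close>

definition hat :: "'k::field_char_0 gpfun \<Rightarrow> 'k efun" where
  "hat x X = (if wfp X then x (fg X) else 0)"

definition flat :: "'k::field_char_0 efun \<Rightarrow> 'k gpfun" where
  "flat \<Phi> = (\<lambda>(G, H). \<Sum>f\<in>attachments G H. \<Sum>g\<in>attachments H G. \<Phi> ((G, f), (H, g)))"

lemma finite_attachments [simp]: "finite (attachments G H)"
proof -
  have "attachments G H = {f. set f \<subseteq> {..<fst G} \<and> length f = length (snd H)}"
    by (auto simp: attachments_def)
  then show ?thesis by (simp add: finite_lists_length_eq)
qed

lemma wfp_iff: "wfp ((G, f), (H, g)) \<longleftrightarrow> wf_graph G \<and> wf_graph H \<and> f \<in> attachments G H \<and> g \<in> attachments H G"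
  by (cases G; cases H) (auto simp: wf_graph_def attachments_def)

lemma Sym_apply:
  "Sym x ((G, f), (H, g)) =
     (if admissible G H \<and> f \<in> attachments G H \<and> g \<in> attachments H G then x (G, H) else (0 :: 'k::field_char_0))"
proof -
  have B: "Sym_basis (G', H') ((G, f), (H, g)) = (if (G', H') = (G, H) \<and> admissible G H \<and>
      f \<in> attachments G H \<and> g \<in> attachments H G then 1 else (0::'k))" for G' H'
  proof (cases "admissible G' H' \<and> G' = G \<and> H' = H")
    case False
    then show ?thesis by (auto simp: Sym_basis_def sum_fun_at bas_def intro!: sum.neutral)
  next
    case True
    have "Sym_basis (G', H') ((G, f), (H, g)) =
        (\<Sum>f1\<in>attachments G H. \<Sum>f2\<in>attachments H G. if f1 = f then if f2 = g then 1 else 0 else (0::'k))"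
      using True unfolding Sym_basis_def by (auto simp: sum_fun_at bas_def intro!: sum.cong)
    also have "\<dots> = (\<Sum>f1\<in>attachments G H. if f1 = f then \<Sum>f2\<in>attachments H G. if f2 = g then 1 else 0 else (0::'k))"
      by (rule sum.cong) auto
    also have "\<dots> = (if f \<in> attachments G H \<and> g \<in> attachments H G then 1 else 0)"
      by (simp add: sum.delta')
    finally show ?thesis using True by auto
  qed
  have "Sym x ((G, f), (H, g)) = (\<Sum>X\<in>{(G, H)}. x X * Sym_basis X ((G, f), (H, g)))"
    unfolding Sym_def lin_ext_def
    by (rule sum.mono_neutral_left) (auto simp: B split_paired_All split: if_splits)
  then show ?thesis by (simp add: B)
qed

lemma Sym_hat: "wfp X \<Longrightarrow> Sym x X = (if admissible (fst (fst X)) (fst (snd X)) then hat x X else 0)"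
proof -
  assume w: "wfp X"
  obtain G f H g where X: "X = ((G, f), (H, g))" by (metis prod.exhaust)
  show ?thesis using w unfolding X Sym_apply by (simp add: hat_def wfp_iff)
qed

lemma linear_Sym: "Vector_Spaces.linear scl scl (Sym :: 'k::field_char_0 gpfun \<Rightarrow> _)"
  unfolding Sym_def by (rule linear_lin_ext)

lemma pr_Sym:
  assumes "\<And>X. \<Phi> X \<noteq> 0 \<Longrightarrow> fcGC_pair X"
  shows "pr \<Phi> (Sym x) = pr \<Phi> (hat x)"
proof (rule pr_cong)
  fix X assume "\<Phi> X \<noteq> 0"
  then have "fcGC_pair X" by (rule assms)
  then show "Sym x X = hat x X" using Sym_hat[OF fcGC_pair_wfp] by (simp add: fcGC_pair_def)
qed

lemma flat_nonzero:
  assumes "flat \<Phi> (G, H) \<noteq> 0"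
  obtains f g where "f \<in> attachments G H" "g \<in> attachments H G" "\<Phi> ((G, f), (H, g)) \<noteq> 0"
proof (rule ccontr)
  assume n: "\<not> thesis"
  note th = that
  have "flat \<Phi> (G, H) = 0" unfolding flat_def prod.case
    by (intro sum.neutral ballI) (use n th in blast)
  with assms show False by simp
qed

lemma FS_flat: "FS \<Phi> \<Longrightarrow> FS (flat \<Phi>)"
  unfolding FS_def
proof (erule finite_subset[rotated, OF finite_imageI[of _ fg]])
  show "{X. flat \<Phi> X \<noteq> 0} \<subseteq> fg ` {X. \<Phi> X \<noteq> 0}"
  proof
    fix X assume "X \<in> {X. flat \<Phi> X \<noteq> 0}"
    moreover obtain G H where X: "X = (G, H)" by (cases X)
    ultimately have "flat \<Phi> (G, H) \<noteq> 0" by simp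
    then obtain f g where "\<Phi> ((G, f), (H, g)) \<noteq> 0" by (rule flat_nonzero)
    then show "X \<in> fg ` {X. \<Phi> X \<noteq> 0}" unfolding X by (intro image_eqI[of _ _ "((G, f), (H, g))"]) auto
  qed
qed

lemma pr_hat:
  assumes F: "FS \<Phi>" and supp: "\<And>X. \<Phi> X \<noteq> 0 \<Longrightarrow> wfp X"
  shows "pr \<Phi> (hat x) = pr (flat \<Phi>) x"
proof -
  let ?A = "{X. \<Phi> X \<noteq> 0}"
  have A: "finite ?A" using F by (simp add: FS_def)
  have "pr \<Phi> (hat x) = (\<Sum>X\<in>?A. \<Phi> X * x (fg X))"
    unfolding pr_left[OF F] by (rule sum.cong) (use supp in \<open>auto simp: hat_def\<close>)
  also have "\<dots> = (\<Sum>Z\<in>fg ` ?A. \<Sum>X\<in>{X. X \<in> ?A \<and> fg X = Z}. \<Phi> X * x (fg X))"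
    by (rule sum.image_gen[OF A])
  also have "\<dots> = (\<Sum>Z\<in>fg ` ?A. flat \<Phi> Z * x Z)"
  proof (rule sum.cong[OF refl])
    fix Z :: "graph \<times> graph"
    obtain G H where Z: "Z = (G, H)" by (cases Z)
    have "flat \<Phi> Z = (\<Sum>(f, g)\<in>attachments G H \<times> attachments H G. \<Phi> ((G, f), (H, g)))"
      by (simp add: flat_def Z sum.cartesian_product)
    also have "\<dots> = (\<Sum>X\<in>(\<lambda>(f, g). ((G, f), (H, g))) ` (attachments G H \<times> attachments H G). \<Phi> X)"
      by (subst sum.reindex) (auto simp: inj_on_def split_def)
    also have "\<dots> = (\<Sum>X\<in>{X. X \<in> ?A \<and> fg X = Z}. \<Phi> X)"
    proof (rule sum.mono_neutral_right)
      show "{X. X \<in> ?A \<and> fg X = Z} \<subseteq> (\<lambda>(f, g). ((G, f), (H, g))) ` (attachments G H \<times> attachments H G)"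
      proof
        fix X assume X: "X \<in> {X. X \<in> ?A \<and> fg X = Z}"
        obtain G' f H' g where XX: "X = ((G', f), (H', g))" by (metis prod.exhaust)
        show "X \<in> (\<lambda>(f, g). ((G, f), (H, g))) ` (attachments G H \<times> attachments H G)"
          using X supp[of X] unfolding XX wfp_iff Z by auto
      qed
    qed (auto simp: Z)
    finally have "flat \<Phi> Z = (\<Sum>X\<in>{X. X \<in> ?A \<and> fg X = Z}. \<Phi> X)" .
    then show "(\<Sum>X\<in>{X. X \<in> ?A \<and> fg X = Z}. \<Phi> X * x (fg X)) = flat \<Phi> Z * x Z"
      by (simp add: sum_distrib_right)
  qed
  also have "\<dots> = pr (flat \<Phi>) x"
  proof (rule pr_sum[symmetric])
    fix Z assume nz: "flat \<Phi> Z \<noteq> 0"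
    obtain G H where Z: "Z = (G, H)" by (cases Z)
    obtain f g where "\<Phi> ((G, f), (H, g)) \<noteq> 0" using flat_nonzero[OF nz[unfolded Z]] by metis
    then show "Z \<in> fg ` ?A" unfolding Z by (intro image_eqI[of _ _ "((G, f), (H, g))"]) auto
  qed (use A in simp)
  finally show ?thesis .
qed

definition tdif :: "int \<Rightarrow> 'k::field_char_0 gpfun \<Rightarrow> 'k gpfun" where
  "tdif c t = (\<lambda>(G, H). dGC (\<lambda>G'. t (G', H)) G + koszul (gdeg c G) * dGC (\<lambda>H'. t (G, H')) H)"

lemma dif_tensor: "dif (tensor (GC c) (GC d)) = tdif c"
  by (simp add: tensor_def tdif_def fun_eq_iff)

lemma fst_contract1: "fst (fst (contract1 X)) = gcontract (fst (fst X))" "std1 X \<longleftrightarrow> gstd (fst (fst X))"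
proof -
  obtain n es f H g where X: "X = (((n, es), f), (H, g))" by (metis prod.exhaust)
  show "fst (fst (contract1 X)) = gcontract (fst (fst X))" "std1 X \<longleftrightarrow> gstd (fst (fst X))"
    by (simp_all add: X gcontract_def jp_def)
qed

lemma wfp_graphs: "wfp X \<Longrightarrow> wf_graph (fst (fst X)) \<and> wf_graph (fst (snd X))"
proof -
  obtain G f H g where X: "X = ((G, f), (H, g))" by (metis prod.exhaust)
  show "wfp X \<Longrightarrow> ?thesis" unfolding X wfp_iff by simp
qed

lemma up1_hat: "wfp Y \<Longrightarrow> up1 (hat t) Y = gup (\<lambda>G. t (G, fst (snd Y))) (fst (fst Y))"
  using wfp_contract1[of Y] fst_contract1[of Y] by (simp add: up1_def gup_def hat_def)

lemma up2_hat: "wfp Y \<Longrightarrow> up2 (hat t) Y = gup (\<lambda>H. t (fst (fst Y), H)) (fst (snd Y))"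
  using wfp_contract2[of Y] fst_contract1[of "prod.swap Y"] by (simp add: up2_def gup_def hat_def)

text \<open>Contractibility of an edge and the contracted graphs do not depend on hair positions, so
  pulling back from pairs of plain graphs is compatible with the differentials.\<close>

lemma hat_tdif:
  assumes "wfp Y" "nonuniv Y"
  shows "hat (tdif c t) Y = bd c (hat t) Y"
  using assms wfp_graphs[OF assms(1)]
  by (simp add: bd_def up1_hat up2_hat hat_def tdif_def dif_GC_apply nonuniv_def mult.left_commute mult.assoc)

section \<open>One-vertex graphs\<close>

lemma EQ1_one_vertex:
  fixes \<Phi> :: "'k::field_char_0 efun"
  assumes E: "EQ1 c \<Phi>" and X: "wfp X" "nv1 X = 1" "nv2 X = 1" and nz: "\<Phi> X \<noteq> 0" "ne1 X \<noteq> 0"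
  shows "even c \<and> ne1 X = 1"
proof -
  obtain es f es' g where XX: "X = (((1, es), f), ((1, es'), g))" using X(2,3) by (metis prod.exhaust fst_conv snd_conv)
  have es: "es ! i = (0, 0)" if "i < length es" for i
    using X(1) nth_mem[OF that] unfolding XX by auto
  have g: "length g = length es" "\<And>i. i < length es \<Longrightarrow> g ! i = 0"
    using X(1) nth_mem[of _ g] unfolding XX by (auto simp: subset_iff)
  have pos: "0 < length es" using nz(2) by (simp add: XX)
  have ev: "even c"
  proof (rule ccontr)
    assume odd: "odd c"
    \<comment> \<open>A flipped tadpole is the same tadpole, and for odd \<open>c\<close> the flip
      has sign -1.\<close>
    have "flip_edge 0 es = es"
      unfolding flip_edge_def using es[of 0] pos list_update_id[of es 0] by simp
    then have "act1 id id (\<lambda>j. j = 0) X = X"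
      unfolding XX act1.simps using pos by (simp only: act_edges_flip list.map_id permute_list_id)
    then have "\<Phi> X = flip_sign c * \<Phi> X"
      using EQ1D[OF E X(1), of id id "\<lambda>j. j = 0"] or_sign_simps(3)[of 0 "ne1 X" c, where 'k='k] pos
      unfolding XX by (simp add: permutes_id)
    then show False using nz(1) odd by (simp add: flip_sign_def)
  qed
  moreover have "length es = 1"
  proof (rule ccontr)
    let ?t = "tsp 0 (1::nat)"
    assume "length es \<noteq> 1"
    then have "2 \<le> length es" using pos by linarith
    then have t: "?t permutes {..<length es}" by (intro permutes_swap_id) auto
    \<comment> \<open>Two tadpoles are equal edges, and their hairs sit at the only vertex of the
      other graph. So exchanging them fixes \<open>X\<close>, and for even \<open>c\<close> this has
      sign -1.\<close>
    have "permute_list ?t es = es"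
      by (rule nth_equalityI) (use t es permutes_less[OF t] in \<open>auto simp: permute_list_nth\<close>)
    moreover have "permute_list ?t g = g"
      by (rule nth_equalityI) (use t g permutes_less[OF t] in \<open>auto simp: permute_list_nth\<close>)
    ultimately have "act1 id ?t noflip X = X"
      unfolding XX act1.simps act_edges_permute[OF t] by simp
    then have "\<Phi> X = edge_sign c ?t * \<Phi> X"
      using EQ1D[OF E X(1), of id ?t "\<lambda>_. False"] t or_sign_simps(2)[of c "ne1 X" ?t, where 'k='k]
      unfolding XX by (simp add: permutes_id)
    then show False using nz(1) ev by (simp add: edge_sign_def sign_swap_id)
  qed
  ultimately show ?thesis by (simp add: XX)
qed

text \<open>
  A pair of one-vertex graphs has no coboundary in the quotient: a tadpole can be flipped, several
  tadpoles can be permuted, and splitting the vertex of a single tadpole gives a double edge. This is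
  why \<open>Sym\<close> commutes with the differentials although it drops these pairs.
\<close>

lemma D1_one_vertex:
  fixes \<Phi> :: "'k::field_char_0 efun"
  assumes E: "EQ1 c \<Phi>" and supp: "\<And>X. \<Phi> X \<noteq> 0 \<Longrightarrow> wfp X \<and> nonuniv X"
    and X: "wfp X" "nv1 X = 1" "nv2 X = 1"
  shows "D1 \<Phi> X = 0"
proof (rule ccontr)
  assume nz: "D1 \<Phi> X \<noteq> 0"
  obtain es f es' g where XX: "X = (((1, es), f), ((1, es'), g))" using X(2,3) by (metis prod.exhaust fst_conv snd_conv)
  have es: "es ! i = (0, 0)" if "i < length es" for i
    using X(1) nth_mem[OF that] unfolding XX by auto
  have g: "length g = length es" "\<And>i. i < length es \<Longrightarrow> g ! i = 0"
    using X(1) nth_mem[of _ g] unfolding XX by (auto simp: subset_iff)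
  have E': "EQ1 c (D1 \<Phi>)" by (rule D1_EQ1[OF E]) (use supp in blast)
  obtain Y where Y: "\<Phi> Y \<noteq> 0" "std1 Y" "contract1 Y = X" using nz by (rule D1_supp)
  have wY: "wfp Y" "nonuniv Y" using supp[OF Y(1)] by auto
  obtain n u es0 f0 m es0' g0 w where YY: "Y = (((Suc n, (0, Suc u) # es0), f0), ((m, es0'), w # g0))"
      "u < n" "w < m"
      "contract1 Y = (((n, map (map_prod (merge u) (merge u)) es0), map (merge u) f0), ((m, es0'), g0))"
    by (rule std1_cases[OF Y(2) wY(1)])
  have n: "n = 1" "u = 0" "m = 1" "length es0 = length es" "g0 = g" "w = 0" using YY Y(3) unfolding XX by auto
  have nu: "of_bool (0 = v) + of_bool (1 = v) + valency (2, es0) v \<noteq> 1" if "v < 2" for v :: nat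
    using wY(2) that unfolding nonuniv_def has_univalent_def YY(1) n
    using valency_Cons[of 2 0 1 es0 v 2] by (auto simp: numeral_2_eq_2)
  show False
  proof (cases "length es = 0")
    case True
    then have "es0 = []" using n(4) by simp
    then show False using nu[of 0] by (simp add: valency_sum)
  next
    case False
    have "even c \<and> ne1 X = 1" by (rule EQ1_one_vertex[OF E' X nz]) (use False in \<open>simp add: XX\<close>)
    then have ev: "even c" and True: "length es = 1" by (simp_all add: XX)
    let ?t = "tsp 0 (1::nat)"
    have sg: "edge_sign c ?t = (- 1 :: 'k)" using ev by (simp add: edge_sign_def sign_swap_id)
    from True obtain a b where es0: "es0 = [(a, b)]" using n(4) by (metis length_0_conv length_Suc_conv One_nat_def prod.exhaust)
    have ab: "a < 2" "b < 2" using wY(1) unfolding YY(1) n es0 by auto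
    have "a \<noteq> b" using nu[of 0] nu[of 1] ab unfolding es0 by (auto simp: valency_sum less_2_cases_iff)
    have gg: "g = [0]" using g True by (cases g) auto
    have t: "?t permutes {..<2}" by (intro permutes_swap_id) auto
    have Y2: "Y = (((2, [(0, 1), (a, b)]), f0), ((1, es0'), [0, 0]))"
      using YY(1) n es0 gg by (simp add: numeral_2_eq_2)
    \<comment> \<open>The remaining candidate is a double edge. Exchanging its two edges, and
      flipping both if they are antiparallel, fixes the pair. The sign is -1, as \<open>c\<close> is
      even.\<close>
    define F where "F = (\<lambda>i::nat. a = 1)"
    have "act_edges id ?t F [(0, 1), (a, b)] = [(0, 1), (a, b)]"
      using ab \<open>a \<noteq> b\<close> by (auto simp: act_edges_def F_def less_2_cases_iff)
    moreover have "permute_list ?t [0, 0] = [0, 0::nat]" by (simp add: permute_list_def)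
    ultimately have "act1 id ?t F Y = Y" unfolding Y2 act1.simps by simp
    moreover have "or_sign c 2 id ?t F = (- 1 :: 'k)"
      using sg ev by (simp add: or_sign_def vertex_sign_def flip_sign_def F_def)
    ultimately have "\<Phi> Y = - \<Phi> Y"
      using EQ1D[OF E wY(1), of id ?t F] t unfolding Y2 by (simp add: permutes_id numeral_2_eq_2)
    then show False using Y(1) by simp
  qed
qed

lemma gD_one_vertex:
  fixes \<phi> :: "'k::field_char_0 gfun"
  assumes P: "\<phi> \<in> Fun1 c" and G: "fst G = 1" "wf_graph G"
  shows "gD \<phi> G = 0"
  unfolding gD_def comp_apply
proof (rule D1_one_vertex[of c])
  show "EQ1 c (lft \<phi>)" using Fun1D(3)[OF P] gEQ_iff_EQ1 by blast
  show "wfp (jp G)" using G wfp_jp by blast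
  show "nv1 (jp G) = 1" "fst (fst (snd (jp G))) = 1" using G by (simp_all add: jp_def)
  fix X assume "lft \<phi> X \<noteq> 0"
  then obtain G' where G': "X = jp G'" "\<phi> G' \<noteq> 0" using lft_nonzero by blast
  have "\<not> has_univalent G'" using Fun1D(2)[OF P G'(2)] by (rule GC_graph_not_univalent)
  moreover have "\<not> has_univalent (1, [])" by (simp add: has_univalent_def valency_sum)
  ultimately have "nonuniv X" unfolding nonuniv_def G'(1) by (simp add: jp_def)
  then show "wfp X \<and> nonuniv X" using Fun1D(4)[OF P G'(2)] wfp_jp G'(1) by blast
qed

text \<open>\<open>hat\<close> commutes with the differential, and on well-formed pairs
  \<open>Sym\<close> differs from it only where both graphs have one vertex. After passing to the
  transposes this difference is paired with \<open>D1\<close> and \<open>D2\<close> of equivariant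
  functionals, which vanish there by \<open>D1_one_vertex\<close>.\<close>

lemma Fun2_Sym_dif:
  assumes P: "\<Phi> \<in> Fun2 c d"
  shows "pr \<Phi> (lin_ext (delta c) (Sym t)) = pr \<Phi> (Sym (tdif c t))"
proof -
  have supp: "wfp X \<and> nonuniv X" if "\<Phi> X \<noteq> 0" for X using Fun2D(3,4)[OF P that] by blast
  let ?\<Phi> = "\<lambda>X. koszul (gdeg c (fst (fst X))) * \<Phi> X"
  have F: "FS ?\<Phi>" by (rule FS_mono[OF Fun2D(1)[OF P]]) auto
  have E2: "EQ c d ?\<Phi>" by (rule EQ_koszul[OF Fun2D(5)[OF P]])
  have supp2: "wfp X \<and> nonuniv X" if "?\<Phi> X \<noteq> 0" for X using supp that by simp
  have one: "nv1 X = 1 \<and> nv2 X = 1" if "wfp X" "\<not> admissible (fst (fst X)) (fst (snd X))" for X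
    using wfp_graphs[OF that(1)] that(2) unfolding wf_graph_def admissible_def by linarith
  have S: "wfp X \<Longrightarrow> Sym t X = (if admissible (fst (fst X)) (fst (snd X)) then hat t X else 0)" for X
    by (rule Sym_hat)
  have w1: "wfp X" if "D1 \<Psi> X \<noteq> 0" "\<And>X. \<Psi> X \<noteq> 0 \<Longrightarrow> wfp X \<and> nonuniv X" for \<Psi> and X
    using that(1) by (rule D1_supp) (use that(2) wfp_contract1 in blast)
  have e1: "pr (D1 \<Phi>) (Sym t) = pr (D1 \<Phi>) (hat t)"
  proof (rule pr_cong)
    fix X assume nz: "D1 \<Phi> X \<noteq> 0"
    have w: "wfp X" using w1[OF nz supp] by blast
    have "EQ1 c \<Phi>" using Fun2D(5)[OF P] by (simp add: EQ_def)
    then have "admissible (fst (fst X)) (fst (snd X))"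
      using D1_one_vertex[of c \<Phi> X] supp w nz one[OF w] by blast
    then show "Sym t X = hat t X" using S[OF w] by simp
  qed
  have e2: "pr (D2 ?\<Phi>) (Sym t) = pr (D2 ?\<Phi>) (hat t)"
  proof (rule pr_cong)
    fix X assume "D2 ?\<Phi> X \<noteq> 0"
    then have nz: "D1 (?\<Phi> \<circ> prod.swap) (prod.swap X) \<noteq> 0" by (simp add: D2_def)
    have sw: "wfp X \<and> nonuniv X" if "(?\<Phi> \<circ> prod.swap) X \<noteq> 0" for X
      using supp2[of "prod.swap X"] that unfolding comp_apply by (metis wfp_swap nonuniv_swap)
    have "wfp (prod.swap X)" by (rule w1[OF nz]) (rule sw)
    then have w: "wfp X" by (simp only: wfp_swap)
    have E1: "EQ1 d (?\<Phi> \<circ> prod.swap)" using E2 by (simp add: EQ_def)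
    have "admissible (fst (fst X)) (fst (snd X))"
    proof (rule ccontr)
      assume "\<not> ?thesis"
      then have o: "nv1 X = 1" "nv2 X = 1" using one[OF w] by auto
      have "D1 (?\<Phi> \<circ> prod.swap) (prod.swap X) = 0"
      proof (rule D1_one_vertex[OF E1])
        show "wfp X \<and> nonuniv X" if "(?\<Phi> \<circ> prod.swap) X \<noteq> 0" for X by (rule sw[OF that])
      qed (use w o in simp_all)
      with nz show False by simp
    qed
    then show "Sym t X = hat t X" using S[OF w] by simp
  qed
  have "pr \<Phi> (lin_ext (delta c) (Sym t)) = pr \<Phi> (bd c (Sym t))" by (rule pr_dif) (rule supp)
  also have "\<dots> = pr \<Phi> (bd c (hat t))"
    unfolding pr_bd[OF Fun2D(1)[OF P]] pr_D1[OF Fun2D(1)[OF P], symmetric] pr_D2[OF F, symmetric] e1 e2 ..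
  also have "\<dots> = pr \<Phi> (hat (tdif c t))" by (rule pr_cong) (use supp hat_tdif in metis)
  also have "\<dots> = pr \<Phi> (Sym (tdif c t))" by (rule pr_Sym[symmetric]) (rule Fun2D(2)[OF P])
  finally show ?thesis .
qed

text \<open>Each graph is connected by itself. The first one has an edge because its vertices are at
  least bivalent, and the hair of this edge links the two graphs.\<close>

lemma GC_pair_connected:
  assumes "GC_graph G" "GC_graph H" "f \<in> attachments G H" "g \<in> attachments H G"
  shows "connected_pair ((G, f), (H, g))"
proof -
  obtain n es where G: "G = (n, es)" by (cases G)
  obtain m es' where H: "H = (m, es')" by (cases H)
  let ?R = "incidences ((G, f), (H, g))"
  let ?S = "(?R \<union> ?R\<inverse>)\<^sup>*"
  have n: "1 \<le> n" "1 \<le> m" using assms(1,2) by (simp_all add: GC_graph_def wf_graph_def G H)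
  have inc: "?R = incidences (((n, es), f), ((m, es'), g))" by (simp only: G H)
  have edge1: "(Inl a, Inl b) \<in> ?S" if "(a, b) \<in> set es \<union> (set es)\<inverse>" for a b
    using that unfolding inc by (intro r_into_rtrancl) auto
  have L: "(Inl a, Inl b) \<in> ?S" if "a < n" "b < n" for a b
  proof -
    have "(a, b) \<in> (set es \<union> (set es)\<inverse>)\<^sup>*"
      using assms(1) that unfolding GC_graph_def connected_graph_def G by simp
    then show ?thesis
    proof (induction rule: rtrancl_induct)
      case (step y z)
      show ?case by (rule rtrancl_trans[OF step(3) edge1[OF step(2)]])
    qed simp
  qed
  have edge2: "(Inr a, Inr b) \<in> ?S" if "(a, b) \<in> set es' \<union> (set es')\<inverse>" for a b
    using that unfolding inc by (intro r_into_rtrancl) auto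
  have R: "(Inr a, Inr b) \<in> ?S" if "a < m" "b < m" for a b
  proof -
    have "(a, b) \<in> (set es' \<union> (set es')\<inverse>)\<^sup>*"
      using assms(2) that unfolding GC_graph_def connected_graph_def H by simp
    then show ?thesis
    proof (induction rule: rtrancl_induct)
      case (step y z)
      show ?case by (rule rtrancl_trans[OF step(3) edge2[OF step(2)]])
    qed simp
  qed
  have "valency (n, es) 0 \<ge> 2" using assms(1) n by (simp add: GC_graph_def G)
  then have ne: "0 < length es" by (auto simp: valency_sum intro: Nat.gr0I)
  have es: "set es \<subseteq> {..<n} \<times> {..<n}" using assms(1) by (simp add: GC_graph_def wf_graph_def G)
  have hair: "(Inl (endpoint es (0, True)), Inr (g ! 0)) \<in> ?R" unfolding inc using ne by auto
  have e0: "endpoint es (0, True) < n" using endpoint_less[OF es ne] .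
  have "length g = length es" "set g \<subseteq> {..<m}" using assms(4) by (simp_all add: attachments_def G H)
  then have g0: "g ! 0 < m" using ne nth_mem[of 0 g] by (metis lessThan_iff subsetD)
  have LR: "(Inl a, Inr b) \<in> ?S" if "a < n" "b < m" for a b
    using L[OF that(1) e0] R[OF g0 that(2)] r_into_sym(1)[OF hair] by (meson rtrancl_trans)
  have RL: "(Inr b, Inl a) \<in> ?S" if "a < n" "b < m" for a b
    using L[OF e0 that(1)] R[OF that(2) g0] r_into_sym(2)[OF hair] by (meson rtrancl_trans)
  show ?thesis
    unfolding connected_pair_def Let_def fst_conv snd_conv
  proof (intro ballI)
    fix a b assume "a \<in> Inl ` {..<fst G} \<union> Inr ` {..<fst H}" "b \<in> Inl ` {..<fst G} \<union> Inr ` {..<fst H}"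
    then show "(a, b) \<in> ?S" using L R LR RL by (auto simp: G H simp del: incidences.simps)
  qed
qed

lemma edeg_gdeg: "edeg c d X = gdeg c (fst (fst X)) + gdeg d (fst (snd X))"
proof -
  obtain n es f m es' g where X: "X = (((n, es), f), ((m, es'), g))" by (metis prod.exhaust)
  show ?thesis by (simp add: X gdeg_def algebra_simps)
qed

lemma Sym_crr:
  fixes x :: "'k::field_char_0 gpfun"
  assumes "\<And>G H. x (G, H) \<noteq> 0 \<Longrightarrow> GC_graph G \<and> GC_graph H \<and> gdeg c G + gdeg d H = p"
  shows "Sym x \<in> crr (fcGC c d) p"
  unfolding crr_fcGC
proof (intro allI impI)
  fix X assume nz: "Sym x X \<noteq> 0"
  obtain G f H g where X: "X = ((G, f), (H, g))" by (metis prod.exhaust)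
  have a: "admissible G H" "f \<in> attachments G H" "g \<in> attachments H G" "x (G, H) \<noteq> 0"
    using nz unfolding X Sym_apply by (auto split: if_splits)
  have G: "GC_graph G" "GC_graph H" "gdeg c G + gdeg d H = p" using assms[OF a(4)] by auto
  have "wfp X" unfolding X wfp_iff using a G GC_graph_wf by blast
  moreover have "connected_pair X" unfolding X by (rule GC_pair_connected[OF G(1,2) a(2,3)])
  ultimately show "fcGC_pair X \<and> edeg c d X = p"
    unfolding edeg_gdeg using a(1) G(3) by (simp add: fcGC_pair_def Gra_pair_iff X del: wfp.simps)
qed

section \<open>The chain map\<close>

lemma attachments_act [simp]:
  "attachments (n, act_edges s t F es) H = attachments (n, es) H"
  "attachments H (n, act_edges s t F es) = attachments H (n, es)"
  by (simp_all add: attachments_def)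

lemma map_perm_attachments:
  assumes "s permutes {..<fst G}" "f \<in> attachments G H"
  shows "map s f \<in> attachments G H"
  using assms(2) permutes_less[OF assms(1)] by (auto simp: attachments_def)

lemma permute_attachments:
  assumes "t permutes {..<length (snd G)}" "g \<in> attachments H G"
  shows "permute_list t g \<in> attachments H G"
  using assms by (auto simp: attachments_def)

text \<open>A vertex permutation moves the hairs along, and an edge permutation permutes the hair
  list of the other graph. Both are bijections of the attachments, so the sum over all attachments
  inherits equivariance.\<close>

lemma gEQ_flat:
  fixes \<Phi> :: "'k::field_char_0 efun"
  assumes E: "EQ1 c \<Phi>" and supp: "\<And>X. \<Phi> X \<noteq> 0 \<Longrightarrow> wfp X"
  shows "gEQ c (\<lambda>G. flat \<Phi> (G, H))"
  unfolding gEQ_def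
proof (intro allI impI)
  fix G s t F assume G: "wf_graph G" "s permutes {..<fst G}" "t permutes {..<length (snd G)}"
  obtain n es where GG: "G = (n, es)" by (cases G)
  let ?G = "(n, act_edges s t F es)"
  have perm: "s permutes {..<n}" "t permutes {..<length es}" using G by (simp_all add: GG)
  have step: "\<Phi> ((?G, map s f), (H, permute_list t g)) = or_sign c (length es) s t F * \<Phi> ((G, f), (H, g))"
    if fg: "f \<in> attachments G H" "g \<in> attachments H G" for f g
  proof (cases "wf_graph H")
    case True
    have "wfp ((G, f), (H, g))" unfolding wfp_iff using G True fg by blast
    from EQ1D[OF E this, of s t F] show ?thesis using G by (simp add: GG)
  next
    case False
    then have "\<not> wfp ((?G, map s f), (H, permute_list t g))" "\<not> wfp ((G, f), (H, g))" unfolding wfp_iff by blast+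
    then show ?thesis using supp by (metis mult_zero_right)
  qed
  have "flat \<Phi> (?G, H) = (\<Sum>f\<in>attachments G H. \<Sum>g\<in>attachments H G. \<Phi> ((?G, f), (H, g)))"
    by (simp add: flat_def GG)
  also have "\<dots> = (\<Sum>f\<in>attachments G H. \<Sum>g\<in>attachments H G. \<Phi> ((?G, map s f), (H, g)))"
  proof (rule sum.reindex_bij_witness[of _ "map s" "map (inv s)"])
    fix f assume f: "f \<in> attachments G H"
    show "map s (map (inv s) f) = f" "map (inv s) (map s f) = f"
      using permutes_inverses[OF perm(1)] by (simp_all add: comp_def)
    then show "(\<Sum>g\<in>attachments H G. \<Phi> ((?G, map s (map (inv s) f)), (H, g))) =
        (\<Sum>g\<in>attachments H G. \<Phi> ((?G, f), (H, g)))" by (simp only:)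
    show "map s f \<in> attachments G H" "map (inv s) f \<in> attachments G H"
      using map_perm_attachments[OF _ f] G permutes_inv by blast+
  qed
  also have "\<dots> = (\<Sum>f\<in>attachments G H. \<Sum>g\<in>attachments H G. \<Phi> ((?G, map s f), (H, permute_list t g)))"
  proof (rule sum.cong[OF refl], rule sum.reindex_bij_witness[of _ "permute_list t" "permute_list (inv t)"])
    fix f g assume g: "g \<in> attachments H G"
    then have len: "length g = length es" by (simp add: attachments_def GG)
    have t: "t permutes {..<length g}" "inv t permutes {..<length g}" using perm permutes_inv by (simp_all add: len)
    show a: "permute_list t (permute_list (inv t) g) = g"
      using permute_list_compose[OF t(1), of "inv t"] permutes_inv_o[OF perm(2)] by simp
    show "permute_list (inv t) (permute_list t g) = g"
      using permute_list_compose[OF t(2), of t] permutes_inv_o[OF perm(2)] by simp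
    show "\<Phi> ((?G, map s f), (H, permute_list t (permute_list (inv t) g))) = \<Phi> ((?G, map s f), (H, g))"
      unfolding a ..
    show "permute_list t g \<in> attachments H G" "permute_list (inv t) g \<in> attachments H G"
      using permute_attachments[OF _ g] G permutes_inv by blast+
  qed
  also have "\<dots> = (\<Sum>f\<in>attachments G H. \<Sum>g\<in>attachments H G. or_sign c (length es) s t F * \<Phi> ((G, f), (H, g)))"
    by (intro sum.cong refl step)
  also have "\<dots> = or_sign c (length es) s t F * flat \<Phi> (G, H)"
    by (simp add: flat_def sum_distrib_left)
  finally show "flat \<Phi> ((fst G, act_edges s t F (snd G)), H) = or_sign c (length (snd G)) s t F * flat \<Phi> (G, H)"
    by (simp add: GG)
qed

lemma flat_swap: "flat (\<Phi> \<circ> prod.swap) (H, G) = flat \<Phi> (G, H)"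
  unfolding flat_def prod.case comp_apply prod.swap_def fst_conv snd_conv by (rule sum.swap)

text \<open>For a fixed second graph, \<open>flat \<Phi>\<close> is an equivariant functional on the
  first one and therefore kills \<open>a\<close>. The pairing with the tensor is a combination of
  such rows with coefficients from \<open>b\<close>.\<close>

lemma flat_kills:
  fixes \<Phi> :: "'k::field_char_0 efun"
  assumes F: "FS \<Phi>" and E: "EQ1 c \<Phi>" and supp: "\<And>X. \<Phi> X \<noteq> 0 \<Longrightarrow> wfp X" and a: "a \<in> nul (GC c) i"
  shows "pr (flat \<Phi>) (otimes a b) = 0"
proof -
  have F2: "FS (flat \<Phi>)" by (rule FS_flat[OF F])
  let ?S = "{X. flat \<Phi> X \<noteq> 0}"
  have S: "finite ?S" using F2 by (simp add: FS_def)
  have ac: "a \<in> crr (GC c) i" using a nul_GC by blast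
  have row: "pr (\<lambda>G. flat \<Phi> (G, H)) a = 0" for H
  proof -
    let ?\<phi> = "\<lambda>G. if GC_graph G then flat \<Phi> (G, H) else 0"
    have "FS ?\<phi>"
      unfolding FS_def by (rule finite_subset[OF _ finite_imageI[OF S, of fst]]) (auto split: if_splits intro!: image_eqI[of _ fst "(_, H)"])
    moreover have "gEQ c ?\<phi>"
      unfolding gEQ_def
    proof (intro allI impI)
      fix G s t F assume G: "wf_graph G" "s permutes {..<fst G}" "t permutes {..<length (snd G)}"
      let ?G = "(fst G, act_edges s t F (snd G))"
      have iff: "GC_graph ?G \<longleftrightarrow> GC_graph G"
      proof
        assume g: "GC_graph ?G"
        have "GC_graph (fst ?G, act_edges (inv s) (inv t) (\<lambda>i. F (inv t i)) (snd ?G))"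
          by (rule GC_graph_act[OF g]) (use G permutes_inv in auto)
        moreover have "jp (fst ?G, act_edges (inv s) (inv t) (\<lambda>i. F (inv t i)) (snd ?G)) = jp G"
          using act1_inverse[of "jp G" s t F] act1_jp[OF G(3), of s F]
            act1_jp[of "inv t" ?G "inv s" "\<lambda>i. F (inv t i)"] G permutes_inv[OF G(3)] wfp_jp by simp
        ultimately show "GC_graph G" using injD[OF inj_jp] by metis
      qed (rule GC_graph_act[OF _ G(2,3)])
      have "flat \<Phi> (?G, H) = or_sign c (length (snd G)) s t F * flat \<Phi> (G, H)"
        using gEQ_flat[OF E supp, of H] G unfolding gEQ_def by blast
      then show "(if GC_graph ?G then flat \<Phi> (?G, H) else 0) =
          or_sign c (length (snd G)) s t F * (if GC_graph G then flat \<Phi> (G, H) else 0)"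
        unfolding iff by simp
    qed
    ultimately have "?\<phi> \<in> Fun1 c" unfolding Fun1_def by (simp split: if_splits)
    then have "pr ?\<phi> a = 0" using a ac nul_GC_iff by blast
    moreover have "pr ?\<phi> a = pr (\<lambda>G. flat \<Phi> (G, H)) a"
      by (rule pr_cong_left) (use ac in \<open>simp add: crr_GC\<close>)
    ultimately show ?thesis by simp
  qed
  have "pr (flat \<Phi>) (otimes a b) = (\<Sum>X\<in>fst ` ?S \<times> snd ` ?S. flat \<Phi> X * otimes a b X)"
    by (rule pr_sum) (use S in force)+
  also have "\<dots> = (\<Sum>G\<in>fst ` ?S. \<Sum>H\<in>snd ` ?S. b H * (flat \<Phi> (G, H) * a G))"
    unfolding sum.cartesian_product by (rule sum.cong) (auto simp: otimes_def)
  also have "\<dots> = (\<Sum>H\<in>snd ` ?S. b H * (\<Sum>G\<in>fst ` ?S. flat \<Phi> (G, H) * a G))"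
    unfolding sum_distrib_left by (rule sum.swap)
  also have "\<dots> = 0"
  proof (rule sum.neutral, rule ballI)
    fix H
    have "pr (\<lambda>G. flat \<Phi> (G, H)) a = (\<Sum>G\<in>fst ` ?S. flat \<Phi> (G, H) * a G)"
      by (rule pr_sum) (use S in force)+
    then show "b H * (\<Sum>G\<in>fst ` ?S. flat \<Phi> (G, H) * a G) = 0" using row[of H] by simp
  qed
  finally show ?thesis .
qed

lemma pr_flat_swap: "pr (flat (\<Phi> \<circ> prod.swap)) (otimes b a) = pr (flat \<Phi>) (otimes a b)"
  unfolding pr_def
  by (rule sum.reindex_bij_witness[of _ prod.swap prod.swap])
    (auto simp: otimes_def flat_swap mult.commute)

lemma Fun2_kills:
  assumes P: "\<Phi> \<in> Fun2 c d" and "a \<in> nul (GC c) i \<or> b \<in> nul (GC d) j"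
  shows "pr \<Phi> (Sym (otimes a b)) = 0"
proof -
  have "pr \<Phi> (Sym (otimes a b)) = pr (flat \<Phi>) (otimes a b)"
    using pr_Sym[of \<Phi> "otimes a b", OF Fun2D(2)[OF P]] pr_hat[OF Fun2D(1,4)[OF P], of "otimes a b"] by simp
  also have "\<dots> = 0"
    using assms(2)
  proof
    assume "a \<in> nul (GC c) i"
    then show ?thesis using flat_kills[OF Fun2D(1)[OF P] _ Fun2D(4)[OF P]] Fun2D(5)[OF P] unfolding EQ_def by blast
  next
    assume b: "b \<in> nul (GC d) j"
    have "wfp X" if "(\<Phi> \<circ> prod.swap) X \<noteq> 0" for X using Fun2D(4)[OF P, of "prod.swap X"] that by simp
    then show ?thesis
      using flat_kills[OF FS_swap[OF Fun2D(1)[OF P]] _ _ b, of a] Fun2D(5)[OF P]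
      unfolding EQ_def pr_flat_swap by blast
  qed
  finally show ?thesis .
qed

lemma tdif_otimes:
  assumes "a \<in> crr (GC c) i"
  shows "tdif c (otimes a b) = otimes (dGC a) b + scl (koszul i) (otimes a (dGC b))"
proof -
  have k: "koszul (gdeg c G) * a G = koszul i * a G" for G
    using assms unfolding crr_GC by (cases "a G = 0") auto
  have "dGC (\<lambda>G'. a G' * b H) G = dGC a G * b H" for G H
    unfolding lin_ext_def sum_distrib_right by (rule sum.cong) (auto simp: mult_ac)
  moreover have "dGC (\<lambda>H'. a G * b H') H = a G * dGC b H" for G H
    unfolding lin_ext_def sum_distrib_left by (rule sum.cong) (auto simp: mult_ac)
  ultimately show ?thesis
    by (auto simp: tdif_def otimes_def scl_def fun_eq_iff mult.assoc[symmetric] k)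
qed

lemma module_hom_Sym: "module_hom scl scl (Sym :: 'k::field_char_0 gpfun \<Rightarrow> 'k efun)"
  by (rule linear_module_hom[OF linear_Sym])

lemma Sym_linear:
  "Sym (x + y) = Sym x + (Sym y :: 'k::field_char_0 efun)"
  "Sym (x - y) = Sym x - (Sym y :: 'k efun)"
  "Sym (scl r x) = scl r (Sym x :: 'k efun)"
  "Sym 0 = (0 :: 'k efun)"
  using module_hom.add[OF module_hom_Sym] module_hom.diff[OF module_hom_Sym]
    module_hom.scale[OF module_hom_Sym] module_hom.zero[OF module_hom_Sym] by blast+

lemma span_image_subspace:
  assumes "module_hom scl scl F" "ser.subspace T" "\<And>x. x \<in> S \<Longrightarrow> F x \<in> T" "x \<in> spn S"
  shows "F x \<in> T"
proof -
  have "F x \<in> F ` spn S" using assms(4) by blast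
  also have "F ` spn S = spn (F ` S)" using module_hom.span_image[OF assms(1), of S] by simp
  also have "\<dots> \<subseteq> T" by (rule ser.span_minimal) (use assms in auto)
  finally show ?thesis .
qed

section \<open>\<open>Sym\<close> as a chain map, on chains and on cohomology\<close>

abbreviation TT :: "int \<Rightarrow> int \<Rightarrow> (graph \<times> graph, 'k::field_char_0) cpx" where
  "TT c d \<equiv> tensor (GC c) (GC d)"

abbreviation HT :: "int \<Rightarrow> int \<Rightarrow> (graph \<times> graph, 'k::field_char_0) cpx" where
  "HT c d \<equiv> tensor (cohomology (GC c)) (cohomology (GC d))"

lemma crr_tensor: "crr (tensor A B) p = spn {otimes x y | x y i. x \<in> crr A i \<and> y \<in> crr B (p - i)}"
  by (simp add: tensor_def)

lemma nul_tensor: "nul (tensor A B) p = spn {otimes x y | x y i. x \<in> crr A i \<and> y \<in> crr B (p - i) \<and>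
     (x \<in> nul A i \<or> y \<in> nul B (p - i))}"
  by (simp add: tensor_def)

lemma crr_cohomology: "x \<in> crr (cohomology A) p \<longleftrightarrow> x \<in> crr A p \<and> dif A x \<in> nul A (p + 1)"
  by (simp add: cohomology_def)

lemma nul_cohomology: "x \<in> nul (cohomology A) p \<longleftrightarrow> x \<in> crr A p \<and> (\<exists>y\<in>crr A (p - 1). x - dif A y \<in> nul A p)"
  by (simp add: cohomology_def)

lemma crr_TT_supp:
  assumes "x \<in> crr (TT c d) p" "x (G, H) \<noteq> 0"
  shows "GC_graph G \<and> GC_graph H \<and> gdeg c G + gdeg d H = p"
proof -
  have "x (G, H) \<noteq> 0 \<longrightarrow> GC_graph G \<and> GC_graph H \<and> gdeg c G + gdeg d H = p"
    using assms(1) unfolding crr_tensor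
  proof (induction rule: ser.span_induct_alt)
    case (step r z y)
    then obtain a b i where z: "z = otimes a b" "a \<in> crr (GC c) i" "b \<in> crr (GC d) (p - i)" by blast
    have "z (G, H) \<noteq> 0 \<longrightarrow> GC_graph G \<and> GC_graph H \<and> gdeg c G + gdeg d H = p"
      using z(2,3) unfolding z(1) crr_GC otimes_def by auto
    then show ?case using step(2) by (auto simp: scl_def)
  qed simp
  then show ?thesis using assms(2) by blast
qed

lemma Sym_crr_TT: "x \<in> crr (TT c d) p \<Longrightarrow> Sym x \<in> crr (fcGC c d) p"
  using Sym_crr[of x c d p] crr_TT_supp[of x c d p] by blast

lemma Sym_chain:
  assumes x: "x \<in> crr (TT c d) p" and Ck: "tdif c x \<in> crr (TT c d) (p + 1)"
  shows "lin_ext (delta c) (Sym x) - Sym (tdif c x) \<in> nul (GC2 c d) (p + 1)"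
proof -
  have 1: "lin_ext (delta c) (Sym x) \<in> crr (fcGC c d) (p + 1)"
    using is_complex_GC2[of c d, where 'k='a] Sym_crr_TT[OF x] unfolding is_complex_def dif_GC2 crr_GC2 by blast
  have 2: "Sym (tdif c x) \<in> crr (fcGC c d) (p + 1)" by (rule Sym_crr_TT[OF Ck])
  show ?thesis
    unfolding nul_GC2_eq
    using ser.subspace_diff[OF subspace_crr_fcGC 1 2] Fun2_Sym_dif by (auto simp: pr_diff Fun2D(1))
qed

lemma tdif_linear: "tdif c (scl r x + y) = scl r (tdif c x) + tdif c y"
proof -
  have "dGC (\<lambda>G'. (scl r x + y) (G', H)) G =
      r * dGC (\<lambda>G'. x (G', H)) G + dGC (\<lambda>G'. y (G', H)) G" for G H
    unfolding lin_ext_def sum_distrib_left sum.distrib[symmetric] by (simp add: scl_def algebra_simps)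
  moreover have "dGC (\<lambda>H'. (scl r x + y) (G, H')) H =
      r * dGC (\<lambda>H'. x (G, H')) H + dGC (\<lambda>H'. y (G, H')) H" for G H
    unfolding lin_ext_def sum_distrib_left sum.distrib[symmetric] by (simp add: scl_def algebra_simps)
  ultimately show ?thesis by (auto simp: tdif_def fun_eq_iff scl_def algebra_simps)
qed

lemma tdif_zero: "tdif c 0 = 0"
  by (auto simp: tdif_def fun_eq_iff lin_ext_def)

lemma tdif_crr:
  assumes "x \<in> crr (TT c d) p"
  shows "tdif c x \<in> crr (TT c d) (p + 1)"
  using assms unfolding crr_tensor
proof (induction rule: ser.span_induct_alt)
  case base
  show ?case unfolding tdif_zero by (rule ser.span_zero)
next
  case (step r z y)
  then obtain a b i where z: "z = otimes a b" "a \<in> crr (GC c) i" "b \<in> crr (GC d) (p - i)" by blast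
  let ?G = "{otimes x y | x y i. x \<in> crr (GC c) i \<and> y \<in> crr (GC d) (p + 1 - i)}"
  have e: "p + 1 - (i + 1) = p - i" "p - i + 1 = p + 1 - i" by simp_all
  have "otimes (dGC a) b \<in> ?G"
    using dif_GC_crr[OF z(2)] z(3) e(1) by (intro CollectI exI[of _ "dGC a"] exI[of _ b] exI[of _ "i + 1"]) simp
  moreover have "otimes a (dGC b) \<in> ?G"
    using dif_GC_crr[OF z(3)] z(2) e(2) by (intro CollectI exI[of _ "dGC b"] exI[of _ a] exI[of _ i]) simp
  ultimately have "tdif c z \<in> spn ?G"
    unfolding z(1) tdif_otimes[OF z(2)] by (intro ser.span_add ser.span_scale ser.span_base)
  then show ?case unfolding tdif_linear using step(2) by (intro ser.span_add ser.span_scale)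
qed

lemma subspace_nul_GC2: "ser.subspace (nul (GC2 c d :: (egraph, 'k::field_char_0) cpx) p)"
  using is_complex_GC2[of c d, where 'k='k] unfolding is_complex_def by blast

lemma chain_map_Sym: "chain_map (TT c d) (GC2 c d) (Sym :: 'k::field_char_0 gpfun \<Rightarrow> _)"
  unfolding chain_map_def
proof (intro conjI allI ballI)
  show "Vector_Spaces.linear scl scl (Sym :: 'k gpfun \<Rightarrow> _)" by (rule linear_Sym)
  fix p
  show "Sym ` crr (TT c d) p \<subseteq> crr (GC2 c d :: (egraph, 'k) cpx) p"
    unfolding crr_GC2 using Sym_crr_TT by blast
  show "Sym ` nul (TT c d) p \<subseteq> nul (GC2 c d :: (egraph, 'k) cpx) p"
  proof
    fix z :: "'k efun" assume "z \<in> Sym ` nul (TT c d) p"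
    then obtain x where x: "z = Sym x" "x \<in> nul (TT c d) p" by blast
    show "z \<in> nul (GC2 c d) p"
      unfolding x(1)
    proof (rule span_image_subspace[OF module_hom_Sym subspace_nul_GC2 _ x(2)[unfolded nul_tensor]])
      fix y :: "'k gpfun"
      assume "y \<in> {otimes x y | x y i. x \<in> crr (GC c) i \<and> y \<in> crr (GC d) (p - i) \<and>
        (x \<in> nul (GC c) i \<or> y \<in> nul (GC d) (p - i))}"
      then obtain a b i where y: "y = otimes a b" "a \<in> crr (GC c) i" "b \<in> crr (GC d) (p - i)"
        "a \<in> nul (GC c) i \<or> b \<in> nul (GC d) (p - i)" by blast
      have "y \<in> crr (TT c d) p" unfolding crr_tensor y(1) using y(2,3) by (intro ser.span_base) blast
      then show "Sym y \<in> nul (GC2 c d) p"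
        unfolding nul_GC2_eq using Sym_crr_TT Fun2_kills[OF _ y(4)] y(1) by blast
    qed
  qed
  fix x :: "'k gpfun" assume "x \<in> crr (TT c d) p"
  then show "dif (GC2 c d) (Sym x) - Sym (dif (TT c d) x) \<in> nul (GC2 c d :: (egraph, 'k) cpx) (p + 1)"
    unfolding dif_tensor dif_GC2 using Sym_chain tdif_crr by blast
qed

lemma crr_HT_subset: "crr (HT c d) p \<subseteq> crr (TT c d) p"
  unfolding crr_tensor crr_cohomology by (rule ser.span_mono) blast

lemma subspace_cohomology:
  assumes "is_complex A"
  shows "ser.subspace (crr (cohomology A) p)" "ser.subspace (nul (cohomology A) p)"
proof -
  have L: "module_hom scl scl (dif A)"
    by (rule linear_module_hom[OF conjunct1[OF assms[unfolded is_complex_def]]])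
  note l = module_hom.add[OF L] module_hom.scale[OF L] module_hom.zero[OF L]
  have S: "ser.subspace (crr A q)" "ser.subspace (nul A q)" for q
    using spec[OF conjunct2[OF assms[unfolded is_complex_def]], of q] by (simp_all only:)
  note s = ser.subspace_0[OF S(1)] ser.subspace_0[OF S(2)] ser.subspace_add[OF S(1)] ser.subspace_add[OF S(2)]
    ser.subspace_scale[OF S(1)] ser.subspace_scale[OF S(2)]
  show "ser.subspace (crr (cohomology A) p)"
    unfolding ser.subspace_def crr_cohomology
  proof (intro conjI ballI allI)
    show "0 \<in> crr A p" by (rule s)
    show "dif A 0 \<in> nul A (p + 1)" unfolding l(3) by (rule s)
  next
    fix x y assume "x \<in> crr (cohomology A) p" "y \<in> crr (cohomology A) p"
    then have xy: "x \<in> crr A p" "dif A x \<in> nul A (p + 1)" "y \<in> crr A p" "dif A y \<in> nul A (p + 1)"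
      unfolding crr_cohomology by blast+
    show "x + y \<in> crr A p" by (rule s(3)[OF xy(1,3)])
    show "dif A (x + y) \<in> nul A (p + 1)" unfolding l(1) by (rule s(4)[OF xy(2,4)])
  next
    fix r x assume "x \<in> crr (cohomology A) p"
    then have xy: "x \<in> crr A p" "dif A x \<in> nul A (p + 1)" unfolding crr_cohomology by blast+
    show "scl r x \<in> crr A p" by (rule s(5)[OF xy(1)])
    show "dif A (scl r x) \<in> nul A (p + 1)" unfolding l(2) by (rule s(6)[OF xy(2)])
  qed
  show "ser.subspace (nul (cohomology A) p)"
    unfolding ser.subspace_def nul_cohomology
  proof (intro conjI ballI allI)
    show "0 \<in> crr A p" by (rule s)
    show "\<exists>y\<in>crr A (p - 1). 0 - dif A y \<in> nul A p" proof (rule bexI)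
      show "0 - dif A 0 \<in> nul A p" unfolding l(3) using s(2) by simp
      show "0 \<in> crr A (p - 1)" by (rule s)
    qed
  next
    fix x y assume "x \<in> nul (cohomology A) p" "y \<in> nul (cohomology A) p"
    then obtain u v where u: "x \<in> crr A p" "u \<in> crr A (p - 1)" "x - dif A u \<in> nul A p"
      and v: "y \<in> crr A p" "v \<in> crr A (p - 1)" "y - dif A v \<in> nul A p" unfolding nul_cohomology by blast
    show "x + y \<in> crr A p" by (rule s(3)[OF u(1) v(1)])
    have "(x - dif A u) + (y - dif A v) \<in> nul A p" by (rule s(4)[OF u(3) v(3)])
    moreover have "(x - dif A u) + (y - dif A v) = x + y - dif A (u + v)" unfolding l(1) by (simp only: add_diff_add)
    ultimately show "\<exists>z\<in>crr A (p - 1). x + y - dif A z \<in> nul A p" using s(3)[OF u(2) v(2)] by metis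
  next
    fix r x assume "x \<in> nul (cohomology A) p"
    then obtain u where u: "x \<in> crr A p" "u \<in> crr A (p - 1)" "x - dif A u \<in> nul A p"
      unfolding nul_cohomology by blast
    show "scl r x \<in> crr A p" by (rule s(5)[OF u(1)])
    have "scl r (x - dif A u) \<in> nul A p" by (rule s(6)[OF u(3)])
    then have "scl r x - dif A (scl r u) \<in> nul A p" unfolding l(2) ser.scale_right_diff_distrib .
    then show "\<exists>z\<in>crr A (p - 1). scl r x - dif A z \<in> nul A p" using s(5)[OF u(2)] by blast
  qed
qed

lemma chain_map_Sym_cohomology:
  "chain_map (HT c d) (cohomology (GC2 c d)) (Sym :: 'k::field_char_0 gpfun \<Rightarrow> _)"
  unfolding chain_map_def
proof (intro conjI allI ballI)
  show "Vector_Spaces.linear scl scl (Sym :: 'k gpfun \<Rightarrow> _)" by (rule linear_Sym)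
  fix p
  have D: "lin_ext (delta c) (Sym x) \<in> crr (fcGC c d) (q + 1)" if "x \<in> crr (TT c d) q"
    for x :: "'k gpfun" and q
    using is_complex_GC2[of c d, where 'k='k] Sym_crr_TT[OF that] unfolding is_complex_def dif_GC2 crr_GC2 by blast
  show "Sym ` crr (HT c d) p \<subseteq> crr (cohomology (GC2 c d :: (egraph, 'k) cpx)) p"
  proof
    fix z :: "'k efun" assume "z \<in> Sym ` crr (HT c d) p"
    then obtain x where x: "z = Sym x" "x \<in> crr (HT c d) p" by blast
    show "z \<in> crr (cohomology (GC2 c d)) p"
      unfolding x(1)
    proof (rule span_image_subspace[OF module_hom_Sym subspace_cohomology(1)[OF is_complex_GC2] _ x(2)[unfolded crr_tensor]])
      fix y :: "'k gpfun"
      assume "y \<in> {otimes x y | x y i. x \<in> crr (cohomology (GC c)) i \<and> y \<in> crr (cohomology (GC d)) (p - i)}"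
      then obtain a b i where y: "y = otimes a b" "a \<in> crr (GC c) i" "b \<in> crr (GC d) (p - i)"
        "dGC a \<in> nul (GC c) (i + 1)" "dGC b \<in> nul (GC d) (p - i + 1)"
        unfolding crr_cohomology dif_GC by blast
      have yT: "y \<in> crr (TT c d) p" unfolding crr_tensor y(1) using y(2,3) by (intro ser.span_base) blast
      have "pr \<Phi> (lin_ext (delta c) (Sym y)) = 0" if P: "\<Phi> \<in> Fun2 c d" for \<Phi>
        unfolding Fun2_Sym_dif[OF P] unfolding y(1) tdif_otimes[OF y(2)] Sym_linear pr_add[OF Fun2D(1)[OF P]] pr_scl
        using Fun2_kills[OF P disjI1[OF y(4)]] Fun2_kills[OF P disjI2[OF y(5)]] by simp
      then show "Sym y \<in> crr (cohomology (GC2 c d)) p"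
        unfolding crr_cohomology crr_GC2 dif_GC2 nul_GC2_eq using Sym_crr_TT[OF yT] D[OF yT] by blast
    qed
  qed
  show "Sym ` nul (HT c d) p \<subseteq> nul (cohomology (GC2 c d :: (egraph, 'k) cpx)) p"
  proof
    fix z :: "'k efun" assume "z \<in> Sym ` nul (HT c d) p"
    then obtain x where x: "z = Sym x" "x \<in> nul (HT c d) p" by blast
    show "z \<in> nul (cohomology (GC2 c d)) p"
      unfolding x(1)
    proof (rule span_image_subspace[OF module_hom_Sym subspace_cohomology(2)[OF is_complex_GC2] _ x(2)[unfolded nul_tensor]])
      fix y :: "'k gpfun"
      assume "y \<in> {otimes x y | x y i. x \<in> crr (cohomology (GC c)) i \<and> y \<in> crr (cohomology (GC d)) (p - i) \<and>
        (x \<in> nul (cohomology (GC c)) i \<or> y \<in> nul (cohomology (GC d)) (p - i))}"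
      then obtain a b i where y: "y = otimes a b" "a \<in> crr (GC c) i" "b \<in> crr (GC d) (p - i)"
        "dGC a \<in> nul (GC c) (i + 1)" "dGC b \<in> nul (GC d) (p - i + 1)"
        "a \<in> nul (cohomology (GC c)) i \<or> b \<in> nul (cohomology (GC d)) (p - i)"
        unfolding crr_cohomology dif_GC by blast
      have yT: "y \<in> crr (TT c d) p" unfolding crr_tensor y(1) using y(2,3) by (intro ser.span_base) blast
      \<comment> \<open>If one factor of \<open>otimes a b\<close> is a coboundary and the other one
        a cocycle, the tensor is the coboundary of some \<open>w\<close>, up to tensors that
        \<open>Fun2\<close> does not see after \<open>Sym\<close>.\<close>
      have "\<exists>w\<in>crr (TT c d) (p - 1). \<forall>\<Phi>\<in>Fun2 c d. pr \<Phi> (Sym y - Sym (tdif c w)) = (0 :: 'k)"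
        using y(6)
      proof
        assume "a \<in> nul (cohomology (GC c)) i"
        then obtain u where u: "u \<in> crr (GC c) (i - 1)" "a - dGC u \<in> nul (GC c) i"
          unfolding nul_cohomology dif_GC by blast
        have "otimes u b \<in> crr (TT c d) (p - 1)"
          unfolding crr_tensor using u(1) y(3)
          by (intro ser.span_base CollectI exI[of _ u] exI[of _ b] exI[of _ "i - 1"]) simp
        moreover have "pr \<Phi> (Sym y - Sym (tdif c (otimes u b))) = (0 :: 'k)" if P: "\<Phi> \<in> Fun2 c d" for \<Phi>
        proof -
          have "y - tdif c (otimes u b) = otimes (a - dGC u) b - scl (koszul (i - 1)) (otimes u (dGC b))"
            unfolding tdif_otimes[OF u(1)] y(1) by (auto simp: otimes_def fun_eq_iff scl_def algebra_simps)
          then show ?thesis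
            unfolding Sym_linear(2)[symmetric]
            using Fun2_kills[OF P disjI1[OF u(2)]] Fun2_kills[OF P disjI2[OF y(5)]]
            by (simp only: Sym_linear pr_diff[OF Fun2D(1)[OF P]] pr_scl) simp
        qed
        ultimately show ?thesis by blast
      next
        assume "b \<in> nul (cohomology (GC d)) (p - i)"
        then obtain u where u: "u \<in> crr (GC d) (p - i - 1)" "b - dGC u \<in> nul (GC d) (p - i)"
          unfolding nul_cohomology dif_GC by blast
        \<comment> \<open>The factor \<open>koszul i\<close> compensates the sign with which the
          differential passes \<open>a\<close>.\<close>
        have "otimes (scl (koszul i) a) u \<in> crr (TT c d) (p - 1)"
          unfolding crr_tensor using u(1) y(2) ser.subspace_scale[OF subspace_crr_GC y(2), of "koszul i"]
          by (intro ser.span_base CollectI exI[of _ "scl (koszul i) a"] exI[of _ u] exI[of _ i]) (simp add: algebra_simps)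
        moreover have "pr \<Phi> (Sym y - Sym (tdif c (otimes (scl (koszul i) a) u))) = (0 :: 'k)" if P: "\<Phi> \<in> Fun2 c d" for \<Phi>
        proof -
          have ka: "scl (koszul i) a \<in> crr (GC c) i" by (rule ser.subspace_scale[OF subspace_crr_GC y(2)])
          have "dGC (scl (koszul i) a) = scl (koszul i) (dGC a)"
            using module_hom.scale[OF linear_module_hom[OF linear_lin_ext]] by blast
          then have "y - tdif c (otimes (scl (koszul i) a) u) =
              otimes a (b - dGC u) - scl (koszul i) (otimes (dGC a) u)"
            unfolding tdif_otimes[OF ka] y(1) using koszul_cases[of i, where 'k='k]
            by (elim disjE) (auto simp: otimes_def fun_eq_iff scl_def algebra_simps)
          then show ?thesis
            unfolding Sym_linear(2)[symmetric]
            using Fun2_kills[OF P disjI2[OF u(2)]] Fun2_kills[OF P disjI1[OF y(4)]]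
            by (simp only: Sym_linear pr_diff[OF Fun2D(1)[OF P]] pr_scl) simp
        qed
        ultimately show ?thesis by blast
      qed
      then obtain w where w: "w \<in> crr (TT c d) (p - 1)" "\<And>\<Phi>. \<Phi> \<in> Fun2 c d \<Longrightarrow> pr \<Phi> (Sym y - Sym (tdif c w)) = 0"
        by blast
      have "lin_ext (delta c) (Sym w) \<in> crr (fcGC c d) p" using D[OF w(1)] by simp
      then have "Sym y - lin_ext (delta c) (Sym w) \<in> crr (fcGC c d) p"
        by (rule ser.subspace_diff[OF subspace_crr_fcGC Sym_crr_TT[OF yT]])
      moreover have "pr \<Phi> (Sym y - lin_ext (delta c) (Sym w)) = 0" if P: "\<Phi> \<in> Fun2 c d" for \<Phi>
        using w(2)[OF P] Fun2_Sym_dif[OF P, of w] by (simp add: pr_diff[OF Fun2D(1)[OF P]])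
      ultimately show "Sym y \<in> nul (cohomology (GC2 c d)) p"
        unfolding nul_cohomology crr_GC2 dif_GC2 nul_GC2_eq
        using Sym_crr_TT[OF yT] Sym_crr_TT[OF w(1)] by blast
    qed
  qed
  fix x :: "'k gpfun"
  have "dif (HT c d) x = 0" by (auto simp: tensor_def cohomology_def fun_eq_iff)
  then have "dif (cohomology (GC2 c d)) (Sym x) - Sym (dif (HT c d) x) = (0 :: 'k efun)"
    by (simp add: Sym_linear cohomology_def)
  then show "dif (cohomology (GC2 c d)) (Sym x) - Sym (dif (HT c d) x) \<in> nul (cohomology (GC2 c d :: (egraph, 'k) cpx)) (p + 1)"
    using ser.subspace_0[OF subspace_cohomology(2)[OF is_complex_GC2]] by metis
qed

section \<open>The differential of equivariant functions as a sum over edges\<close>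

text \<open>Pairs of graphs from the two graph complexes with arbitrary hair positions. Contraction
  of an edge between different vertices and insertion of a bivalent vertex stay inside
  \<open>GP\<close>, also where the number of vertices drops below the bound in
  \<open>fcGC_pair\<close>.\<close>

definition GP :: "egraph \<Rightarrow> bool" where
  "GP X \<longleftrightarrow> wfp X \<and> GC_graph (fst (fst X)) \<and> GC_graph (fst (snd X))"

text \<open>Such functions occur in both roles, as functionals and as elements. Being finitely
  supported they can be paired with one another, and this pairing is nondegenerate
  (\<open>eqf_nondegenerate\<close>).\<close>

definition eqf :: "int \<Rightarrow> int \<Rightarrow> 'k::field_char_0 efun \<Rightarrow> bool" where
  "eqf c d y \<longleftrightarrow> FS y \<and> (\<forall>X. y X \<noteq> 0 \<longrightarrow> GP X) \<and> EQ c d y"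

lemma eqfD:
  assumes "eqf c d y"
  shows "FS y" "\<And>X. y X \<noteq> 0 \<Longrightarrow> GP X" "EQ c d y" "EQ1 c y" "\<And>X. y X \<noteq> 0 \<Longrightarrow> wfp X"
  using assms unfolding eqf_def EQ_def GP_def by blast+

lemma GP_swap [simp]: "GP (prod.swap X) \<longleftrightarrow> GP X"
  by (auto simp: GP_def)

lemma eqf_swap: "eqf c d y \<Longrightarrow> eqf d c (y \<circ> prod.swap)"
  unfolding eqf_def using FS_swap[of y] EQ_swap[of c d y] GP_swap by (metis comp_apply)

lemma GP_nonuniv: "GP X \<Longrightarrow> nonuniv X"
  by (simp add: GP_def nonuniv_def GC_graph_not_univalent)

lemma GP_wfp: "GP X \<Longrightarrow> wfp X"
  by (simp add: GP_def)

lemma fst_act1: "fst (fst (act1 s t F X)) = (nv1 X, act_edges s t F (snd (fst (fst X))))"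
proof -
  obtain n es f H g where X: "X = (((n, es), f), (H, g))" by (metis prod.exhaust)
  show ?thesis by (simp add: X)
qed

lemma GP_act1:
  assumes "GP X" "s permutes {..<nv1 X}" "t permutes {..<ne1 X}"
  shows "GP (act1 s t F X)"
  using assms wfp_act1[of X s t F] GC_graph_act[of "fst (fst X)" s t F] unfolding GP_def fst_act1 by simp

lemma GP_act1_iff:
  assumes "wfp X" "s permutes {..<nv1 X}" "t permutes {..<ne1 X}"
  shows "GP (act1 s t F X) \<longleftrightarrow> GP X"
proof
  assume "GP (act1 s t F X)"
  then have "GP (act1 (inv s) (inv t) (\<lambda>i. F (inv t i)) (act1 s t F X))"
    by (rule GP_act1) (use assms permutes_inv in \<open>simp_all only: sizes_act1\<close>)
  then show "GP X" unfolding act1_inverse[OF assms] .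
qed (rule GP_act1[OF _ assms(2,3)])

lemma GP_contract1:
  assumes "std1 X" "wfp X" "nonuniv X"
  shows "GP (contract1 X) \<longleftrightarrow> GP X"
  using assms GC_graph_contract[of "fst (fst X)"] wfp_graphs[OF assms(2)] fst_contract1[of X] wfp_contract1[OF assms(1,2)]
  unfolding GP_def nonuniv_def by simp

text \<open>The group changes \<open>u\<close> only by signs, so it preserves the set where
  \<open>u\<close> is \<open>a\<close> or \<open>- a\<close>.\<close>

lemma EQ1_restrict_abs:
  fixes u :: "'k::field_char_0 efun"
  assumes E: "EQ1 c u"
  shows "EQ1 c (\<lambda>Z. if u Z = a \<or> u Z = - a then u Z else 0)"
proof (rule EQ1_restrict[OF E])
  fix X s t F assume X: "wfp X" "s permutes {..<nv1 X}" "t permutes {..<ne1 X}"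
  show "u (act1 s t F X) = a \<or> u (act1 s t F X) = - a \<longleftrightarrow> u X = a \<or> u X = - a"
    using EQ1D[OF E X, of F] or_sign_pm[of c "ne1 X" s t F, where 'k='k] by (auto simp: minus_equation_iff)
qed

text \<open>
  The restriction of \<open>y\<close> to the set where it takes the values \<open>\<plusminus> y X\<close> is equivariant, and its pairing with \<open>y\<close> is
  a positive multiple of the square of \<open>y X\<close>.
\<close>

lemma eqf_nondegenerate:
  fixes y :: "'k::field_char_0 efun"
  assumes y: "eqf c d y" and z: "\<And>\<Phi>. eqf c d \<Phi> \<Longrightarrow> pr \<Phi> y = 0"
  shows "y X = 0"
proof (rule ccontr)
  assume n: "y X \<noteq> 0"
  let ?P = "\<lambda>Z. if y Z = y X \<or> y Z = - y X then y Z else 0"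
  have F: "FS ?P" by (rule FS_mono[OF eqfD(1)[OF y]]) (simp split: if_splits)
  have "EQ1 d (?P \<circ> prod.swap)"
    using EQ1_restrict_abs[OF eqfD(4)[OF eqf_swap[OF y]], of "y X"] by (simp only: comp_def)
  then have "eqf c d ?P"
    using F eqfD(2)[OF y] EQ1_restrict_abs[OF eqfD(4)[OF y], of "y X"] unfolding eqf_def EQ_def by auto
  from z[OF this] have "0 = (\<Sum>Z | ?P Z \<noteq> 0. ?P Z * y Z)" unfolding pr_left[OF F] by simp
  also have "\<dots> = (\<Sum>Z | ?P Z \<noteq> 0. y X * y X)" by (rule sum.cong) (auto split: if_splits)
  also have "\<dots> = of_nat (card {Z. ?P Z \<noteq> 0}) * (y X * y X)" by simp
  finally have "card {Z. ?P Z \<noteq> 0} = 0" using n by simp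
  moreover have "X \<in> {Z. ?P Z \<noteq> 0}" using n by simp
  ultimately show False using F unfolding FS_def card_eq_0_iff by blast
qed

text \<open>Cutting an equivariant representative down to \<open>GP\<close> changes no pairing with
  a function from \<open>eqf\<close>, as these vanish elsewhere.\<close>

lemma eqf_representative:
  fixes y :: "'k::field_char_0 efun"
  assumes y: "FS y" "\<And>X. y X \<noteq> 0 \<Longrightarrow> fcGC_pair X \<and> P (esize X)"
  obtains y' where "eqf c d y'" "\<And>\<Phi>. eqf c d \<Phi> \<Longrightarrow> pr \<Phi> y' = pr \<Phi> y" "\<And>X. y' X \<noteq> 0 \<Longrightarrow> P (esize X)"
proof -
  note th = that
  obtain y' where y': "FS y'" "\<And>Y. y' Y \<noteq> 0 \<Longrightarrow> fcGC_pair Y \<and> P (esize Y)"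
    "\<And>r. r \<in> fcGC_rel c d \<Longrightarrow> pr y' r = 0" "y - y' \<in> spn (fcGC_rel c d)"
    by (rule equivariant_representative[where R = "fcGC_rel c d" and V = fcGC_pair and sz = esize and P = P,
          OF fcGC_rel_cases finite_fcGC_esize y]) blast+
  let ?z = "\<lambda>X. if GP X then y' X else 0"
  have "EQ c d y'" using EQ_iff_rel[of y' c d] y'(2,3) by blast
  then have "EQ c d ?z" by (rule EQ_restrict) (simp_all add: GP_act1_iff)
  moreover have "FS ?z" by (rule FS_mono[OF y'(1)]) (simp split: if_splits)
  ultimately have "eqf c d ?z" unfolding eqf_def by simp
  moreover have "pr \<Phi> ?z = pr \<Phi> y" if E: "eqf c d \<Phi>" for \<Phi> :: "'k efun"
  proof -
    let ?Q = "\<lambda>X. if fcGC_pair X then \<Phi> X else 0"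
    have Q: "?Q \<in> Fun2 c d"
      by (rule restrict_fcGC_Fun2[OF eqfD(1,3)[OF E]]) (use eqfD(2)[OF E] GP_nonuniv in blast)
    have FS: "FS r" if rr: "r \<in> fcGC_rel c d" for r :: "'k efun"
    proof -
      obtain X Y e where r: "r = bas X - scl e (bas Y)" using fcGC_rel_cases[OF rr] by blast
      show ?thesis unfolding r by (intro FS_diff FS_scl FS_bas)
    qed
    have "pr ?Q (y - y') = 0"
      using pr_span_zero(1)[OF FS _ y'(4), of ?Q] EQ_iff_rel[of ?Q c d] Fun2D(2,5)[OF Q] by blast
    moreover have "pr ?Q u = pr \<Phi> u" if "\<And>X. u X \<noteq> 0 \<Longrightarrow> fcGC_pair X" for u
      by (rule pr_cong_left) (use that in simp)
    ultimately have "pr \<Phi> y = pr \<Phi> y'" using pr_diff_FS[OF y(1) y'(1), of ?Q] y(2) y'(2) by simp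
    also have "\<dots> = pr \<Phi> ?z" by (rule pr_cong) (simp add: eqfD(2)[OF E])
    finally show ?thesis ..
  qed
  moreover have "P (esize X)" if "?z X \<noteq> 0" for X using that y'(2)[of X] by (simp split: if_splits)
  ultimately show ?thesis by (rule th[of ?z])
qed

abbreviation es1 :: "egraph \<Rightarrow> (nat \<times> nat) list" where "es1 X \<equiv> snd (fst (fst X))"

definition front :: "nat \<Rightarrow> egraph \<Rightarrow> egraph" where
  "front i X = act1 (tsp 0 (fst (es1 X ! i))) (tsp 0 i) noflip X"

definition front_sign :: "int \<Rightarrow> nat \<Rightarrow> egraph \<Rightarrow> 'k::field_char_0" where
  "front_sign c i X = or_sign c (ne1 X) (tsp 0 (fst (es1 X ! i))) (tsp 0 i) noflip"

definition nonloop :: "egraph \<Rightarrow> nat \<Rightarrow> bool" where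
  "nonloop X i \<longleftrightarrow> i < ne1 X \<and> fst (es1 X ! i) \<noteq> snd (es1 X ! i)"

text \<open>The signed value of \<open>y\<close> at the contraction of the edge \<open>i\<close>.
  For equivariant \<open>y\<close>, any other way of moving this edge to the front gives the same
  value (\<open>cval_choice\<close>).\<close>

definition cval :: "int \<Rightarrow> nat \<Rightarrow> 'k::field_char_0 efun \<Rightarrow> egraph \<Rightarrow> 'k" where
  "cval c i y X = front_sign c i X * y (contract1 (front i X))"

text \<open>The part of the differential that contracts edges of the first graph. A pair in standard
  position is \<open>front i X\<close> for exactly \<open>ne1 X\<close> times \<open>nv1 X\<close>
  choices of \<open>X\<close> and \<open>i\<close>, one for each place of the edge and each name of
  its source. Division by this number and by 2 matches the term \<open>(1 / 2) * up1\<close> of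
  \<open>bd\<close> (\<open>pr_d1\<close>).\<close>

definition d1 :: "int \<Rightarrow> 'k::field_char_0 efun \<Rightarrow> 'k efun" where
  "d1 c y X = (if GP X then 1 / (2 * of_nat (nv1 X) * of_nat (ne1 X)) * (\<Sum>i | nonloop X i. cval c i y X) else 0)"

lemma wfp_edge:
  assumes "wfp X" "i < ne1 X"
  shows "fst (es1 X ! i) < nv1 X" "snd (es1 X ! i) < nv1 X" "0 < nv1 X"
proof -
  obtain n es f m es' g where X: "X = (((n, es), f), ((m, es'), g))" by (metis prod.exhaust)
  have "es ! i \<in> {..<n} \<times> {..<n}" "0 < n" using assms nth_mem[of i es] unfolding X by auto
  then show "fst (es1 X ! i) < nv1 X" "snd (es1 X ! i) < nv1 X" "0 < nv1 X" unfolding X by auto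
qed

lemma front_perms:
  assumes "wfp X" "i < ne1 X"
  shows "tsp 0 (fst (es1 X ! i)) permutes {..<nv1 X}" "tsp 0 i permutes {..<ne1 X}"
  using wfp_edge[OF assms] assms(2) by (auto intro!: permutes_swap_id)

lemma std1_alt: "std1 X \<longleftrightarrow> 0 < ne1 X \<and> fst (es1 X ! 0) = 0 \<and> snd (es1 X ! 0) \<noteq> 0"
proof -
  obtain n es f H g where X: "X = (((n, es), f), (H, g))" by (metis prod.exhaust)
  show ?thesis by (cases es) (auto simp: X prod_eq_iff gr0_conv_Suc)
qed

lemma es1_act1: "i < ne1 X \<Longrightarrow> es1 (act1 s t F X) ! i = (if F i then prod.swap else id) (map_prod s s (es1 X ! t i))"
  by (simp add: fst_act1)

lemma std1_front:
  assumes "wfp X" "i < ne1 X"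
  shows "std1 (front i X) \<longleftrightarrow> nonloop X i"
proof -
  have "0 < ne1 X" by (rule le_less_trans[OF le0 assms(2)])
  then have "es1 (front i X) ! 0 = map_prod (tsp 0 (fst (es1 X ! i))) (tsp 0 (fst (es1 X ! i))) (es1 X ! i)"
    unfolding front_def by (subst es1_act1) simp_all
  then show ?thesis
    unfolding std1_alt nonloop_def using assms(2) by (auto simp: front_def Transposition.transpose_def split: if_splits)
qed

lemma wfp_front: "wfp X \<Longrightarrow> i < ne1 X \<Longrightarrow> wfp (front i X)"
  unfolding front_def by (intro wfp_act1 front_perms)

lemma GP_front: "GP X \<Longrightarrow> i < ne1 X \<Longrightarrow> GP (front i X)"
  unfolding front_def by (intro GP_act1 front_perms GP_wfp)

lemma GP_contract_front: "GP X \<Longrightarrow> nonloop X i \<Longrightarrow> GP (contract1 (front i X))"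
  using GP_front[of X i] GP_contract1[of "front i X"] std1_front[of X i] GP_wfp GP_nonuniv
  unfolding nonloop_def by blast

lemma sizes_front [simp]: "nv1 (front i X) = nv1 X" "ne1 (front i X) = ne1 X" "fst (snd (front i X)) = fst (snd X)"
  by (simp_all add: front_def)

lemma finite_nonloop [simp]: "finite {i. nonloop X i}"
  by (rule finite_subset[of _ "{..<ne1 X}"]) (auto simp: nonloop_def)

lemma front_inverse:
  assumes "std1 Z" "wfp Z" "i < ne1 Z" "a < nv1 Z"
  defines "Y \<equiv> act1 (tsp 0 a) (tsp 0 i) noflip Z"
  shows "front i Y = Z" "fst (es1 Y ! i) = a" "nonloop Y i"
proof -
  have e: "fst (es1 Z ! 0) = 0" "snd (es1 Z ! 0) \<noteq> 0" using assms(1) unfolding std1_alt by blast+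
  have ei: "es1 Y ! i = map_prod (tsp 0 a) (tsp 0 a) (es1 Z ! 0)"
    unfolding Y_def by (subst es1_act1[OF assms(3)]) simp
  show a: "fst (es1 Y ! i) = a" unfolding ei using e by (simp add: map_prod_def split_def)
  have t: "tsp 0 i permutes {..<ne1 Z}" using assms(3) by (intro permutes_swap_id) auto
  show "front i Y = Z"
    unfolding front_def a unfolding Y_def act1_act1[OF assms(2) t] by (simp only: transpose_comp_involutory simp_thms act1_id)
  have "snd (es1 Y ! i) \<noteq> a"
    unfolding ei using e(2) by (auto simp: Transposition.transpose_def map_prod_def split_def split: if_splits)
  then show "nonloop Y i" unfolding nonloop_def a using assms(3) by (simp add: Y_def)
qed

lemma pr_d1:
  fixes \<Phi> :: "'k::field_char_0 efun"
  assumes E: "EQ1 c \<Phi>" and F: "FS \<Phi>" and supp: "\<And>X. \<Phi> X \<noteq> 0 \<Longrightarrow> GP X"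
  shows "pr \<Phi> (d1 c y) = (1 / 2) * pr \<Phi> (up1 y)"
proof -
  let ?S = "{X. \<Phi> X \<noteq> 0}" and ?S1 = "{X. \<Phi> X \<noteq> 0 \<and> std1 X}"
  let ?T = "Sigma ?S (\<lambda>Y. {i. nonloop Y i})"
  let ?U = "Sigma ?S1 (\<lambda>Z. {..<ne1 Z} \<times> {..<nv1 Z})"
  let ?w = "\<lambda>X. 1 / (2 * of_nat (nv1 X) * of_nat (ne1 X)) :: 'k"
  have S: "finite ?S" "finite ?S1" using F unfolding FS_def by (auto intro: finite_subset[rotated])
  have w: "wfp X" if "\<Phi> X \<noteq> 0" for X using supp[OF that] by (rule GP_wfp)
  have cv: "\<Phi> Y * cval c i y Y = \<Phi> (front i Y) * y (contract1 (front i Y))" if "\<Phi> Y \<noteq> 0" "nonloop Y i" for Y i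
  proof -
    have i: "i < ne1 Y" using that(2) by (simp add: nonloop_def)
    have "\<Phi> (front i Y) = front_sign c i Y * \<Phi> Y"
      unfolding front_def front_sign_def by (rule EQ1D[OF E w[OF that(1)] front_perms[OF w[OF that(1)] i]])
    then show ?thesis unfolding cval_def by (simp add: mult_ac)
  qed
  have "pr \<Phi> (d1 c y) = (\<Sum>Y\<in>?S. \<Phi> Y * (?w Y * (\<Sum>i | nonloop Y i. cval c i y Y)))"
    unfolding pr_left[OF F] by (rule sum.cong) (use supp in \<open>auto simp: d1_def\<close>)
  also have "\<dots> = (\<Sum>Y\<in>?S. \<Sum>i | nonloop Y i. ?w Y * (\<Phi> (front i Y) * y (contract1 (front i Y))))"
    unfolding sum_distrib_left by (intro sum.cong refl) (use cv in \<open>simp add: mult.left_commute\<close>)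
  also have "\<dots> = (\<Sum>(Y, i)\<in>?T. ?w Y * (\<Phi> (front i Y) * y (contract1 (front i Y))))"
    by (rule sum.Sigma) (use S in auto)
  also have "\<dots> = (\<Sum>(Z, i, a)\<in>?U. ?w Z * (\<Phi> Z * y (contract1 Z)))"
  proof (rule sum.reindex_bij_witness[of _
      "\<lambda>(Z, i, a). (act1 (tsp 0 a) (tsp 0 i) noflip Z, i)"
      "\<lambda>(Y, i). (front i Y, i, fst (es1 Y ! i))"])
    fix T assume "T \<in> ?T"
    then obtain Y i where T: "T = (Y, i)" "\<Phi> Y \<noteq> 0" "nonloop Y i" by auto
    have i: "i < ne1 Y" using T(3) by (simp add: nonloop_def)
    note wY = w[OF T(2)]
    have "act1 (tsp 0 (fst (es1 Y ! i))) (tsp 0 i) noflip (front i Y) = Y"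
      unfolding front_def act1_act1[OF wY front_perms(2)[OF wY i]] by (simp only: transpose_comp_involutory simp_thms act1_id)
    then show "(\<lambda>(Z, i, a). (act1 (tsp 0 a) (tsp 0 i) noflip Z, i))
        ((\<lambda>(Y, i). (front i Y, i, fst (es1 Y ! i))) T) = T" unfolding T(1) prod.case by simp
    have "\<Phi> (front i Y) \<noteq> 0"
      unfolding front_def EQ1D[OF E wY front_perms[OF wY i]]
      using T(2) or_sign_sq[of c "ne1 Y" "tsp 0 (fst (es1 Y ! i))" "tsp 0 i" "\<lambda>_. False", where 'k='k]
      by auto
    then show "(\<lambda>(Y, i). (front i Y, i, fst (es1 Y ! i))) T \<in> ?U"
      unfolding T(1) prod.case using std1_front[OF wY i] T(3) i wfp_edge(1)[OF wY i] by simp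
    show "(case (case T of (Y, i) \<Rightarrow> (front i Y, i, fst (es1 Y ! i))) of (Z, i, a) \<Rightarrow> ?w Z * (\<Phi> Z * y (contract1 Z))) =
        (case T of (Y, i) \<Rightarrow> ?w Y * (\<Phi> (front i Y) * y (contract1 (front i Y))))"
      unfolding T(1) prod.case by simp
  next
    fix U assume "U \<in> ?U"
    then obtain Z i a where U: "U = (Z, i, a)" "\<Phi> Z \<noteq> 0" "std1 Z" "i < ne1 Z" "a < nv1 Z" by auto
    note wZ = w[OF U(2)]
    let ?Y = "act1 (tsp 0 a) (tsp 0 i) noflip Z"
    note fi = front_inverse[OF U(3) wZ U(4,5)]
    show "(\<lambda>(Y, i). (front i Y, i, fst (es1 Y ! i)))
        ((\<lambda>(Z, i, a). (act1 (tsp 0 a) (tsp 0 i) noflip Z, i)) U) = U"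
      unfolding U(1) prod.case fi(1,2) ..
    have p: "tsp 0 a permutes {..<nv1 Z}" "tsp 0 i permutes {..<ne1 Z}"
      using U(4,5) by (auto intro!: permutes_swap_id)
    have "\<Phi> ?Y \<noteq> 0"
      unfolding EQ1D[OF E wZ p] using U(2)
        or_sign_sq[of c "ne1 Z" "tsp 0 a" "tsp 0 i" "\<lambda>_. False", where 'k='k]
      by auto
    then show "(\<lambda>(Z, i, a). (act1 (tsp 0 a) (tsp 0 i) noflip Z, i)) U \<in> ?T"
      unfolding U(1) prod.case using fi(3) by simp
  qed
  also have "\<dots> = (\<Sum>Z\<in>?S1. \<Sum>ia\<in>{..<ne1 Z} \<times> {..<nv1 Z}. ?w Z * (\<Phi> Z * y (contract1 Z)))"
    using S by (subst sum.Sigma) (auto simp: split_def)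
  also have "\<dots> = (\<Sum>Z\<in>?S1. (1 / 2) * (\<Phi> Z * y (contract1 Z)))"
  proof (rule sum.cong[OF refl])
    fix Z assume "Z \<in> ?S1"
    then have "wfp Z" "0 < ne1 Z" using w std1_alt[of Z] by auto
    then have "0 < ne1 Z" "0 < nv1 Z" using wfp_edge(3) by blast+
    then show "(\<Sum>ia\<in>{..<ne1 Z} \<times> {..<nv1 Z}. ?w Z * (\<Phi> Z * y (contract1 Z))) = (1 / 2) * (\<Phi> Z * y (contract1 Z))"
      by (simp add: field_simps)
  qed
  also have "\<dots> = (1 / 2) * pr \<Phi> (up1 y)"
  proof -
    have "pr \<Phi> (up1 y) = (\<Sum>Z\<in>?S1. \<Phi> Z * up1 y Z)"
      by (rule pr_sum[OF S(2)]) (auto simp: up1_def split: if_splits)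
    also have "\<dots> = (\<Sum>Z\<in>?S1. \<Phi> Z * y (contract1 Z))" by (rule sum.cong) (auto simp: up1_def)
    finally show ?thesis by (simp add: sum_distrib_left)
  qed
  finally show ?thesis .
qed

lemma cval_choice:
  assumes "EQ1 c y" "wfp X" "nonloop X i" "s permutes {..<nv1 X}" "t permutes {..<ne1 X}" "t 0 = i"
    "std1 (act1 s t F X)"
  shows "cval c i y X = or_sign c (ne1 X) s t F * y (contract1 (act1 s t F X))"
proof -
  have i: "i < ne1 X" using assms(3) by (simp add: nonloop_def)
  show ?thesis
    unfolding cval_def front_sign_def front_def
    by (rule EQ1_contract_choice[OF assms(1,2) front_perms[OF assms(2) i] assms(4,5)])
      (use assms(3,6,7) std1_front[OF assms(2) i] in \<open>simp_all add: front_def\<close>)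
qed

lemma nonloop_act1:
  assumes "s permutes {..<nv1 X}" "t permutes {..<ne1 X}"
  shows "nonloop (act1 s t F X) i \<longleftrightarrow> nonloop X (t i)"
proof (cases "i < ne1 X")
  case True
  have inj: "s a = s b \<longleftrightarrow> a = b" for a b using permutes_inj[OF assms(1)] by (auto dest: injD)
  show ?thesis
    unfolding nonloop_def es1_act1[OF True] using True permutes_less[OF assms(2) True] inj
    by (auto simp: map_prod_def split_def)
next
  case False
  then have "t i = i" using permutes_not_in[OF assms(2)] by simp
  then show ?thesis using False by (simp add: nonloop_def)
qed

lemma cval_act1:
  assumes E: "EQ1 c y" and X: "wfp X" and p: "s permutes {..<nv1 X}" "t permutes {..<ne1 X}"
    and n: "nonloop X (t i)"
  shows "cval c i y (act1 s t F X) = or_sign c (ne1 X) s t F * (cval c (t i) y X :: 'k::field_char_0)"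
proof -
  let ?X = "act1 s t F X"
  have w: "wfp ?X" by (rule wfp_act1[OF X p])
  have nl: "nonloop ?X i" unfolding nonloop_act1[OF p] by (rule n)
  have i: "i < ne1 ?X" "i < ne1 X" using nl by (auto simp: nonloop_def)
  let ?a = "tsp 0 (fst (es1 ?X ! i))" and ?b = "tsp 0 i"
  have ab: "?a permutes {..<nv1 X}" "?b permutes {..<ne1 X}" using front_perms[OF w i(1)] by simp_all
  let ?F = "\<lambda>j. False \<noteq> F (?b j)"
  have eq: "front i ?X = act1 (?a \<circ> s) (t \<circ> ?b) ?F X"
    unfolding front_def by (rule act1_act1[OF X ab(2)])
  have "cval c (t i) y X = or_sign c (ne1 X) (?a \<circ> s) (t \<circ> ?b) ?F * y (contract1 (act1 (?a \<circ> s) (t \<circ> ?b) ?F X))"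
  proof (rule cval_choice[OF E X n])
    show "?a \<circ> s permutes {..<nv1 X}" "t \<circ> ?b permutes {..<ne1 X}" using permutes_compose p ab by blast+
    show "(t \<circ> ?b) 0 = t i" by simp
    show "std1 (act1 (?a \<circ> s) (t \<circ> ?b) ?F X)" using std1_front[OF w i(1)] nl unfolding eq by blast
  qed
  also have "or_sign c (ne1 X) (?a \<circ> s) (t \<circ> ?b) ?F = (front_sign c i ?X * or_sign c (ne1 X) s t F :: 'k)"
    unfolding front_sign_def sizes_act1 by (rule or_sign_comp[OF ab(1) p(1) ab(2) p(2)])
  finally have "or_sign c (ne1 X) s t F * cval c (t i) y X =
      (or_sign c (ne1 X) s t F * or_sign c (ne1 X) s t F) * cval c i y ?X"
    unfolding cval_def[of c i] eq by (simp only: mult_ac)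
  then show ?thesis by (simp only: or_sign_sq mult_1)
qed

lemma EQ1_d1:
  assumes E: "EQ1 c y"
  shows "EQ1 c (d1 c y)"
  unfolding EQ1_def
proof (intro allI impI)
  fix X s t F assume X: "wfp X" and p: "s permutes {..<nv1 X}" "t permutes {..<ne1 X}"
  have "(\<Sum>i | nonloop (act1 s t F X) i. cval c i y (act1 s t F X)) =
      (\<Sum>i | nonloop X (t i). or_sign c (ne1 X) s t F * cval c (t i) y X)"
    by (rule sum.cong) (auto simp: nonloop_act1[OF p] cval_act1[OF E X p])
  also have "\<dots> = (\<Sum>i | nonloop X i. or_sign c (ne1 X) s t F * cval c i y X)"
    by (rule sum.reindex_bij_witness[of _ "inv t" t]) (auto simp: permutes_inverses[OF p(2)])
  finally have S: "(\<Sum>i | nonloop (act1 s t F X) i. cval c i y (act1 s t F X)) =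
      or_sign c (ne1 X) s t F * (\<Sum>i | nonloop X i. cval c i y X)" unfolding sum_distrib_left .
  show "d1 c y (act1 s t F X) = or_sign c (ne1 X) s t F * d1 c y X"
    unfolding d1_def GP_act1_iff[OF X p] sizes_act1 S by (simp add: mult_ac)
qed

lemma act1_act2: "act1 s t F (act2 s' t' F' X) = act2 s' t' F' (act1 s t F X)"
  if "wfp X" "t permutes {..<ne1 X}" "t' permutes {..<ne2 X}"
proof -
  obtain n es f m es' g where X: "X = (((n, es), f), ((m, es'), g))" by (metis prod.exhaust)
  show ?thesis using that by (simp add: X permute_list_map)
qed

lemma fst_act2: "fst (fst (act2 s t F X)) = fst (fst X)"
  by simp

lemma EQ2D:
  assumes "EQ1 d (y \<circ> prod.swap)" "wfp X" "s permutes {..<nv2 X}" "t permutes {..<ne2 X}"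
  shows "y (act2 s t F X) = or_sign d (ne2 X) s t F * y X"
  using EQ1D[OF assms(1), of "prod.swap X" s t F] assms(2-4) by simp

lemma EQ2I:
  assumes "\<And>X s t F. wfp X \<Longrightarrow> s permutes {..<nv2 X} \<Longrightarrow> t permutes {..<ne2 X} \<Longrightarrow>
    y (act2 s t F X) = or_sign d (ne2 X) s t F * y X"
  shows "EQ1 d (y \<circ> prod.swap)"
  unfolding EQ1_def
proof (intro allI impI)
  fix X s t F assume "wfp X" "s permutes {..<nv1 X}" "t permutes {..<ne1 X}"
  then show "(y \<circ> prod.swap) (act1 s t F X) = or_sign d (ne1 X) s t F * (y \<circ> prod.swap) X"
    using assms[of "prod.swap X" s t F] by simp
qed

lemma GP_act2_iff:
  assumes "wfp X" "s permutes {..<nv2 X}" "t permutes {..<ne2 X}"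
  shows "GP (act2 s t F X) \<longleftrightarrow> GP X"
  using GP_act1_iff[of "prod.swap X" s t F] assms by simp

lemma EQ2_d1:
  assumes E: "EQ1 d (y \<circ> prod.swap)"
  shows "EQ1 d (d1 c y \<circ> prod.swap)"
proof (rule EQ2I)
  fix X s t F assume X: "wfp X" and p: "s permutes {..<nv2 X}" "t permutes {..<ne2 X}"
  let ?o = "or_sign d (ne2 X) s t F"
  have cv: "cval c i y (act2 s t F X) = ?o * cval c i y X" if n: "nonloop X i" for i
  proof -
    have i: "i < ne1 X" using n by (simp add: nonloop_def)
    have "front i (act2 s t F X) = act2 s t F (front i X)"
      unfolding front_def fst_act2 by (rule act1_act2[OF X front_perms(2)[OF X i] p(2)])
    moreover have "contract1 (act2 s t F (front i X)) = act2 s t F (contract1 (front i X))"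
      by (rule contract1_act2(1)[OF wfp_front[OF X i]]) (use p in simp)
    moreover have "wfp (contract1 (front i X))"
      using wfp_contract1[of "front i X"] std1_front[OF X i] n wfp_front[OF X i] by blast
    ultimately show ?thesis
      unfolding cval_def using EQ2D[OF E, of "contract1 (front i X)" s t F] p
      by (simp add: front_sign_def mult_ac del: act1.simps contract1.simps)
  qed
  have nl: "nonloop (act2 s t F X) i \<longleftrightarrow> nonloop X i" for i by (simp add: nonloop_def)
  have S: "(\<Sum>i | nonloop (act2 s t F X) i. cval c i y (act2 s t F X)) = ?o * (\<Sum>i | nonloop X i. cval c i y X)"
    unfolding nl sum_distrib_left by (rule sum.cong) (use cv in auto)
  show "d1 c y (act2 s t F X) = ?o * d1 c y X"
    unfolding d1_def GP_act2_iff[OF X p] S unfolding fst_act2 by (simp add: mult_ac)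
qed

lemma FS_by_size:
  assumes "finite K" "\<And>X. z X \<noteq> 0 \<Longrightarrow> wfp X \<and> esize X \<in> K"
  shows "FS z"
  unfolding FS_def
proof (rule finite_subset)
  show "{X. z X \<noteq> 0} \<subseteq> (\<Union>k\<in>K. {X. wfp X \<and> esize X = k})" using assms(2) by blast
  show "finite (\<Union>k\<in>K. {X. wfp X \<and> esize X = k})" using assms(1) finite_wfp_esize by blast
qed

lemma esize_alt: "esize X = ((nv1 X, ne1 X), (nv2 X, ne2 X))"
proof -
  obtain n es f m es' g where X: "X = (((n, es), f), ((m, es'), g))" by (metis prod.exhaust)
  show ?thesis by (simp add: X)
qed

definition up_size :: "(nat \<times> nat) \<times> (nat \<times> nat) \<Rightarrow> (nat \<times> nat) \<times> (nat \<times> nat)" where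
  "up_size k = ((Suc (fst (fst k)), Suc (snd (fst k))), snd k)"

lemma esize_contract1: "std1 Z \<Longrightarrow> wfp Z \<Longrightarrow> esize Z = up_size (esize (contract1 Z))"
  using sizes_contract1[of Z] unfolding esize_alt up_size_def by simp

lemma d1_nonzero:
  assumes "d1 c y X \<noteq> 0"
  obtains i where "GP X" "nonloop X i" "y (contract1 (front i X)) \<noteq> 0" "esize X = up_size (esize (contract1 (front i X)))"
proof -
  note th = that
  have GP: "GP X" using assms by (auto simp: d1_def split: if_splits)
  have "\<exists>i. nonloop X i \<and> cval c i y X \<noteq> 0"
  proof (rule ccontr)
    assume "\<not> ?thesis"
    then have "(\<Sum>i | nonloop X i. cval c i y X) = 0" by (intro sum.neutral) blast
    then have "d1 c y X = 0" unfolding d1_def by (simp only: mult_zero_right if_cancel)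
    then show False using assms by simp
  qed
  then obtain i where i: "nonloop X i" "cval c i y X \<noteq> 0" by blast
  have i': "i < ne1 X" using i(1) by (simp add: nonloop_def)
  have "y (contract1 (front i X)) \<noteq> 0" using i(2) unfolding cval_def by auto
  moreover have "esize X = up_size (esize (contract1 (front i X)))"
    using esize_contract1[of "front i X"] std1_front[OF GP_wfp[OF GP] i'] i(1) wfp_front[OF GP_wfp[OF GP] i']
    by (simp add: front_def del: contract1.simps act1.simps)
  ultimately show ?thesis using th GP i(1) by blast
qed

lemma eqf_d1:
  assumes y: "eqf c d y"
  shows "eqf c d (d1 c y)"
proof -
  have "FS (d1 c y)"
  proof (rule FS_by_size)
    show "finite (up_size ` esize ` {X. y X \<noteq> 0})" using eqfD(1)[OF y] by (simp add: FS_def)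
    show "wfp X \<and> esize X \<in> up_size ` esize ` {X. y X \<noteq> 0}" if "d1 c y X \<noteq> 0" for X
      using that by (rule d1_nonzero) (use GP_wfp in blast)
  qed
  moreover have "EQ c d (d1 c y)" using EQ1_d1 EQ2_d1 eqfD(3)[OF y] unfolding EQ_def by blast
  moreover have "GP X" if "d1 c y X \<noteq> 0" for X using that by (rule d1_nonzero)
  ultimately show ?thesis unfolding eqf_def by blast
qed

section \<open>The contracting homotopy\<close>

text \<open>
  The homotopy inserts a bivalent vertex on an edge \<open>j\<close>, next to one of its ends: the new edge gets the average
  hair position, and \<open>j\<close> the difference of its hair position and the average. Contracting the new edge gives back
  \<open>j\<close> with this difference, and contracting \<open>j\<close> forgets its hair, hence gives zero.
\<close>

definition insert_vertex :: "nat \<Rightarrow> bool \<Rightarrow> nat \<Rightarrow> egraph \<Rightarrow> egraph" where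
  "insert_vertex j b w X =
     (split_vertex (endpoint (es1 X) (j, b)) {(j, b)} {} (fst X), add_hair w (snd X))"

definition upd :: "nat \<Rightarrow> nat \<Rightarrow> egraph \<Rightarrow> egraph" where
  "upd k w X = (fst X, (fst (snd X), (snd (snd X))[k := w]))"

definition avg :: "nat \<Rightarrow> (nat \<Rightarrow> 'k::field_char_0) \<Rightarrow> 'k" where
  "avg m a = 1 / of_nat m * (\<Sum>w<m. a w)"

text \<open>The projection complementary to averaging over the position of hair \<open>k\<close>. It
  measures the dependence on this position, and the projections for different hairs commute.\<close>

definition dev :: "nat \<Rightarrow> 'k::field_char_0 efun \<Rightarrow> 'k efun" where
  "dev k y X = y X - avg (nv2 X) (\<lambda>w. y (upd k w X))"

text \<open>The prefactor cancels the denominator of \<open>d1\<close> at pairs with one more vertex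
  and one more edge. The deviation has index \<open>Suc j\<close> since the new edge has taken
  position 0, and \<open>b\<close> selects the end of \<open>j\<close> next to which the vertex is
  inserted.\<close>

definition hmt :: "'k::field_char_0 efun \<Rightarrow> 'k efun" where
  "hmt y X = (if GP X then 2 * of_nat (Suc (nv1 X)) * of_nat (Suc (ne1 X)) *
     (\<Sum>j<ne1 X. \<Sum>b\<in>UNIV. avg (nv2 X) (\<lambda>w. dev (Suc j) y (insert_vertex j b w X))) else 0)"

lemma avg_cong: "(\<And>w. w < m \<Longrightarrow> a w = b w) \<Longrightarrow> avg m a = avg m b"
  by (simp add: avg_def)

lemma avg_const: "0 < m \<Longrightarrow> avg m (\<lambda>_. a) = a"
  by (simp add: avg_def)

lemma avg_mult: "avg m (\<lambda>w. r * a w) = r * avg m a"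
  by (simp add: avg_def sum_distrib_left mult.left_commute)

lemma avg_diff: "avg m (\<lambda>w. a w - b w) = avg m a - avg m b"
  by (simp add: avg_def sum_subtractf right_diff_distrib)

lemma avg_sum: "avg m (\<lambda>w. \<Sum>i\<in>I. a i w) = (\<Sum>i\<in>I. avg m (a i))"
  by (simp add: avg_def sum_distrib_left sum.swap[of _ I])

lemma avg_permute:
  assumes "s permutes {..<m}"
  shows "avg m (\<lambda>w. a (s w)) = avg m a"
  using sum.permute[OF assms, of a] by (simp add: avg_def comp_def)

lemma insert_vertex_eq:
  "insert_vertex j b w (((n, es), f), (H, g)) =
     (((Suc n, (0, Suc (endpoint es (j, b))) #
        map (\<lambda>i. (if i = j \<and> b then 0 else Suc (endpoint es (i, True)),
                  if i = j \<and> \<not> b then 0 else Suc (endpoint es (i, False)))) [0..<length es]), map Suc f), (H, w # g))"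
proof -
  have "split_hairs {} f = map Suc f"
    by (rule nth_equalityI) (auto simp: split_hairs_def)
  then show ?thesis
    by (simp add: insert_vertex_def split_vertex_def add_hair_def split_edges_def)
qed

lemma upd_eq: "upd k w (A, (H, g)) = (A, (H, g[k := w]))"
  by (simp add: upd_def)

lemma insert_vertex_contract:
  assumes "j < ne1 X"
  shows "std1 (insert_vertex j b w X)" "contract1 (insert_vertex j b w X) = X"
proof -
  have S: "{(j, b)} \<subseteq> half_edges (snd (fst (fst X))) (endpoint (es1 X) (j, b))"
    using assms by (simp add: half_edges_def)
  show "std1 (insert_vertex j b w X)" "contract1 (insert_vertex j b w X) = X"
    using contract1_split[of "{(j, b)}" "fst X" "endpoint (es1 X) (j, b)" "{}" w "snd X"] S
    unfolding insert_vertex_def by simp_all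
qed

lemma sizes_insert [simp]:
  "nv1 (insert_vertex j b w X) = Suc (nv1 X)" "ne1 (insert_vertex j b w X) = Suc (ne1 X)"
  "fst (snd (insert_vertex j b w X)) = fst (snd X)"
  by (simp_all add: insert_vertex_def split_vertex_def add_hair_def)

lemma sizes_upd [simp]: "fst (upd k w X) = fst X" "fst (snd (upd k w X)) = fst (snd X)"
  by (simp_all add: upd_def)

lemma wfp_upd: "wfp X \<Longrightarrow> w < nv2 X \<Longrightarrow> wfp (upd k w X)"
proof -
  obtain n es f m es' g where X: "X = (((n, es), f), ((m, es'), g))" by (metis prod.exhaust)
  show "wfp X \<Longrightarrow> w < nv2 X \<Longrightarrow> wfp (upd k w X)"
    using set_update_subset_insert[of g k w] unfolding X by (auto simp: upd_eq)
qed

lemma GP_upd: "GP X \<Longrightarrow> w < nv2 X \<Longrightarrow> GP (upd k w X)"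
  using wfp_upd unfolding GP_def by simp

lemma GP_nv2: "GP X \<Longrightarrow> 0 < nv2 X"
proof -
  obtain n es f m es' g where X: "X = (((n, es), f), ((m, es'), g))" by (metis prod.exhaust)
  show "GP X \<Longrightarrow> 0 < nv2 X" using GP_wfp[of X] by (auto simp: X)
qed

lemma wfp_insert:
  assumes "wfp X" "j < ne1 X" "w < nv2 X"
  shows "wfp (insert_vertex j b w X)"
proof -
  obtain n es f m es' g where X: "X = (((n, es), f), ((m, es'), g))" by (metis prod.exhaust)
  have "set es \<subseteq> {..<n} \<times> {..<n}" using assms(1) by (simp add: X)
  note e = endpoint_less[OF this]
  show ?thesis using assms e unfolding X insert_vertex_eq by auto
qed

text \<open>The new vertex is bivalent: it carries the moved half-edge and one of the new edge. The
  old vertices keep their valencies, so none is univalent, and \<open>GC_graph_contract\<close>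
  applies to the contraction of the new edge.\<close>

lemma GP_insert:
  assumes X: "GP X" and j: "j < ne1 X" "w < nv2 X"
  shows "GP (insert_vertex j b w X)"
proof -
  let ?Y = "insert_vertex j b w X"
  obtain n es where G: "fst (fst X) = (n, es)" by (metis prod.exhaust)
  let ?u = "endpoint es (j, b)"
  let ?S = "split_edges ?u {(j, b)} (n, es)"
  have GY: "fst (fst ?Y) = ?S" using G by (simp add: insert_vertex_def split_vertex_def)
  have j': "j < length es" using j(1) by (simp add: G)
  have sub: "{(j, b)} \<subseteq> half_edges (snd (n, es)) ?u" using j' by (simp add: half_edges_def)
  have GC: "GC_graph (n, es)" using X by (simp add: GP_def G)
  have wf: "set es \<subseteq> {..<n} \<times> {..<n}" using GC_graph_wf[OF GC] by (simp add: wf_graph_def)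
  have u: "?u < n" by (rule endpoint_less[OF wf j'])
  have w: "wfp ?Y" by (rule wfp_insert[OF GP_wfp[OF X] j])
  have wS: "wf_graph ?S" using wfp_graphs[OF w] GY by simp
  define es' where "es' = tl (snd ?S)"
  have S: "?S = (Suc n, (0, Suc ?u) # es')" unfolding es'_def by (simp add: prod_eq_iff snd_split_edges)
  have es'w: "set es' \<subseteq> {..<Suc n} \<times> {..<Suc n}" using wS unfolding S wf_graph_def by simp
  have m: "map (map_prod (merge ?u) (merge ?u)) es' = es" using merge_split_edges[OF sub] by (simp add: es'_def)
  have v0: "valency (Suc n, es') 0 = 1"
    using half_edges_split[OF sub] by (simp add: valency_def es'_def)
  have vc: "valency (n, es) v = (if v = ?u then valency (Suc n, es') 0 + valency (Suc n, es') (Suc ?u) else valency (Suc n, es') (Suc v))" for v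
    using valency_contract[OF es'w u, of v] unfolding m .
  have "valency ?S v \<noteq> 1" if v: "v < Suc n" for v
  proof (cases v)
    case 0
    then show ?thesis unfolding S valency_Cons[of _ _ _ _ _ "Suc n"] using v0 by simp
  next
    case (Suc x)
    then have "2 \<le> valency (n, es) x" using GC v by (simp add: GC_graph_def)
    then show ?thesis unfolding S valency_Cons[of _ _ _ _ _ "Suc n"] Suc using vc[of x] v0 by (auto split: if_splits)
  qed
  then have "\<not> has_univalent ?S" unfolding has_univalent_def by simp
  then have "GC_graph ?S" using GC_graph_contract[OF wS] gcontract_split[OF sub] GC by simp
  then show ?thesis using w X GY unfolding GP_def by simp
qed

lemma insert_act1:
  assumes "j < ne1 X" "t permutes {..<ne1 X}"
  shows "act1 (lift_perm s) (lift_perm t) (lift_flip F) (insert_vertex (t j) (b \<noteq> F j) w X) =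
    insert_vertex j b w (act1 s t F X)"
proof -
  obtain n es f H g where X: "X = (((n, es), f), (H, g))" by (metis prod.exhaust)
  have j: "j < length es" and t: "t permutes {..<length es}" using assms by (simp_all add: X)
  have inj: "t a = t c \<longleftrightarrow> a = c" for a c using permutes_inj[OF t] by (auto dest: injD)
  let ?L = "map (\<lambda>i. (if i = t j \<and> (b \<noteq> F j) then 0 else Suc (endpoint es (i, True)),
                  if i = t j \<and> \<not> (b \<noteq> F j) then 0 else Suc (endpoint es (i, False)))) [0..<length es]"
  let ?R = "map (\<lambda>i. (if i = j \<and> b then 0 else Suc (endpoint (act_edges s t F es) (i, True)),
                  if i = j \<and> \<not> b then 0 else Suc (endpoint (act_edges s t F es) (i, False)))) [0..<length es]"
  have "act_edges (lift_perm s) t F ?L = ?R"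
  proof (rule nth_equalityI)
    fix i assume "i < length (act_edges (lift_perm s) t F ?L)"
    then have i: "i < length es" by simp
    show "act_edges (lift_perm s) t F ?L ! i = ?R ! i"
      using i permutes_less[OF t i] endpoint_act_edges[OF i, of s t F] inj[of i j]
      by (cases "i = j"; cases b; cases "F i") auto
  qed simp
  moreover have "endpoint (act_edges s t F es) (j, b) = s (endpoint es (t j, b \<noteq> F j))"
    by (rule endpoint_act_edges[OF j])
  ultimately show ?thesis
    by (simp add: X insert_vertex_eq act_edges_Cons_lift permute_list_Cons_lift comp_def)
qed

lemma upd_act1:
  assumes "t permutes {..<ne1 X}" "wfp X" "k < ne1 X"
  shows "upd k w (act1 s t F X) = act1 s t F (upd (t k) w X)"
proof -
  obtain n es f m es' g where X: "X = (((n, es), f), ((m, es'), g))" by (metis prod.exhaust)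
  have t: "t permutes {..<length g}" and k: "k < length g" using assms by (auto simp: X)
  have inj: "t a = t c \<longleftrightarrow> a = c" for a c using permutes_inj[OF t] by (auto dest: injD)
  have t': "t permutes {..<length (g[t k := w])}" using t by simp
  have "(permute_list t g)[k := w] = permute_list t (g[t k := w])"
  proof (rule nth_equalityI)
    fix i assume "i < length ((permute_list t g)[k := w])"
    then have i: "i < length g" by simp
    show "(permute_list t g)[k := w] ! i = permute_list t (g[t k := w]) ! i"
      using i permutes_less[OF t i] permutes_less[OF t k] inj[of i k]
      by (cases "i = k") (simp_all add: permute_list_nth[OF t] permute_list_nth[OF t'])
  qed simp
  then show ?thesis by (simp add: X upd_eq)
qed

lemma dev_act1:
  fixes y :: "'k::field_char_0 efun"
  assumes E: "EQ1 c y" and X: "wfp X" "k < ne1 X" and p: "s permutes {..<nv1 X}" "t permutes {..<ne1 X}"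
  shows "dev k y (act1 s t F X) = or_sign c (ne1 X) s t F * dev (t k) y X"
proof -
  have u: "y (upd k w (act1 s t F X)) = or_sign c (ne1 X) s t F * y (upd (t k) w X)" if "w < nv2 X" for w
    unfolding upd_act1[OF p(2) X] using EQ1D[OF E wfp_upd[OF X(1) that], of s "t k" t F] p
      EQ1D[OF E wfp_upd[OF X(1) that, of "t k"], of s t F] by simp
  have "avg (nv2 (act1 s t F X)) (\<lambda>w. y (upd k w (act1 s t F X))) =
      or_sign c (ne1 X) s t F * avg (nv2 X) (\<lambda>w. y (upd (t k) w X))"
    unfolding sizes_act1 avg_mult[symmetric] by (rule avg_cong) (rule u)
  then show ?thesis
    unfolding dev_def[of k] dev_def[of "t k"] using EQ1D[OF E X(1) p, of F] by (simp add: right_diff_distrib)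
qed

lemma hmt_EQ1:
  fixes y :: "'k::field_char_0 efun"
  assumes E: "EQ1 c y"
  shows "EQ1 c (hmt y)"
  unfolding EQ1_def
proof (intro allI impI)
  fix X s t F assume X: "wfp X" and p: "s permutes {..<nv1 X}" "t permutes {..<ne1 X}"
  let ?o = "or_sign c (ne1 X) s t F :: 'k"
  let ?A = "\<lambda>j b X. avg (nv2 X) (\<lambda>w. dev (Suc j) y (insert_vertex j b w X))"
  have A: "?A j b (act1 s t F X) = ?o * ?A (t j) (b \<noteq> F j) X" if j: "j < ne1 X" for j b
    unfolding sizes_act1 avg_mult[symmetric]
  proof (rule avg_cong)
    fix w assume w: "w < nv2 X"
    have tj: "t j < ne1 X" by (rule permutes_less[OF p(2) j])
    have "dev (Suc j) y (act1 (lift_perm s) (lift_perm t) (lift_flip F) (insert_vertex (t j) (b \<noteq> F j) w X)) =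
      or_sign c (Suc (ne1 X)) (lift_perm s) (lift_perm t) (lift_flip F) * dev (lift_perm t (Suc j)) y (insert_vertex (t j) (b \<noteq> F j) w X)"
      using dev_act1[OF E wfp_insert[OF X tj w, of "b \<noteq> F j"], of "Suc j" "lift_perm s" "lift_perm t" "lift_flip F"]
        lift_perm_permutes[OF p(1)] lift_perm_permutes[OF p(2)] j by simp
    then show "dev (Suc j) y (insert_vertex j b w (act1 s t F X)) =
        ?o * dev (Suc (t j)) y (insert_vertex (t j) (b \<noteq> F j) w X)"
      unfolding insert_act1[OF j p(2)] or_sign_lift[OF p] lift_perm_simps .
  qed
  have "(\<Sum>j<ne1 X. \<Sum>b\<in>UNIV. ?A j b (act1 s t F X)) = (\<Sum>j<ne1 X. \<Sum>b\<in>UNIV. ?o * ?A (t j) (b \<noteq> F j) X)"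
    by (intro sum.cong refl A) simp
  also have "\<dots> = (\<Sum>j<ne1 X. \<Sum>b\<in>UNIV. ?o * ?A (t j) b X)"
  proof (rule sum.cong[OF refl])
    fix j show "(\<Sum>b\<in>UNIV. ?o * ?A (t j) (b \<noteq> F j) X) = (\<Sum>b\<in>UNIV. ?o * ?A (t j) b X)"
      by (cases "F j") (simp_all add: UNIV_bool add.commute)
  qed
  also have "\<dots> = (\<Sum>j<ne1 X. \<Sum>b\<in>UNIV. ?o * ?A j b X)"
    using sum.permute[OF p(2), of "\<lambda>j. \<Sum>b\<in>UNIV. ?o * ?A j b X"] by (simp add: comp_def)
  finally have S: "(\<Sum>j<ne1 X. \<Sum>b\<in>UNIV. ?A j b (act1 s t F X)) = ?o * (\<Sum>j<ne1 X. \<Sum>b\<in>UNIV. ?A j b X)"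
    unfolding sum_distrib_left .
  show "hmt y (act1 s t F X) = ?o * hmt y X"
    unfolding hmt_def GP_act1_iff[OF X p] using S by (simp add: mult_ac)
qed

lemma insert_act2:
  assumes "wfp X" "t permutes {..<ne2 X}"
  shows "insert_vertex j b (s w) (act2 s t F X) = act2 s t F (insert_vertex j b w X)"
proof -
  obtain n es f m es' g where X: "X = (((n, es), f), ((m, es'), g))" by (metis prod.exhaust)
  show ?thesis using assms by (simp add: X insert_vertex_eq permute_list_map)
qed

lemma upd_act2: "upd k (s w) (act2 s t F X) = act2 s t F (upd k w X)"
proof -
  obtain n es f m es' g where X: "X = (((n, es), f), ((m, es'), g))" by (metis prod.exhaust)
  show ?thesis by (simp add: X upd_eq map_update)
qed

lemma hmt_EQ2:
  fixes y :: "'k::field_char_0 efun"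
  assumes E: "EQ1 d (y \<circ> prod.swap)"
  shows "EQ1 d (hmt y \<circ> prod.swap)"
proof (rule EQ2I)
  fix X s t F
  assume X: "wfp X" and p: "s permutes {..<nv2 X}" "t permutes {..<ne2 X}"
  let ?o = "or_sign d (ne2 X) s t F :: 'k"
  have dv: "dev k y (act2 s t F Z) = ?o * dev k y Z" if Z: "wfp Z" "fst (snd Z) = fst (snd X)" for k Z
  proof -
    have u: "y (upd k (s w) (act2 s t F Z)) = ?o * y (upd k w Z)" if "w < nv2 X" for w
      unfolding upd_act2 using EQ2D[OF E, of "upd k w Z" s t F] wfp_upd[of Z w k] that Z p by simp
    have "avg (nv2 (act2 s t F Z)) (\<lambda>w. y (upd k w (act2 s t F Z))) = avg (nv2 X) (\<lambda>w. y (upd k w (act2 s t F Z)))"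
      by (simp add: Z(2))
    also have "\<dots> = avg (nv2 X) (\<lambda>w. y (upd k (s w) (act2 s t F Z)))" by (rule avg_permute[OF p(1), symmetric])
    also have "\<dots> = ?o * avg (nv2 Z) (\<lambda>w. y (upd k w Z))"
      unfolding avg_mult[symmetric] Z(2) by (rule avg_cong) (rule u)
    finally show ?thesis
      unfolding dev_def using EQ2D[OF E Z(1), of s t F] p Z(2) by (simp add: right_diff_distrib)
  qed
  let ?A = "\<lambda>j b X. avg (nv2 X) (\<lambda>w. dev (Suc j) y (insert_vertex j b w X))"
  have A: "?A j b (act2 s t F X) = ?o * ?A j b X" if j: "j < ne1 X" for j b
  proof -
    have "?A j b (act2 s t F X) = avg (nv2 X) (\<lambda>w. dev (Suc j) y (insert_vertex j b w (act2 s t F X)))" by simp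
    \<comment> \<open>The average over \<open>w\<close> absorbs the renumbering of the vertices of
      the second graph.\<close>
    also have "\<dots> = avg (nv2 X) (\<lambda>w. dev (Suc j) y (insert_vertex j b (s w) (act2 s t F X)))"
      by (rule avg_permute[OF p(1), symmetric])
    also have "\<dots> = ?o * ?A j b X"
      unfolding avg_mult[symmetric]
    proof (rule avg_cong)
      fix w assume "w < nv2 X"
      then have "wfp (insert_vertex j b w X)" by (rule wfp_insert[OF X j])
      then show "dev (Suc j) y (insert_vertex j b (s w) (act2 s t F X)) = ?o * dev (Suc j) y (insert_vertex j b w X)"
        unfolding insert_act2[OF X p(2)] by (rule dv) simp
    qed
    finally show ?thesis .
  qed
  have "(\<Sum>j<ne1 X. \<Sum>b\<in>UNIV. ?A j b (act2 s t F X)) = ?o * (\<Sum>j<ne1 X. \<Sum>b\<in>UNIV. ?A j b X)"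
    unfolding sum_distrib_left by (intro sum.cong refl A) simp
  then show "hmt y (act2 s t F X) = ?o * hmt y X"
    unfolding hmt_def GP_act2_iff[OF X p] by (simp add: mult_ac)
qed

lemma dev_nonzero: "dev k y X \<noteq> 0 \<Longrightarrow> y X \<noteq> 0 \<or> (\<exists>w<nv2 X. y (upd k w X) \<noteq> 0)"
proof (rule ccontr)
  assume d: "dev k y X \<noteq> 0" and "\<not> (y X \<noteq> 0 \<or> (\<exists>w<nv2 X. y (upd k w X) \<noteq> 0))"
  then have "y X = 0" "(\<Sum>w<nv2 X. y (upd k w X)) = 0" by (auto intro: sum.neutral)
  then show False using d unfolding dev_def avg_def by simp
qed

lemma esize_upd: "esize (upd k w X) = esize X"
  by (simp add: esize_alt)

lemma eqf_hmt:
  fixes y :: "'k::field_char_0 efun"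
  assumes y: "eqf c d y"
  shows "eqf c d (hmt y)"
proof -
  have "FS (hmt y)"
  proof (rule FS_by_size)
    let ?K = "(\<lambda>k. ((fst (fst k) - 1, snd (fst k) - 1), snd k)) ` esize ` {X. y X \<noteq> 0}"
    show "finite ?K" using eqfD(1)[OF y] by (simp add: FS_def)
    fix X assume nz: "hmt y X \<noteq> 0"
    have GP: "GP X" using nz by (auto simp: hmt_def split: if_splits)
    have "\<exists>j<ne1 X. \<exists>b. \<exists>w<nv2 X. dev (Suc j) y (insert_vertex j b w X) \<noteq> 0"
    proof (rule ccontr)
      assume n: "\<not> ?thesis"
      have "avg (nv2 X) (\<lambda>w. dev (Suc j) y (insert_vertex j b w X)) = 0" if "j < ne1 X" for j b
        unfolding avg_def using n that by (simp add: sum.neutral)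
      then have "hmt y X = 0" unfolding hmt_def by (simp add: sum.neutral)
      with nz show False by simp
    qed
    then obtain j b w where "dev (Suc j) y (insert_vertex j b w X) \<noteq> 0" by blast
    then obtain Z where Z: "y Z \<noteq> 0" "esize Z = esize (insert_vertex j b w X)"
      using dev_nonzero[of "Suc j" y "insert_vertex j b w X"] esize_upd by metis
    have "esize X = (\<lambda>k. ((fst (fst k) - 1, snd (fst k) - 1), snd k)) (esize Z)"
      by (simp only: Z(2)) (simp add: esize_alt)
    then show "wfp X \<and> esize X \<in> ?K" using GP_wfp[OF GP] Z(1) by blast
  qed
  moreover have "EQ c d (hmt y)" using hmt_EQ1 hmt_EQ2 eqfD(3)[OF y] unfolding EQ_def by blast
  moreover have "GP X" if "hmt y X \<noteq> 0" for X using that by (auto simp: hmt_def split: if_splits)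
  ultimately show ?thesis unfolding eqf_def by blast
qed

section \<open>Insertion of a vertex against contraction of an edge\<close>

lemma merge_transpose: "merge (Suc v) (tsp 0 1 (Suc x)) = Suc (merge v x)"
  "merge (Suc v) (tsp 0 1 0) = 0"
  by (cases x) (auto simp: Transposition.transpose_def merge_def)

text \<open>The new edge and the edge to be contracted both claim the first place. Exchanging the
  first two edges and the vertices 0 and 1 resolves this; as a group element it has sign -1, which
  is the sign in \<open>cval_insert_other\<close>.\<close>

lemma insert_vertex_exch:
  fixes b :: bool and w :: nat
  assumes Z: "std1 Z" "wfp Z" and j: "0 < j" "j < ne1 Z"
  defines "W \<equiv> act1 (tsp 0 1) (tsp 0 1) noflip (insert_vertex j b w Z)"
  shows "std1 W" "contract1 W = insert_vertex (j - 1) b w (contract1 Z)"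
proof -
  obtain n v es f m es' g g0 where ZZ: "Z = (((Suc n, (0, Suc v) # es), f), ((m, es'), g0 # g))"
    "contract1 Z = (((n, map (map_prod (merge v) (merge v)) es), map (merge v) f), ((m, es'), g))"
    using std1_cases[OF Z] by metis
  obtain j' where jj: "j = Suc j'" using j(1) by (cases j) auto
  have j': "j' < length es" using j(2) by (simp add: ZZ jj)
  let ?r = "tsp 0 (1::nat)"
  have ep: "endpoint (x # es) (Suc i, k) = endpoint es (i, k)" for x i k by (simp add: endpoint_def)
  let ?L = "map (\<lambda>i. (if i = j' \<and> b then 0 else Suc (endpoint es (i, True)),
                  if i = j' \<and> \<not> b then 0 else Suc (endpoint es (i, False)))) [0..<length es]"
  have up: "[0..<Suc (length es)] = 0 # map Suc [0..<length es]"
    by (simp only: upt_conv_Cons[OF zero_less_Suc] map_Suc_upt)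
  have e0: "endpoint ((0, Suc v) # es) (0, True) = 0" "endpoint ((0, Suc v) # es) (0, False) = Suc v"
    by (simp_all add: endpoint_def)
  have I: "insert_vertex j b w Z = (((Suc (Suc n), (0, Suc (endpoint es (j', b))) # (1, Suc (Suc v)) # ?L), map Suc f),
      ((m, es'), w # g0 # g))"
    unfolding ZZ insert_vertex_eq jj length_Cons up ep by (simp add: ep e0 comp_def del: upt_Suc)
  have W: "W = (((Suc (Suc n), (0, Suc (Suc v)) # (1, ?r (Suc (endpoint es (j', b)))) # map (map_prod ?r ?r) ?L),
      map ?r (map Suc f)), ((m, es'), g0 # w # g))"
    unfolding W_def I act1.simps act_edges_exch permute_list_exch by (simp add: Transposition.transpose_def)
  show "std1 W" unfolding W by simp
  have M: "merge (Suc v) (?r (Suc x)) = Suc (merge v x)" "merge (Suc v) (?r 0) = 0" "merge (Suc v) 1 = 0" for x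
    using merge_transpose[of v] by simp_all
  have "map (map_prod (merge (Suc v)) (merge (Suc v))) (map (map_prod ?r ?r) ?L) =
     map (\<lambda>i. (if i = j' \<and> b then 0 else Suc (endpoint (map (map_prod (merge v) (merge v)) es) (i, True)),
                  if i = j' \<and> \<not> b then 0 else Suc (endpoint (map (map_prod (merge v) (merge v)) es) (i, False)))) [0..<length es]"
    by (rule nth_equalityI) (auto simp: M[unfolded One_nat_def] endpoint_map simp del: transpose_apply_first transpose_apply_second)
  then show "contract1 W = insert_vertex (j - 1) b w (contract1 Z)"
    unfolding W ZZ(2) insert_vertex_eq jj using M[unfolded One_nat_def] endpoint_map[of "(j', b)" es "merge v"] j'
    by (simp add: comp_def)
qed

lemma nonloop_insert:
  assumes "wfp X" "j < ne1 X"
  shows "nonloop (insert_vertex j b w X) 0" "nonloop (insert_vertex j b w X) (Suc j)"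
    "i \<noteq> j \<Longrightarrow> nonloop (insert_vertex j b w X) (Suc i) \<longleftrightarrow> nonloop X i"
proof -
  obtain n es f H g where X: "X = (((n, es), f), (H, g))" by (metis prod.exhaust)
  show "nonloop (insert_vertex j b w X) 0" "nonloop (insert_vertex j b w X) (Suc j)"
    "i \<noteq> j \<Longrightarrow> nonloop (insert_vertex j b w X) (Suc i) \<longleftrightarrow> nonloop X i"
    using assms(2) by (auto simp: X insert_vertex_eq nonloop_def endpoint_def nth_append simp del: upt_Suc)
qed

text \<open>Insertion on \<open>j\<close> anticommutes with the contraction of another edge. The
  index \<open>tsp 0 i j - 1\<close> is the place of \<open>j\<close> after \<open>i\<close> has
  been exchanged with the first edge and removed.\<close>

lemma cval_insert_other:
  fixes y :: "'k::field_char_0 efun"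
  assumes E: "EQ1 c y" and X: "wfp X" "j < ne1 X" "w < nv2 X" and i: "nonloop X i" "i \<noteq> j"
  shows "cval c (Suc i) y (insert_vertex j b w X) =
    - front_sign c i X * y (insert_vertex (tsp 0 i j - 1) b w (contract1 (front i X)))"
proof -
  let ?Y = "insert_vertex j b w X"
  let ?s = "tsp 0 (fst (es1 X ! i))" and ?t = "tsp 0 i"
  let ?r = "tsp 0 (1::nat)"
  have i': "i < ne1 X" using i(1) by (simp add: nonloop_def)
  note p = front_perms[OF X(1) i']
  have tj: "?t j < ne1 X" "0 < ?t j" "?t (?t j) = j"
    using permutes_less[OF p(2) X(2)] i(2) by (auto simp: Transposition.transpose_def)
  have wY: "wfp ?Y" by (rule wfp_insert[OF X])
  have std: "std1 (front i X)" using std1_front[OF X(1) i'] i(1) by blast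
  have lift: "act1 (lift_perm ?s) (lift_perm ?t) (lift_flip noflip) ?Y = insert_vertex (?t j) b w (front i X)"
    using insert_act1[OF tj(1) p(2), of ?s "\<lambda>_. False" b w] unfolding tj(3) front_def by simp
  note lp = lift_perm_permutes[OF p(1)] lift_perm_permutes[OF p(2)]
  have r: "?r permutes {..<Suc (nv1 X)}" "?r permutes {..<Suc (ne1 X)}"
    using wfp_edge(3)[OF X(1) i'] X(2) by (auto intro!: permutes_swap_id)
  have comp: "act1 (?r \<circ> lift_perm ?s) (lift_perm ?t \<circ> ?r) (\<lambda>k. False \<noteq> lift_flip noflip (?r k)) ?Y =
      act1 ?r ?r noflip (insert_vertex (?t j) b w (front i X))"
    unfolding lift[symmetric] by (rule act1_act1[OF wY, symmetric]) (use r in simp)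
  have ex: "std1 (act1 ?r ?r noflip (insert_vertex (?t j) b w (front i X)))"
    "contract1 (act1 ?r ?r noflip (insert_vertex (?t j) b w (front i X))) = insert_vertex (?t j - 1) b w (contract1 (front i X))"
    using insert_vertex_exch[OF std wfp_front[OF X(1) i'] tj(2)] tj(1) by simp_all
  have sgn: "or_sign c (Suc (ne1 X)) (?r \<circ> lift_perm ?s) (lift_perm ?t \<circ> ?r) (\<lambda>k. False \<noteq> lift_flip noflip (?r k)) =
      (- front_sign c i X :: 'k)"
  proof -
    have "or_sign c (Suc (ne1 X)) ?r ?r noflip = (- 1 :: 'k)"
      by (simp add: or_sign_def vertex_sign_def edge_sign_def sign_swap_id)
    then show ?thesis
      using or_sign_comp[OF r(1) lp(1) r(2) lp(2), of c "\<lambda>_. False" "lift_flip noflip", where 'k='k]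
      unfolding or_sign_lift[OF p] front_sign_def by simp
  qed
  have "cval c (Suc i) y ?Y = or_sign c (ne1 ?Y) (?r \<circ> lift_perm ?s) (lift_perm ?t \<circ> ?r)
      (\<lambda>k. False \<noteq> lift_flip noflip (?r k)) *
    y (contract1 (act1 (?r \<circ> lift_perm ?s) (lift_perm ?t \<circ> ?r) (\<lambda>k. False \<noteq> lift_flip noflip (?r k)) ?Y))"
  proof (rule cval_choice[OF E wY])
    show "nonloop ?Y (Suc i)" using nonloop_insert(3)[OF X(1,2), of i b w] i by blast
    show "?r \<circ> lift_perm ?s permutes {..<nv1 ?Y}" "lift_perm ?t \<circ> ?r permutes {..<ne1 ?Y}"
      using permutes_compose lp r by simp_all
    show "(lift_perm ?t \<circ> ?r) 0 = Suc i" by simp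
    show "std1 (act1 (?r \<circ> lift_perm ?s) (lift_perm ?t \<circ> ?r) (\<lambda>k. False \<noteq> lift_flip noflip (?r k)) ?Y)"
      unfolding comp by (rule ex(1))
  qed
  then show ?thesis unfolding sizes_insert comp ex(2) sgn .
qed

lemma upd_insert: "insert_vertex j b w (upd k w' X) = upd (Suc k) w' (insert_vertex j b w X)"
proof -
  obtain n es f H g where X: "X = (((n, es), f), (H, g))" by (metis prod.exhaust)
  show ?thesis by (simp add: X insert_vertex_eq upd_eq)
qed

lemma upd_upd [simp]: "upd k w (upd k w' X) = upd k w X"
  by (simp add: upd_def)

lemma front_upd:
  assumes "wfp X" "i < ne1 X" "k < ne1 X"
  shows "front i (upd k w X) = upd (tsp 0 i k) w (front i X)"
proof -
  have k: "tsp 0 i k < ne1 X" by (rule permutes_less[OF front_perms(2)[OF assms(1,2)] assms(3)])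
  show ?thesis
    unfolding front_def sizes_upd using upd_act1[OF front_perms(2)[OF assms(1,2)] assms(1) k] by simp
qed

lemma contract1_upd: "contract1 (upd k w Z) = (if k = 0 then contract1 Z else upd (k - 1) w (contract1 Z))"
proof -
  obtain n es f H g where X: "Z = (((n, es), f), (H, g))" by (metis prod.exhaust)
  show ?thesis by (cases k; cases g) (simp_all add: X upd_eq)
qed

lemma fst_snd_contract1: "fst (snd (contract1 Z)) = fst (snd Z)"
proof -
  obtain n es f H g where X: "Z = (((n, es), f), (H, g))" by (metis prod.exhaust)
  show ?thesis by (simp add: X)
qed

text \<open>A contracted edge loses its hair. Hence contracting \<open>k\<close> itself gives a
  value that does not depend on the position of its hair, and the deviation of this value
  vanishes.\<close>

lemma contract_front_upd:
  assumes "wfp X" "i < ne1 X" "k < ne1 X"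
  shows "contract1 (front i (upd k w X)) =
    (if k = i then contract1 (front i X) else upd (tsp 0 i k - 1) w (contract1 (front i X)))"
  unfolding front_upd[OF assms] contract1_upd by (auto simp: Transposition.transpose_def)

lemma nonloop_upd: "nonloop (upd k w X) = nonloop X"
  by (simp add: nonloop_def fun_eq_iff)

lemma front_sign_upd: "front_sign c i (upd k w X) = front_sign c i X"
  by (simp add: front_sign_def)

definition cdev :: "int \<Rightarrow> nat \<Rightarrow> nat \<Rightarrow> 'k::field_char_0 efun \<Rightarrow> egraph \<Rightarrow> 'k" where
  "cdev c k i y X = cval c i y X - avg (nv2 X) (\<lambda>w. cval c i y (upd k w X))"

lemma dev_d1:
  fixes y :: "'k::field_char_0 efun"
  assumes X: "GP X"
  shows "dev k (d1 c y) X = 1 / (2 * of_nat (nv1 X) * of_nat (ne1 X)) * (\<Sum>i | nonloop X i. cdev c k i y X)"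
proof -
  let ?l = "1 / (2 * of_nat (nv1 X) * of_nat (ne1 X)) :: 'k"
  have "avg (nv2 X) (\<lambda>w. d1 c y (upd k w X)) = avg (nv2 X) (\<lambda>w. ?l * (\<Sum>i | nonloop X i. cval c i y (upd k w X)))"
    by (rule avg_cong) (simp add: d1_def GP_upd[OF X] nonloop_upd)
  also have "\<dots> = ?l * (\<Sum>i | nonloop X i. avg (nv2 X) (\<lambda>w. cval c i y (upd k w X)))"
    unfolding avg_mult avg_sum ..
  finally show ?thesis
    unfolding dev_def cdev_def sum_subtractf right_diff_distrib by (simp add: d1_def X)
qed

lemma cval_insert_new:
  assumes E: "EQ1 c y" and X: "wfp X" "j < ne1 X" "w < nv2 X"
  shows "cval c 0 y (insert_vertex j b w X) = y X"
proof -
  have "cval c 0 y (insert_vertex j b w X) = or_sign c (ne1 (insert_vertex j b w X)) id id noflip *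
      y (contract1 (act1 id id noflip (insert_vertex j b w X)))"
    by (rule cval_choice[OF E wfp_insert[OF X] nonloop_insert(1)[OF X(1,2)] permutes_id permutes_id])
      (use insert_vertex_contract(1)[OF X(2)] in \<open>simp_all only: act1_id id_apply\<close>)
  then show ?thesis unfolding act1_id or_sign_id insert_vertex_contract(2)[OF X(2)] by simp
qed

lemma cdev_insert:
  fixes y :: "'k::field_char_0 efun" and b :: bool
  assumes E: "EQ1 c y" and X: "wfp X" "j < ne1 X" "w < nv2 X"
  defines "Y \<equiv> insert_vertex j b w X"
  shows "cdev c (Suc j) 0 y Y = dev j y X"
    "cdev c (Suc j) (Suc j) y Y = 0"
    "nonloop X i \<Longrightarrow> i \<noteq> j \<Longrightarrow> cdev c (Suc j) (Suc i) y Y = - front_sign c i X *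
       dev (Suc (tsp 0 i j - 1)) y
         (insert_vertex (tsp 0 i j - 1) b w (contract1 (front i X)))"
proof -
  have U: "upd (Suc j) w' Y = insert_vertex j b w (upd j w' X)" for w'
    unfolding Y_def by (rule upd_insert[symmetric])
  have n2: "nv2 Y = nv2 X" by (simp add: Y_def)
  have Xw: "wfp (upd j w' X)" "j < ne1 (upd j w' X)" "w < nv2 (upd j w' X)" if "w' < nv2 X" for w'
    using wfp_upd[OF X(1) that] X by simp_all
  have "avg (nv2 X) (\<lambda>w'. cval c 0 y (upd (Suc j) w' Y)) = avg (nv2 X) (\<lambda>w'. y (upd j w' X))"
    by (rule avg_cong) (unfold U, rule cval_insert_new[OF E Xw])
  then show "cdev c (Suc j) 0 y Y = dev j y X"
    unfolding cdev_def dev_def n2 using cval_insert_new[OF E X, of b] by (simp add: Y_def)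
  have wY: "wfp Y" unfolding Y_def by (rule wfp_insert[OF X])
  have "cval c (Suc j) y (upd (Suc j) w' Y) = cval c (Suc j) y Y" for w'
  proof -
    have "Suc j < ne1 Y" using X(2) by (simp add: Y_def)
    then show ?thesis unfolding cval_def front_sign_upd using contract_front_upd[OF wY, of "Suc j" "Suc j" w'] by simp
  qed
  then have "avg (nv2 X) (\<lambda>w'. cval c (Suc j) y (upd (Suc j) w' Y)) = cval c (Suc j) y Y"
    using avg_const[of "nv2 X" "cval c (Suc j) y Y"] X(3) by simp
  then show "cdev c (Suc j) (Suc j) y Y = 0" unfolding cdev_def n2 by simp
  assume i: "nonloop X i" "i \<noteq> j"
  let ?be = "tsp 0 i j - 1" and ?Z = "contract1 (front i X)"
  have i': "i < ne1 X" using i(1) by (simp add: nonloop_def)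
  have "cval c (Suc i) y (upd (Suc j) w' Y) = - front_sign c i X * y (upd (Suc ?be) w' (insert_vertex ?be b w ?Z))"
    if w': "w' < nv2 X" for w'
  proof -
    have n: "nonloop (upd j w' X) i" using i(1) unfolding nonloop_upd .
    show ?thesis
      unfolding U cval_insert_other[OF E Xw[OF w'] n i(2)] front_sign_upd contract_front_upd[OF X(1) i' X(2)]
      using i(2) by (simp add: upd_insert)
  qed
  then have "avg (nv2 X) (\<lambda>w'. cval c (Suc i) y (upd (Suc j) w' Y)) =
      - front_sign c i X * avg (nv2 X) (\<lambda>w'. y (upd (Suc ?be) w' (insert_vertex ?be b w ?Z)))"
    unfolding avg_mult[symmetric] by (rule avg_cong)
  moreover have "nv2 (insert_vertex ?be b w ?Z) = nv2 X" by (simp add: fst_snd_contract1)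
  ultimately show "cdev c (Suc j) (Suc i) y Y = - front_sign c i X * dev (Suc ?be) y (insert_vertex ?be b w ?Z)"
    unfolding cdev_def dev_def n2 using cval_insert_other[OF E X i, of b] by (simp add: Y_def algebra_simps)
qed

lemma nonloop_insert_set:
  assumes "wfp X" "j < ne1 X"
  shows "{i. nonloop (insert_vertex j b w X) i} = insert 0 (insert (Suc j) (Suc ` {i. nonloop X i \<and> i \<noteq> j}))"
proof (rule set_eqI)
  fix i show "i \<in> {i. nonloop (insert_vertex j b w X) i} \<longleftrightarrow>
      i \<in> insert 0 (insert (Suc j) (Suc ` {i. nonloop X i \<and> i \<noteq> j}))"
    using nonloop_insert(1,2)[OF assms, of b w] nonloop_insert(3)[OF assms, of "i - 1" b w] by (cases i) auto
qed

text \<open>In \<open>hmt (d1 c y)\<close>, the new edge contributes \<open>dev j y X\<close> and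
  the edge \<open>j\<close> contributes 0. The remaining contractions are the terms of
  \<open>d1 c (hmt y)\<close> with the opposite sign. The factor 2 counts the two ends of
  \<open>j\<close>. Loops take part as places of insertion, since a vertex inserted on a loop makes
  it contractible.\<close>

lemma hmt_d1:
  fixes y :: "'k::field_char_0 efun"
  assumes E: "EQ1 c y" and X: "GP X"
  shows "hmt (d1 c y) X + d1 c (hmt y) X = 2 * (\<Sum>j<ne1 X. dev j y X)"
proof -
  let ?N = "{i. nonloop X i}"
  let ?Z = "\<lambda>i. contract1 (front i X)"
  let ?T = "\<lambda>i be b w. dev (Suc be) y (insert_vertex be b w (?Z i))"
  let ?be = "\<lambda>i j. tsp 0 i j - 1"
  let ?fs = "\<lambda>i. front_sign c i X :: 'k"
  note wX = GP_wfp[OF X]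
  have A: "2 * of_nat (Suc (nv1 X)) * of_nat (Suc (ne1 X)) * dev (Suc j) (d1 c y) (insert_vertex j b w X) =
      dev j y X - (\<Sum>i | nonloop X i \<and> i \<noteq> j. ?fs i * ?T i (?be i j) b w)"
    if j: "j < ne1 X" and w: "w < nv2 X" for j b w
  proof -
    let ?Y = "insert_vertex j b w X"
    have "2 * of_nat (Suc (nv1 X)) * of_nat (Suc (ne1 X)) * dev (Suc j) (d1 c y) ?Y =
        (\<Sum>i | nonloop ?Y i. cdev c (Suc j) i y ?Y)"
      unfolding dev_d1[OF GP_insert[OF X j w]] sizes_insert by (simp del: of_nat_Suc)
    also have "\<dots> = cdev c (Suc j) 0 y ?Y + (cdev c (Suc j) (Suc j) y ?Y +
        (\<Sum>i\<in>Suc ` {i. nonloop X i \<and> i \<noteq> j}. cdev c (Suc j) i y ?Y))"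
    proof -
      have "finite {i. nonloop X i \<and> i \<noteq> j}" by (rule finite_subset[OF _ finite_nonloop[of X]]) auto
      moreover have "Suc j \<notin> Suc ` {i. nonloop X i \<and> i \<noteq> j}" by auto
      ultimately show ?thesis unfolding nonloop_insert_set[OF wX j] by simp
    qed
    also have "(\<Sum>i\<in>Suc ` {i. nonloop X i \<and> i \<noteq> j}. cdev c (Suc j) i y ?Y) =
        (\<Sum>i | nonloop X i \<and> i \<noteq> j. cdev c (Suc j) (Suc i) y ?Y)"
      by (subst sum.reindex) simp_all
    also have "\<dots> = (\<Sum>i | nonloop X i \<and> i \<noteq> j. - (?fs i * ?T i (?be i j) b w))"
      by (rule sum.cong[OF refl]) (use cdev_insert(3)[OF E wX j w] in simp)
    finally show ?thesis
      unfolding cdev_insert(1,2)[OF E wX j w] by (simp add: sum_negf)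
  qed
  have B: "?fs i * hmt y (?Z i) = 2 * of_nat (nv1 X) * of_nat (ne1 X) *
      (\<Sum>j | j < ne1 X \<and> j \<noteq> i. \<Sum>b\<in>UNIV. avg (nv2 X) (\<lambda>w. ?fs i * ?T i (?be i j) b w))" if i: "nonloop X i" for i
  proof -
    have i': "i < ne1 X" using i by (simp add: nonloop_def)
    have "std1 (front i X)" using std1_front[OF wX i'] i by blast
    note sz = sizes_contract1[OF this wfp_front[OF wX i'], unfolded sizes_front]
    have "(\<Sum>be<ne1 (?Z i). \<Sum>b\<in>UNIV. avg (nv2 X) (\<lambda>w. ?T i be b w)) =
        (\<Sum>j | j < ne1 X \<and> j \<noteq> i. \<Sum>b\<in>UNIV. avg (nv2 X) (\<lambda>w. ?T i (?be i j) b w))"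
    proof (rule sum.reindex_bij_witness[of _ "\<lambda>j. ?be i j" "\<lambda>be. tsp 0 i (Suc be)"])
      fix a assume "a \<in> {..<ne1 (?Z i)}"
      then have a: "Suc a < ne1 X" using sz(2) by simp
      show "?be i (tsp 0 i (Suc a)) = a" by simp
      then show "(\<Sum>b\<in>UNIV. avg (nv2 X) (\<lambda>w. ?T i (?be i (tsp 0 i (Suc a))) b w)) =
          (\<Sum>b\<in>UNIV. avg (nv2 X) (\<lambda>w. ?T i a b w))" by simp
      show "tsp 0 i (Suc a) \<in> {j. j < ne1 X \<and> j \<noteq> i}"
        using permutes_less[OF front_perms(2)[OF wX i'] a] by (auto simp: Transposition.transpose_def)
    next
      fix j assume j: "j \<in> {j. j < ne1 X \<and> j \<noteq> i}"
      then have "0 < tsp 0 i j" by (auto simp: Transposition.transpose_def)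
      then show "tsp 0 i (Suc (?be i j)) = j" by simp
      have "tsp 0 i j < ne1 X" by (rule permutes_less[OF front_perms(2)[OF wX i']]) (use j in simp)
      then show "?be i j \<in> {..<ne1 (?Z i)}" using sz(2) \<open>0 < tsp 0 i j\<close> by simp
    qed
    then show ?thesis
      unfolding hmt_def sz(3) using GP_contract_front[OF X i] sz(1,2)
      by (simp add: avg_mult sum_distrib_left[symmetric] del: of_nat_Suc)
  qed
  have exchange: "(\<Sum>j<ne1 X. \<Sum>i | nonloop X i \<and> i \<noteq> j. g i j) = (\<Sum>i\<in>?N. \<Sum>j | j < ne1 X \<and> j \<noteq> i. g i j)" for g :: "nat \<Rightarrow> nat \<Rightarrow> 'k"
  proof -
    have "(\<Sum>(j, i)\<in>Sigma {..<ne1 X} (\<lambda>j. {i. nonloop X i \<and> i \<noteq> j}). g i j) =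
        (\<Sum>(i, j)\<in>Sigma ?N (\<lambda>i. {j. j < ne1 X \<and> j \<noteq> i}). g i j)"
      by (rule sum.reindex_bij_witness[of _ prod.swap prod.swap]) (auto simp: nonloop_def)
    moreover have "finite {i. nonloop X i \<and> i \<noteq> j}" for j by (rule finite_subset[OF _ finite_nonloop[of X]]) auto
    ultimately show ?thesis by (simp add: sum.Sigma)
  qed
  have "hmt (d1 c y) X = (\<Sum>j<ne1 X. \<Sum>b\<in>UNIV. avg (nv2 X) (\<lambda>w.
      2 * of_nat (Suc (nv1 X)) * of_nat (Suc (ne1 X)) * dev (Suc j) (d1 c y) (insert_vertex j b w X)))"
    unfolding hmt_def avg_mult sum_distrib_left[symmetric] using X by simp
  also have "\<dots> = (\<Sum>j<ne1 X. \<Sum>b\<in>(UNIV :: bool set). avg (nv2 X) (\<lambda>w. dev j y X -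
      (\<Sum>i | nonloop X i \<and> i \<noteq> j. ?fs i * ?T i (?be i j) b w)))"
    by (intro sum.cong refl avg_cong) (use A in auto)
  also have "\<dots> = (\<Sum>j<ne1 X. \<Sum>b\<in>(UNIV :: bool set). dev j y X -
      (\<Sum>i | nonloop X i \<and> i \<noteq> j. avg (nv2 X) (\<lambda>w. ?fs i * ?T i (?be i j) b w)))"
    unfolding avg_diff avg_sum using avg_const[OF GP_nv2[OF X], where 'a='k] by simp
  also have "\<dots> = 2 * (\<Sum>j<ne1 X. dev j y X) - (\<Sum>j<ne1 X. \<Sum>b\<in>(UNIV :: bool set).
      \<Sum>i | nonloop X i \<and> i \<noteq> j. avg (nv2 X) (\<lambda>w. ?fs i * ?T i (?be i j) b w))"
    by (simp add: sum_subtractf sum_distrib_left card_UNIV_bool)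
  also have "(\<Sum>j<ne1 X. \<Sum>b\<in>(UNIV :: bool set).
      \<Sum>i | nonloop X i \<and> i \<noteq> j. avg (nv2 X) (\<lambda>w. ?fs i * ?T i (?be i j) b w)) = d1 c (hmt y) X"
  proof -
    have "(\<Sum>j<ne1 X. \<Sum>b\<in>(UNIV :: bool set).
        \<Sum>i | nonloop X i \<and> i \<noteq> j. avg (nv2 X) (\<lambda>w. ?fs i * ?T i (?be i j) b w)) =
        (\<Sum>j<ne1 X. \<Sum>i | nonloop X i \<and> i \<noteq> j. \<Sum>b\<in>(UNIV :: bool set). avg (nv2 X) (\<lambda>w. ?fs i * ?T i (?be i j) b w))"
      by (intro sum.cong refl sum.swap)
    also have "\<dots> = (\<Sum>i\<in>?N. \<Sum>j | j < ne1 X \<and> j \<noteq> i. \<Sum>b\<in>(UNIV :: bool set). avg (nv2 X) (\<lambda>w. ?fs i * ?T i (?be i j) b w))"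
      by (rule exchange)
    also have "\<dots> = (\<Sum>i\<in>?N. 1 / (2 * of_nat (nv1 X) * of_nat (ne1 X)) * cval c i (hmt y) X)"
    proof (rule sum.cong[OF refl])
      fix i assume "i \<in> ?N"
      then have i: "nonloop X i" by simp
      then have "i < ne1 X" by (simp add: nonloop_def)
      then have "of_nat (nv1 X) \<noteq> (0::'k)" "of_nat (ne1 X) \<noteq> (0::'k)" using wfp_edge(3)[OF wX] by auto
      then show "(\<Sum>j | j < ne1 X \<and> j \<noteq> i. \<Sum>b\<in>(UNIV :: bool set). avg (nv2 X) (\<lambda>w. ?fs i * ?T i (?be i j) b w)) =
          1 / (2 * of_nat (nv1 X) * of_nat (ne1 X)) * cval c i (hmt y) X"
        unfolding cval_def B[OF i] by simp
    qed
    also have "\<dots> = d1 c (hmt y) X" by (simp add: d1_def X sum_distrib_left)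
    finally show ?thesis .
  qed
  finally show ?thesis by simp
qed

subsection \<open>Functions independent of the hair positions\<close>

text \<open>\<open>P\<close> restricts the condition to certain numbers of vertices of the graph
  whose edges label the hairs in question: the second graph here, the first one in
  \<open>g_indep\<close>. The descending induction takes \<open>P\<close> to be a lower
  bound.\<close>

definition f_indep :: "(nat \<Rightarrow> bool) \<Rightarrow> 'k::field_char_0 efun \<Rightarrow> bool" where
  "f_indep P y \<longleftrightarrow> (\<forall>X X'. GP X \<and> GP X' \<and> P (nv2 X) \<and> fst (fst X) = fst (fst X') \<and> snd X = snd X' \<longrightarrow> y X = y X')"

definition g_indep :: "(nat \<Rightarrow> bool) \<Rightarrow> 'k::field_char_0 efun \<Rightarrow> bool" where
  "g_indep P y \<longleftrightarrow> (\<forall>X X'. GP X \<and> GP X' \<and> P (nv1 X) \<and> fst X = fst X' \<and> fst (snd X) = fst (snd X') \<longrightarrow> y X = y X')"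

lemma f_indepI: "(\<And>X X'. GP X \<Longrightarrow> GP X' \<Longrightarrow> P (nv2 X) \<Longrightarrow> fst (fst X) = fst (fst X') \<Longrightarrow> snd X = snd X' \<Longrightarrow> y X = y X') \<Longrightarrow> f_indep P y"
  unfolding f_indep_def by blast

lemma f_indepD: "f_indep P y \<Longrightarrow> GP X \<Longrightarrow> GP X' \<Longrightarrow> P (nv2 X) \<Longrightarrow> fst (fst X) = fst (fst X') \<Longrightarrow> snd X = snd X' \<Longrightarrow> y X = y X'"
  unfolding f_indep_def by blast

lemma g_indepI: "(\<And>X X'. GP X \<Longrightarrow> GP X' \<Longrightarrow> P (nv1 X) \<Longrightarrow> fst X = fst X' \<Longrightarrow> fst (snd X) = fst (snd X') \<Longrightarrow> y X = y X') \<Longrightarrow> g_indep P y"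
  unfolding g_indep_def by blast

lemma g_indepD: "g_indep P y \<Longrightarrow> GP X \<Longrightarrow> GP X' \<Longrightarrow> P (nv1 X) \<Longrightarrow> fst X = fst X' \<Longrightarrow> fst (snd X) = fst (snd X') \<Longrightarrow> y X = y X'"
  unfolding g_indep_def by blast

lemma f_indep_swap: "f_indep P (y \<circ> prod.swap) \<longleftrightarrow> g_indep P y"
proof
  assume a: "f_indep P (y \<circ> prod.swap)"
  show "g_indep P y"
  proof (rule g_indepI)
    fix X X' assume "GP X" "GP X'" "P (nv1 X)" "fst X = fst X'" "fst (snd X) = fst (snd X')"
    then show "y X = y X'" using f_indepD[OF a, of "prod.swap X" "prod.swap X'"] by simp
  qed
next
  assume a: "g_indep P y"
  show "f_indep P (y \<circ> prod.swap)"
  proof (rule f_indepI)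
    fix X X' assume "GP X" "GP X'" "P (nv2 X)" "fst (fst X) = fst (fst X')" "snd X = snd X'"
    then show "(y \<circ> prod.swap) X = (y \<circ> prod.swap) X'" using g_indepD[OF a, of "prod.swap X" "prod.swap X'"] by simp
  qed
qed

lemma g_indep_swap: "g_indep P (y \<circ> prod.swap) \<longleftrightarrow> f_indep P y"
  using f_indep_swap[of P "y \<circ> prod.swap"] by (simp add: comp_assoc)

lemma d1_cong:
  assumes X: "GP X" "GP X'" "fst (fst X) = fst (fst X')"
    and y: "\<And>i. nonloop X i \<Longrightarrow> GP (contract1 (front i X)) \<Longrightarrow> GP (contract1 (front i X')) \<Longrightarrow>
      y (contract1 (front i X)) = y (contract1 (front i X'))"
  shows "d1 c y X = d1 c y X'"
proof -
  have nl: "nonloop X' = nonloop X" using X(3) by (simp add: nonloop_def fun_eq_iff)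
  have "cval c i y X = cval c i y X'" if i: "nonloop X i" for i
    using y[OF i] GP_contract_front[OF X(1) i] GP_contract_front[OF X(2), of i] nl i X(3)
    by (simp add: cval_def front_sign_def)
  then have "(\<Sum>i | nonloop X i. cval c i y X) = (\<Sum>i | nonloop X' i. cval c i y X')"
    unfolding nl by (intro sum.cong) auto
  then show ?thesis using X by (simp add: d1_def)
qed

lemma f_indep_d1:
  assumes "f_indep P y"
  shows "f_indep P (d1 c y)"
proof (rule f_indepI)
  fix X X' assume X: "GP X" "GP X'" "P (nv2 X)" "fst (fst X) = fst (fst X')" "snd X = snd X'"
  obtain n es f H g where XX: "X = (((n, es), f), (H, g))" by (metis prod.exhaust)
  obtain f' where XX': "X' = (((n, es), f'), (H, g))" using X(4,5) unfolding XX by (metis prod.collapse fst_conv snd_conv)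
  show "d1 c y X = d1 c y X'"
    by (rule d1_cong[OF X(1,2,4)], rule f_indepD[OF assms]) (use X(3) in \<open>simp_all add: XX XX' front_def\<close>)
qed

lemma g_indep_d1:
  assumes "g_indep (\<lambda>_. True) y"
  shows "g_indep (\<lambda>_. True) (d1 c y)"
proof (rule g_indepI)
  fix X X' assume X: "GP X" "GP X'" "fst X = fst X'" "fst (snd X) = fst (snd X')"
  obtain n es f H g where XX: "X = (((n, es), f), (H, g))" by (metis prod.exhaust)
  obtain g' where XX': "X' = (((n, es), f), (H, g'))" using X(3,4) unfolding XX by (metis prod.collapse fst_conv snd_conv)
  have e: "fst (fst X) = fst (fst X')" using X(3) by simp
  show "d1 c y X = d1 c y X'"
    by (rule d1_cong[OF X(1,2) e], rule g_indepD[OF assms]) (simp_all add: XX XX' front_def)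
qed

text \<open>The homotopy for the hairs of one kind keeps independence of the hairs of the other
  kind. This prevents the second round in \<open>independent_primitive\<close> from destroying the
  result of the first.\<close>

lemma f_indep_hmt:
  assumes "f_indep (\<lambda>_. True) y"
  shows "f_indep (\<lambda>_. True) (hmt y)"
proof (rule f_indepI)
  fix X X' assume X: "GP X" "GP X'" "fst (fst X) = fst (fst X')" "snd X = snd X'"
  have d: "dev (Suc j) y (insert_vertex j b w X) = dev (Suc j) y (insert_vertex j b w X')" if j: "j < ne1 X" "w < nv2 X" for j b w
  proof -
    let ?Y = "insert_vertex j b w X" and ?Y' = "insert_vertex j b w X'"
    have Y: "GP ?Y" "GP ?Y'" using GP_insert X j by simp_all
    obtain n es f H g where XX: "X = (((n, es), f), (H, g))" by (metis prod.exhaust)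
    obtain f' where XX': "X' = (((n, es), f'), (H, g))" using X(3,4) unfolding XX by (metis prod.collapse fst_conv snd_conv)
    have e: "fst (fst ?Y) = fst (fst ?Y')" "snd ?Y = snd ?Y'" unfolding XX XX' insert_vertex_eq by simp_all
    have "y ?Y = y ?Y'" by (rule f_indepD[OF assms Y _ e]) simp
    moreover have "avg (nv2 X) (\<lambda>w'. y (upd (Suc j) w' ?Y)) = avg (nv2 X) (\<lambda>w'. y (upd (Suc j) w' ?Y'))"
    proof (rule avg_cong)
      fix w' assume w': "w' < nv2 X"
      show "y (upd (Suc j) w' ?Y) = y (upd (Suc j) w' ?Y')"
      proof (rule f_indepD[OF assms])
        show "GP (upd (Suc j) w' ?Y)" "GP (upd (Suc j) w' ?Y')" using GP_upd Y w' X(4) by simp_all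
        show "fst (fst (upd (Suc j) w' ?Y)) = fst (fst (upd (Suc j) w' ?Y'))" using e by simp
        show "snd (upd (Suc j) w' ?Y) = snd (upd (Suc j) w' ?Y')" unfolding upd_def using e by simp
      qed simp
    qed
    ultimately show ?thesis unfolding dev_def using X(4) by simp
  qed
  have n: "ne1 X' = ne1 X" "nv1 X' = nv1 X" "nv2 X' = nv2 X" using X(3,4) by simp_all
  have "(\<Sum>j<ne1 X. \<Sum>b\<in>UNIV. avg (nv2 X) (\<lambda>w. dev (Suc j) y (insert_vertex j b w X))) =
      (\<Sum>j<ne1 X. \<Sum>b\<in>UNIV. avg (nv2 X) (\<lambda>w. dev (Suc j) y (insert_vertex j b w X')))"
    by (intro sum.cong refl avg_cong d) auto
  then show "hmt y X = hmt y X'" unfolding hmt_def n using X(1,2) by simp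
qed

lemma g_indep_dev:
  assumes "g_indep P y" "GP X" "P (nv1 X)"
  shows "dev k y X = 0"
proof -
  have "avg (nv2 X) (\<lambda>w. y (upd k w X)) = avg (nv2 X) (\<lambda>w. y X)"
    by (rule avg_cong) (use g_indepD[OF assms(1) GP_upd[OF assms(2)] assms(2)] assms(3) in simp)
  then show ?thesis unfolding dev_def avg_const[OF GP_nv2[OF assms(2)]] by simp
qed

text \<open>Vanishing deviations allow hairs to be moved one at a time. The positions in
  \<open>X\<close> are replaced from left to right by those in \<open>X'\<close>.\<close>

lemma dev_g_indep:
  assumes z: "\<And>X k. GP X \<Longrightarrow> P (nv1 X) \<Longrightarrow> k < ne1 X \<Longrightarrow> dev k y X = 0"
  shows "g_indep P y"
proof (rule g_indepI)
  fix X X' assume X: "GP X" "GP X'" "P (nv1 X)" "fst X = fst X'" "fst (snd X) = fst (snd X')"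
  have step: "y (upd k w Z) = y Z" if "GP Z" "P (nv1 Z)" "k < ne1 Z" "w < nv2 Z" for Z k w
    using z[OF that(1-3)] z[OF GP_upd[OF that(1,4)], of k] that(2,3) unfolding dev_def by simp
  define Y where "Y i = (fst X, (fst (snd X), take i (snd (snd X')) @ drop i (snd (snd X))))" for i
  obtain A H g where XX: "X = (A, (H, g))" by (metis prod.exhaust)
  obtain g' where XX': "X' = (A, (H, g'))" using X(4,5) unfolding XX by (metis prod.collapse fst_conv snd_conv)
  obtain n es f m es' where AH: "A = ((n, es), f)" "H = (m, es')" by (metis prod.exhaust)
  have len: "length g = length es" "length g' = length es" "set g' \<subseteq> {..<m}"
    using GP_wfp[OF X(1)] GP_wfp[OF X(2)] by (simp_all add: XX XX' AH)
  have "GP (Y i) \<and> y (Y i) = y X" if "i \<le> length es" for i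
    using that
  proof (induction i)
    case 0
    then show ?case using X(1) by (simp add: Y_def XX)
  next
    case (Suc i)
    have "take (Suc i) g' @ drop (Suc i) g = (take i g' @ drop i g)[i := g' ! i]"
      using Suc.prems len
      by (simp add: take_Suc_conv_app_nth list_update_append Cons_nth_drop_Suc[symmetric])
    then have "Y (Suc i) = upd i (g' ! i) (Y i)" by (simp add: Y_def XX XX' upd_def)
    moreover have "g' ! i < m" using subsetD[OF len(3) nth_mem[of i g']] len Suc.prems by simp
    ultimately show ?case
      using Suc GP_upd[of "Y i" "g' ! i" i] step[of "Y i" i "g' ! i"] X(3) by (simp add: Y_def XX AH)
  qed
  from this[of "length es"] show "y X = y X'" using len by (simp add: Y_def XX XX')
qed

section \<open>Removing the dependence on hair positions\<close>

definition d2 :: "int \<Rightarrow> 'k::field_char_0 efun \<Rightarrow> 'k efun" where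
  "d2 d y = d1 d (y \<circ> prod.swap) \<circ> prod.swap"

text \<open>The weights cover the differential \<open>Dd\<close> and its mirror image: the Koszul
  sign stands at \<open>d2\<close> for one order of the two graphs and at \<open>d1\<close> for the
  other. As \<open>a\<close> sees the second graph only, it commutes with \<open>d1\<close>
  (\<open>d1_scale\<close>).\<close>

definition tot :: "(nat \<times> nat \<Rightarrow> 'k::field_char_0) \<Rightarrow> ((nat \<times> nat) \<times> (nat \<times> nat) \<Rightarrow> 'k) \<Rightarrow> int \<Rightarrow> int \<Rightarrow>
    'k efun \<Rightarrow> 'k efun" where
  "tot a b c d y X = a (snd (esize X)) * d1 c y X + b (esize X) * d2 d y X"

lemma d1_linear: "d1 c (\<lambda>X. y X - r * z X) X = d1 c y X - r * d1 c z X"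
proof -
  have "cval c i (\<lambda>X. y X - r * z X) X = cval c i y X - r * cval c i z X" for i
    by (simp add: cval_def algebra_simps)
  then have "(\<Sum>i | nonloop X i. cval c i (\<lambda>X. y X - r * z X) X) =
      (\<Sum>i | nonloop X i. cval c i y X) - r * (\<Sum>i | nonloop X i. cval c i z X)"
    by (simp add: sum_subtractf sum_distrib_left)
  then show ?thesis by (simp add: d1_def right_diff_distrib mult.left_commute)
qed

lemma d2_linear: "d2 d (\<lambda>X. y X - r * z X) X = d2 d y X - r * d2 d z X"
  using d1_linear[of d "y \<circ> prod.swap" r "z \<circ> prod.swap" "prod.swap X"] by (simp add: d2_def comp_def)

lemma tot_linear: "tot a b c d (\<lambda>X. y X - r * z X) = (\<lambda>X. tot a b c d y X - r * tot a b c d z X)"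
  by (simp add: tot_def d1_linear d2_linear fun_eq_iff algebra_simps)

lemma eqf_scale:
  assumes y: "eqf c d y"
  shows "eqf c d (\<lambda>X. a (esize X) * y X)"
proof -
  have "EQ1 c (\<lambda>X. a (esize X) * y X)"
    using eqfD(4)[OF y] unfolding EQ1_def by (simp add: mult.left_commute)
  moreover have "EQ1 d ((\<lambda>X. a (esize X) * y X) \<circ> prod.swap)"
    using eqfD(4)[OF eqf_swap[OF y]] unfolding EQ1_def by (simp add: mult.left_commute esize_swap)
  moreover have "FS (\<lambda>X. a (esize X) * y X)" by (rule FS_mono[OF eqfD(1)[OF y]]) auto
  ultimately show ?thesis using eqfD(2)[OF y] unfolding eqf_def EQ_def by auto
qed

lemma eqf_lin:
  assumes y: "eqf c d y" and z: "eqf c d z"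
  shows "eqf c d (\<lambda>X. y X - r * z X)"
proof -
  have "EQ1 c (\<lambda>X. y X - r * z X)"
    using eqfD(4)[OF y] eqfD(4)[OF z] unfolding EQ1_def by (simp add: algebra_simps)
  moreover have "EQ1 d ((\<lambda>X. y X - r * z X) \<circ> prod.swap)"
    using eqfD(4)[OF eqf_swap[OF y]] eqfD(4)[OF eqf_swap[OF z]] unfolding EQ1_def by (simp add: algebra_simps)
  moreover have "FS (\<lambda>X. y X - r * z X)"
    using FS_diff[OF eqfD(1)[OF y] FS_scl[OF eqfD(1)[OF z], of r]] by (simp add: scl_def fun_diff_def)
  moreover have "GP X" if "y X - r * z X \<noteq> 0" for X
  proof (cases "y X = 0")
    case True
    then have "z X \<noteq> 0" using that by auto
    then show ?thesis by (rule eqfD(2)[OF z])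
  qed (rule eqfD(2)[OF y])
  ultimately show ?thesis unfolding eqf_def EQ_def by blast
qed

lemma eqf_d2: "eqf c d y \<Longrightarrow> eqf c d (d2 d y)"
  unfolding d2_def by (intro eqf_swap eqf_d1)

lemma eqf_tot:
  assumes "eqf c d y"
  shows "eqf c d (tot a b c d y)"
proof -
  have "eqf c d (\<lambda>X. a (snd (esize X)) * d1 c y X - (- 1) * (b (esize X) * d2 d y X))"
    by (rule eqf_lin[OF eqf_scale[OF eqf_d1[OF assms], of "\<lambda>k. a (snd k)"] eqf_scale[OF eqf_d2[OF assms], of b]])
  then show ?thesis by (simp add: tot_def[abs_def])
qed

lemma f_indep_swap_d: "f_indep (\<lambda>_. True) y \<Longrightarrow> f_indep (\<lambda>_. True) (d2 d y)"
  unfolding d2_def f_indep_swap by (intro g_indep_d1) (simp add: g_indep_swap)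

lemma g_indep_d2: "g_indep P y \<Longrightarrow> g_indep P (d2 d y)"
  unfolding d2_def g_indep_swap by (intro f_indep_d1) (simp add: f_indep_swap)

lemma esize_f: "fst (fst X) = fst (fst X') \<Longrightarrow> snd X = snd X' \<Longrightarrow> esize X = esize X'"
  "fst X = fst X' \<Longrightarrow> fst (snd X) = fst (snd X') \<Longrightarrow> esize X = esize X'"
  by (simp_all add: esize_alt)

lemma f_indep_lin: "f_indep P y \<Longrightarrow> f_indep P z \<Longrightarrow> f_indep P (\<lambda>X. a (esize X) * y X - b (esize X) * z X)"
proof (rule f_indepI)
  fix X X' assume "f_indep P y" "f_indep P z" and X: "GP X" "GP X'" "P (nv2 X)" "fst (fst X) = fst (fst X')" "snd X = snd X'"
  then have "y X = y X'" "z X = z X'" using f_indepD[of P y X X'] f_indepD[of P z X X'] by simp_all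
  then show "a (esize X) * y X - b (esize X) * z X = a (esize X') * y X' - b (esize X') * z X'"
    using esize_f(1)[OF X(4,5)] by simp
qed

lemma g_indep_lin: "g_indep P y \<Longrightarrow> g_indep P z \<Longrightarrow> g_indep P (\<lambda>X. a (esize X) * y X - b (esize X) * z X)"
proof (rule g_indepI)
  fix X X' assume "g_indep P y" "g_indep P z" and X: "GP X" "GP X'" "P (nv1 X)" "fst X = fst X'" "fst (snd X) = fst (snd X')"
  then have "y X = y X'" "z X = z X'" using g_indepD[of P y X X'] g_indepD[of P z X X'] by simp_all
  then show "a (esize X) * y X - b (esize X) * z X = a (esize X') * y X' - b (esize X') * z X'"
    using esize_f(2)[OF X(4,5)] by simp
qed

lemma f_indep_tot:
  assumes f: "f_indep (\<lambda>_. True) y"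
  shows "f_indep (\<lambda>_. True) (tot a b c d y)"
  using f_indep_lin[OF f_indep_d1[OF f, of c] f_indep_swap_d[OF f, of d], where a = "\<lambda>k. a (snd k)" and b = "\<lambda>k. - b k"]
  by (simp add: tot_def[abs_def])

lemma d1_scale: "d1 c (\<lambda>X. a (snd (esize X)) * y X) X = a (snd (esize X)) * d1 c y X"
proof -
  have "cval c i (\<lambda>X. a (snd (esize X)) * y X) X = a (snd (esize X)) * cval c i y X" for i
    by (simp add: cval_def esize_alt fst_snd_contract1)
  then show ?thesis by (simp add: d1_def sum_distrib_left mult.left_commute)
qed

lemma d1_zero:
  assumes "\<And>Z. y Z \<noteq> 0 \<Longrightarrow> Suc (nv1 Z) \<noteq> nv1 X"
  shows "d1 c y X = 0"
proof (rule ccontr)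
  assume "d1 c y X \<noteq> 0"
  then obtain i where "y (contract1 (front i X)) \<noteq> 0" "esize X = up_size (esize (contract1 (front i X)))"
    by (rule d1_nonzero)
  then show False using assms[of "contract1 (front i X)"] by (simp add: esize_alt up_size_def)
qed

lemma d2_zero:
  assumes "\<And>Z. y Z \<noteq> 0 \<Longrightarrow> nv1 Z \<noteq> nv1 X"
  shows "d2 d y X = 0"
proof (rule ccontr)
  assume "d2 d y X \<noteq> 0"
  then have "d1 d (y \<circ> prod.swap) (prod.swap X) \<noteq> 0" by (simp add: d2_def)
  then obtain i where "(y \<circ> prod.swap) (contract1 (front i (prod.swap X))) \<noteq> 0"
    "esize (prod.swap X) = up_size (esize (contract1 (front i (prod.swap X))))"
    by (rule d1_nonzero)
  then show False using assms[of "prod.swap (contract1 (front i (prod.swap X)))"] by (simp add: esize_alt up_size_def)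
qed

lemma dev_cong:
  assumes "\<And>Z. GP Z \<Longrightarrow> esize Z = esize X \<Longrightarrow> y Z = y' Z" "GP X"
  shows "dev k y X = dev k y' X"
proof -
  have "avg (nv2 X) (\<lambda>w. y (upd k w X)) = avg (nv2 X) (\<lambda>w. y' (upd k w X))"
    by (rule avg_cong) (use assms GP_upd[OF assms(2)] esize_upd in simp)
  then show ?thesis unfolding dev_def using assms by simp
qed

lemma dev_zero: "dev k (\<lambda>_. 0) = (\<lambda>_. 0)"
  by (simp add: dev_def avg_def fun_eq_iff)

lemma hmt_zero:
  assumes "\<And>k Z. GP Z \<Longrightarrow> nv1 Z = Suc (nv1 X) \<Longrightarrow> dev k y Z = 0"
  shows "hmt y X = 0"
proof (cases "GP X")
  case True
  have A: "avg (nv2 X) (\<lambda>w. dev (Suc j) y (insert_vertex j b w X)) = 0" if "j < ne1 X" for j b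
  proof -
    have "avg (nv2 X) (\<lambda>w. dev (Suc j) y (insert_vertex j b w X)) = avg (nv2 X) (\<lambda>_. 0)"
      by (rule avg_cong) (use assms GP_insert[OF True that] in simp)
    then show ?thesis by (simp add: avg_def)
  qed
  have "(\<Sum>j<ne1 X. \<Sum>b\<in>UNIV. avg (nv2 X) (\<lambda>w. dev (Suc j) y (insert_vertex j b w X))) = 0"
    by (intro sum.neutral ballI A) simp
  then show ?thesis unfolding hmt_def by simp
qed (simp add: hmt_def)

definition devs :: "nat list \<Rightarrow> 'k::field_char_0 efun \<Rightarrow> 'k efun" where
  "devs l y = foldr dev l y"

lemma devs_simps [simp]: "devs [] y = y" "devs (k # l) y = dev k (devs l y)" "devs (l @ [k]) y = devs l (dev k y)"
  by (simp_all add: devs_def)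

lemma avg_swap: "avg m (\<lambda>w. avg m' (\<lambda>w'. a w w')) = avg m' (\<lambda>w'. avg m (\<lambda>w. a w w'))"
  by (simp add: avg_def sum_distrib_left mult_ac sum.swap[of _ "{..<m}"])

lemma dev_commute: "dev j (dev k y) = dev k (dev j y)"
proof (cases "j = k")
  case False
  show ?thesis
  proof
    fix X
    have "upd k w (upd j w' X) = upd j w' (upd k w X)" for w w' using False by (simp add: upd_def list_update_swap)
    then show "dev j (dev k y) X = dev k (dev j y) X"
      by (simp add: dev_def avg_diff) (rule avg_swap)
  qed
qed simp

lemma dev_idem:
  fixes y :: "'k::field_char_0 efun"
  shows "dev j (dev j y) = dev j y"
proof
  fix X
  have "avg m (\<lambda>_. avg m a) = avg m a" for m and a :: "nat \<Rightarrow> 'k" by (simp add: avg_def)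
  then show "dev j (dev j y) X = dev j y X" unfolding dev_def sizes_upd avg_diff by simp
qed

lemma devs_dev: "devs l (dev j y) = dev j (devs l y)"
  by (induction l) (simp_all add: dev_commute[of j])

lemma devs_dev_mem: "j \<in> set l \<Longrightarrow> devs l (dev j y) = devs l y"
proof (induction l)
  case (Cons k l)
  show ?case
  proof (cases "j \<in> set l")
    case False
    then show ?thesis using Cons.prems by (simp add: devs_dev dev_idem)
  qed (use Cons.IH in simp)
qed simp

lemma devs_cong:
  assumes "\<And>Z. GP Z \<Longrightarrow> esize Z = esize X \<Longrightarrow> y Z = y' Z" "GP X"
  shows "devs l y X = devs l y' X"
  using assms
proof (induction l arbitrary: X)
  case (Cons k l)
  then show ?case using dev_cong[of X "devs l y" "devs l y'" k] by (metis devs_simps(2))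
qed simp

lemma dev_lin: "dev k (\<lambda>X. y X - r * (\<Sum>j<N. z j X)) = (\<lambda>X. dev k y X - r * (\<Sum>j<N. dev k (z j) X))"
proof
  fix X
  have "avg (nv2 X) (\<lambda>w. y (upd k w X) - r * (\<Sum>j<N. z j (upd k w X))) =
      avg (nv2 X) (\<lambda>w. y (upd k w X)) - r * (\<Sum>j<N. avg (nv2 X) (\<lambda>w. z j (upd k w X)))"
    unfolding avg_diff avg_mult avg_sum ..
  then show "dev k (\<lambda>X. y X - r * (\<Sum>j<N. z j X)) X = dev k y X - r * (\<Sum>j<N. dev k (z j) X)"
    unfolding dev_def by (simp add: sum_subtractf algebra_simps)
qed

lemma devs_lin: "devs l (\<lambda>X. y X - r * (\<Sum>j<N. z j X)) = (\<lambda>X. devs l y X - r * (\<Sum>j<N. devs l (z j) X))"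
  by (induction l) (simp_all add: dev_lin)

text \<open>The condition says that, at \<open>v\<close> vertices of the first graph,
  \<open>y\<close> is a sum of functions each of which depends on at most \<open>r\<close> hairs. In
  terms of the commuting projections \<open>dev\<close>, products of more than \<open>r\<close>
  different ones kill \<open>y\<close>.\<close>

definition dvan :: "nat \<Rightarrow> nat \<Rightarrow> 'k::field_char_0 efun \<Rightarrow> bool" where
  "dvan v r y \<longleftrightarrow> (\<forall>l X. GP X \<and> nv1 X = v \<and> distinct l \<and> set l \<subseteq> {..<ne1 X} \<and> r < length l \<longrightarrow> devs l y X = 0)"

text \<open>The sum of the deviations multiplies a component that depends on exactly
  \<open>k\<close> hairs by \<open>k\<close>, so the subtraction kills the components with
  \<open>Suc r\<close> hairs. In formulas: a further deviation applied to a product of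
  \<open>Suc r\<close> of them is absorbed if it occurs already, and gives 0 otherwise.\<close>

lemma dvan_step:
  fixes y :: "'k::field_char_0 efun"
  assumes y: "dvan v (Suc r) y"
    and y': "\<And>X. GP X \<Longrightarrow> nv1 X = v \<Longrightarrow> y' X = y X - 1 / of_nat (Suc r) * (\<Sum>j<ne1 X. dev j y X)"
  shows "dvan v r y'"
  unfolding dvan_def
proof (intro allI impI)
  fix l X assume a: "GP X \<and> nv1 X = v \<and> distinct l \<and> set l \<subseteq> {..<ne1 X} \<and> r < length l"
  let ?q = "1 / of_nat (Suc r) :: 'k"
  have "devs l y' X = devs l (\<lambda>Z. y Z - ?q * (\<Sum>j<ne1 X. dev j y Z)) X"
  proof (rule devs_cong)
    fix Z assume "GP Z" "esize Z = esize X"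
    then show "y' Z = y Z - ?q * (\<Sum>j<ne1 X. dev j y Z)" using y'[of Z] a by (simp add: esize_alt)
  qed (use a in blast)
  also have "\<dots> = devs l y X - ?q * (\<Sum>j<ne1 X. devs l (dev j y) X)" unfolding devs_lin ..
  also have "(\<Sum>j<ne1 X. devs l (dev j y) X) = (\<Sum>j<ne1 X. if j \<in> set l then devs l y X else 0)"
  proof (rule sum.cong[OF refl])
    fix j assume j: "j \<in> {..<ne1 X}"
    show "devs l (dev j y) X = (if j \<in> set l then devs l y X else 0)"
    proof (cases "j \<in> set l")
      case False
      then have "GP X \<and> nv1 X = v \<and> distinct (l @ [j]) \<and> set (l @ [j]) \<subseteq> {..<ne1 X} \<and> Suc r < length (l @ [j])"
        using a j by auto
      then have "devs (l @ [j]) y X = 0" using y unfolding dvan_def by blast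
      then show ?thesis using False by simp
    qed (simp add: devs_dev_mem)
  qed
  also have "\<dots> = of_nat (length l) * devs l y X"
  proof -
    have "{..<ne1 X} \<inter> set l = set l" using a by blast
    then show ?thesis using a distinct_card[of l] by (simp add: sum.inter_restrict[symmetric])
  qed
  also have "devs l y X - ?q * (of_nat (length l) * devs l y X) = 0"
  proof (cases "length l = Suc r")
    case False
    then have "devs l y X = 0" using y a unfolding dvan_def by (metis Suc_lessI)
    then show ?thesis by simp
  qed (simp del: of_nat_Suc)
  finally show "devs l y' X = 0" .
qed

text \<open>Subtracting a multiple of \<open>tot a b c d z\<close> does not change the boundary of
  \<open>y\<close>. For \<open>z\<close> made from \<open>hmt y\<close> it affects only pairs with
  at most \<open>v\<close> vertices in the first graph, and at \<open>v\<close> vertices it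
  subtracts a multiple of the sum of the deviations. Each round lowers \<open>r\<close> by
  one.\<close>

lemma kill_level:
  fixes y :: "'k::field_char_0 efun"
  assumes y: "eqf c d y" "tot a b c d y = eta" "g_indep (\<lambda>n. v < n) y"
    and eta: "g_indep (\<lambda>_. True) eta"
    and sq: "\<And>k. a k * a k = 1"
    and tt: "\<And>z. eqf c d z \<Longrightarrow> tot a b c d (tot a b c d z) = (\<lambda>_. 0)"
  shows "dvan v r y \<Longrightarrow> \<exists>y'. eqf c d y' \<and> tot a b c d y' = eta \<and> g_indep (\<lambda>n. v < n) y' \<and> dvan v 0 y' \<and>
    (f_indep (\<lambda>_. True) y \<longrightarrow> f_indep (\<lambda>_. True) y')"
  using y
proof (induction r arbitrary: y)
  case 0
  then show ?case by blast
next
  case (Suc r)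
  note y = Suc.prems(2-4)
  \<comment> \<open>The weight \<open>a\<close> in \<open>z\<close> cancels the weight of
    \<open>d1\<close> in \<open>tot\<close>, by \<open>sq\<close>.\<close>
  define z where "z X = a (snd (esize X)) * hmt y X" for X
  \<comment> \<open>\<open>hmt_d1\<close> yields twice the sum of the deviations, and
    \<open>dvan_step\<close> asks for this sum divided by \<open>Suc r\<close>.\<close>
  define y' where "y' X = y X - 1 / (2 * of_nat (Suc r)) * tot a b c d z X" for X
  have z: "eqf c d z" unfolding z_def by (rule eqf_scale[OF eqf_hmt[OF y(1)], of "\<lambda>k. a (snd k)"])
  \<comment> \<open>At \<open>v\<close> or more vertices \<open>hmt y\<close> involves
    \<open>y\<close> at more than \<open>v\<close> vertices, where all deviations vanish.\<close>
  have zz: "z X = 0" if "v \<le> nv1 X" for X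
    unfolding z_def by (subst hmt_zero) (use that in \<open>auto intro: g_indep_dev[OF y(3)]\<close>)
  have up: "y' X = y X" if "v < nv1 X" for X
  proof -
    have "d1 c z X = 0" by (rule d1_zero) (use that in \<open>metis zz less_Suc_eq_le\<close>)
    moreover have "d2 d z X = 0" by (rule d2_zero) (use that in \<open>metis zz less_imp_le\<close>)
    ultimately show ?thesis by (simp add: y'_def tot_def)
  qed
  have lev: "y' X = y X - 1 / of_nat (Suc r) * (\<Sum>j<ne1 X. dev j y X)" if X: "GP X" "nv1 X = v" for X
  proof -
    have "d2 d z X = 0" by (rule d2_zero) (use X(2) in \<open>metis zz order_refl\<close>)
    moreover have "a (snd (esize X)) * d1 c z X = d1 c (hmt y) X"
      unfolding z_def d1_scale mult.assoc[symmetric] sq by simp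
    \<comment> \<open>Solving \<open>tot a b c d y = eta\<close> for \<open>d1 c y\<close> shows
      that, above \<open>v\<close>, it is as independent of hair positions as \<open>eta\<close> and
      \<open>d2 d y\<close>. So this half of the homotopy identity vanishes at \<open>v\<close>
      vertices.\<close>
    moreover have "hmt (d1 c y) X = 0"
    proof (rule hmt_zero)
      fix k Z assume Z: "GP Z" "nv1 Z = Suc (nv1 X)"
      have e: "d1 c y Z = a (snd (esize Z)) * eta Z - (a (snd (esize Z)) * b (esize Z)) * d2 d y Z" for Z
      proof -
        have "eta Z = a (snd (esize Z)) * d1 c y Z + b (esize Z) * d2 d y Z" unfolding y(2)[symmetric] tot_def ..
        then have "a (snd (esize Z)) * eta Z = (a (snd (esize Z)) * a (snd (esize Z))) * d1 c y Z +
            a (snd (esize Z)) * b (esize Z) * d2 d y Z" by (simp only: distrib_left mult.assoc)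
        then show ?thesis unfolding sq by simp
      qed
      have "g_indep (\<lambda>n. v < n) eta" using eta unfolding g_indep_def by blast
      from g_indep_lin[OF this g_indep_d2[OF y(3), of d], where a = "\<lambda>k. a (snd k)" and b = "\<lambda>k. a (snd k) * b k"]
      have "g_indep (\<lambda>n. v < n) (d1 c y)" by (simp add: e[abs_def, symmetric])
      then show "dev k (d1 c y) Z = 0" by (rule g_indep_dev) (use Z X(2) in simp_all)
    qed
    ultimately have "tot a b c d z X = 2 * (\<Sum>j<ne1 X. dev j y X)"
      using hmt_d1[OF eqfD(4)[OF y(1)] X(1)] by (simp add: tot_def)
    then show ?thesis by (simp add: y'_def field_simps del: of_nat_Suc)
  qed
  have "dvan v r y'" by (rule dvan_step[OF Suc.prems(1) lev])
  moreover have "eqf c d y'" unfolding y'_def by (rule eqf_lin[OF y(1) eqf_tot[OF z]])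
  moreover have "tot a b c d y' = eta" unfolding y'_def tot_linear tt[OF z] y(2) by simp
  moreover have "g_indep (\<lambda>n. v < n) y'"
  proof (rule g_indepI)
    fix X X' assume X: "GP X" "GP X'" "v < nv1 X" "fst X = fst X'" "fst (snd X) = fst (snd X')"
    then show "y' X = y' X'" using g_indepD[OF y(3) X] up[of X] up[of X'] by simp
  qed
  ultimately obtain y'' where y'': "eqf c d y''" "tot a b c d y'' = eta" "g_indep (\<lambda>n. v < n) y''" "dvan v 0 y''"
    "f_indep (\<lambda>_. True) y' \<longrightarrow> f_indep (\<lambda>_. True) y''"
    using Suc.IH[of y'] by blast
  have "f_indep (\<lambda>_. True) y'" if f: "f_indep (\<lambda>_. True) y"
  proof -
    have "f_indep (\<lambda>_. True) z"
      using f_indep_lin[OF f_indep_hmt[OF f] f_indep_hmt[OF f], where a = "\<lambda>k. a (snd k)" and b = "\<lambda>_. 0"] by (simp add: z_def[abs_def])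
    then show ?thesis
      using f_indep_lin[OF f f_indep_tot[of z a b c d], where a = "\<lambda>_. 1" and b = "\<lambda>_. 1 / (2 * of_nat (Suc r))"] by (simp add: y'_def[abs_def])
  qed
  then show ?case using y'' by blast
qed

lemma remove_g_dependence:
  fixes y :: "'k::field_char_0 efun"
  assumes y: "eqf c d y" "tot a b c d y = eta"
    and eta: "g_indep (\<lambda>_. True) eta"
    and sq: "\<And>k. a k * a k = 1"
    and tt: "\<And>z. eqf c d z \<Longrightarrow> tot a b c d (tot a b c d z) = (\<lambda>_. 0)"
  obtains y' where "eqf c d y'" "tot a b c d y' = eta" "g_indep (\<lambda>_. True) y'"
    "f_indep (\<lambda>_. True) y \<Longrightarrow> f_indep (\<lambda>_. True) y'"
proof -
  note th = that
  obtain B where B: "\<And>X. y X \<noteq> 0 \<Longrightarrow> nv1 X < B"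
  proof -
    have "finite (nv1 ` {X. y X \<noteq> 0})" using eqfD(1)[OF y(1)] by (simp add: FS_def)
    from finite_nat_set_iff_bounded[THEN iffD1, OF this] obtain B where b: "\<forall>k\<in>nv1 ` {X. y X \<noteq> 0}. k < B" ..
    show ?thesis by (rule that[of B], use b in blast)
  qed
  \<comment> \<open>After \<open>i\<close> steps the numbers of vertices from \<open>B - i\<close>
    on are settled. The induction starts at \<open>B\<close>, from where on \<open>y\<close>
    vanishes.\<close>
  have "\<exists>y'. eqf c d y' \<and> tot a b c d y' = eta \<and> g_indep (\<lambda>n. B - i < Suc n) y' \<and>
      (f_indep (\<lambda>_. True) y \<longrightarrow> f_indep (\<lambda>_. True) y')" for i
  proof (induction i)
    case 0
    have "g_indep (\<lambda>n. B < Suc n) y"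
    proof (rule g_indepI)
      fix X X' assume "B < Suc (nv1 X)" "fst X = fst (X' :: egraph)"
      then have "y X = 0" "y X' = 0" using B[of X] B[of X'] by auto
      then show "y X = y X'" by simp
    qed
    then show ?case using y by auto
  next
    case (Suc i)
    then obtain y1 where y1: "eqf c d y1" "tot a b c d y1 = eta" "g_indep (\<lambda>n. B - i < Suc n) y1"
      "f_indep (\<lambda>_. True) y \<longrightarrow> f_indep (\<lambda>_. True) y1" by blast
    show ?case
    proof (cases "i < B")
      case False
      then show ?thesis using y1 by auto
    next
      case True
      let ?v = "B - Suc i"
      have v: "B - i = Suc ?v" using True by simp
      obtain N where N: "\<And>X. y1 X \<noteq> 0 \<Longrightarrow> ne1 X < N"
      proof -
        have "finite (ne1 ` {X. y1 X \<noteq> 0})" using eqfD(1)[OF y1(1)] by (simp add: FS_def)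
        from finite_nat_set_iff_bounded[THEN iffD1, OF this] obtain N where b: "\<forall>k\<in>ne1 ` {X. y1 X \<noteq> 0}. k < N" ..
        show ?thesis by (rule that[of N], use b in blast)
      qed
      \<comment> \<open>More than \<open>N\<close> different hairs require more than
        \<open>N\<close> edges, where \<open>y1\<close> vanishes. So the descent in \<open>r\<close>
        can start at \<open>N\<close>.\<close>
      have dv: "dvan ?v N y1"
        unfolding dvan_def
      proof (intro allI impI)
        fix l X assume a: "GP X \<and> nv1 X = ?v \<and> distinct l \<and> set l \<subseteq> {..<ne1 X} \<and> N < length l"
        then have "length l \<le> ne1 X" using card_mono[of "{..<ne1 X}" "set l"] distinct_card[of l] by simp
        then have "N \<le> ne1 X" using a by simp
        have "devs l y1 X = devs l (\<lambda>_. 0) X"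
        proof (rule devs_cong)
          fix Z assume "esize Z = esize X"
          then show "y1 Z = 0" using N[of Z] \<open>N \<le> ne1 X\<close> by (auto simp: esize_alt)
        qed (use a in blast)
        also have "devs l (\<lambda>_. 0) = (\<lambda>_. 0 :: 'k)" by (induction l) (simp_all add: dev_zero)
        finally show "devs l y1 X = 0" by simp
      qed
      have "g_indep (\<lambda>n. ?v < n) y1" using y1(3) unfolding v by simp
      from kill_level[OF y1(1,2) this eta sq tt dv]
      obtain y' where y': "eqf c d y'" "tot a b c d y' = eta" "g_indep (\<lambda>n. ?v < n) y'" "dvan ?v 0 y'"
        "f_indep (\<lambda>_. True) y1 \<longrightarrow> f_indep (\<lambda>_. True) y'" by blast
      have "g_indep (\<lambda>n. ?v < Suc n) y'"
      proof (rule dev_g_indep)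
        fix X k assume X: "GP X" "?v < Suc (nv1 X)" "k < ne1 X"
        show "dev k y' X = 0"
        proof (cases "nv1 X = ?v")
          case True
          have "GP X \<and> nv1 X = ?v \<and> distinct [k] \<and> set [k] \<subseteq> {..<ne1 X} \<and> 0 < length [k]" using X True by simp
          then have "devs [k] y' X = 0" using y'(4) unfolding dvan_def by blast
          then show ?thesis by simp
        qed (rule g_indep_dev[OF y'(3) X(1)], use X in simp)
      qed
      then show ?thesis using y' y1(4) by blast
    qed
  qed
  from this[of B] obtain y' where "eqf c d y'" "tot a b c d y' = eta" "g_indep (\<lambda>_. True) y'"
    "f_indep (\<lambda>_. True) y \<longrightarrow> f_indep (\<lambda>_. True) y'" by auto
  then show ?thesis using th by blast
qed

section \<open>The total differential on equivariant functions\<close>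

definition kz :: "int \<Rightarrow> nat \<times> nat \<Rightarrow> 'k::field_char_0" where
  "kz c k = koszul (c * (int (fst k) - 1) + (1 - c) * int (snd k))"

definition Dd :: "int \<Rightarrow> int \<Rightarrow> 'k::field_char_0 efun \<Rightarrow> 'k efun" where
  "Dd c d = tot (\<lambda>_. 1) (\<lambda>k. kz c (fst k)) c d"

text \<open>The transpose of \<open>bd\<close>, which is equivariant again, whereas
  \<open>Dd\<close> is an equivariant form of \<open>bd\<close> itself. The double minus gives the
  expression the shape required by \<open>eqf_lin\<close>.\<close>

definition Dt :: "int \<Rightarrow> 'k::field_char_0 efun \<Rightarrow> 'k efun" where
  "Dt c \<Phi> X = 1 / 2 * D1 \<Phi> X - (- 1 / 2) * D2 (\<lambda>X. kz c (fst (esize X)) * \<Phi> X) X"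

lemma koszul_kz: "koszul (gdeg c (fst (fst X))) = kz c (fst (esize X))"
  by (simp add: kz_def gdeg_def esize_alt)

lemma kz_sq: "kz c k * kz c k = 1"
  by (simp add: kz_def)

lemma pr_weight: "pr \<Phi> (\<lambda>X. k X * z X) = pr (\<lambda>X. k X * \<Phi> X) z"
  unfolding pr_def by (simp add: mult_ac)

lemma eqf_kz: "eqf c d \<Phi> \<Longrightarrow> eqf c d (\<lambda>X. kz a (fst (esize X)) * \<Phi> X)"
  by (rule eqf_scale[where a = "\<lambda>k. kz a (fst k)"])

lemma eqf_D1:
  assumes P: "eqf c d \<Phi>"
  shows "eqf c d (D1 \<Phi>)"
proof -
  have "GP X" if "D1 \<Phi> X \<noteq> 0" for X
  proof -
    from that obtain Y where Y: "\<Phi> Y \<noteq> 0" "std1 Y" "contract1 Y = X" by (rule D1_supp)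
    show ?thesis using GP_contract1[OF Y(2) GP_wfp GP_nonuniv] eqfD(2)[OF P Y(1)] Y(3) by blast
  qed
  then show ?thesis
    unfolding eqf_def using FS_D1[OF eqfD(1)[OF P]] D1_EQ[OF eqfD(3)[OF P] eqfD(5)[OF P]] by blast
qed

lemma eqf_D2: "eqf c d \<Phi> \<Longrightarrow> eqf c d (D2 \<Phi>)"
  unfolding D2_def by (intro eqf_swap eqf_D1)

lemma eqf_Dt:
  assumes P: "eqf c d \<Phi>"
  shows "eqf c d (Dt c \<Phi>)"
  unfolding Dt_def[abs_def]
  by (rule eqf_lin[OF eqf_scale[OF eqf_D1[OF P], where a = "\<lambda>_. 1 / 2"] eqf_D2[OF eqf_kz[OF P]]])

lemma pr_Dt:
  fixes \<Phi> :: "'k::field_char_0 efun"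
  assumes P: "eqf c d \<Phi>"
  shows "pr (Dt c \<Phi>) x = pr \<Phi> (bd c x)"
proof -
  let ?K = "D2 (\<lambda>X. kz c (fst (esize X)) * \<Phi> X)"
  note F = eqfD(1)[OF P] eqfD(1)[OF eqf_kz[OF P, of c]]
  have e: "Dt c \<Phi> = scl (1 / 2) (D1 \<Phi>) + scl (1 / 2) ?K"
    by (simp add: Dt_def fun_eq_iff scl_def)
  have "pr x (Dt c \<Phi>) = (1 / 2) * pr x (D1 \<Phi>) + (1 / 2) * pr x ?K"
    unfolding e pr_add_FS[OF FS_scl[OF FS_D1[OF F(1)]] FS_scl[OF FS_D2[OF F(2)]]] pr_scl ..
  then show ?thesis
    unfolding pr_commute[of x] pr_D1[OF F(1)] pr_D2[OF F(2)] pr_bd[OF F(1)] koszul_kz .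
qed

lemma pr_Dd:
  assumes P: "eqf c d \<Phi>"
  shows "pr \<Phi> (Dd c d y) = pr \<Phi> (bd c y)"
proof -
  let ?P = "\<lambda>X. kz c (fst (esize X)) * \<Phi> X"
  note P' = eqf_swap[OF eqf_kz[OF P, of c]]
  have "Dd c d y = d1 c y + (\<lambda>X. kz c (fst (esize X)) * d2 d y X)"
    by (simp add: Dd_def tot_def fun_eq_iff)
  then have "pr \<Phi> (Dd c d y) = pr \<Phi> (d1 c y) + pr ?P (d2 d y)"
    by (simp add: pr_add[OF eqfD(1)[OF P]] pr_weight del: plus_fun_apply)
  also have "pr ?P (d2 d y) = pr (?P \<circ> prod.swap) (d1 d (y \<circ> prod.swap))"
    unfolding d2_def pr_swap ..
  also have "\<dots> = (1 / 2) * pr (?P \<circ> prod.swap) (up1 (y \<circ> prod.swap))"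
    by (rule pr_d1[OF eqfD(4)[OF P'] eqfD(1)[OF P'] eqfD(2)[OF P']])
  also have "pr (?P \<circ> prod.swap) (up1 (y \<circ> prod.swap)) = pr ?P (up2 y)" unfolding up2_up1 pr_swap ..
  also have "pr \<Phi> (d1 c y) = (1 / 2) * pr \<Phi> (up1 y)"
    by (rule pr_d1[OF eqfD(4)[OF P] eqfD(1)[OF P] eqfD(2)[OF P]])
  finally show ?thesis unfolding pr_bd[OF eqfD(1)[OF P]] koszul_kz .
qed

lemma eqf_Dd: "eqf c d y \<Longrightarrow> eqf c d (Dd c d y)"
  unfolding Dd_def by (rule eqf_tot)

text \<open>The left-hand side is equivariant, so it may be tested against equivariant functionals.
  In these pairings \<open>Dd\<close> becomes \<open>bd\<close>, and the double contractions cancel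
  in pairs.\<close>

lemma Dd_Dd:
  fixes z :: "'k::field_char_0 efun"
  assumes z: "eqf c d z"
  shows "Dd c d (Dd c d z) = (\<lambda>_. 0)"
proof
  fix X
  show "Dd c d (Dd c d z) X = 0"
  proof (rule eqf_nondegenerate[OF eqf_Dd[OF eqf_Dd[OF z]]])
    fix \<Phi> :: "'k efun" assume P: "eqf c d \<Phi>"
    have F: "FS \<Phi>" "EQ1 c \<Phi>" "EQ1 d (\<Phi> \<circ> prod.swap)" using eqfD[OF P] unfolding EQ_def by blast+
    have w: "wfp X" if "\<Phi> X \<noteq> 0" for X using eqfD(5)[OF P that] .
    have "pr \<Phi> (Dd c d (Dd c d z)) = pr (Dt c \<Phi>) (Dd c d z)" unfolding pr_Dd[OF P] pr_Dt[OF P] ..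
    also have "\<dots> = pr \<Phi> (bd c (bd c z))" by (rule trans[OF pr_Dd[OF eqf_Dt[OF P]] pr_Dt[OF P]])
    also have "\<dots> = pr \<Phi> (scl (1 / 4) (up1 (up1 z)) + scl (1 / 4) (up2 (up2 z)))"
      by (rule pr_cong) (simp add: bd_bd w scl_def)
    also have "\<dots> = 0"
      using pr_up1_up1[OF F(2,1) w, of z] pr_up2_up2[OF F(3,1) w, of z]
      unfolding pr_add[OF F(1)] pr_scl by simp
    finally show "pr \<Phi> (Dd c d (Dd c d z)) = 0" .
  qed
qed

lemma tot_swap: "tot (kz c) (\<lambda>_. 1) d c (y \<circ> prod.swap) = Dd c d y \<circ> prod.swap"
  by (simp add: fun_eq_iff tot_def Dd_def d2_def esize_swap comp_assoc add.commute comp_def)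

text \<open>Two rounds of \<open>remove_g_dependence\<close>, the second one with the two graphs
  exchanged. The boundary never changes, and the independence gained in the first round survives the
  second.\<close>

lemma independent_primitive:
  fixes y :: "'k::field_char_0 efun"
  assumes y: "eqf c d y" and g: "g_indep (\<lambda>_. True) (Dd c d y)" and f: "f_indep (\<lambda>_. True) (Dd c d y)"
  obtains y' where "eqf c d y'" "Dd c d y' = Dd c d y" "g_indep (\<lambda>_. True) y'" "f_indep (\<lambda>_. True) y'"
proof -
  note th = that
  obtain y1 where y1: "eqf c d y1" "Dd c d y1 = Dd c d y" "g_indep (\<lambda>_. True) y1"
  proof (rule remove_g_dependence[of c d y "\<lambda>_. 1" "\<lambda>k. kz c (fst k)" "Dd c d y"])
    show "tot (\<lambda>_. 1) (\<lambda>k. kz c (fst k)) c d y = Dd c d y" by (simp add: Dd_def)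
    show "tot (\<lambda>_. 1) (\<lambda>k. kz c (fst k)) c d (tot (\<lambda>_. 1) (\<lambda>k. kz c (fst k)) c d z) = (\<lambda>_. 0)"
      if "eqf c d z" for z :: "'k efun" using Dd_Dd[OF that] by (simp add: Dd_def)
    fix y' assume "eqf c d y'" "tot (\<lambda>_. 1) (\<lambda>k. kz c (fst k)) c d y' = Dd c d y" "g_indep (\<lambda>_. True) y'"
    then show thesis by (intro that) (simp_all add: Dd_def)
  qed (use y g in simp_all)
  obtain y2 where y2: "eqf d c y2" "tot (kz c) (\<lambda>_. 1) d c y2 = Dd c d y \<circ> prod.swap" "g_indep (\<lambda>_. True) y2"
    "f_indep (\<lambda>_. True) y2"
  proof (rule remove_g_dependence[of d c "y1 \<circ> prod.swap" "kz c" "\<lambda>_. 1" "Dd c d y \<circ> prod.swap"])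
    show "eqf d c (y1 \<circ> prod.swap)" by (rule eqf_swap[OF y1(1)])
    show "tot (kz c) (\<lambda>_. 1) d c (y1 \<circ> prod.swap) = Dd c d y \<circ> prod.swap" unfolding tot_swap y1(2) ..
    show "g_indep (\<lambda>_. True) (Dd c d y \<circ> prod.swap)" unfolding g_indep_swap by (rule f)
    show "tot (kz c) (\<lambda>_. 1) d c (tot (kz c) (\<lambda>_. 1) d c z) = (\<lambda>_. 0)" if "eqf d c z" for z :: "'k efun"
    proof -
      have "tot (kz c) (\<lambda>_. 1) d c z = Dd c d (z \<circ> prod.swap) \<circ> prod.swap"
        using tot_swap[of c d "z \<circ> prod.swap"] by (simp add: comp_assoc)
      then have "tot (kz c) (\<lambda>_. 1) d c (tot (kz c) (\<lambda>_. 1) d c z) = Dd c d (Dd c d (z \<circ> prod.swap)) \<circ> prod.swap"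
        by (simp only: tot_swap)
      then show ?thesis unfolding Dd_Dd[OF eqf_swap[OF that]] by (simp add: comp_def)
    qed
    fix y' assume a: "eqf d c y'" "tot (kz c) (\<lambda>_. 1) d c y' = Dd c d y \<circ> prod.swap" "g_indep (\<lambda>_. True) y'"
      "f_indep (\<lambda>_. True) (y1 \<circ> prod.swap) \<Longrightarrow> f_indep (\<lambda>_. True) y'"
    have "f_indep (\<lambda>_. True) y'" by (rule a(4)) (simp add: f_indep_swap y1(3))
    then show thesis by (rule that[OF a(1-3)])
  qed (rule kz_sq)
  have z: "y2 = (y2 \<circ> prod.swap) \<circ> prod.swap" by (simp add: comp_assoc)
  have "Dd c d (y2 \<circ> prod.swap) \<circ> prod.swap = Dd c d y \<circ> prod.swap"
    using y2(2) unfolding tot_swap[symmetric] z[symmetric] .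
  then have "Dd c d (y2 \<circ> prod.swap) = Dd c d y" by (metis comp_assoc swap_comp_swap comp_id)
  then show ?thesis
    by (intro th[of "y2 \<circ> prod.swap"]) (simp_all add: eqf_swap[OF y2(1)] f_indep_swap g_indep_swap y2)
qed

section \<open>Averaging over hair positions\<close>

definition asz :: "(nat \<times> nat) \<times> (nat \<times> nat) \<Rightarrow> 'k::field_char_0" where
  "asz k = 1 / (of_nat (fst (fst k)) ^ snd (snd k) * of_nat (fst (snd k)) ^ snd (fst k))"

text \<open>\<open>asz\<close> is the reciprocal of the number of all hair attachments. So
  \<open>hav\<close> is a right inverse of the summation \<open>flat\<close>
  (\<open>flat_hav\<close>), and \<open>hav (flat \<Phi>)\<close> is the average of \<Phi> over hair
  positions.\<close>

definition hav :: "'k::field_char_0 gpfun \<Rightarrow> 'k efun" where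
  "hav u X = asz (esize X) * hat u X"

lemma card_attachments: "card (attachments G H) = fst G ^ length (snd H)"
proof -
  have "attachments G H = {f. set f \<subseteq> {..<fst G} \<and> length f = length (snd H)}" by (auto simp: attachments_def)
  then show ?thesis by (simp add: card_lists_length_eq)
qed

lemma flat_scale: "flat (\<lambda>X. k (esize X) * \<Phi> X) (G, H) = k (gsize G, gsize H) * flat \<Phi> (G, H)"
  by (simp add: flat_def esize_alt sum_distrib_left)

lemma flat_hat:
  assumes "wf_graph G" "wf_graph H"
  shows "asz (gsize G, gsize H) * flat (hat u) (G, H) = (u (G, H) :: 'k::field_char_0)"
proof -
  have "flat (hat u) (G, H) = (\<Sum>f\<in>attachments G H. \<Sum>g\<in>attachments H G. u (G, H))"
    unfolding flat_def prod.case by (intro sum.cong refl) (use assms in \<open>simp add: hat_def wfp_iff del: wfp.simps\<close>)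
  also have "\<dots> = of_nat (fst G) ^ length (snd H) * (of_nat (fst H) ^ length (snd G) * u (G, H))"
    by (simp add: card_attachments)
  finally show ?thesis using assms by (simp add: asz_def wf_graph_def)
qed

lemma flat_hav:
  assumes "\<And>G H. u (G, H) \<noteq> 0 \<Longrightarrow> wf_graph G \<and> wf_graph H"
  shows "flat (hav u) = u"
proof
  fix GH :: "graph \<times> graph"
  obtain G H where GH: "GH = (G, H)" by (cases GH)
  show "flat (hav u) GH = u GH"
  proof (cases "wf_graph G \<and> wf_graph H")
    case True
    then show ?thesis unfolding GH hav_def[abs_def] flat_scale using flat_hat by blast
  next
    case False
    then have "hat u ((G, f), (H, g)) = 0" for f g by (auto simp: hat_def wfp_iff simp del: wfp.simps)
    then have "flat (hav u) (G, H) = 0" unfolding flat_def hav_def by simp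
    then show ?thesis using False assms[of G H] unfolding GH by auto
  qed
qed

lemma eqf_hav:
  fixes u :: "'k::field_char_0 gpfun"
  assumes F: "FS u" and supp: "\<And>G H. u (G, H) \<noteq> 0 \<Longrightarrow> GC_graph G \<and> GC_graph H"
    and E1: "\<And>H. gEQ c (\<lambda>G. u (G, H))" and E2: "\<And>G. gEQ d (\<lambda>H. u (G, H))"
  shows "eqf c d (hav u)"
proof -
  have E: "EQ1 c (hat u)" if E: "\<And>H. gEQ c (\<lambda>G. u (G, H))" for c and u :: "'k gpfun"
    unfolding EQ1_def
  proof (intro allI impI)
    fix X s t F assume X: "wfp X" "s permutes {..<nv1 X}" "t permutes {..<ne1 X}"
    have "u (fg (act1 s t F X)) = or_sign c (ne1 X) s t F * u (fg X)"
      using E[of "fst (snd X)"] wfp_graphs[OF X(1)] X(2,3) unfolding gEQ_def fst_act1 by simp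
    then show "hat u (act1 s t F X) = or_sign c (ne1 X) s t F * hat u X"
      unfolding hat_def using X(1) wfp_act1[OF X, of F] by (simp del: act1.simps)
  qed
  have sw: "hat u \<circ> prod.swap = hat (u \<circ> prod.swap)" by (simp add: fun_eq_iff hat_def)
  have "EQ c d (hat u)" unfolding EQ_def sw by (intro conjI E) (use E1 E2 in simp_all)
  moreover have supp': "GP X \<and> u (fg X) \<noteq> 0" if "hat u X \<noteq> 0" for X
    using that supp[of "fst (fst X)" "fst (snd X)"] by (auto simp: hat_def GP_def split: if_splits)
  moreover have "FS (hat u)"
  proof (rule FS_by_size)
    show "finite ((\<lambda>(G, H). (gsize G, gsize H)) ` {GH. u GH \<noteq> 0})" using F by (simp add: FS_def)
    fix X assume "hat u X \<noteq> 0"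
    note s = supp'[OF this]
    have "esize X = (\<lambda>(G, H). (gsize G, gsize H)) (fg X)" by (simp add: esize_alt)
    then show "wfp X \<and> esize X \<in> (\<lambda>(G, H). (gsize G, gsize H)) ` {GH. u GH \<noteq> 0}" using s GP_wfp by blast
  qed
  ultimately have "eqf c d (hat u)" unfolding eqf_def by blast
  then show ?thesis unfolding hav_def[abs_def] by (rule eqf_scale)
qed

lemma eqf_hav_flat:
  assumes P: "eqf c d \<Phi>"
  shows "eqf c d (hav (flat \<Phi>))"
proof (rule eqf_hav)
  show "FS (flat \<Phi>)" by (rule FS_flat[OF eqfD(1)[OF P]])
  show "gEQ c (\<lambda>G. flat \<Phi> (G, H))" for H by (rule gEQ_flat[OF eqfD(4,5)[OF P]])
  show "gEQ d (\<lambda>H. flat \<Phi> (G, H))" for G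
    using gEQ_flat[OF eqfD(4,5)[OF eqf_swap[OF P]], of G] by (simp add: flat_swap)
  show "GC_graph G \<and> GC_graph H" if "flat \<Phi> (G, H) \<noteq> 0" for G H
  proof -
    from that obtain f g where "\<Phi> ((G, f), (H, g)) \<noteq> 0" by (rule flat_nonzero)
    from eqfD(2)[OF P this] show ?thesis by (simp add: GP_def)
  qed
qed

abbreviation gasz :: "graph \<times> graph \<Rightarrow> 'k::field_char_0" where
  "gasz GH \<equiv> asz (gsize (fst GH), gsize (snd GH))"

lemma hav_hat: "hav u = hat (\<lambda>GH. gasz GH * u GH)"
  by (simp add: fun_eq_iff hav_def hat_def esize_alt)

lemma pr_hat_eqf: "eqf c d \<Phi> \<Longrightarrow> pr \<Phi> (hat x) = pr (flat \<Phi>) x"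
  by (rule pr_hat) (rule eqfD, assumption)+

lemma pr_hav: "eqf c d \<Phi> \<Longrightarrow> pr \<Phi> (hav u) = pr (flat \<Phi>) (\<lambda>GH. gasz GH * u GH)"
  unfolding hav_hat by (rule pr_hat_eqf)

text \<open>Self-adjointness of the average: both sides are the weighted pairing of
  \<open>flat \<Phi>\<close> with \<open>flat eta\<close>.\<close>

lemma pr_hav_flat:
  assumes "eqf c d \<Phi>" "eqf c d eta"
  shows "pr \<Phi> (hav (flat eta)) = pr (hav (flat \<Phi>)) eta"
proof -
  have "pr \<Phi> (hav (flat eta)) = pr (\<lambda>GH. gasz GH * flat \<Phi> GH) (flat eta)"
    unfolding pr_hav[OF assms(1)] by (rule pr_weight)
  also have "\<dots> = pr eta (hav (flat \<Phi>))"
    unfolding pr_hav[OF assms(2)] by (rule pr_commute)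
  finally show ?thesis by (simp only: pr_commute)
qed

lemma flat_wf:
  assumes "eqf c d \<Phi>" "flat \<Phi> (G, H) \<noteq> 0"
  shows "wf_graph G \<and> wf_graph H"
  using assms(2) by (rule flat_nonzero) (use eqfD(5)[OF assms(1)] wfp_iff in blast)

lemma flat_hav_flat: "eqf c d \<Phi> \<Longrightarrow> flat (hav (flat \<Phi>)) = flat \<Phi>"
  by (rule flat_hav) (rule flat_wf)

lemma indep_hav: "f_indep P (hav u)" "g_indep P (hav u)"
proof -
  have "hav u X = hav u X'" if "GP X" "GP X'" "fst (fst X) = fst (fst X')" "fst (snd X) = fst (snd X')" for X X'
    using that GP_wfp by (simp add: hav_def hat_def esize_alt)
  then show "f_indep P (hav u)" "g_indep P (hav u)" unfolding f_indep_def g_indep_def by metis+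
qed

text \<open>A pulled back series does not notice whether the functional is averaged. By
  self-adjointness \<open>eta\<close> and its average then have the same pairings, and nondegeneracy
  identifies them.\<close>

lemma hav_flat_fixed:
  fixes eta :: "'k::field_char_0 efun"
  assumes e: "eqf c d eta" and x: "\<And>\<Phi>. eqf c d \<Phi> \<Longrightarrow> pr \<Phi> eta = pr \<Phi> (hat x)"
  shows "hav (flat eta) = eta"
proof
  fix X
  have "hav (flat eta) X - 1 * eta X = 0"
  proof (rule eqf_nondegenerate[OF eqf_lin[OF eqf_hav_flat[OF e] e]])
    fix \<Phi> :: "'k efun" assume P: "eqf c d \<Phi>"
    note P' = eqf_hav_flat[OF P]
    have "pr \<Phi> (hav (flat eta)) = pr (hav (flat \<Phi>)) (hat x)" unfolding pr_hav_flat[OF P e] by (rule x[OF P'])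
    also have "\<dots> = pr (flat \<Phi>) x"
      unfolding pr_hat_eqf[OF P'] flat_hav_flat[OF P] ..
    also have "\<dots> = pr \<Phi> eta" unfolding x[OF P] pr_hat_eqf[OF P] ..
    finally have "pr \<Phi> (hav (flat eta) - eta) = 0" unfolding pr_diff[OF eqfD(1)[OF P]] by simp
    then show "pr \<Phi> (\<lambda>X. hav (flat eta) X - 1 * eta X) = 0" by (simp add: fun_diff_def)
  qed
  then show "hav (flat eta) X = eta X" by simp
qed

lemma independent_hav:
  fixes y :: "'k::field_char_0 efun"
  assumes y: "eqf c d y" and f: "f_indep (\<lambda>_. True) y" and g: "g_indep (\<lambda>_. True) y"
  shows "y = hav (flat y)"
proof
  fix X
  show "y X = hav (flat y) X"
  proof (cases "GP X")
    case False
    then have "y X = 0" "hav (flat y) X = 0" using eqfD(2)[OF y] eqfD(2)[OF eqf_hav_flat[OF y]] by blast+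
    then show ?thesis by simp
  next
    case True
    obtain G f0 H g0 where X: "X = ((G, f0), (H, g0))" by (metis prod.exhaust)
    have att: "wf_graph G" "wf_graph H" "f0 \<in> attachments G H" "g0 \<in> attachments H G"
      using GP_wfp[OF True] unfolding X wfp_iff by blast+
    have GC: "GC_graph G" "GC_graph H" using True by (simp_all add: GP_def X)
    have G: "GP ((G, f), (H, g))" if "f \<in> attachments G H" "g \<in> attachments H G" for f g
      using att that GC by (simp add: GP_def wfp_iff del: wfp.simps)
    have "y ((G, f), (H, g)) = hat (\<lambda>_. y X) ((G, f), (H, g))" if fg: "f \<in> attachments G H" "g \<in> attachments H G" for f g
    proof -
      have "y ((G, f), (H, g)) = y ((G, f), (H, g0))" by (rule g_indepD[OF g]) (use G fg att in simp_all)
      also have "\<dots> = y X" unfolding X by (rule f_indepD[OF f]) (use G fg att in simp_all)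
      finally show ?thesis using att fg by (simp add: hat_def wfp_iff del: wfp.simps)
    qed
    then have "flat y (G, H) = flat (hat (\<lambda>_. y X)) (G, H)" by (simp add: flat_def)
    then show ?thesis
      using flat_hat[OF att(1,2), of "\<lambda>_. y X"] GP_wfp[OF True] unfolding hav_hat hat_def X by simp
  qed
qed

lemma FS_otimes:
  assumes "FS \<phi>" "FS \<psi>"
  shows "FS (otimes \<phi> \<psi>)"
proof -
  have "{X. otimes \<phi> \<psi> X \<noteq> 0} \<subseteq> {G. \<phi> G \<noteq> 0} \<times> {H. \<psi> H \<noteq> 0}" by (auto simp: otimes_def)
  then show ?thesis using assms unfolding FS_def by (meson finite_SigmaI finite_subset)
qed

lemma pr_otimes:
  fixes z :: "('a \<times> 'b, 'k::field) series"
  assumes "FS \<phi>" "FS \<psi>"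
  shows "pr (otimes \<phi> \<psi>) z = pr \<phi> (\<lambda>G. pr \<psi> (\<lambda>H. z (G, H)))"
    "pr (otimes \<phi> \<psi>) z = pr \<psi> (\<lambda>H. pr \<phi> (\<lambda>G. z (G, H)))"
proof -
  let ?A = "{G. \<phi> G \<noteq> 0}" and ?B = "{H. \<psi> H \<noteq> 0}"
  have f: "finite ?A" "finite ?B" using assms by (simp_all add: FS_def)
  have "pr (otimes \<phi> \<psi>) z = (\<Sum>(G, H)\<in>?A \<times> ?B. \<phi> G * \<psi> H * z (G, H))"
    by (subst pr_sum[of "?A \<times> ?B"]) (use f in \<open>auto simp: otimes_def split_def\<close>)
  then have e: "pr (otimes \<phi> \<psi>) z = (\<Sum>G\<in>?A. \<Sum>H\<in>?B. \<phi> G * \<psi> H * z (G, H))"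
    by (simp add: sum.cartesian_product)
  then show "pr (otimes \<phi> \<psi>) z = pr \<phi> (\<lambda>G. pr \<psi> (\<lambda>H. z (G, H)))"
    by (simp add: pr_left[OF assms(1)] pr_left[OF assms(2)] sum_distrib_left mult.assoc)
  from e have "pr (otimes \<phi> \<psi>) z = (\<Sum>H\<in>?B. \<Sum>G\<in>?A. \<phi> G * \<psi> H * z (G, H))"
    by (subst sum.swap)
  then show "pr (otimes \<phi> \<psi>) z = pr \<psi> (\<lambda>H. pr \<phi> (\<lambda>G. z (G, H)))"
    by (simp add: pr_left[OF assms(1)] pr_left[OF assms(2)] sum_distrib_left mult.left_commute mult.assoc)
qed

section \<open>Products of cocycles against boundaries\<close>

lemma cocycle_kills_tdif:
  assumes P: "\<phi> \<in> cocycles c" and Q: "\<psi> \<in> cocycles d"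
  shows "pr (otimes \<phi> \<psi>) (tdif c t) = (0 :: 'k::field_char_0)"
proof -
  have p: "\<phi> \<in> Fun1 c" "gD \<phi> = 0" "\<psi> \<in> Fun1 d" "gD \<psi> = 0" using P Q by (simp_all add: cocycles_def)
  note F = Fun1D(1)[OF p(1)] Fun1D(1)[OF p(3)]
  let ?u = "\<lambda>(G, H). dGC (\<lambda>G'. t (G', H)) G"
  let ?v = "\<lambda>(G, H). koszul (gdeg c G) * dGC (\<lambda>H'. t (G, H')) H"
  have "FS (otimes \<phi> \<psi>)" by (rule FS_otimes[OF F])
  moreover have "tdif c t = ?u + ?v" by (auto simp: tdif_def fun_eq_iff)
  ultimately have "pr (otimes \<phi> \<psi>) (tdif c t) = pr (otimes \<phi> \<psi>) ?u + pr (otimes \<phi> \<psi>) ?v"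
    by (simp only: pr_add)
  also have "pr (otimes \<phi> \<psi>) ?u = 0"
    unfolding pr_otimes(2)[OF F] prod.case pr_dif_GC[OF p(1)] p(2) by simp
  also have "pr (otimes \<phi> \<psi>) ?v = 0"
    unfolding pr_otimes(1)[OF F] prod.case pr_scl[unfolded scl_def] pr_dif_GC[OF p(3)] p(4) by simp
  finally show ?thesis by simp
qed

lemma eqf_hav_otimes:
  assumes P: "\<phi> \<in> Fun1 c" and Q: "\<psi> \<in> Fun1 d"
  shows "eqf c d (hav (otimes \<phi> \<psi>))" "flat (hav (otimes \<phi> \<psi>)) = otimes \<phi> \<psi>"
proof -
  show "eqf c d (hav (otimes \<phi> \<psi>))"
  proof (rule eqf_hav[OF FS_otimes[OF Fun1D(1)[OF P] Fun1D(1)[OF Q]]])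
    show "GC_graph G \<and> GC_graph H" if "otimes \<phi> \<psi> (G, H) \<noteq> 0" for G H
      using that Fun1D(2)[OF P, of G] Fun1D(2)[OF Q, of H] by (simp add: otimes_def)
    show "gEQ c (\<lambda>G. otimes \<phi> \<psi> (G, H))" for H
      using Fun1D(3)[OF P] unfolding gEQ_def otimes_def by (simp add: mult.assoc)
    show "gEQ d (\<lambda>H. otimes \<phi> \<psi> (G, H))" for G
      using Fun1D(3)[OF Q] unfolding gEQ_def otimes_def by (simp add: mult.left_commute)
  qed
  show "flat (hav (otimes \<phi> \<psi>)) = otimes \<phi> \<psi>"
  proof (rule flat_hav)
    show "wf_graph G \<and> wf_graph H" if "otimes \<phi> \<psi> (G, H) \<noteq> 0" for G H
      using that Fun1D(4)[OF P, of G] Fun1D(4)[OF Q, of H] by (simp add: otimes_def)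
  qed
qed

lemma GP_fcGC_pair: "GP X \<Longrightarrow> fcGC_pair X \<longleftrightarrow> admissible (fst (fst X)) (fst (snd X))"
proof -
  assume X: "GP X"
  obtain G f H g where XX: "X = ((G, f), (H, g))" by (metis prod.exhaust)
  have "wf_graph G" "wf_graph H" "f \<in> attachments G H" "g \<in> attachments H G"
    using GP_wfp[OF X] unfolding XX wfp_iff by blast+
  moreover have "connected_pair X" unfolding XX
    by (rule GC_pair_connected) (use X calculation in \<open>simp_all add: GP_def XX del: wfp.simps\<close>)
  ultimately show ?thesis by (simp add: fcGC_pair_def Gra_pair_def XX del: wfp.simps)
qed

lemma eqf_Fun2:
  assumes "eqf c d \<Phi>" "\<And>X. \<Phi> X \<noteq> 0 \<Longrightarrow> admissible (fst (fst X)) (fst (snd X))"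
  shows "\<Phi> \<in> Fun2 c d"
  unfolding Fun2_def using eqfD[OF assms(1)] assms(2) GP_fcGC_pair GP_nonuniv by blast

lemma pr_bd_cong:
  fixes y y' :: "'k::field_char_0 efun"
  assumes "\<And>Z. GP Z \<Longrightarrow> P (esize Z) \<Longrightarrow> y Z = y' Z"
    and P: "\<And>X. \<Phi> X \<noteq> 0 \<Longrightarrow> GP X \<and> (\<forall>k. esize X = up_size k \<longrightarrow> P k) \<and>
      (\<forall>k. esize X = prod.swap (up_size (prod.swap k)) \<longrightarrow> P k)"
  shows "pr \<Phi> (bd c y) = pr \<Phi> (bd c y')"
proof (rule pr_cong)
  fix X assume "\<Phi> X \<noteq> 0"
  note X = P[OF this]
  have up: "up1 y Z = up1 y' Z" if Z: "GP Z" "\<And>W. GP W \<Longrightarrow> esize Z = up_size (esize W) \<Longrightarrow> y W = y' W"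
    for Z :: egraph and y y' :: "'k efun"
  proof (cases "std1 Z")
    case True
    note s = GP_wfp[OF Z(1)]
    have "GP (contract1 Z)" using GP_contract1[OF True s GP_nonuniv[OF Z(1)]] Z(1) by blast
    then show ?thesis using Z(2) esize_contract1[OF True s] by (simp add: up1_def)
  qed (simp add: up1_def)
  have "up1 y X = up1 y' X" by (rule up) (use X assms(1) in blast)+
  moreover have "up1 (y \<circ> prod.swap) (prod.swap X) = up1 (y' \<circ> prod.swap) (prod.swap X)"
  proof (rule up)
    show "GP (prod.swap X)" using X by simp
  next
    fix W :: egraph assume W: "GP W" "esize (prod.swap X) = up_size (esize W)"
    have "esize X = prod.swap (up_size (prod.swap (esize (prod.swap W))))"
      using W(2) unfolding esize_swap by (metis swap_swap)
    then have "P (esize (prod.swap W))" using X by blast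
    then show "(y \<circ> prod.swap) W = (y' \<circ> prod.swap) W" using assms(1)[of "prod.swap W"] W(1) by simp
  qed
  then have "up2 y X = up2 y' X" unfolding up2_up1 comp_apply .
  ultimately show "bd c y X = bd c y' X" by (simp add: bd_def)
qed

lemma Dd_nonzero:
  assumes "Dd c d y X \<noteq> 0"
  obtains Z where "y Z \<noteq> 0" "esize X = up_size (esize Z) \<or> esize X = prod.swap (up_size (prod.swap (esize Z)))"
proof (cases "d1 c y X = 0")
  case False
  then show ?thesis by (rule d1_nonzero) (use that in blast)
next
  case True
  then have "d1 d (y \<circ> prod.swap) (prod.swap X) \<noteq> 0" using assms by (auto simp: Dd_def tot_def d2_def)
  then obtain i where i: "(y \<circ> prod.swap) (contract1 (front i (prod.swap X))) \<noteq> 0"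
    "esize (prod.swap X) = up_size (esize (contract1 (front i (prod.swap X))))" by (rule d1_nonzero)
  let ?Z = "prod.swap (contract1 (front i (prod.swap X)))"
  have "esize X = prod.swap (up_size (prod.swap (esize ?Z)))"
    using i(2) unfolding esize_swap by (metis swap_swap)
  then show ?thesis using that[of ?Z] i(1) by simp
qed

text \<open>The primitive \<open>y\<close> is replaced by an equivariant one of finite support, and
  this by one without dependence on hair positions. The latter is pulled back from pairs of plain
  graphs, so its boundary is pulled back from a coboundary of the tensor product, and products of
  cocycles kill coboundaries.\<close>

lemma cocycle_kills_primitive:
  fixes x :: "'k::field_char_0 gpfun"
  assumes P: "\<phi> \<in> cocycles c" and Q: "\<psi> \<in> cocycles d"
    and adm: "\<And>G H. \<phi> G \<noteq> 0 \<Longrightarrow> \<psi> H \<noteq> 0 \<Longrightarrow> admissible G H"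
    and ysupp: "\<And>X. y X \<noteq> 0 \<Longrightarrow> fcGC_pair X" and nul: "Sym x - lin_ext (delta c) y \<in> nul (GC2 c d) p"
  shows "pr (otimes \<phi> \<psi>) x = 0"
proof (cases "\<exists>G H. \<phi> G \<noteq> 0 \<and> \<psi> H \<noteq> 0")
  case False
  then have "otimes \<phi> \<psi> = 0" by (auto simp: otimes_def fun_eq_iff)
  then show ?thesis by simp
next
  case True
  have F: "\<phi> \<in> Fun1 c" "\<psi> \<in> Fun1 d" using P Q by (simp_all add: cocycles_def)
  have "\<exists>k. \<forall>G. \<phi> G \<noteq> 0 \<longrightarrow> gsize G = k" "\<exists>k. \<forall>H. \<psi> H \<noteq> 0 \<longrightarrow> gsize H = k"
    using P Q by (simp_all add: cocycles_def)
  then obtain k k' where kk: "\<forall>G. \<phi> G \<noteq> 0 \<longrightarrow> gsize G = k" "\<forall>H. \<psi> H \<noteq> 0 \<longrightarrow> gsize H = k'" by blast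
  obtain n e m e' where nme: "k = (n, e)" "k' = (m, e')" by (metis prod.exhaust)
  have ne: "gsize G = (n, e)" if "\<phi> G \<noteq> 0" for G using kk(1) that nme by simp
  have me: "gsize H = (m, e')" if "\<psi> H \<noteq> 0" for H using kk(2) that nme by simp
  have nm: "3 \<le> n + m"
  proof -
    obtain G H where GH: "\<phi> G \<noteq> 0" "\<psi> H \<noteq> 0" using True by blast
    show ?thesis using adm[OF GH] ne[OF GH(1)] me[OF GH(2)] by (simp add: admissible_def)
  qed
  \<comment> \<open>The window of sizes that matter. The differentials preserve edges minus vertices
    of each graph (written additively in \<open>nat\<close>), and \<open>i\<close> is the number of
    vertices missing from the total \<open>n + m\<close>. Boundaries in \<open>C 0\<close> come from
    \<open>C 1\<close>, which holds for finitely many sizes.\<close>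
  define C where "C i k \<longleftrightarrow> snd (fst k) + n = e + fst (fst k) \<and> snd (snd k) + m = e' + fst (snd k) \<and>
    fst (fst k) + fst (snd k) + i = n + m" for i :: nat and k :: "(nat \<times> nat) \<times> (nat \<times> nat)"
  have Cup: "C 0 (up_size k) \<longleftrightarrow> C 1 k" "C 0 (prod.swap (up_size (prod.swap k))) \<longleftrightarrow> C 1 k" for k
    by (auto simp: C_def up_size_def)
  have finC: "finite {k. C 1 k}"
    by (rule finite_subset[of _ "({..n + m} \<times> {..e + n + m}) \<times> ({..n + m} \<times> {..e' + n + m})"]) (auto simp: C_def)
  define yC where "yC X = (if GP X \<and> C 1 (esize X) then y X else 0)" for X
  have "FS yC" by (rule FS_by_size[OF finC]) (auto simp: yC_def GP_wfp split: if_splits)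
  moreover have "fcGC_pair X \<and> C 1 (esize X)" if "yC X \<noteq> 0" for X
    using that ysupp[of X] by (auto simp: yC_def split: if_splits)
  ultimately obtain y0 where y0: "eqf c d y0" "\<forall>\<Phi>. eqf c d \<Phi> \<longrightarrow> pr \<Phi> y0 = pr \<Phi> yC"
    "\<forall>X. y0 X \<noteq> 0 \<longrightarrow> C 1 (esize X)"
    using eqf_representative[of yC "C 1" c d thesis] by blast
  let ?eta = "Dd c d y0"
  have etaC: "C 0 (esize X)" if "?eta X \<noteq> 0" for X
    using that by (rule Dd_nonzero) (use y0(3) Cup in metis)
  \<comment> \<open>For functionals supported in the window, the boundary of \<open>y0\<close>
    cannot be distinguished from \<open>hat x\<close>. These functionals belong to
    \<open>Fun2\<close>, because \<open>3 \<le> n + m\<close> excludes the pairs that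
    \<open>Sym\<close> drops.\<close>
  have step: "pr \<Phi> ?eta = pr \<Phi> (hat x)" if E: "eqf c d \<Phi>" and S: "\<And>X. \<Phi> X \<noteq> 0 \<Longrightarrow> C 0 (esize X)"
    for \<Phi> :: "'k efun"
  proof -
    have F2: "\<Phi> \<in> Fun2 c d"
    proof (rule eqf_Fun2[OF E])
      fix X assume "\<Phi> X \<noteq> 0"
      from S[OF this] show "admissible (fst (fst X)) (fst (snd X))" using nm by (simp add: C_def admissible_def esize_alt)
    qed
    have "pr \<Phi> ?eta = pr (Dt c \<Phi>) y0" unfolding pr_Dd[OF E] pr_Dt[OF E] ..
    also have "\<dots> = pr \<Phi> (bd c yC)" by (rule trans[OF y0(2)[rule_format, OF eqf_Dt[OF E]] pr_Dt[OF E]])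
    also have "\<dots> = pr \<Phi> (bd c y)"
    proof (rule pr_bd_cong[of "C 1"])
      show "yC Z = y Z" if "GP Z" "C 1 (esize Z)" for Z using that by (simp add: yC_def)
      fix X assume X: "\<Phi> X \<noteq> 0"
      show "GP X \<and> (\<forall>k. esize X = up_size k \<longrightarrow> C 1 k) \<and> (\<forall>k. esize X = prod.swap (up_size (prod.swap k)) \<longrightarrow> C 1 k)"
        using eqfD(2)[OF E X] S[OF X] Cup by (intro conjI allI impI) simp_all
    qed
    also have "\<dots> = pr \<Phi> (lin_ext (delta c) y)"
      by (rule pr_dif[symmetric]) (use eqfD(2)[OF E] GP_wfp GP_nonuniv in blast)
    also have "\<dots> = pr \<Phi> (Sym x)"
    proof -
      have "pr \<Phi> (Sym x - lin_ext (delta c) y) = 0" using nul F2 unfolding nul_GC2_eq by blast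
      then show ?thesis unfolding pr_diff[OF eqfD(1)[OF E]] by simp
    qed
    also have "\<dots> = pr \<Phi> (hat x)" by (rule pr_Sym) (rule Fun2D(2)[OF F2])
    finally show ?thesis .
  qed
  \<comment> \<open>Reduction of arbitrary functionals to the window: \<open>?eta\<close> is
    supported in it, so the factor \<open>ind\<close> may be inserted at \<open>?eta\<close>, moved
    to the functional, and finally used to truncate \<open>x\<close> to \<open>xC\<close>.\<close>
  define ind where "ind k = (if C 0 k then 1 else 0 :: 'k)" for k
  define xC where "xC GH = ind (gsize (fst GH), gsize (snd GH)) * x GH" for GH
  have ee: "eqf c d ?eta" by (rule eqf_Dd[OF y0(1)])
  have fixed: "hav (flat ?eta) = ?eta"
  proof (rule hav_flat_fixed[OF ee])
    fix \<Phi> :: "'k efun" assume E: "eqf c d \<Phi>"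
    have "pr \<Phi> ?eta = pr \<Phi> (\<lambda>X. ind (esize X) * ?eta X)"
    proof (rule arg_cong[of _ _ "pr \<Phi>"], rule ext)
      fix X show "?eta X = ind (esize X) * ?eta X" using etaC[of X] by (cases "?eta X = 0") (simp_all add: ind_def)
    qed
    also have "\<dots> = pr (\<lambda>X. ind (esize X) * \<Phi> X) ?eta" by (rule pr_weight)
    also have "\<dots> = pr (\<lambda>X. ind (esize X) * \<Phi> X) (hat x)"
      by (rule step[OF eqf_scale[OF E]]) (simp add: ind_def split: if_splits)
    also have "\<dots> = pr \<Phi> (\<lambda>X. ind (esize X) * hat x X)" by (rule pr_weight[symmetric])
    also have "\<dots> = pr \<Phi> (hat xC)"
      by (rule arg_cong[of _ _ "pr \<Phi>"]) (simp add: fun_eq_iff hat_def xC_def esize_alt)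
    finally show "pr \<Phi> ?eta = pr \<Phi> (hat xC)" .
  qed
  \<comment> \<open>Being its own average, \<open>?eta\<close> depends on no hair position; this is
    the hypothesis for removing the dependence from \<open>y0\<close>.\<close>
  obtain y' where y': "eqf c d y'" "Dd c d y' = ?eta" "g_indep (\<lambda>_. True) y'" "f_indep (\<lambda>_. True) y'"
    by (rule independent_primitive[OF y0(1) indep_hav(2)[of _ "flat ?eta", unfolded fixed] indep_hav(1)[of _ "flat ?eta", unfolded fixed]])
  define Y' where "Y' GH = gasz GH * flat y' GH" for GH
  have yY: "y' = hat Y'"
    using independent_hav[OF y'(1,4,3)] unfolding hav_hat Y'_def[abs_def] .
  let ?P = "hav (otimes \<phi> \<psi>)"
  note p = eqf_hav_otimes[OF F]
  have "pr (otimes \<phi> \<psi>) x = pr ?P (hat x)" unfolding pr_hat_eqf[OF p(1)] p(2) ..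
  also have "\<dots> = pr ?P (Dd c d y')"
    unfolding y'(2)
  proof (rule step[OF p(1), symmetric])
    fix X assume "?P X \<noteq> 0"
    then have "otimes \<phi> \<psi> (fg X) \<noteq> 0" by (auto simp: hav_def hat_def split: if_splits)
    then have "\<phi> (fst (fst X)) \<noteq> 0" "\<psi> (fst (snd X)) \<noteq> 0" by (auto simp: otimes_def)
    then show "C 0 (esize X)" using ne me by (simp add: C_def esize_alt)
  qed
  also have "\<dots> = pr ?P (bd c (hat Y'))" unfolding pr_Dd[OF p(1)] yY[symmetric] ..
  also have "\<dots> = pr ?P (hat (tdif c Y'))"
    by (rule pr_cong) (use hat_tdif eqfD(2)[OF p(1)] GP_wfp GP_nonuniv in metis)
  also have "\<dots> = pr (otimes \<phi> \<psi>) (tdif c Y')" unfolding pr_hat_eqf[OF p(1)] p(2) ..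
  also have "\<dots> = 0" by (rule cocycle_kills_tdif[OF P Q])
  finally show ?thesis .
qed

lemma Sym_nul_functional:
  assumes P: "\<phi> \<in> Fun1 c" and Q: "\<psi> \<in> Fun1 d" and nul: "Sym x \<in> nul (GC2 c d) p"
  shows "pr (otimes \<phi> \<psi>) (\<lambda>GH. (if admissible (fst GH) (snd GH) then 1 else 0) * x GH) = (0 :: 'k::field_char_0)"
proof -
  let ?P = "hav (otimes \<phi> \<psi>)"
  let ?k = "\<lambda>GH. if admissible (fst GH) (snd GH) then 1 else 0 :: 'k"
  note p = eqf_hav_otimes[OF P Q]
  have "eqf c d (\<lambda>X. ?k (fg X) * ?P X)"
    using eqf_scale[OF p(1), of "\<lambda>k. if fst (fst k) + fst (snd k) \<ge> 3 then 1 else 0"]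
    by (simp add: admissible_def esize_alt)
  then have F2: "(\<lambda>X. ?k (fg X) * ?P X) \<in> Fun2 c d" by (rule eqf_Fun2) (simp split: if_splits)
  have "pr (otimes \<phi> \<psi>) (\<lambda>GH. ?k GH * x GH) = pr ?P (hat (\<lambda>GH. ?k GH * x GH))"
    unfolding pr_hat_eqf[OF p(1)] p(2) ..
  also have "\<dots> = pr ?P (\<lambda>X. ?k (fg X) * hat x X)"
    by (rule arg_cong[of _ _ "pr ?P"]) (auto simp: hat_def fun_eq_iff)
  also have "\<dots> = pr (\<lambda>X. ?k (fg X) * ?P X) (hat x)" by (rule pr_weight)
  also have "\<dots> = pr (\<lambda>X. ?k (fg X) * ?P X) (Sym x)" by (rule pr_Sym[symmetric]) (rule Fun2D(2)[OF F2])
  also have "\<dots> = 0" using nul F2 unfolding nul_GC2_eq by blast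
  finally show ?thesis .
qed

section \<open>Injectivity\<close>

lemma Fun1_one_vertex:
  fixes \<phi> :: "'k::field_char_0 gfun"
  assumes P: "\<phi> \<in> Fun1 c" and G: "\<phi> G \<noteq> 0" "fst G = 1"
  shows "even c \<and> G = tadpole"
proof -
  obtain es where GG: "G = (1, es)" using G(2) by (metis prod.collapse)
  have GC: "GC_graph G" "wf_graph G" using Fun1D(2,4)[OF P G(1)] .
  have "es \<noteq> []"
  proof
    assume "es = []"
    then have "valency G 0 = 0" by (simp add: GG valency_def half_edges_def)
    moreover have "2 \<le> valency G 0" using GC(1) G(2) unfolding GC_graph_def by simp
    ultimately show False by simp
  qed
  then have "even c \<and> ne1 (jp G) = 1"
    by (intro EQ1_one_vertex[OF Fun1D(3)[OF P, unfolded gEQ_iff_EQ1] wfp_jp[THEN iffD2, OF GC(2)]])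
      (use G in \<open>simp_all add: GG jp_def lft_def\<close>)
  then have "even c \<and> length es = 1" by (simp add: GG)
  moreover have "set es \<subseteq> {..<1} \<times> {..<1}" using GC(2) by (simp add: GG wf_graph_def)
  ultimately show ?thesis by (cases es; cases "hd es") (auto simp: GG tadpole_def)
qed

lemma Fun1_inadmissible:
  assumes P: "\<phi> \<in> Fun1 c" and Q: "\<psi> \<in> Fun1 d" and n: "\<phi> G \<noteq> 0" "\<psi> H \<noteq> 0" "\<not> admissible G H"
  shows "even c \<and> even d \<and> G = tadpole \<and> H = tadpole"
proof -
  have "fst G = 1" "fst H = 1"
    using n(3) Fun1D(4)[OF P n(1)] Fun1D(4)[OF Q n(2)] by (auto simp: admissible_def wf_graph_def)
  then show ?thesis using Fun1_one_vertex[OF P n(1)] Fun1_one_vertex[OF Q n(2)] by blast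
qed

section \<open>The tensor of two tadpoles and the kernel of \<open>Sym\<close>\<close>

abbreviation tad2 :: "'k::field_char_0 gpfun" where
  "tad2 \<equiv> otimes (bas tadpole) (bas tadpole)"

text \<open>\<open>Sym\<close> kills \<open>tad2\<close>, and by \<open>Fun1_inadmissible\<close>
  its entry is the only dropped one that products of equivariant functionals can see. Removing it
  allows all parities to be treated by the same argument.\<close>

definition wotad :: "int \<Rightarrow> int \<Rightarrow> 'k::field_char_0 gpfun \<Rightarrow> 'k gpfun" where
  "wotad c d x = (if even c \<and> even d then x - scl (x (tadpole, tadpole)) tad2 else x)"

lemma Sym_tad2: "Sym tad2 = 0"
proof
  fix X :: egraph obtain G f H g where X: "X = ((G, f), (H, g))" by (metis prod.exhaust)
  show "Sym tad2 X = (0 :: egraph \<Rightarrow> 'a) X"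
    unfolding X Sym_apply by (auto simp: otimes_def bas_def admissible_def tadpole_def)
qed

lemma Sym_wotad: "Sym (wotad c d x) = Sym x"
  unfolding wotad_def
  by (cases "even c \<and> even d")
    (simp_all only: if_True if_False simp_thms Sym_linear Sym_tad2 ser.scale_zero_right diff_zero)

lemma pr_wotad:
  assumes P: "\<phi> \<in> Fun1 c" and Q: "\<psi> \<in> Fun1 d"
  shows "pr (otimes \<phi> \<psi>) (\<lambda>GH. (if admissible (fst GH) (snd GH) then 1 else 0) * wotad c d x GH) =
    pr (otimes \<phi> \<psi>) (wotad c d x)"
proof (rule pr_cong)
  fix GH assume n: "otimes \<phi> \<psi> GH \<noteq> 0"
  obtain G H where GH: "GH = (G, H)" by (cases GH)
  have n': "\<phi> G \<noteq> 0" "\<psi> H \<noteq> 0" using n by (auto simp: GH otimes_def)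
  show "(if admissible (fst GH) (snd GH) then 1 else 0) * wotad c d x GH = wotad c d x GH"
  proof (cases "admissible G H")
    case False
    from Fun1_inadmissible[OF P Q n' this] show ?thesis
      by (simp add: GH wotad_def otimes_def bas_def scl_def)
  qed (simp add: GH)
qed

lemma tensor_list:
  assumes "\<And>i. ser.subspace (crr A i)" "x \<in> crr (tensor A B) p"
  shows "\<exists>l. (\<forall>(i, a, b)\<in>set l. a \<in> crr A i \<and> b \<in> crr B (p - i)) \<and> x = (\<Sum>(i, a, b)\<leftarrow>l. otimes a b)"
  using assms(2) unfolding crr_tensor
proof (induction rule: ser.span_induct_alt)
  case base
  then show ?case by (intro exI[of _ "[]"]) simp
next
  case (step k u v)
  then obtain a b i where u: "u = otimes a b" "a \<in> crr A i" "b \<in> crr B (p - i)" by blast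
  obtain l where l: "\<forall>(i, a, b)\<in>set l. a \<in> crr A i \<and> b \<in> crr B (p - i)" "v = (\<Sum>(i, a, b)\<leftarrow>l. otimes a b)"
    using step.IH by blast
  have "scl k u = otimes (scl k a) b" by (auto simp: u otimes_def scl_def fun_eq_iff)
  moreover have "scl k a \<in> crr A i" by (rule ser.subspace_scale[OF assms(1) u(2)])
  ultimately show ?case using l u(3) by (intro exI[of _ "(i, scl k a, b) # l"]) simp
qed

lemma pr_otimes_otimes:
  assumes "FS \<phi>" "FS \<psi>"
  shows "pr (otimes \<phi> \<psi>) (otimes a b) = pr \<phi> a * pr \<psi> b"
proof -
  have "pr (otimes \<phi> \<psi>) (otimes a b) = pr \<phi> (\<lambda>G. pr \<psi> (scl (a G) b))"
    unfolding pr_otimes(1)[OF assms] by (simp add: otimes_def scl_def)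
  also have "\<dots> = pr \<phi> (scl (pr \<psi> b) a)" 
    by (rule arg_cong[of _ _ "pr \<phi>"]) (simp add: pr_scl scl_def[of "pr \<psi> b"] fun_eq_iff mult.commute)
  finally show ?thesis by (simp add: pr_scl mult.commute)
qed

lemma tensor_nul:
  fixes A :: "('a, 'k::field) cpx" and B :: "('b, 'k) cpx"
  assumes subA: "\<And>i. ser.subspace (crr A i)" and subB: "\<And>i. ser.subspace (crr B i)"
    and sepA: "\<And>i a. a \<in> crr A i \<Longrightarrow> (\<And>\<phi>. \<phi> \<in> K \<Longrightarrow> pr \<phi> a = 0) \<Longrightarrow> a \<in> nul A i"
    and sepB: "\<And>i b. b \<in> crr B i \<Longrightarrow> (\<And>\<psi>. \<psi> \<in> L \<Longrightarrow> pr \<psi> b = 0) \<Longrightarrow> b \<in> nul B i"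
    and FSK: "\<And>\<phi>. \<phi> \<in> K \<Longrightarrow> FS \<phi>" and FSL: "\<And>\<psi>. \<psi> \<in> L \<Longrightarrow> FS \<psi>"
    and hom: "\<And>\<psi> i j b b'. \<psi> \<in> L \<Longrightarrow> b \<in> crr B i \<Longrightarrow> b' \<in> crr B j \<Longrightarrow> pr \<psi> b \<noteq> 0 \<Longrightarrow> pr \<psi> b' \<noteq> 0 \<Longrightarrow> i = j"
    and x: "x \<in> crr (tensor A B) p" and zero: "\<And>\<phi> \<psi>. \<phi> \<in> K \<Longrightarrow> \<psi> \<in> L \<Longrightarrow> pr (otimes \<phi> \<psi>) x = 0"
  shows "x \<in> nul (tensor A B) p"
proof -
  obtain l where l: "\<forall>(i, a, b)\<in>set l. a \<in> crr A i \<and> b \<in> crr B (p - i)" "x = (\<Sum>(i, a, b)\<leftarrow>l. otimes a b)"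
    using tensor_list[OF subA x] by blast
  have z: "(\<Sum>(i, a, b)\<leftarrow>l. pr \<phi> a * pr \<psi> b) = 0" if K: "\<phi> \<in> K" "\<psi> \<in> L" for \<phi> \<psi>
  proof -
    have "pr (otimes \<phi> \<psi>) x = (\<Sum>(i, a, b)\<leftarrow>l. pr \<phi> a * pr \<psi> b)"
      unfolding l(2) pr_sum_list[OF FS_otimes[OF FSK[OF K(1)] FSL[OF K(2)]]]
      by (rule arg_cong[of _ _ sum_list], rule map_cong[OF refl])
        (simp add: split_def pr_otimes_otimes[OF FSK[OF K(1)] FSL[OF K(2)]])
    then show ?thesis using zero[OF K] by simp
  qed
  show ?thesis
    unfolding l(2)
  proof (rule tensor_separation[where K = K and L = L])
    show "\<forall>(i, a, b)\<in>set l. a \<in> crr A i \<and> b \<in> crr B (p - i)" by (rule l(1))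
  qed (fact subA subB sepA sepB FSK FSL hom z)+
qed

text \<open>Functionals of one size still separate, since a functional is the sum of its parts of
  fixed size. They see a single degree, as \<open>tensor_nul\<close> demands of one of the two
  families.\<close>

definition Fun1s :: "int \<Rightarrow> 'k::field_char_0 gfun set" where
  "Fun1s d = {\<psi> \<in> Fun1 d. \<exists>k. \<forall>G. \<psi> G \<noteq> 0 \<longrightarrow> gsize G = k}"

lemma Fun1s_separation:
  assumes b: "b \<in> crr (GC d) i" and z: "\<And>\<psi>. \<psi> \<in> Fun1s d \<Longrightarrow> pr \<psi> b = 0"
  shows "b \<in> nul (GC d) i"
proof -
  have "pr \<psi> b = 0" if P: "\<psi> \<in> Fun1 d" for \<psi>
  proof -
    let ?S = "{G. \<psi> G \<noteq> 0}"
    have S: "finite ?S" using Fun1D(1)[OF P] by (simp add: FS_def)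
    have "pr \<psi> b = (\<Sum>k\<in>gsize ` ?S. \<Sum>G | G \<in> ?S \<and> gsize G = k. \<psi> G * b G)"
      unfolding pr_left[OF Fun1D(1)[OF P]] by (rule sum.image_gen[OF S])
    also have "\<dots> = (\<Sum>k\<in>gsize ` ?S. 0)"
    proof (rule sum.cong[OF refl])
      fix k
      have r: "(\<lambda>G. if gsize G = k then \<psi> G else 0) \<in> Fun1s d"
        unfolding Fun1s_def using restrict_Fun1[OF P, of k] by auto
      have "(\<Sum>G | G \<in> ?S \<and> gsize G = k. \<psi> G * b G) = pr (\<lambda>G. if gsize G = k then \<psi> G else 0) b"
        by (subst pr_sum[of "{G. G \<in> ?S \<and> gsize G = k}"]) (use S in \<open>auto split: if_splits\<close>)
      then show "(\<Sum>G | G \<in> ?S \<and> gsize G = k. \<psi> G * b G) = 0" using z[OF r] by simp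
    qed
    finally show ?thesis by simp
  qed
  then show ?thesis using b unfolding nul_GC_eq by blast
qed

lemma Fun1s_degree:
  assumes "\<psi> \<in> Fun1s d" "b \<in> crr (GC d) i" "b' \<in> crr (GC d) j" "pr \<psi> b \<noteq> 0" "pr \<psi> b' \<noteq> 0"
  shows "i = j"
proof -
  have nz: "\<exists>G. \<psi> G \<noteq> 0 \<and> b G \<noteq> 0" if "pr \<psi> b \<noteq> 0" for b
  proof (rule ccontr)
    assume n: "\<not> ?thesis"
    have "pr \<psi> b = pr \<psi> 0" by (rule pr_cong) (use n in auto)
    then show False using that by simp
  qed
  obtain G G' where G: "\<psi> G \<noteq> 0" "b G \<noteq> 0" "\<psi> G' \<noteq> 0" "b' G' \<noteq> 0" using nz[OF assms(4)] nz[OF assms(5)] by blast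
  have "gsize G = gsize G'" using assms(1) G(1,3) unfolding Fun1s_def by fastforce
  then have "gdeg d G = gdeg d G'" by (simp add: gdeg_def)
  then show ?thesis using assms(2,3) G unfolding crr_GC by force
qed

lemma cocycles_Fun1s: "\<psi> \<in> cocycles d \<Longrightarrow> \<psi> \<in> Fun1s d"
  by (simp add: cocycles_def Fun1s_def)

text \<open>The tadpole is a cocycle because \<open>gD\<close> of a functional vanishes at
  one-vertex graphs, so \<open>tad2\<close> also represents a class in the tensor product of the
  cohomologies. The nonzero coefficient of \<open>x\<close> shows that it has degree
  \<open>p\<close>.\<close>

lemma tad2_crr:
  fixes x :: "'k::field_char_0 gpfun"
  assumes x: "x \<in> crr (TT c d) p" "x (tadpole, tadpole) \<noteq> 0"
  shows "(tad2 :: 'k gpfun) \<in> crr (HT c d) p"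
proof -
  have t: "GC_graph tadpole" "gdeg c tadpole + gdeg d tadpole = p" using crr_TT_supp[OF x] by simp_all
  have B: "(bas tadpole :: 'k gfun) \<in> crr (cohomology (GC b)) (gdeg b tadpole)" for b
  proof -
    have C: "(bas tadpole :: 'k gfun) \<in> crr (GC b) (gdeg b tadpole)"
      unfolding crr_GC using t(1) by (simp add: bas_def)
    have "pr \<phi> (dGC (bas tadpole)) = (0 :: 'k)" if P: "\<phi> \<in> Fun1 b" for \<phi>
      unfolding pr_dif_GC[OF P] using gD_one_vertex[OF P, of tadpole] GC_graph_wf[OF t(1)] by (simp add: tadpole_def)
    then have "dGC (bas tadpole :: 'k gfun) \<in> nul (GC b) (gdeg b tadpole + 1)"
      unfolding nul_GC_eq using dif_GC_crr[OF C] by blast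
    then show ?thesis unfolding crr_cohomology using C by (simp add: GC_def Let_def)
  qed
  have "gdeg d tadpole = p - gdeg c tadpole" using t(2) by simp
  then show ?thesis
    unfolding crr_tensor using B[of c] B[of d]
    by (intro ser.span_base CollectI exI[of _ "bas tadpole :: 'k gfun"] exI[of _ "gdeg c tadpole"] conjI refl) simp_all
qed

text \<open>\<open>T\<close> stands for the tensor product of the complexes or for that of their
  cohomologies, which both lie between the two bounds.\<close>

lemma wotad_crr:
  fixes x :: "'k::field_char_0 gpfun"
  assumes sub: "crr (HT c d) p \<subseteq> crr T p" "crr T p \<subseteq> crr (TT c d) p" and T: "ser.subspace (crr T p)" and x: "x \<in> crr T p"
  shows "wotad c d x \<in> crr T p" "scl (x (tadpole, tadpole)) tad2 \<in> spn ({tad2} \<inter> crr T p)"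
proof -
  have "scl (x (tadpole, tadpole)) tad2 \<in> spn ({tad2} \<inter> crr T p) \<and> scl (x (tadpole, tadpole)) tad2 \<in> crr T p"
  proof (cases "x (tadpole, tadpole) = 0")
    case True
    then have z: "scl (x (tadpole, tadpole)) tad2 = (0 :: 'k gpfun)" by (simp add: scl_def fun_eq_iff)
    show ?thesis unfolding z using ser.span_zero ser.subspace_0[OF T] by blast
  next
    case False
    have "(tad2 :: 'k gpfun) \<in> crr T p" using tad2_crr[of x c d p] x sub False by blast
    then show ?thesis using ser.subspace_scale[OF T] by (simp add: ser.span_scale ser.span_base)
  qed
  then show "wotad c d x \<in> crr T p" "scl (x (tadpole, tadpole)) tad2 \<in> spn ({tad2} \<inter> crr T p)"
    unfolding wotad_def using ser.subspace_diff[OF T x] x by auto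
qed

lemma subspace_crr_tensor: "ser.subspace (crr (tensor A B) p)"
  unfolding crr_tensor by (rule ser.subspace_span)

lemma crr_GC_cohomology: "crr (cohomology (GC c)) i \<subseteq> crr (GC c) i"
  by (auto simp: crr_cohomology)

lemma wotad_nul_chain:
  fixes x :: "'k::field_char_0 gpfun"
  assumes x: "x \<in> crr (TT c d) p" and nul: "Sym x \<in> nul (GC2 c d) p"
  shows "wotad c d x \<in> nul (TT c d) p"
proof (rule tensor_nul[where K = "Fun1 c" and L = "Fun1s d"])
  show "wotad c d x \<in> crr (TT c d) p" by (rule wotad_crr(1)[OF crr_HT_subset subset_refl subspace_crr_tensor x])
  show "pr (otimes \<phi> \<psi>) (wotad c d x) = 0" if "\<phi> \<in> Fun1 c" "\<psi> \<in> Fun1s d" for \<phi> \<psi> :: "'k gfun"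
  proof -
    have F: "\<psi> \<in> Fun1 d" using that(2) by (simp add: Fun1s_def)
    have "Sym (wotad c d x) \<in> nul (GC2 c d) p" unfolding Sym_wotad by (rule nul)
    from Sym_nul_functional[OF that(1) F this] show ?thesis unfolding pr_wotad[OF that(1) F] .
  qed
  show "a \<in> nul (GC c) i" if "a \<in> crr (GC c) i" "\<And>\<phi>. \<phi> \<in> Fun1 c \<Longrightarrow> pr \<phi> a = 0"
    for i and a :: "'k gfun" unfolding nul_GC_eq using that by blast
  show "b \<in> nul (GC d) i" if "b \<in> crr (GC d) i" "\<And>\<psi>. \<psi> \<in> Fun1s d \<Longrightarrow> pr \<psi> b = 0"
    for i and b :: "'k gfun" using that by (rule Fun1s_separation)
  show "i = j" if "\<psi> \<in> Fun1s d" "b \<in> crr (GC d) i" "b' \<in> crr (GC d) j" "pr \<psi> b \<noteq> 0" "pr \<psi> b' \<noteq> 0"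
    for \<psi> b b' :: "'k gfun" and i j using that by (rule Fun1s_degree)
qed (auto simp: Fun1s_def Fun1D(1) subspace_crr_GC)

lemma wotad_nul_cohomology:
  fixes x :: "'k::field_char_0 gpfun"
  assumes x: "x \<in> crr (HT c d) p" and nul: "Sym x \<in> nul (cohomology (GC2 c d)) p"
  shows "wotad c d x \<in> nul (HT c d) p"
proof (rule tensor_nul[where K = "cocycles c" and L = "cocycles d"])
  show "wotad c d x \<in> crr (HT c d) p" by (rule wotad_crr(1)[OF subset_refl crr_HT_subset subspace_crr_tensor x])
  have "\<exists>y\<in>crr (GC2 c d) (p - 1). Sym x - dif (GC2 c d) y \<in> nul (GC2 c d) p"
    using nul unfolding nul_cohomology by blast
  then obtain y where yy: "y \<in> crr (GC2 c d) (p - 1)" "Sym x - dif (GC2 c d) y \<in> nul (GC2 c d) p" by blast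
  from yy(2) have y: "Sym (wotad c d x) - lin_ext (delta c) y \<in> nul (GC2 c d) p"
    unfolding Sym_wotad by (simp only: dif_GC2)
  show "pr (otimes \<phi> \<psi>) (wotad c d x) = 0" if P: "\<phi> \<in> cocycles c" "\<psi> \<in> cocycles d"
    for \<phi> \<psi> :: "'k gfun"
  \<comment> \<open>Each cocycle lives on one size, so either all pairs in the support of the
    product are admissible or none is. In the second case \<open>wotad c d x\<close> vanishes on
    this support.\<close>
  proof (cases "\<exists>G H. \<phi> G \<noteq> 0 \<and> \<psi> H \<noteq> 0 \<and> \<not> admissible G H")
    case False
    show ?thesis
    proof (rule cocycle_kills_primitive[OF P _ _ y])
      show "fcGC_pair X" if "y X \<noteq> 0" for X using yy(1) that unfolding crr_GC2 crr_fcGC by blast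
    qed (use False in blast)
  next
    case True
    have F: "\<phi> \<in> Fun1 c" "\<psi> \<in> Fun1 d" using P by (simp_all add: cocycles_def)
    from True obtain G H where G: "\<phi> G \<noteq> 0" "\<psi> H \<noteq> 0" "\<not> admissible G H" by blast
    have "\<exists>k. \<forall>G. \<phi> G \<noteq> 0 \<longrightarrow> gsize G = k" "\<exists>k. \<forall>H. \<psi> H \<noteq> 0 \<longrightarrow> gsize H = k"
      using P by (simp_all add: cocycles_def)
    then obtain k k' where kk: "\<forall>G. \<phi> G \<noteq> 0 \<longrightarrow> gsize G = k" "\<forall>H. \<psi> H \<noteq> 0 \<longrightarrow> gsize H = k'" by blast
    have "fst G' = fst G" if "\<phi> G' \<noteq> 0" for G'
    proof -
      have "gsize G' = gsize G" using kk(1) G(1) that by simp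
      then show ?thesis by simp
    qed
    moreover have "fst H' = fst H" if "\<psi> H' \<noteq> 0" for H'
    proof -
      have "gsize H' = gsize H" using kk(2) G(2) that by simp
      then show ?thesis by simp
    qed
    ultimately have n: "\<not> admissible G' H'" if "\<phi> G' \<noteq> 0" "\<psi> H' \<noteq> 0" for G' H'
      using G(3) that by (simp add: admissible_def)
    have "pr (otimes \<phi> \<psi>) (wotad c d x) =
        pr (otimes \<phi> \<psi>) (\<lambda>GH. (if admissible (fst GH) (snd GH) then 1 else 0) * wotad c d x GH)"
      by (rule pr_wotad[OF F, symmetric])
    also have "\<dots> = pr (otimes \<phi> \<psi>) 0" by (rule pr_cong) (use n in \<open>auto simp: otimes_def\<close>)
    finally show ?thesis by simp
  qed
  show "a \<in> nul (cohomology (GC b)) i" if a: "a \<in> crr (cohomology (GC b)) i" "\<And>\<phi>. \<phi> \<in> cocycles b \<Longrightarrow> pr \<phi> a = 0"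
    for b i and a :: "'k gfun"
  proof -
    have C: "a \<in> crr (GC b) i" using a(1) crr_GC_cohomology by blast
    show ?thesis unfolding nul_cohomology using cohomology_separation[OF C a(2)] C by (simp add: GC_def Let_def)
  qed
  then show "a \<in> nul (cohomology (GC d)) i" if "a \<in> crr (cohomology (GC d)) i" "\<And>\<phi>. \<phi> \<in> cocycles d \<Longrightarrow> pr \<phi> a = 0"
    for i and a :: "'k gfun" using that by blast
  show "i = j" if "\<psi> \<in> cocycles d" "b \<in> crr (cohomology (GC d)) i" "b' \<in> crr (cohomology (GC d)) j"
    "pr \<psi> b \<noteq> 0" "pr \<psi> b' \<noteq> 0" for \<psi> b b' :: "'k gfun" and i j
    by (rule Fun1s_degree[OF cocycles_Fun1s[OF that(1)] _ _ that(4,5)])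
      (use that(2,3) crr_GC_cohomology in blast)+
qed (auto simp: cocycles_def Fun1D(1) subspace_cohomology[OF is_complex_GC])

lemma mod_out_inclusion:
  fixes F :: "('a, 'k::field) series \<Rightarrow> ('b, 'k) series"
  assumes ch: "chain_map T B F" and B: "\<And>p. ser.subspace (nul B p)" and R: "\<And>r. r \<in> R \<Longrightarrow> F r = 0"
    and inj: "\<And>p x. x \<in> crr T p \<Longrightarrow> F x \<in> nul B p \<Longrightarrow> \<exists>t. x - t \<in> nul T p \<and> t \<in> spn (R \<inter> crr T p)"
  shows "inclusion_of_complexes (mod_out R T) B F"
proof -
  have h: "module_hom scl scl F"
    using ch unfolding chain_map_def Vector_Spaces.linear_def by blast
  have "F x \<in> nul B p" if "x \<in> spn (nul T p \<union> (R \<inter> crr T p))" for x p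
  proof (rule span_image_subspace[OF h B _ that])
    fix z assume "z \<in> nul T p \<union> (R \<inter> crr T p)"
    moreover have "F ` nul T p \<subseteq> nul B p" using ch unfolding chain_map_def by blast
    ultimately show "F z \<in> nul B p" using R ser.subspace_0[OF B] by auto
  qed
  then have "chain_map (mod_out R T) B F" using ch unfolding chain_map_def mod_out_def by auto
  moreover have "x \<in> nul (mod_out R T) p" if x: "x \<in> crr (mod_out R T) p" "F x \<in> nul B p" for x p
  proof -
    obtain t where t: "x - t \<in> nul T p" "t \<in> spn (R \<inter> crr T p)" using inj[of x p] x by (auto simp: mod_out_def)
    have "x - t \<in> spn (nul T p \<union> (R \<inter> crr T p))" using t(1) by (intro ser.span_base) simp
    moreover have "t \<in> spn (nul T p \<union> (R \<inter> crr T p))" using t(2) ser.span_mono[of "R \<inter> crr T p" "nul T p \<union> (R \<inter> crr T p)"] by blast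
    ultimately have "(x - t) + t \<in> spn (nul T p \<union> (R \<inter> crr T p))" by (rule ser.span_add)
    then show ?thesis by (simp add: mod_out_def del: minus_apply plus_fun_apply)
  qed
  ultimately show ?thesis unfolding inclusion_of_complexes_def by blast
qed

theorem proposition6p6:
  fixes c d :: int
  shows
    "is_complex (GC c :: (graph, 'k::field_char_0) cpx) \<and>
     is_complex (GC d :: (graph, 'k) cpx) \<and>
     is_complex (GC2 c d :: (egraph, 'k) cpx) \<and>
     (odd c \<or> odd d \<longrightarrow>
        inclusion_of_complexes
          (tensor (GC c) (GC d)) (GC2 c d :: (egraph, 'k) cpx) Sym \<and>
        inclusion_of_complexes
          (tensor (cohomology (GC c)) (cohomology (GC d)))
          (cohomology (GC2 c d) :: (egraph, 'k) cpx) Sym) \<and>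
     (even c \<and> even d \<longrightarrow>
        inclusion_of_complexes
          (mod_out {otimes (bas tadpole) (bas tadpole)} (tensor (GC c) (GC d)))
          (GC2 c d :: (egraph, 'k) cpx) Sym \<and>
        inclusion_of_complexes
          (mod_out {otimes (bas tadpole) (bas tadpole)}
             (tensor (cohomology (GC c)) (cohomology (GC d))))
          (cohomology (GC2 c d) :: (egraph, 'k) cpx) Sym)"
proof (intro conjI impI)
  show "is_complex (GC c :: (graph, 'k) cpx)" "is_complex (GC d :: (graph, 'k) cpx)"
    "is_complex (GC2 c d :: (egraph, 'k) cpx)"
    by (rule is_complex_GC is_complex_GC2)+
next
  assume "odd c \<or> odd d"
  \<comment> \<open>With an odd parameter no tadpole tensor is removed, so the statements about
    \<open>wotad\<close> concern \<open>x\<close> itself.\<close>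
  then have w: "wotad c d x = x" for x :: "'k gpfun" by (auto simp: wotad_def)
  show "inclusion_of_complexes (TT c d) (GC2 c d :: (egraph, 'k) cpx) Sym"
    unfolding inclusion_of_complexes_def
  proof (intro conjI allI ballI impI)
    show "chain_map (TT c d) (GC2 c d :: (egraph, 'k) cpx) Sym" by (rule chain_map_Sym)
    fix p and x :: "'k gpfun"
    assume "x \<in> crr (TT c d) p" "Sym x \<in> nul (GC2 c d) p"
    then show "x \<in> nul (TT c d) p" using wotad_nul_chain[of x c d p] unfolding w by blast
  qed
  show "inclusion_of_complexes (HT c d) (cohomology (GC2 c d) :: (egraph, 'k) cpx) Sym"
    unfolding inclusion_of_complexes_def
  proof (intro conjI allI ballI impI)
    show "chain_map (HT c d) (cohomology (GC2 c d) :: (egraph, 'k) cpx) Sym" by (rule chain_map_Sym_cohomology)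
    fix p and x :: "'k gpfun"
    assume "x \<in> crr (HT c d) p" "Sym x \<in> nul (cohomology (GC2 c d)) p"
    then show "x \<in> nul (HT c d) p" using wotad_nul_cohomology[of x c d p] unfolding w by blast
  qed
next
  assume "even c \<and> even d"
  then have w: "x - scl (x (tadpole, tadpole)) tad2 = wotad c d x" for x :: "'k gpfun"
    by (simp add: wotad_def)
  show "inclusion_of_complexes (mod_out {tad2} (TT c d)) (GC2 c d :: (egraph, 'k) cpx) Sym"
  proof (rule mod_out_inclusion[OF chain_map_Sym subspace_nul_GC2])
    fix p and x :: "'k gpfun" assume x: "x \<in> crr (TT c d) p" "Sym x \<in> nul (GC2 c d) p"
    show "\<exists>t. x - t \<in> nul (TT c d) p \<and> t \<in> spn ({tad2} \<inter> crr (TT c d) p)"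
      using wotad_nul_chain[OF x] wotad_crr(2)[OF crr_HT_subset subset_refl subspace_crr_tensor x(1)] unfolding w[symmetric] by blast
  qed (simp add: Sym_tad2)
  show "inclusion_of_complexes (mod_out {tad2} (HT c d)) (cohomology (GC2 c d) :: (egraph, 'k) cpx) Sym"
  proof (rule mod_out_inclusion[OF chain_map_Sym_cohomology subspace_cohomology(2)[OF is_complex_GC2]])
    fix p and x :: "'k gpfun" assume x: "x \<in> crr (HT c d) p" "Sym x \<in> nul (cohomology (GC2 c d)) p"
    show "\<exists>t. x - t \<in> nul (HT c d) p \<and> t \<in> spn ({tad2} \<inter> crr (HT c d) p)"
      using wotad_nul_cohomology[OF x] wotad_crr(2)[OF subset_refl crr_HT_subset subspace_crr_tensor x(1)] unfolding w[symmetric] by blast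
  qed (simp add: Sym_tad2)
qed

end
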